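(* Let $0<\alpha<1$, let $\Omega$ be a bounded and simply-connected domain in $\mathbb R^3$ without holes and with a $C^{r+\alpha}$ boundary, $r\ge3$, and let $\mathcal H^e\in C^{2+\alpha}_{\rm loc}(\Omega^c,\mathbb R^3)\cap C^{1+\alpha}_{\rm loc}(\overline{\Omega^c},\mathbb R^3)$ satisfy $\operatorname{curl}\mathcal H^e=\mathbf 0$, $\operatorname{div}\mathcal H^e=0$ in $\Omega^c$ and $\int_{\partial\Omega}\nu\cdot\mathcal H^e\,dS=0$. Let $\mathcal H\in C^{2+\alpha}_{\rm loc}(\overline{\Omega^c},\mathbb R^3)$ satisfy $\operatorname{curl}\mathcal H=\mathbf 0$, $\operatorname{div}\mathcal H=0$ in $\Omega^c$, $\|\mathcal H_T^+\|_{C^0(\partial\Omega)}<\sqrt{5/18}$, $\mathcal H-\mathcal H^e\in C^\alpha(\overline{\Omega^c},\mathbb R^3)$ and $\lim_{|x|\to\infty}(\mathcal H-\mathcal H^e)=\mathbf 0$. Let $\lambda_{f\mathbf A}(\Omega,\mathcal H_T)$ and $\kappa_{f\mathbf A}(\Omega,\mathcal H_T,\lambda)$ be the threshold numbers described in the context. Then for all $0<\lambda<\lambda_{f\mathbf A}(\Omega,\mathcal H_T)$ and $\kappa>\kappa_{f\mathbf A}(\Omega,\mathcal H_T,\lambda)$, problem (N) has a solution $(f,\mathbf H)$ with $(f,\mathbf H|_{\overline\Omega})\in\mathbb U(\Omega)$, $\mathbf H=\mathcal H$ in $\Omega^c$, and $$(f,\mathbf H)\in C^{3+\beta}(\overline\Omega)\times\mathbb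 C_t^{2+\alpha,0}(\overline\Omega,\overline{\Omega^c},\mathbb R^3)\quad\text{for any }0<\beta<\min\{1/2,\alpha\}.$$
   Context: $\Omega^c=\mathbb R^3\setminus\overline\Omega$; "without holes" means $\Omega^c$ is connected. $\nu$ is the unit normal of $\partial\Omega$ pointing into $\Omega^c$; subscript $T$: tangential component on $\partial\Omega$; superscripts $-,+$: traces from $\Omega$, $\Omega^c$; $[\cdot]$ is the jump. $C^{k+\alpha}_{\rm loc}(\overline{\Omega^c})$ means $C^{k+\alpha}(\overline{B\cap\Omega^c})$ for every ball $B$. $\mathbb C_t^{2+\alpha,0}(\overline\Omega,\overline{\Omega^c},\mathbb R^3)$ is the set of $\mathbf H\in C^{2+\alpha}(\overline\Omega,\mathbb R^3)\cap C^{2+\alpha}_{\rm loc}(\overline{\Omega^c},\mathbb R^3)$ with $\mathbf H_T^-=\mathbf H_T^+$ on $\partial\Omega$. Problem (N): $$-\tfrac{\lambda^2}{\kappa^2}\Delta f=(1-f^2-\lambda^2f^{-4}|\operatorname{curl}\mathbf H|^2)f,\ \ \lambda^2\operatorname{curl}(f^{-2}\operatorname{curl}\mathbf H)+\mathbf H=\mathbf 0\ \text{in }\Omega,\quad\operatorname{curl}\mathbf H=\mathbf 0,\ \operatorname{div}\mathbf H=0\ \text{in }\Omega^c,$$ $$\tfrac{\partial f}{\partial\nu}=0,\ [\mathbf H_T]=\mathbf 0\ \text{on }\partial\Omega,\qquad\mathbf H-\mathcal H^e\to\mathbf 0\ \text{as }|x|\to\infty .$$ $\mathbb K(\Omega)$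 is the set of $(f,\mathbf A)\in C^{2+\alpha}(\overline\Omega)\times C^{2+\alpha}(\overline\Omega,\mathbb R^3)$ with $f>0$ and $f^2-|\mathbf A|^2-\frac13>0$ on $\overline\Omega$; $\mathbb U(\Omega)$ is the set of $(f,\mathbf H)\in C^{2+\alpha}(\overline\Omega)\times C^{2+\alpha}(\overline\Omega,\mathbb R^3)$ with $(f,-\lambda f^{-2}\operatorname{curl}\mathbf H)\in\mathbb K(\Omega)$. Thresholds: for a tangential field $\mathcal B_T\in C^{2+\alpha}(\partial\Omega,\mathbb R^3)$ with $\nu\cdot\operatorname{curl}\mathcal B_T=0$ and $\|\mathcal B_T\|_{C^0(\partial\Omega)}<\sqrt{5/18}$ (in particular $\mathcal B_T=\mathcal H_T^+$), there exist $\lambda_{f\mathbf A}(\Omega,\mathcal B_T)>0$ and, for $0<\lambda<\lambda_{f\mathbf A}(\Omega,\mathcal B_T)$, $\kappa_{f\mathbf A}(\Omega,\mathcal B_T,\lambda)>0$ such that for all such $\lambda$ and $\kappa>\kappa_{f\mathbf A}(\Omega,\mathcal B_T,\lambda)$ the problem $$-\tfrac{\lambda^2}{\kappa^2}\Delta f=(1-f^2-|\mathbf A|^2)f,\ \ \lambda^2\operatorname{curl}^2\mathbf A+f^2\mathbf A=\mathbf 0\ \text{in }\Omega,\quad\tfrac{\partial f}{\partial\nu}=0,\ \lambda(\operatorname{curl}\mathbf A)_T=\mathcal B_T\ \text{on }\partial\Omega$$ has a classical solution $(f_\kappa,\mathbf A_\kappa)$ with $f_\kappa>0$ and $\nu\cdot\mathbf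 A_\kappa=0$ on $\partial\Omega$, unique in $\mathbb K(\Omega)$, and with $\mathbf H_\kappa=\lambda\operatorname{curl}\mathbf A_\kappa$ one has $(f_\kappa,\mathbf H_\kappa)\in\mathbb U(\Omega)$; moreover $(f_\kappa,\mathbf A_\kappa)$ converges uniformly on $\overline\Omega$ as $\kappa\to\infty$ to $((1-|\mathbf A_\infty|^2)^{1/2},\mathbf A_\infty)$ where $-\lambda^2\operatorname{curl}^2\mathbf A_\infty=(1-|\mathbf A_\infty|^2)\mathbf A_\infty$ in $\Omega$ and $\lambda(\operatorname{curl}\mathbf A_\infty)_T=\mathcal B_T$ on $\partial\Omega$. *)

theory Defs
  imports "HOL-Analysis.Analysis"
begin

section \<open>Differential operators\<close>

definition pd :: "3 \<Rightarrow> (real^3 \<Rightarrow> 'b::real_normed_vector) \<Rightarrow> real^3 \<Rightarrow> 'b" where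
  "pd i u x = frechet_derivative u (at x) (axis i 1)"

definition grad :: "(real^3 \<Rightarrow> real) \<Rightarrow> real^3 \<Rightarrow> real^3" where
  "grad f x = (\<chi> i. pd i f x)"

definition laplacian :: "(real^3 \<Rightarrow> real) \<Rightarrow> real^3 \<Rightarrow> real" where
  "laplacian f x = (\<Sum>i\<in>UNIV. pd i (pd i f) x)"

definition divergence :: "(real^3 \<Rightarrow> real^3) \<Rightarrow> real^3 \<Rightarrow> real" where
  "divergence u x = (\<Sum>i\<in>UNIV. pd i u x $ i)"

definition curl :: "(real^3 \<Rightarrow> real^3) \<Rightarrow> real^3 \<Rightarrow> real^3" where
  "curl u x = vector [pd 2 u x $ 3 - pd 3 u x $ 2,
                      pd 3 u x $ 1 - pd 1 u x $ 3,
                      pd 1 u x $ 2 - pd 2 u x $ 1]"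

section \<open>Hoelder spaces\<close>

text \<open>All spaces below are predicates on the restriction of \<open>u\<close> to an open set \<open>U\<close>; a space of
  functions on the closure of \<open>U\<close> requires that the derivatives extend continuously to the
  closure. The values that the total function \<open>u\<close> happens to take on the boundary of \<open>U\<close> are
  irrelevant: boundary values are always those of the extension from \<open>U\<close>, see \<open>ext\<close>. In this
  way one total function represents a field with different traces from the two sides of an
  interface.\<close>

primrec Ck :: "nat \<Rightarrow> (real^3) set \<Rightarrow> (real^3 \<Rightarrow> 'b::real_normed_vector) \<Rightarrow> bool" where
  "Ck 0 U u \<longleftrightarrow> continuous_on U u"
| "Ck (Suc k) U u \<longleftrightarrow> (\<forall>x\<in>U. u differentiable at x) \<and> (\<forall>i. Ck k U (pd i u))"

definition pds :: "3 list \<Rightarrow> (real^3 \<Rightarrow> 'b::real_normed_vector) \<Rightarrow> real^3 \<Rightarrow> 'b" where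
  "pds is u = fold pd is u"

definition Ck_closure :: "nat \<Rightarrow> (real^3) set \<Rightarrow> (real^3 \<Rightarrow> 'b::real_normed_vector) \<Rightarrow> bool" where
  "Ck_closure k U u \<longleftrightarrow> Ck k U u \<and>
     (\<forall>is. length is \<le> k \<longrightarrow>
        (\<exists>g. continuous_on (closure U) g \<and> (\<forall>x\<in>U. g x = pds is u x)))"

definition hoelder_cont ::
  "real \<Rightarrow> (real^3) set \<Rightarrow> (real^3 \<Rightarrow> 'b::real_normed_vector) \<Rightarrow> bool" where
  "hoelder_cont \<alpha> U v \<longleftrightarrow>
     (\<exists>C. \<forall>x\<in>U. \<forall>y\<in>U. norm (v x - v y) \<le> C * dist x y powr \<alpha>)"

text \<open>\<open>Ck_hoelder k \<alpha> U\<close> is $C^{k+\alpha}(\overline U)$, the space with finite Hoelder norm; for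
  unbounded \<open>U\<close> the boundedness is a condition of its own.\<close>

definition Ck_hoelder ::
  "nat \<Rightarrow> real \<Rightarrow> (real^3) set \<Rightarrow> (real^3 \<Rightarrow> 'b::real_normed_vector) \<Rightarrow> bool" where
  "Ck_hoelder k \<alpha> U u \<longleftrightarrow> Ck_closure k U u \<and>
     (\<forall>is. length is \<le> k \<longrightarrow> bounded (pds is u ` U)) \<and>
     (\<forall>is. length is = k \<longrightarrow> hoelder_cont \<alpha> U (pds is u))"

text \<open>$C^{k+\alpha}_{\rm loc}(\overline U)$: up to the boundary, but only on bounded pieces.\<close>

definition Ck_hoelder_loc_closure ::
  "nat \<Rightarrow> real \<Rightarrow> (real^3) set \<Rightarrow> (real^3 \<Rightarrow> 'b::real_normed_vector) \<Rightarrow> bool" where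
  "Ck_hoelder_loc_closure k \<alpha> U u \<longleftrightarrow> (\<forall>c \<rho>. Ck_hoelder k \<alpha> (ball c \<rho> \<inter> U) u)"

text \<open>$C^{k+\alpha}_{\rm loc}(U)$: interior regularity.\<close>

definition Ck_hoelder_loc ::
  "nat \<Rightarrow> real \<Rightarrow> (real^3) set \<Rightarrow> (real^3 \<Rightarrow> 'b::real_normed_vector) \<Rightarrow> bool" where
  "Ck_hoelder_loc k \<alpha> U u \<longleftrightarrow>
     (\<forall>V. open V \<and> compact (closure V) \<and> closure V \<subseteq> U \<longrightarrow> Ck_hoelder k \<alpha> V u)"

section \<open>Domains, traces and surface integrals\<close>

definition ext :: "(real^3) set \<Rightarrow> (real^3 \<Rightarrow> 'b::t2_space) \<Rightarrow> real^3 \<Rightarrow> 'b" where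
  "ext U u x = (if x \<in> U then u x else Lim (at x within U) u)"

abbreviation exterior :: "(real^3) set \<Rightarrow> (real^3) set" where
  "exterior \<Omega> \<equiv> - closure \<Omega>"

text \<open>Boundary of class $C^{k+\alpha}$ by local straightening, as in Gilbarg and Trudinger,
  Section 6.2.\<close>

definition hoelder_boundary :: "nat \<Rightarrow> real \<Rightarrow> (real^3) set \<Rightarrow> bool" where
  "hoelder_boundary k \<alpha> \<Omega> \<longleftrightarrow>
     (\<forall>x\<in>frontier \<Omega>. \<exists>\<rho>>0. \<exists>\<psi> :: real^3 \<Rightarrow> real^3. let B = ball x \<rho> in
        inj_on \<psi> B \<and> open (\<psi> ` B) \<and>
        \<psi> ` (B \<inter> \<Omega>) \<subseteq> {y. y $ 3 > 0} \<and> \<psi> ` (B \<inter> frontier \<Omega>) \<subseteq> {y. y $ 3 = 0} \<and>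
        Ck_hoelder k \<alpha> B \<psi> \<and> Ck_hoelder k \<alpha> (\<psi> ` B) (inv_into B \<psi>))"

text \<open>The unit vector orthogonal to the tangent plane of the boundary that points into the
  exterior.\<close>

definition outer_normal :: "(real^3) set \<Rightarrow> real^3 \<Rightarrow> real^3" where
  "outer_normal \<Omega> x = (THE n. norm n = 1 \<and>
     ((\<lambda>y. ((y - x) \<bullet> n) / norm (y - x)) \<longlongrightarrow> 0) (at x within frontier \<Omega>) \<and>
     (\<forall>\<^sub>F t in at_right 0. x + t *\<^sub>R n \<in> exterior \<Omega>))"

definition tangential :: "(real^3) set \<Rightarrow> (real^3 \<Rightarrow> real^3) \<Rightarrow> real^3 \<Rightarrow> real^3" where
  "tangential \<Omega> v x = v x - (v x \<bullet> outer_normal \<Omega> x) *\<^sub>R outer_normal \<Omega> x"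

abbreviation inner_tangential_trace ::
  "(real^3) set \<Rightarrow> (real^3 \<Rightarrow> real^3) \<Rightarrow> real^3 \<Rightarrow> real^3" where
  "inner_tangential_trace \<Omega> u \<equiv> tangential \<Omega> (ext \<Omega> u)"

abbreviation outer_tangential_trace ::
  "(real^3) set \<Rightarrow> (real^3 \<Rightarrow> real^3) \<Rightarrow> real^3 \<Rightarrow> real^3" where
  "outer_tangential_trace \<Omega> u \<equiv> tangential \<Omega> (ext (exterior \<Omega>) u)"

text \<open>Surface measure is the two-dimensional Hausdorff measure, normalised by the area
  $\frac{\pi}{4}d^2$ of a disc of diameter $d$. It is a metric outer measure, hence countably
  additive on the Borel sets, so that \<open>measure_of\<close> does not degenerate to zero.\<close>

definition hausdorff2_premeasure :: "real \<Rightarrow> (real^3) set \<Rightarrow> ennreal" where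
  "hausdorff2_premeasure \<delta> S =
     (INF C \<in> {C :: nat \<Rightarrow> (real^3) set.
                 S \<subseteq> (\<Union>n. C n) \<and> (\<forall>n. bounded (C n) \<and> diameter (C n) \<le> \<delta>)}.
        (\<Sum>n. ennreal (pi / 4 * (diameter (C n))\<^sup>2)))"

definition hausdorff2 :: "(real^3) measure" where
  "hausdorff2 = measure_of UNIV (sets borel) (\<lambda>S. SUP \<delta>\<in>{0<..}. hausdorff2_premeasure \<delta> S)"

definition surface_integral :: "(real^3) set \<Rightarrow> (real^3 \<Rightarrow> real) \<Rightarrow> real" where
  "surface_integral \<Omega> g = (LINT x|restrict_space hausdorff2 (frontier \<Omega>). g x)"

section \<open>The Meissner problems\<close>

definition KK :: "real \<Rightarrow> (real^3) set \<Rightarrow> ((real^3 \<Rightarrow> real) \<times> (real^3 \<Rightarrow> real^3)) set" where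
  "KK \<alpha> \<Omega> = {(f, A). Ck_hoelder 2 \<alpha> \<Omega> f \<and> Ck_hoelder 2 \<alpha> \<Omega> A \<and>
     (\<forall>x\<in>closure \<Omega>. ext \<Omega> f x > 0 \<and> (ext \<Omega> f x)\<^sup>2 - (norm (ext \<Omega> A x))\<^sup>2 - 1/3 > 0)}"

definition UU ::
  "real \<Rightarrow> real \<Rightarrow> (real^3) set \<Rightarrow> ((real^3 \<Rightarrow> real) \<times> (real^3 \<Rightarrow> real^3)) set" where
  "UU lam \<alpha> \<Omega> = {(f, H). Ck_hoelder 2 \<alpha> \<Omega> f \<and> Ck_hoelder 2 \<alpha> \<Omega> H \<and>
     (f, \<lambda>x. (- lam / (f x)\<^sup>2) *\<^sub>R curl H x) \<in> KK \<alpha> \<Omega>}"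

text \<open>$\mathbb C_t^{2+\alpha,0}(\overline\Omega,\overline{\Omega^c},\mathbb R^3)$\<close>

definition Ct_hoelder :: "real \<Rightarrow> (real^3) set \<Rightarrow> (real^3 \<Rightarrow> real^3) set" where
  "Ct_hoelder \<alpha> \<Omega> = {H. Ck_hoelder 2 \<alpha> \<Omega> H \<and> Ck_hoelder_loc_closure 2 \<alpha> (exterior \<Omega>) H \<and>
     (\<forall>x\<in>frontier \<Omega>. inner_tangential_trace \<Omega> H x = outer_tangential_trace \<Omega> H x)}"

text \<open>The boundary value problem for \<open>(f, A)\<close> with boundary datum \<open>BT\<close>, in the classical sense.\<close>

definition solves_fA ::
  "real \<Rightarrow> real \<Rightarrow> (real^3) set \<Rightarrow> (real^3 \<Rightarrow> real^3) \<Rightarrow>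
   (real^3 \<Rightarrow> real) \<Rightarrow> (real^3 \<Rightarrow> real^3) \<Rightarrow> bool" where
  "solves_fA lam \<kappa> \<Omega> BT f A \<longleftrightarrow>
     Ck 2 \<Omega> f \<and> Ck_closure 1 \<Omega> f \<and> Ck 2 \<Omega> A \<and> Ck_closure 1 \<Omega> A \<and>
     (\<forall>x\<in>\<Omega>. - (lam\<^sup>2 / \<kappa>\<^sup>2) * laplacian f x = (1 - (f x)\<^sup>2 - (norm (A x))\<^sup>2) * f x \<and>
            lam\<^sup>2 *\<^sub>R curl (curl A) x + (f x)\<^sup>2 *\<^sub>R A x = 0) \<and>
     (\<forall>x\<in>frontier \<Omega>. outer_normal \<Omega> x \<bullet> ext \<Omega> (grad f) x = 0 \<and>
            lam *\<^sub>R inner_tangential_trace \<Omega> (curl A) x = BT x)"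

text \<open>The limiting problem as \<open>\<kappa>\<close> tends to infinity.\<close>

definition solves_limit_A ::
  "real \<Rightarrow> (real^3) set \<Rightarrow> (real^3 \<Rightarrow> real^3) \<Rightarrow> (real^3 \<Rightarrow> real^3) \<Rightarrow> bool" where
  "solves_limit_A lam \<Omega> BT A \<longleftrightarrow>
     Ck 2 \<Omega> A \<and> Ck_closure 1 \<Omega> A \<and> (\<forall>x\<in>closure \<Omega>. norm (ext \<Omega> A x) \<le> 1) \<and>
     (\<forall>x\<in>\<Omega>. - (lam\<^sup>2 *\<^sub>R curl (curl A) x) = (1 - (norm (A x))\<^sup>2) *\<^sub>R A x) \<and>
     (\<forall>x\<in>frontier \<Omega>. lam *\<^sub>R inner_tangential_trace \<Omega> (curl A) x = BT x)"

text \<open>\<open>L\<close> and \<open>K\<close> are threshold numbers for \<open>\<Omega>\<close> and the boundary datum \<open>BT\<close>: below \<open>L\<close> and above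
  \<open>K lam\<close> the boundary value problem for \<open>(f, A)\<close> is solvable, uniquely in \<open>KK\<close>, with convergence
  of the solutions \<open>(F \<kappa>, AA \<kappa>)\<close> as \<open>\<kappa>\<close> tends to infinity.\<close>

definition threshold_numbers ::
  "real \<Rightarrow> (real^3) set \<Rightarrow> (real^3 \<Rightarrow> real^3) \<Rightarrow> real \<Rightarrow> (real \<Rightarrow> real) \<Rightarrow> bool" where
  "threshold_numbers \<alpha> \<Omega> BT L K \<longleftrightarrow> L > 0 \<and>
     (\<forall>lam. 0 < lam \<and> lam < L \<longrightarrow> K lam > 0 \<and>
       (\<exists>F AA.
          (\<forall>\<kappa>>K lam.
             solves_fA lam \<kappa> \<Omega> BT (F \<kappa>) (AA \<kappa>) \<and>
             (\<forall>x\<in>closure \<Omega>. ext \<Omega> (F \<kappa>) x > 0) \<and>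
             (\<forall>x\<in>frontier \<Omega>. outer_normal \<Omega> x \<bullet> ext \<Omega> (AA \<kappa>) x = 0) \<and>
             (F \<kappa>, AA \<kappa>) \<in> KK \<alpha> \<Omega> \<and>
             (\<forall>g B. (g, B) \<in> KK \<alpha> \<Omega> \<and> solves_fA lam \<kappa> \<Omega> BT g B \<longrightarrow>
                (\<forall>x\<in>\<Omega>. g x = F \<kappa> x \<and> B x = AA \<kappa> x)) \<and>
             (F \<kappa>, \<lambda>x. lam *\<^sub>R curl (AA \<kappa>) x) \<in> UU lam \<alpha> \<Omega>) \<and>
          (\<exists>Alim. solves_limit_A lam \<Omega> BT Alim \<and>
             uniform_limit (closure \<Omega>) (\<lambda>\<kappa>. ext \<Omega> (F \<kappa>))
               (\<lambda>x. sqrt (1 - (norm (ext \<Omega> Alim x))\<^sup>2)) at_top \<and>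
             uniform_limit (closure \<Omega>) (\<lambda>\<kappa>. ext \<Omega> (AA \<kappa>)) (ext \<Omega> Alim) at_top)))"

text \<open>Problem (N) on the whole space with applied field \<open>He\<close>.\<close>

definition solves_N ::
  "real \<Rightarrow> real \<Rightarrow> (real^3) set \<Rightarrow> (real^3 \<Rightarrow> real^3) \<Rightarrow>
   (real^3 \<Rightarrow> real) \<Rightarrow> (real^3 \<Rightarrow> real^3) \<Rightarrow> bool" where
  "solves_N lam \<kappa> \<Omega> He f H \<longleftrightarrow>
     (\<forall>x\<in>\<Omega>. - (lam\<^sup>2 / \<kappa>\<^sup>2) * laplacian f x
              = (1 - (f x)\<^sup>2 - lam\<^sup>2 / (f x)^4 * (norm (curl H x))\<^sup>2) * f x \<and>
            lam\<^sup>2 *\<^sub>R curl (\<lambda>y. (1 / (f y)\<^sup>2) *\<^sub>R curl H y) x + H x = 0) \<and>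
     (\<forall>x\<in>exterior \<Omega>. curl H x = 0 \<and> divergence H x = 0) \<and>
     (\<forall>x\<in>frontier \<Omega>. outer_normal \<Omega> x \<bullet> ext \<Omega> (grad f) x = 0 \<and>
            inner_tangential_trace \<Omega> H x = outer_tangential_trace \<Omega> H x) \<and>
     ((\<lambda>x. H x - He x) \<longlongrightarrow> 0) at_infinity"

end

theory Submission
  imports Defs
begin

text \<open>
  Put \<open>H = \<lambda> curl A\<close> inside \<open>\<Omega>\<close> and the given field outside, where \<open>(f, A)\<close> is the solution of the
  interior problem: taking the curl of the equation for \<open>A\<close> gives the equation for \<open>H\<close>, and the
  tangential traces agree by the boundary condition for \<open>A\<close>. What remains is that \<open>f\<close> is
  \<open>C\<^sup>3\<^sup>+\<^sup>\<beta>\<close> up to the boundary, which is regularity for the Neumann problem of \<open>\<Delta>f = g\<close> with \<open>g\<close> of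
  class \<open>C\<^sup>2\<close>. It follows from bounds of order \<open>s\<^sup>\<alpha>\<^sup>-\<^sup>1\<close> for the fourth derivatives of the
  mollification of \<open>f\<close> at every scale \<open>s\<close> below the distance to the boundary. The derivative of the
  mollifier in \<open>s\<close> is a Laplacian, so in the interior the dependence on \<open>s\<close> of these derivatives is
  controlled by moving derivatives onto \<open>g\<close>. For scales beyond the distance to the boundary, subtract
  first a cubic polynomial which satisfies the equation and the Neumann condition at the nearest
  boundary point up to the order of the Hoelder remainder. Adding to the kernel its reflection in the
  tangent plane makes its normal derivative vanish there, and Green's identity bounds the change in
  \<open>s\<close>. Points that are closer to the boundary than to each other are joined by moving both inwards.
\<close>

text \<open>The order s^(\<alpha>-1) is the right one for C^(3+\<alpha>): over a segment of length s
  it gives a difference of order s^\<alpha>, and at that scale a third derivative differs from its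
  mollification only by order s. It results from integrating a rate of order s^(\<alpha>-2) in the
  scale. The obstacle is that the solution is known to be only of class C^(2+\<alpha>). After
  subtraction of a polynomial the remainder near a boundary point is of order s^(2+\<alpha>), one
  power of s short of what the rate asks for. The reflected kernel regains it: its normal derivative
  vanishes on the tangent plane, from which the boundary departs quadratically, and so does not grow
  like 1/s on the boundary. In exchange the Laplacian of the remainder and its flux must be of order
  s^(1+\<alpha>) and s^(2+\<alpha>). This is what the cubic term is for: the Taylor polynomial of
  second order leaves a linear term in the equation and a quadratic one in the Neumann condition.
  The boundary is not flattened. It enters as a level set of \<open>\<rho>\<close>, and integrals
  over thin layers replace surface integrals.\<close>

lemma pd_eq: "(f has_derivative D) (at x) ==> pd i f x = D (axis i 1)"
  unfolding pd_def using frechet_derivative_at by metis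

lemma linear_inner_axis:
  fixes D :: "real^3 => real"
  assumes "linear D" shows "D h = (\<chi> i. D (axis i 1)) \<bullet> h"
proof -
  have "h = (\<Sum>i\<in>UNIV. (h $ i) *\<^sub>R axis i 1)"
    by (simp add: vec_eq_iff axis_def if_distrib cong: if_cong)
  then have "D h = (\<Sum>i\<in>UNIV. (h $ i) *\<^sub>R D (axis i 1))"
    using assms by (metis (no_types, lifting) linear_sum linear_scale sum.cong)
  then show ?thesis by (simp add: inner_vec_def mult.commute)
qed

lemma has_derivative_grad:
  fixes f :: "real^3 => real"
  assumes "f differentiable at x" shows "(f has_derivative (%h. grad f x \<bullet> h)) (at x)"
proof -
  have 1: "(f has_derivative frechet_derivative f (at x)) (at x)"
    using assms frechet_derivative_works by blast
  have "frechet_derivative f (at x) h = grad f x \<bullet> h" for h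
    by (subst linear_inner_axis[OF has_derivative_linear[OF 1]]) (simp add: grad_def pd_def)
  then have "frechet_derivative f (at x) = (%h. grad f x \<bullet> h)" by auto
  then show ?thesis using 1 by simp
qed

lemma pd_inner: "(f has_derivative (%h. a \<bullet> h)) (at x) ==> pd i f x = a $ i"
  by (drule pd_eq[where i=i]) (simp add: inner_axis)

lemma grad_eq:
  "(f has_derivative (%h. a \<bullet> h)) (at x) ==> grad f x = a"
  unfolding grad_def by (simp add: vec_eq_iff pd_inner)

text \<open>\<open>frechet_derivative\<close> is chosen by a predicate, and functions that agree
  near \<open>x\<close> satisfy it for the same linear maps. This covers points without a derivative
  too.\<close>

lemma pd_cong:
  assumes "open U" "x \<in> U" "!!y. y \<in> U ==> f y = g y"
  shows "pd i f x = pd i g x"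
proof -
  have "(f has_derivative D) (at x) = (g has_derivative D) (at x)" for D
    using has_derivative_transform_within_open[OF _ assms(1,2)] assms(3) by metis
  then show ?thesis unfolding pd_def frechet_derivative_def by presburger
qed

lemma pd_add:
  "f differentiable at x ==> g differentiable at x ==> pd i (%x. f x + g x) x = pd i f x + pd i g x"
  unfolding pd_def by (subst frechet_derivative_at[symmetric])
    (auto intro: has_derivative_add simp: frechet_derivative_works)

lemma pd_diff:
  "f differentiable at x ==> g differentiable at x ==> pd i (%x. f x - g x) x = pd i f x - pd i g x"
  unfolding pd_def by (subst frechet_derivative_at[symmetric])
    (auto intro: has_derivative_diff simp: frechet_derivative_works)

lemma pd_scaleR:
  "f differentiable at x ==> pd i (%x. c *\<^sub>R f x) x = c *\<^sub>R pd i f x"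
  unfolding pd_def by (subst frechet_derivative_at[symmetric])
    (auto intro: has_derivative_scaleR_right simp: frechet_derivative_works)

lemma pd_cmult:
  "f differentiable at x ==> pd i (%x. c * f x) x = c * pd i f x" for c :: real
  using pd_scaleR[of f x i c] by simp

lemma pd_mult:
  fixes f g :: "real^3 => real"
  assumes "f differentiable at x" "g differentiable at x"
  shows "pd i (%x. f x * g x) x = f x * pd i g x + pd i f x * g x"
  using has_derivative_mult[OF has_derivative_grad[OF assms(1)] has_derivative_grad[OF assms(2)]]
  by (auto dest!: pd_eq[where i=i] simp: grad_def inner_axis)

lemma pd_const: "pd i (%x. c) = (%x. 0)"
  by (rule ext) (simp add: pd_def)

lemma pd_sum:
  "finite S ==> (!!j. j \<in> S ==> f j differentiable at x) ==>
   pd i (%x. \<Sum>j\<in>S. f j x) x = (\<Sum>j\<in>S. pd i (f j) x)"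
proof (induction S rule: finite_induct)
  case (insert a F)
  then have "(%x. \<Sum>j\<in>F. f j x) differentiable at x" by (auto intro: differentiable_sum)
  then show ?case using insert by (simp add: pd_add)
qed (simp add: pd_const)

lemma pd_nth:
  fixes A :: "real^3 => real^3"
  assumes "A differentiable at x" shows "pd i (%x. A x $ j) x = pd i A x $ j"
proof -
  have "(A has_derivative frechet_derivative A (at x)) (at x)"
    using assms frechet_derivative_works by blast
  from bounded_linear.has_derivative[OF bounded_linear_vec_nth this]
  show ?thesis unfolding pd_def[of i A] by (rule pd_eq)
qed

section \<open>Stability of the classes \<open>Ck\<close>\<close>

lemma differentiable_cong:
  assumes "open U" "x \<in> U" "!!y. y \<in> U ==> f y = g y" "f differentiable at x"
  shows "g differentiable at x"
  using assms has_derivative_transform_within_open unfolding differentiable_def by blast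

lemma Ck_cong_imp:
  assumes "open U" "!!y. y \<in> U ==> f y = g y"
  shows "Ck k U f ==> Ck k U g"
  using assms(2)
proof (induction k arbitrary: f g)
  case 0 then show ?case by (simp cong: continuous_on_cong)
next
  case (Suc k)
  have eq: "pd i f y = pd i g y" if "y \<in> U" for i y
    using pd_cong[OF assms(1) that] Suc.prems(2) by blast
  have "Ck k U (pd i g)" for i
    by (rule Suc.IH[of "pd i f"]) (use Suc.prems eq in auto)
  moreover have "\<forall>x\<in>U. g differentiable at x"
    using differentiable_cong[OF assms(1)] Suc.prems by (metis Ck.simps(2))
  ultimately show ?case by simp
qed

lemma Ck_cong:
  assumes "open U" "!!y. y \<in> U ==> f y = g y" shows "Ck k U f \<longleftrightarrow> Ck k U g"
  using Ck_cong_imp[OF assms(1)] assms(2) by metis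

lemma Ck_subset: "Ck k U f ==> V \<subseteq> U ==> Ck k V f"
  by (induction k arbitrary: f) (auto intro: continuous_on_subset)

lemma Ck_continuous_on: "Ck k U f ==> continuous_on U f"
  by (cases k) (auto intro!: continuous_at_imp_continuous_on differentiable_imp_continuous_within)

lemma Ck_SucD: "Ck (Suc k) U f ==> Ck k U f"
proof (induction k arbitrary: f)
  case 0 then show ?case using Ck_continuous_on[OF 0] by (subst Ck.simps(1))
qed auto

lemma Ck_mono: "Ck k U f ==> j <= k ==> Ck j U f"
  by (induction k) (auto simp: le_Suc_eq dest: Ck_SucD simp del: Ck.simps)

lemma Ck_pd: "Ck (Suc k) U f ==> Ck k U (pd i f)" by simp

lemma Ck_diff_at: "Ck (Suc k) U f ==> x \<in> U ==> f differentiable at x" by simp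

text \<open>Serves to glue a function from pieces, such as a product with a kernel of compact
  support: the product on the domain, zero off the support.\<close>

lemma Ck_local:
  assumes "!!x. x \<in> U ==> \<exists>V. open V \<and> x \<in> V \<and> Ck k V f"
  shows "Ck k U f"
  using assms
proof (induction k arbitrary: f)
  case 0
  have "isCont f x" if "x \<in> U" for x
    using 0[OF that] continuous_on_eq_continuous_at by force
  then show ?case by (simp add: continuous_at_imp_continuous_on)
next
  case (Suc k)
  have "Ck k U (pd i f)" for i by (rule Suc.IH) (use Suc.prems in force)
  then show ?case using Suc.prems by force
qed

lemma Ck_const: "Ck k U (%x. c)"
  by (induction k arbitrary: c) (auto simp: pd_const)

lemma Ck_add: "open U ==> Ck k U f ==> Ck k U g ==> Ck k U (%x. f x + g x)"
proof (induction k arbitrary: f g)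
  case (Suc k)
  have "Ck k U (%x. pd i f x + pd i g x)" for i using Suc by auto
  then have "Ck k U (pd i (%x. f x + g x))" for i
    by (rule Ck_cong_imp[OF Suc.prems(1), rotated]) (use Suc.prems in \<open>auto simp: pd_add\<close>)
  then show ?case using Suc.prems by (auto intro: differentiable_add)
qed (auto intro: continuous_on_add)

lemma Ck_scaleR: "open U ==> Ck k U f ==> Ck k U (%x. c *\<^sub>R f x)"
proof (induction k arbitrary: f)
  case (Suc k)
  have "Ck k U (%x. c *\<^sub>R pd i f x)" for i using Suc by auto
  then have "Ck k U (pd i (%x. c *\<^sub>R f x))" for i
    by (rule Ck_cong_imp[OF Suc.prems(1), rotated]) (use Suc.prems in \<open>auto simp: pd_scaleR\<close>)
  then show ?case using Suc.prems by (auto intro: differentiable_scaleR)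
qed (auto intro: continuous_intros)

lemma Ck_cmult: "open U ==> Ck k U f ==> Ck k U (%x. c * f x)" for c :: real
  using Ck_scaleR[of U k f c] by simp

lemma Ck_diff: "open U ==> Ck k U f ==> Ck k U g ==> Ck k U (%x. f x - g x)"
  using Ck_add[of U k f "%x. (-1) *\<^sub>R g x"] Ck_scaleR[of U k g "-1"] by simp

lemma Ck_mult:
  fixes f g :: "real^3 => real"
  shows "open U ==> Ck k U f ==> Ck k U g ==> Ck k U (%x. f x * g x)"
proof (induction k arbitrary: f g)
  case (Suc k)
  have "Ck k U (%x. f x * pd i g x + pd i f x * g x)" for i
    using Suc by (intro Ck_add Suc.IH) (auto intro: Ck_SucD simp del: Ck.simps dest: Ck_pd)
  then have "Ck k U (pd i (%x. f x * g x))" for i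
    by (rule Ck_cong_imp[OF Suc.prems(1), rotated]) (use Suc.prems in \<open>auto simp: pd_mult\<close>)
  then show ?case using Suc.prems by (auto intro: differentiable_mult)
qed (auto intro: continuous_intros)

lemma Ck_sum:
  assumes "open U" "finite S" "!!j. j \<in> S ==> Ck k U (f j)"
  shows "Ck k U (%x. \<Sum>j\<in>S. f j x)"
  using assms(2,3) by (induction S rule: finite_induct) (auto intro: Ck_add assms(1) Ck_const)

lemma Ck_nth:
  fixes A :: "real^3 => real^3"
  shows "open U ==> Ck k U A ==> Ck k U (%x. A x $ j)"
proof (induction k arbitrary: A)
  case (Suc k)
  have "Ck k U (%x. pd i A x $ j)" for i using Suc by auto
  then have "Ck k U (pd i (%x. A x $ j))" for i
    by (rule Ck_cong_imp[OF Suc.prems(1), rotated]) (use Suc.prems in \<open>auto simp: pd_nth\<close>)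
  moreover have "\<forall>x\<in>U. (%x. A x $ j) differentiable at x"
  proof
    fix x assume "x \<in> U"
    then have "A differentiable at x" using Suc.prems by simp
    then obtain D where "(A has_derivative D) (at x)" unfolding differentiable_def by blast
    from bounded_linear.has_derivative[OF bounded_linear_vec_nth this]
    show "(%x. A x $ j) differentiable at x" unfolding differentiable_def by blast
  qed
  ultimately show ?case by simp
qed (auto intro: continuous_intros)

lemma pds_Nil [simp]: "pds [] u = u" by (simp add: pds_def)
lemma pds_Cons [simp]: "pds (i # is) u = pds is (pd i u)" by (simp add: pds_def)
lemma pds_snoc: "pds (is @ [j]) u = pd j (pds is u)" by (simp add: pds_def)

lemma Ck_pds: "Ck (length is + k) U u ==> Ck k U (pds is u)"
  by (induction "is" arbitrary: u) auto

lemma pds_cong: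
  assumes "open U" "!!y. y \<in> U ==> f y = g y"
  shows "x \<in> U ==> pds is f x = pds is g x"
  using assms(2)
proof (induction "is" arbitrary: f g)
  case (Cons i "is")
  have "pd i f y = pd i g y" if "y \<in> U" for y
    using pd_cong[OF assms(1) that] Cons.prems(2) by blast
  then show ?case unfolding pds_Cons using Cons by blast
qed auto

lemma pds_nth:
  fixes A :: "real^3 => real^3"
  assumes "open U" "x \<in> U"
  shows "Ck (length is) U A ==> pds is (%x. A x $ j) x = pds is A x $ j"
proof (induction "is" arbitrary: A)
  case (Cons i "is")
  have "pds is (pd i (%x. A x $ j)) x = pds is (%x. pd i A x $ j) x"
    by (rule pds_cong[OF assms(1) _ assms(2)]) (use Cons.prems in \<open>auto intro: pd_nth\<close>)
  then show ?case using Cons by simp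
qed auto

lemma mvt_grad:
  fixes f :: "real^3 => real"
  assumes "closed_segment x y \<subseteq> U" "!!z. z \<in> U ==> f differentiable at z"
    "!!z. z \<in> closed_segment x y ==> norm (grad f z) <= B"
  shows "\<bar>f x - f y\<bar> <= B * norm (x - y)"
proof -
  have "norm (f x - f y) <= B * norm (x - y)"
  proof (rule differentiable_bound[where S="closed_segment x y" and f'="%z h. grad f z \<bullet> h"])
    fix z assume z: "z \<in> closed_segment x y"
    show "(f has_derivative (%h. grad f z \<bullet> h)) (at z within closed_segment x y)"
      using has_derivative_grad assms z by (meson has_derivative_at_withinI subsetD)
    show "onorm (%h. grad f z \<bullet> h) <= B"
    proof (rule onorm_bound)
      show "0 <= B" using assms(3)[OF z] norm_ge_zero order_trans by blast
      show "norm (grad f z \<bullet> h) <= B * norm h" for h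
        using Cauchy_Schwarz_ineq2[of "grad f z" h] mult_right_mono[OF assms(3)[OF z], of "norm h"]
        by simp
    qed
  qed auto
  then show ?thesis by simp
qed

lemma norm_grad_le: "(!!i. \<bar>pd i f x\<bar> <= B) ==> norm (grad f x) <= 3 * B"
proof -
  assume h: "!!i. \<bar>pd i f x\<bar> <= B"
  have "norm (grad f x) <= \<bar>pd 1 f x\<bar> + \<bar>pd 2 f x\<bar> + \<bar>pd 3 f x\<bar>"
    using norm_le_l1_cart[of "grad f x"] by (simp add: grad_def sum_3)
  then show ?thesis using h[of 1] h[of 2] h[of 3] by linarith
qed

lemma pd_le_norm_grad: "\<bar>pd i f x\<bar> <= norm (grad f x)"
  using component_le_norm_cart[of "grad f x" i] by (simp add: grad_def)

lemma DERIV_line: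
  fixes f :: "real^3 => real"
  assumes "f differentiable at (x + s *\<^sub>R v)"
  shows "((%s. f (x + s *\<^sub>R v)) has_real_derivative grad f (x + s *\<^sub>R v) \<bullet> v) (at s)"
proof -
  have "((%s. x + s *\<^sub>R v) has_derivative (%h. h *\<^sub>R v)) (at s)"
    by (auto intro!: derivative_eq_intros)
  from has_derivative_compose[OF this has_derivative_grad[OF assms]]
  show ?thesis by (simp add: has_field_derivative_def mult.commute[of _ "grad f _ \<bullet> v"] mult_commute_abs)
qed

lemma DERIV_axis:
  fixes f :: "real^3 => real"
  assumes "f differentiable at (x + s *\<^sub>R axis i 1)"
  shows "((%s. f (x + s *\<^sub>R axis i 1)) has_real_derivative pd i f (x + s *\<^sub>R axis i 1)) (at s)"
  using DERIV_line[OF assms] by (simp add: inner_axis grad_def)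

lemma dist_add_add: "dist (x + u + v) x = norm (u + v)" for x :: "'a::real_normed_vector"
  by (metis add.assoc add_diff_cancel_left' dist_norm)

text \<open>The mean value theorem in direction \<open>i\<close>, applied to the increment of
  \<open>f\<close> in direction \<open>j\<close>, and then in direction \<open>j\<close>, applied to
  \<open>pd i f\<close>. Up to the order of its terms the left side is symmetric in \<open>i\<close>
  and \<open>j\<close>.\<close>

lemma second_difference:
  fixes f :: "real^3 => real"
  assumes U: "ball x r \<subseteq> U" and f: "Ck 2 U f" and t: "0 < t" "2 * t < r"
  shows "\<exists>\<xi> \<eta>. 0 < \<xi> \<and> \<xi> < t \<and> 0 < \<eta> \<and> \<eta> < t \<and>
    f (x + t *\<^sub>R axis i 1 + t *\<^sub>R axis j 1) - f (x + t *\<^sub>R axis i 1) - f (x + t *\<^sub>R axis j 1) + f x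
      = t * t * pd j (pd i f) (x + \<xi> *\<^sub>R axis i 1 + \<eta> *\<^sub>R axis j 1)"
proof -
  let ?p = "%a b. x + a *\<^sub>R axis i 1 + b *\<^sub>R axis j 1 :: real^3"
  have inU: "?p a b \<in> U" if "0 <= a" "a <= t" "0 <= b" "b <= t" for a b
  proof -
    have "norm (a *\<^sub>R axis i 1 + b *\<^sub>R axis j 1 :: real^3) <= \<bar>a\<bar> + \<bar>b\<bar>"
      using norm_triangle_ineq[of "a *\<^sub>R axis i 1 :: real^3" "b *\<^sub>R axis j 1"] by simp
    then have "dist x (?p a b) < r"
      unfolding dist_commute[of x] dist_add_add using that t by linarith
    then show ?thesis using U by auto
  qed
  have d1: "f differentiable at (?p a b)" and d2: "pd i f differentiable at (?p a b)"
    if "0 <= a" "a <= t" "0 <= b" "b <= t" for a b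
    using f inU[OF that] by (auto simp: numeral_2_eq_2)
  define \<phi> where "\<phi> s = f (?p s t) - f (?p s 0)" for s
  have \<phi>': "(\<phi> has_real_derivative pd i f (?p s t) - pd i f (?p s 0)) (at s)" if s: "0 <= s" "s <= t" for s
  proof -
    have eq: "?p s b = (x + b *\<^sub>R axis j 1) + s *\<^sub>R axis i 1" for s b by simp
    have "((%s. f (?p s b)) has_real_derivative pd i f (?p s b)) (at s)" if "b = 0 \<or> b = t" for b
      unfolding eq by (rule DERIV_axis) (use d1[of s b] s t that eq in auto)
    from this[of t] this[of 0] show ?thesis unfolding \<phi>_def by (intro DERIV_diff) blast+
  qed
  have "\<exists>z>0. z < t \<and> \<phi> t - \<phi> 0 = (t - 0) * (pd i f (?p z t) - pd i f (?p z 0))"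
    by (rule MVT2[OF t(1)]) (rule \<phi>')
  then obtain \<xi> where \<xi>: "0 < \<xi>" "\<xi> < t"
    "\<phi> t - \<phi> 0 = (t - 0) * (pd i f (?p \<xi> t) - pd i f (?p \<xi> 0))" by blast
  have "((%b. pd i f (?p \<xi> b)) has_real_derivative pd j (pd i f) (?p \<xi> b)) (at b)" if "0 <= b" "b <= t" for b
    by (rule DERIV_axis) (use d2[of \<xi> b] \<xi> that in auto)
  from MVT2[OF t(1) this] obtain \<eta> where \<eta>: "0 < \<eta>" "\<eta> < t"
    "pd i f (?p \<xi> t) - pd i f (?p \<xi> 0) = (t - 0) * pd j (pd i f) (?p \<xi> \<eta>)" by blast
  show ?thesis
    by (rule exI[of _ \<xi>], rule exI[of _ \<eta>]) (use \<xi> \<eta> in \<open>simp add: \<phi>_def\<close>)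
qed

text \<open>The symmetric second difference equals \<open>t * t\<close> times either mixed
  derivative, taken at two points close to \<open>x\<close>. Were the derivatives at
  \<open>x\<close> different, continuity would separate them at these points as well.\<close>

lemma pd_commute:
  fixes f :: "real^3 => real"
  assumes "open U" "Ck 2 U f" "x \<in> U"
  shows "pd i (pd j f) x = pd j (pd i f) x"
proof (rule ccontr)
  assume ne: "\<not> ?thesis"
  define e where "e = dist (pd i (pd j f) x) (pd j (pd i f) x) / 2"
  have e: "e > 0" using ne by (simp add: e_def)
  have c: "isCont (pd k (pd l f)) x" for k l
  proof -
    have "continuous_on U (pd k (pd l f))" using assms(2) by (simp add: numeral_2_eq_2)
    then show ?thesis using assms(1,3) continuous_on_eq_continuous_at by blast
  qed
  obtain r0 where r0: "r0 > 0" "ball x r0 \<subseteq> U" using assms open_contains_ball by blast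
  obtain r1 where r1: "r1 > 0" "!!y. dist y x < r1 ==> dist (pd i (pd j f) y) (pd i (pd j f) x) < e"
    using c e unfolding continuous_at_eps_delta by metis
  obtain r2 where r2: "r2 > 0" "!!y. dist y x < r2 ==> dist (pd j (pd i f) y) (pd j (pd i f) x) < e"
    using c e unfolding continuous_at_eps_delta by metis
  define t where "t = min r0 (min r1 r2) / 3"
  have t: "0 < t" "2 * t < r0" "2 * t < r1" "2 * t < r2" using r0 r1 r2 by (auto simp: t_def)
  have near: "dist (x + a *\<^sub>R axis k 1 + b *\<^sub>R axis l 1) x < 2 * t"
    if "0 < a" "a < t" "0 < b" "b < t" for a b k l
  proof -
    show ?thesis
      unfolding dist_add_add
      using norm_triangle_ineq[of "a *\<^sub>R axis k 1 :: real^3" "b *\<^sub>R axis l 1"] that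
      by simp
  qed
  obtain a b where ab: "0 < a" "a < t" "0 < b" "b < t"
    "f (x + t *\<^sub>R axis i 1 + t *\<^sub>R axis j 1) - f (x + t *\<^sub>R axis i 1) - f (x + t *\<^sub>R axis j 1) + f x
      = t * t * pd j (pd i f) (x + a *\<^sub>R axis i 1 + b *\<^sub>R axis j 1)"
    using second_difference[OF r0(2) assms(2) t(1,2)] by metis
  obtain a' b' where ab': "0 < a'" "a' < t" "0 < b'" "b' < t"
    "f (x + t *\<^sub>R axis j 1 + t *\<^sub>R axis i 1) - f (x + t *\<^sub>R axis j 1) - f (x + t *\<^sub>R axis i 1) + f x
      = t * t * pd i (pd j f) (x + a' *\<^sub>R axis j 1 + b' *\<^sub>R axis i 1)"
    using second_difference[OF r0(2) assms(2) t(1,2)] by metis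
  have sw: "x + t *\<^sub>R axis j 1 + t *\<^sub>R axis i 1 = x + t *\<^sub>R axis i 1 + t *\<^sub>R axis j 1"
    by (simp only: ac_simps)
  have "t * t * pd i (pd j f) (x + a' *\<^sub>R axis j 1 + b' *\<^sub>R axis i 1)
      = t * t * pd j (pd i f) (x + a *\<^sub>R axis i 1 + b *\<^sub>R axis j 1)"
    using ab(5) ab'(5) unfolding sw by linarith
  then have eq: "pd i (pd j f) (x + a' *\<^sub>R axis j 1 + b' *\<^sub>R axis i 1)
      = pd j (pd i f) (x + a *\<^sub>R axis i 1 + b *\<^sub>R axis j 1)"
    using t(1) mult_cancel_left by (metis less_irrefl mult_eq_0_iff)
  have "dist (pd i (pd j f) (x + a' *\<^sub>R axis j 1 + b' *\<^sub>R axis i 1)) (pd i (pd j f) x) < e"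
    by (rule r1(2)) (use near[OF ab'(1-4), of j i] t(3) in linarith)
  moreover have "dist (pd i (pd j f) (x + a' *\<^sub>R axis j 1 + b' *\<^sub>R axis i 1)) (pd j (pd i f) x) < e"
    unfolding eq by (rule r2(2)) (use near[OF ab(1-4), of i j] t(4) in linarith)
  ultimately have "dist (pd i (pd j f) x) (pd j (pd i f) x) < e + e"
    by (metis dist_commute dist_triangle_less_add)
  then show False by (simp add: e_def)
qed

section \<open>Integrals of compactly supported functions\<close>

lemma integral_translate:
  fixes f :: "real^3 => real"
  assumes "f \<in> borel_measurable borel"
  shows "(LINT y|lborel. f (c + y)) = (LINT y|lborel. f y)"
proof -
  have "(LINT y|lborel. f y) = (LINT y|distr lborel borel ((+) c). f y)"
    by (simp add: lborel_distr_plus)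
  also have "... = (LINT y|lborel. f (c + y))"
    using assms by (subst integral_distr) auto
  finally show ?thesis by simp
qed

lemma integrable_compact_support:
  fixes f :: "real^3 => real"
  assumes "continuous_on UNIV f" "!!y. norm y > R ==> f y = 0"
  shows "integrable lborel f"
proof -
  have "integrable lborel (%x. indicator (cball 0 R) x *\<^sub>R f x)"
    by (rule borel_integrable_compact) (auto intro: continuous_on_subset assms)
  moreover have "(%x. indicator (cball 0 R) x *\<^sub>R f x) = f"
    using assms(2) by (auto simp: indicator_def fun_eq_iff not_le)
  ultimately show ?thesis by simp
qed

lemma bounded_compact_support:
  fixes f :: "real^3 => real"
  assumes "continuous_on UNIV f" "!!y. norm y > R ==> f y = 0"
  obtains B where "B > 0" "!!y. \<bar>f y\<bar> <= B"
proof -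
  have "compact (f ` cball 0 R)"
    by (intro compact_continuous_image continuous_on_subset[OF assms(1)]) auto
  then obtain B where B: "B > 0" "!!y. y \<in> f ` cball 0 R ==> norm y <= B"
    using compact_imp_bounded[of "f ` cball 0 R"] unfolding bounded_pos by auto
  have "\<bar>f y\<bar> <= B" for y
    using B(2)[of "f y"] assms(2)[of y] B(1) by (cases "norm y > R") (auto simp: not_less)
  then show ?thesis using that B(1) by blast
qed

text \<open>The integral is invariant under translations in direction \<open>i\<close>; differentiate this.\<close>

lemma integral_pd_eq_0:
  fixes F :: "real^3 => real"
  assumes F: "Ck 1 UNIV F" and supp: "!!y. norm y > R ==> F y = 0"
  shows "(LINT y|lborel. pd i F y) = 0"
proof -
  have diff: "F differentiable at y" for y using F by simp
  have cpd: "continuous_on UNIV (pd i F)" for i using F by simp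
  have cF: "continuous_on UNIV F" using F Ck_continuous_on by blast
  have supp': "pd k F y = 0" if "norm y > R" for y k
  proof -
    have "pd k F y = pd k (%y. 0) y"
      by (rule pd_cong[of "- cball 0 R"]) (use supp that in auto)
    then show ?thesis by (simp add: pd_const)
  qed
  obtain B where B: "B > 0" "!!y. \<bar>pd i F y\<bar> <= B"
    using bounded_compact_support[OF cpd supp'] by metis
  define \<tau> where "\<tau> n = 1 / real (Suc n)" for n
  have \<tau>: "\<tau> n > 0" "\<tau> n <= 1" for n by (auto simp: \<tau>_def)
  have \<tau>0: "\<tau> \<longlonglongrightarrow> 0" unfolding \<tau>_def by (rule LIMSEQ_inverse_real_of_nat[unfolded inverse_eq_divide])
  let ?e = "axis i 1 :: real^3"
  define q where "q n y = (F (\<tau> n *\<^sub>R ?e + y) - F y) / \<tau> n" for n y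
  have int: "integrable lborel F" using integrable_compact_support[OF cF supp] .
  have "F \<in> borel_measurable borel" by (rule borel_measurable_continuous_onI[OF cF])
  note meas = this
  have "(LINT y|lborel. q n y) = 0" for n
  proof -
    have "integrable lborel (%y. F (\<tau> n *\<^sub>R ?e + y))"
    proof (rule integrable_compact_support[where R="R + 1"])
      show "continuous_on UNIV (%y. F (\<tau> n *\<^sub>R ?e + y))"
        by (intro continuous_on_compose2[OF cF] continuous_intros) auto
      show "F (\<tau> n *\<^sub>R ?e + y) = 0" if "norm y > R + 1" for y
        using \<tau>[of n] norm_diff_ineq[of y "\<tau> n *\<^sub>R ?e"] that
        by (intro supp) (simp add: add.commute)
    qed
    then show ?thesis unfolding q_def using int integral_translate[OF meas] by simp
  qed
  moreover have "(%n. LINT y|lborel. q n y) \<longlonglongrightarrow> (LINT y|lborel. pd i F y)"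
  \<comment> \<open>By the mean value theorem the quotients \<open>q n\<close> are bounded by
    \<open>B\<close>; since all increments are at most 1, they vanish outside the ball of radius
    \<open>R + 1\<close>.\<close>
  proof (rule integral_dominated_convergence[where w="%y. B * indicator (cball 0 (R + 1)) y"])
    show "pd i F \<in> borel_measurable lborel" by (simp add: borel_measurable_continuous_onI[OF cpd])
    show "q n \<in> borel_measurable lborel" for n
      unfolding q_def using meas by measurable
    show "integrable lborel (%y::real^3. B * indicator (cball 0 (R + 1)) y)"
      using borel_integrable_compact[of "cball 0 (R+1) :: (real^3) set" "%_. B"] by (simp add: mult.commute)
    show "AE y in lborel. (%n. q n y) \<longlonglongrightarrow> pd i F y"
    proof (rule AE_I2)
      fix y
      have "((%s. F (y + s *\<^sub>R ?e)) has_real_derivative pd i F (y + 0 *\<^sub>R ?e)) (at 0)"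
        by (rule DERIV_axis) (use diff in simp)
      then have "((%h. (F (y + h *\<^sub>R ?e) - F y) / h) \<longlongrightarrow> pd i F y) (at 0)"
        by (simp add: DERIV_def)
      moreover have "filterlim \<tau> (at 0) sequentially"
        using \<tau>0 \<tau>(1) unfolding filterlim_at by (auto simp: less_le)
      ultimately have "(%n. (F (y + \<tau> n *\<^sub>R ?e) - F y) / \<tau> n) \<longlonglongrightarrow> pd i F y"
        using filterlim_compose by blast
      then show "(%n. q n y) \<longlonglongrightarrow> pd i F y" by (simp add: q_def add.commute)
    qed
    show "AE y in lborel. norm (q n y) <= B * indicator (cball 0 (R + 1)) y" for n
    proof (rule AE_I2)
      fix y
      show "norm (q n y) <= B * indicator (cball 0 (R + 1)) y"
      proof (cases "norm y <= R + 1")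
        case True
        have "\<exists>z>0. z < \<tau> n \<and> F (y + \<tau> n *\<^sub>R ?e) - F (y + 0 *\<^sub>R ?e) = (\<tau> n - 0) * pd i F (y + z *\<^sub>R ?e)"
          by (rule MVT2[OF \<tau>(1)]) (rule DERIV_axis[OF diff])
        then obtain z where "F (y + \<tau> n *\<^sub>R ?e) - F y = \<tau> n * pd i F (y + z *\<^sub>R ?e)" by auto
        then have "q n y = pd i F (y + z *\<^sub>R ?e)"
          using \<tau>(1)[of n] by (simp add: q_def add.commute)
        then show ?thesis using B(2) True by simp
      next
        case False
        have "norm (\<tau> n *\<^sub>R ?e) <= 1" using \<tau>[of n] by simp
        then have "norm (\<tau> n *\<^sub>R ?e + y) > R"
          using False norm_diff_ineq[of y "\<tau> n *\<^sub>R ?e"] by (simp add: add.commute)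
        then have "q n y = 0" using False supp by (simp add: q_def)
        then show ?thesis using B(1) by simp
      qed
    qed
  qed
  ultimately have "(%n. 0::real) \<longlonglongrightarrow> (LINT y|lborel. pd i F y)" by (simp only:)
  then show ?thesis by (simp add: LIMSEQ_const_iff)
qed

section \<open>Kernels supported in the unit ball, and convolution at scale \<open>s\<close>\<close>

definition kern :: "nat => (real^3 => real) => bool" where
  "kern k K \<longleftrightarrow> Ck k UNIV K \<and> (\<forall>x. norm x > 1 --> K x = 0)"

lemma kernD: "kern k K ==> Ck k UNIV K" "kern k K ==> norm x > 1 ==> K x = 0"
  by (auto simp: kern_def)

lemma kern_continuous: "kern k K ==> continuous_on UNIV K"
  using Ck_continuous_on kernD(1) by blast

lemma kern_mono: "kern k K ==> j <= k ==> kern j K"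
  unfolding kern_def using Ck_mono by blast

lemma kern_pd: "kern (Suc k) K ==> kern k (pd i K)"
proof -
  assume K: "kern (Suc k) K"
  have "pd i K x = 0" if "norm x > 1" for x
  proof -
    have "pd i K x = pd i (%y. 0) x"
      by (rule pd_cong[of "- cball 0 1"]) (use kernD(2)[OF K] that in auto)
    then show ?thesis by (simp add: pd_const)
  qed
  then show ?thesis using K by (simp add: kern_def)
qed

lemma kern_pds: "kern (length is + k) K ==> kern k (pds is K)"
  by (induction "is" arbitrary: K) (auto dest: kern_pd)

lemma kern_add: "kern k K ==> kern k L ==> kern k (%x. K x + L x)"
  unfolding kern_def by (auto intro: Ck_add)

lemma kern_cmult: "kern k K ==> kern k (%x. c * K x)"
  unfolding kern_def by (auto intro: Ck_cmult)

lemma kern_mult: "Ck k UNIV f ==> kern k K ==> kern k (%x. f x * K x)"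
  unfolding kern_def by (auto intro: Ck_mult)

lemma kern_sum: "finite S ==> (!!j. j \<in> S ==> kern k (K j)) ==> kern k (%x. \<Sum>j\<in>S. K j x)"
  unfolding kern_def by (auto intro: Ck_sum)

lemma kern_bounded:
  assumes "kern k K" obtains B where "B > 0" "!!x. \<bar>K x\<bar> <= B"
  using bounded_compact_support[OF kern_continuous[OF assms] kernD(2)[OF assms]] by metis

lemma kern_grad_bounded:
  assumes "kern (Suc k) K" obtains B where "B > 0" "!!x. norm (grad K x) <= B"
proof -
  have "\<exists>B>0. \<forall>x. \<bar>pd i K x\<bar> <= B" for i
    using kern_bounded[OF kern_pd[OF assms, of i]] by metis
  then obtain B where B: "!!i. B i > 0" "!!i x. \<bar>pd i K x\<bar> <= B i" by metis
  have "norm (grad K x) <= 3 * (B 1 + B 2 + B 3)" for x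
  proof (rule norm_grad_le)
    fix i :: 3
    show "\<bar>pd i K x\<bar> <= B 1 + B 2 + B 3"
      using B(2)[where i=i and x=x] B(1)[of 1] B(1)[of 2] B(1)[of 3] exhaust_3[of i] by auto
  qed
  then show ?thesis using that[of "3 * (B 1 + B 2 + B 3)"] B(1)[of 1] B(1)[of 2] B(1)[of 3] by simp
qed

lemma differentiable_inner: "(%z. a \<bullet> z) differentiable at x" for a :: "real^3"
  by (rule bounded_linear_imp_differentiable[OF bounded_linear_inner_right])

lemma grad_inner: "grad (%z. a \<bullet> z) x = a"
  by (rule grad_eq) (rule bounded_linear_imp_has_derivative[OF bounded_linear_inner_right])

lemma grad_diff:
  "f differentiable at x ==> g differentiable at x ==> grad (%x. f x - g x) x = grad f x - grad g x"
  by (simp add: grad_def vec_eq_iff pd_diff)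

text \<open>The remainder is quadratic with a constant independent of the point \<open>a\<close>.
  This uniformity lets a convolution be differentiated by integrating the expansion of its
  kernel.\<close>

lemma kern_taylor:
  assumes K: "kern 2 K"
  obtains C where "C > 0" "!!a h. \<bar>K (a + h) - K a - grad K a \<bullet> h\<bar> <= C * (norm h)\<^sup>2"
proof -
  have K1: "kern (Suc 0) (pd i K)" for i using K by (intro kern_pd) (simp add: numeral_2_eq_2)
  have dK: "K differentiable at x" for x using kernD(1)[OF K] by (simp add: numeral_2_eq_2)
  have "\<exists>B>0. \<forall>x. norm (grad (pd i K) x) <= B" for i
    using kern_grad_bounded[OF K1, of i] by metis
  then obtain B where B: "!!i. B i > 0" "!!i x. norm (grad (pd i K) x) <= B i" by metis
  define C where "C = B 1 + B 2 + B 3"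
  have Bi: "B i <= C" for i
    using B(1)[of 1] B(1)[of 2] B(1)[of 3] exhaust_3[of i] unfolding C_def by auto
  have C: "C > 0" using B(1)[of 1] B(1)[of 2] B(1)[of 3] by (simp add: C_def)
  have g: "norm (grad K z - grad K a) <= 3 * C * norm (z - a)" for z a
  proof -
    have "\<bar>(grad K z - grad K a) $ i\<bar> <= C * norm (z - a)" for i
    proof -
      have "\<bar>pd i K z - pd i K a\<bar> <= C * norm (z - a)"
        by (rule mvt_grad[where U=UNIV])
          (use kernD(1)[OF K1] order_trans[OF B(2) Bi] in auto)
      then show ?thesis by (simp add: grad_def)
    qed
    from this[of 1] this[of 2] this[of 3]
    show ?thesis using norm_le_l1_cart[of "grad K z - grad K a"] by (simp only: sum_3)
  qed
  have "\<bar>K (a + h) - K a - grad K a \<bullet> h\<bar> <= 3 * C * (norm h)\<^sup>2" for a h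
  proof -
    let ?f = "%z. K z - grad K a \<bullet> z"
    have "\<bar>?f (a + h) - ?f a\<bar> <= (3 * C * norm h) * norm (a + h - a)"
    proof (rule mvt_grad[where U=UNIV])
      show "?f differentiable at z" for z by (intro differentiable_diff dK differentiable_inner)
      fix z assume z: "z \<in> closed_segment (a + h) a"
      have "norm (z - a) <= norm h"
        using segment_bound(2)[OF z] by (simp add: norm_minus_commute)
      then have "3 * C * norm (z - a) <= 3 * C * norm h" using C by simp
      then show "norm (grad ?f z) <= 3 * C * norm h"
        using g[of z a] by (simp only: grad_diff[OF dK differentiable_inner] grad_inner)
    qed simp
    then show ?thesis by (simp add: inner_add_right power2_eq_square algebra_simps)
  qed
  then show ?thesis using that[of "3 * C"] C by simp
qed

text \<open>The power \<open>s ^ 3\<close> that would normalise the kernel is left out: derivatives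
  of the kernel call for higher powers of \<open>s\<close>, and \<open>mol\<close> supplies the
  right one.\<close>

definition conv :: "(real^3 => real) => (real^3 => real) => real => real^3 => real" where
  "conv v K s x = (LINT y|lborel. v y * K ((1 / s) *\<^sub>R (x - y)))"

lemma conv_measurable:
  fixes K :: "real^3 => real"
  assumes "continuous_on UNIV K"
  shows "(%y. K ((1 / s) *\<^sub>R (x - y))) \<in> borel_measurable borel"
  by (intro borel_measurable_continuous_onI continuous_on_compose2[OF assms] continuous_intros) auto

lemma conv_integrable:
  fixes K :: "real^3 => real"
  assumes v: "integrable lborel v" and K: "continuous_on UNIV K" and B: "!!x. \<bar>K x\<bar> <= B"
  shows "integrable lborel (%y. v y * K ((1 / s) *\<^sub>R (x - y)))"
proof (rule Bochner_Integration.integrable_bound[where f="%y. B * v y"])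
  show "integrable lborel (%y. B * v y)" using v by simp
  have "v \<in> borel_measurable borel" using v by auto
  then show "(%y. v y * K ((1 / s) *\<^sub>R (x - y))) \<in> borel_measurable lborel"
    using conv_measurable[OF K] by simp
  have B0: "0 <= B" using order_trans[OF abs_ge_zero B] .
  show "AE y in lborel. norm (v y * K ((1 / s) *\<^sub>R (x - y))) <= norm (B * v y)"
  proof (rule AE_I2)
    fix y
    show "norm (v y * K ((1 / s) *\<^sub>R (x - y))) <= norm (B * v y)"
      using mult_right_mono[OF B, of "\<bar>v y\<bar>"] B0
      by (simp add: abs_mult mult.commute[of "\<bar>v y\<bar>"])
  qed
qed

lemma kern_conv_integrable:
  assumes "integrable lborel v" "kern k K"
  shows "integrable lborel (%y. v y * K ((1 / s) *\<^sub>R (x - y)))"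
  using kern_bounded[OF assms(2)] conv_integrable[OF assms(1) kern_continuous[OF assms(2)]] by metis

lemma conv_kern_add:
  assumes "integrable lborel v" "kern k K" "kern l L"
  shows "conv v (%x. K x + L x) s x = conv v K s x + conv v L s x"
  unfolding conv_def using kern_conv_integrable[OF assms(1,2)] kern_conv_integrable[OF assms(1,3)]
  by (simp add: distrib_left)

lemma conv_kern_cmult: "conv v (%x. c * K x) s x = c * conv v K s x"
  unfolding conv_def by (simp add: mult.left_commute)

lemma norm_scaleR_inverse: "s > 0 ==> norm ((1 / s) *\<^sub>R u) > 1 \<longleftrightarrow> norm u > s"
  by (simp add: field_simps)

text \<open>The dilated kernel sees only the ball of radius \<open>s\<close>. Hence at scales below
  the distance to the boundary an extension by zero may be replaced by the function itself, and near
  a mirror point outside the domain by zero.\<close>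

lemma conv_cong:
  assumes "kern k K" "s > 0" "!!y. y \<in> cball x s ==> v y = w y"
  shows "conv v K s x = conv w K s x"
proof -
  have "v y * K ((1 / s) *\<^sub>R (x - y)) = w y * K ((1 / s) *\<^sub>R (x - y))" for y
  proof (cases "y \<in> cball x s")
    case False
    then have "norm ((1 / s) *\<^sub>R (x - y)) > 1"
      using assms(2) by (simp add: dist_norm norm_scaleR_inverse)
    then show ?thesis using kernD(2)[OF assms(1)] by simp
  qed (use assms(3) in simp)
  then show ?thesis unfolding conv_def by presburger
qed

lemma conv_bound:
  assumes K: "kern k K" and s: "s > 0" and B: "!!x. \<bar>K x\<bar> <= B" and v: "!!y. y \<in> cball x s ==> \<bar>v y\<bar> <= A"
  shows "\<bar>conv v K s x\<bar> <= A * B * unit_ball_vol 3 * s ^ 3"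
proof -
  have A0: "0 <= A" using v[of x] s order_trans[OF abs_ge_zero] by simp
  have B0: "0 <= B" using order_trans[OF abs_ge_zero B] .
  have "\<bar>v y * K ((1 / s) *\<^sub>R (x - y))\<bar> <= A * B * indicator (cball x s) y" for y
  proof (cases "y \<in> cball x s")
    case True
    then show ?thesis using mult_mono[OF v[OF True] B A0 abs_ge_zero] by (simp add: abs_mult)
  next
    case False
    then have "norm ((1 / s) *\<^sub>R (x - y)) > 1"
      using s by (simp add: dist_norm norm_scaleR_inverse)
    then show ?thesis using kernD(2)[OF K] A0 B0 by simp
  qed
  moreover have "integrable lborel (%y. A * B * indicator (cball x s) y :: real)"
    by (intro integrable_mult_right integrable_real_indicator) (use emeasure_bounded_finite[OF bounded_cball, of x s] in auto)
  ultimately have "\<bar>conv v K s x\<bar> <= (LINT y|lborel. A * B * indicator (cball x s) y)"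
    unfolding conv_def
    by (intro order_trans[OF integral_abs_bound]) (rule integral_mono'; simp add: A0 B0)
  also have "... = A * B * unit_ball_vol 3 * s ^ 3"
    using s by (simp add: content_cball)
  finally show ?thesis .
qed

lemma has_derivative_quadratic:
  fixes f :: "'a::real_normed_vector => real"
  assumes "bounded_linear D" "!!h. \<bar>f (x + h) - f x - D h\<bar> <= C * (norm h)\<^sup>2"
  shows "(f has_derivative D) (at x)"
  unfolding has_derivative_at
proof
  show "(%h. norm (f (x + h) - f x - D h) / norm h) \<midarrow>0\<rightarrow> 0"
  proof (rule Lim_null_comparison[where g="%h. C * norm h"])
    show "\<forall>\<^sub>F h in at 0. norm (norm (f (x + h) - f x - D h) / norm h) <= C * norm h"
      unfolding eventually_at_filter
      by (rule always_eventually) (use assms(2) in \<open>simp add: divide_le_eq power2_eq_square mult.assoc\<close>)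
    show "((%h. C * norm h) \<longlongrightarrow> 0) (at (0::'a))" by (auto intro!: tendsto_eq_intros)
  qed
qed (rule assms(1))

text \<open>Integration of the expansion in \<open>kern_taylor\<close> against \<open>v\<close>
  leaves a remainder of order \<open>(norm h)\<^sup>2\<close>. All smoothness is provided by the
  kernel.\<close>

lemma conv_has_derivative:
  assumes v: "integrable lborel v" and K: "kern 2 K"
  shows "(conv v K s has_derivative (%h. (\<chi> i. (1 / s) * conv v (pd i K) s x) \<bullet> h)) (at x)"
proof -
  obtain C where C: "C > 0" "!!a h. \<bar>K (a + h) - K a - grad K a \<bullet> h\<bar> <= C * (norm h)\<^sup>2"
    using kern_taylor[OF K] by blast
  have K1: "kern 1 (pd i K)" for i using K by (intro kern_pd) (simp add: numeral_2_eq_2)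
  let ?a = "%x y. (1 / s) *\<^sub>R (x - y) :: real^3"
  have I: "integrable lborel (%y. v y * K (?a x y))" for x by (rule kern_conv_integrable[OF v K])
  have Ii: "integrable lborel (%y. v y * pd i K (?a x y))" for i x by (rule kern_conv_integrable[OF v K1])
  show ?thesis
  proof (rule has_derivative_quadratic)
    show "bounded_linear (%h. (\<chi> i. (1 / s) * conv v (pd i K) s x) \<bullet> h)" by (rule bounded_linear_inner_right)
    fix h :: "real^3"
    have D: "(\<chi> i. (1 / s) * conv v (pd i K) s x) \<bullet> h = (LINT y|lborel. v y * (grad K (?a x y) \<bullet> ((1 / s) *\<^sub>R h)))"
    proof -
      have "(LINT y|lborel. v y * (grad K (?a x y) \<bullet> ((1 / s) *\<^sub>R h)))
        = (LINT y|lborel. (\<Sum>i\<in>UNIV. (h $ i / s) * (v y * pd i K (?a x y))))"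
        by (rule Bochner_Integration.integral_cong) (simp_all add: inner_vec_def grad_def sum_distrib_left mult_ac)
      also have "... = (\<Sum>i\<in>UNIV. (h $ i / s) * conv v (pd i K) s x)"
        unfolding conv_def using Ii by (subst Bochner_Integration.integral_sum) auto
      finally show ?thesis by (simp add: inner_vec_def mult_ac)
    qed
    have ID: "integrable lborel (%y. v y * (grad K (?a x y) \<bullet> ((1 / s) *\<^sub>R h)))"
    proof -
      have "integrable lborel (%y. (\<Sum>i\<in>UNIV. (h $ i / s) * (v y * pd i K (?a x y))))"
        using Ii by (intro Bochner_Integration.integrable_sum) auto
      then show ?thesis by (simp add: inner_vec_def grad_def sum_distrib_left mult_ac)
    qed
    have "conv v K s (x + h) - conv v K s x - (\<chi> i. (1 / s) * conv v (pd i K) s x) \<bullet> h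
      = (LINT y|lborel. v y * K (?a (x + h) y) - v y * K (?a x y) - v y * (grad K (?a x y) \<bullet> ((1 / s) *\<^sub>R h)))"
      unfolding D unfolding conv_def using I ID by (simp add: Bochner_Integration.integral_diff)
    also have "\<bar>...\<bar> <= (LINT y|lborel. \<bar>v y\<bar> * (C * (norm ((1 / s) *\<^sub>R h))\<^sup>2))"
    proof (rule order_trans[OF integral_abs_bound integral_mono])
      show "integrable lborel (%y. \<bar>v y * K (?a (x + h) y) - v y * K (?a x y) - v y * (grad K (?a x y) \<bullet> ((1 / s) *\<^sub>R h))\<bar>)"
        using I ID by auto
      show "integrable lborel (%y. \<bar>v y\<bar> * (C * (norm ((1 / s) *\<^sub>R h))\<^sup>2))" using v by auto
      fix y
      have "?a (x + h) y = ?a x y + (1 / s) *\<^sub>R h" by (simp add: algebra_simps)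
      then have "v y * K (?a (x + h) y) - v y * K (?a x y) - v y * (grad K (?a x y) \<bullet> ((1 / s) *\<^sub>R h))
        = v y * (K (?a x y + (1 / s) *\<^sub>R h) - K (?a x y) - grad K (?a x y) \<bullet> ((1 / s) *\<^sub>R h))"
        by (simp only: right_diff_distrib)
      then show "\<bar>v y * K (?a (x + h) y) - v y * K (?a x y) - v y * (grad K (?a x y) \<bullet> ((1 / s) *\<^sub>R h))\<bar>
        <= \<bar>v y\<bar> * (C * (norm ((1 / s) *\<^sub>R h))\<^sup>2)"
        by (simp only: abs_mult) (rule mult_left_mono[OF C(2)], simp)
    qed
    also have "... = ((LINT y|lborel. \<bar>v y\<bar>) * C / s\<^sup>2) * (norm h)\<^sup>2"
      by (simp add: power_divide power_mult_distrib)
    finally show "\<bar>conv v K s (x + h) - conv v K s x - (\<chi> i. (1 / s) * conv v (pd i K) s x) \<bullet> h\<bar>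
      <= ((LINT y|lborel. \<bar>v y\<bar>) * C / s\<^sup>2) * (norm h)\<^sup>2" .
  qed
qed

lemma pd_conv:
  assumes "integrable lborel v" "kern 2 K" shows "pd i (conv v K s) x = (1 / s) * conv v (pd i K) s x"
  using pd_inner[OF conv_has_derivative[OF assms]] by simp

lemma conv_differentiable:
  assumes "integrable lborel v" "kern 2 K" shows "conv v K s differentiable at x"
  using conv_has_derivative[OF assms] differentiableI by blast

section \<open>Dependence of a convolution on its scale\<close>

definition euler :: "real => (real^3 => real) => real^3 => real" where
  "euler a K y = a * K y + grad K y \<bullet> y"

lemma Ck_coord: "Ck k U (%y. y $ i)"
proof (induction k)
  case (Suc k)
  have hd: "((%y. y $ i) has_derivative (%h. h $ i)) (at x)" for x :: "real^3"
    by (rule bounded_linear_imp_has_derivative[OF bounded_linear_vec_nth])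
  then have "pd j (%y. y $ i) = (%x. axis j (1::real) $ i)" for j
    by (intro ext pd_eq)
  then show ?case using hd Ck_const by (auto simp: differentiable_def)
qed (auto intro: continuous_intros)

lemma pd_coord: "pd j (%y. y $ i) x = (if i = j then 1 else 0)"
  by (subst pd_eq[OF bounded_linear_imp_has_derivative[OF bounded_linear_vec_nth]]) (simp add: axis_def)

lemma differentiable_coord: "(%y. y $ i) differentiable at x" for x :: "real^3"
  by (rule bounded_linear_imp_differentiable[OF bounded_linear_vec_nth])

lemma euler_alt: "euler a K = (%y. a * K y + (\<Sum>j\<in>UNIV. y $ j * pd j K y))"
  by (auto simp: euler_def grad_def inner_vec_def mult.commute)

lemma kern_euler: "kern (Suc k) K ==> kern k (euler a K)"
  unfolding euler_alt
  by (intro kern_add kern_cmult kern_sum kern_mult Ck_coord kern_pd) (auto intro: kern_mono)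

text \<open>Differentiating K(y/s) / s^m in s produces \<open>- euler m K\<close> at y/s, divided by
  s^(m+1). A partial derivative of the kernel raises the parameter by one, because the commutator of
  \<open>pd i\<close> with the radial derivative is \<open>pd i\<close> itself; this matches the
  extra power of s that a derivative costs.\<close>

lemma pd_euler:
  assumes K: "Ck 2 UNIV K"
  shows "pd i (euler a K) = euler (a + 1) (pd i K)"
proof
  fix x
  have d: "K differentiable at x" "pd j K differentiable at x" for j x
    using K by (auto simp: numeral_2_eq_2)
  have dc: "(%y. y $ j * pd j K y) differentiable at x" for j
    by (intro differentiable_mult differentiable_coord d)
  have "pd i (euler a K) x = pd i (%y. a * K y) x + pd i (%y. \<Sum>j\<in>UNIV. y $ j * pd j K y) x"
    unfolding euler_alt
    by (rule pd_add) (intro differentiable_mult differentiable_const d differentiable_sum ballI finite dc)+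
  also have "pd i (%y. \<Sum>j\<in>UNIV. y $ j * pd j K y) x = (\<Sum>j\<in>UNIV. pd i (%y. y $ j * pd j K y) x)"
    by (rule pd_sum) (simp_all add: dc)
  also have "... = (\<Sum>j\<in>UNIV. x $ j * pd i (pd j K) x + (if j = i then 1 else 0) * pd j K x)"
    by (simp only: pd_mult[OF differentiable_coord d(2)] pd_coord)
  also have "pd i (%y. a * K y) x = a * pd i K x" by (rule pd_cmult[OF d(1)])
  also have "(\<Sum>j\<in>UNIV. x $ j * pd i (pd j K) x + (if j = i then 1 else 0) * pd j K x)
      = (\<Sum>j\<in>UNIV. x $ j * pd j (pd i K) x) + (\<Sum>j\<in>UNIV. if j = i then pd j K x else 0)"
    unfolding sum.distrib pd_commute[OF open_UNIV K UNIV_I, of i]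
    by (intro arg_cong2[where f="(+)"] sum.cong) auto
  also have "(\<Sum>j\<in>UNIV. if j = i then pd j K x else 0) = pd i K x" by simp
  also have "a * pd i K x + ((\<Sum>j\<in>UNIV. x $ j * pd j (pd i K) x) + pd i K x) = euler (a + 1) (pd i K) x"
    unfolding euler_alt by (simp add: distrib_right)
  finally show "pd i (euler a K) x = euler (a + 1) (pd i K) x" .
qed

lemma has_real_derivative_integral:
  fixes f :: "real => 'a => real"
  assumes s0: "a < s0" "s0 < b"
    and int: "!!s. a < s ==> s < b ==> integrable M (f s)"
    and der: "!!s y. a < s ==> s < b ==> ((%s. f s y) has_real_derivative f' s y) (at s)"
    and bd: "!!s y. a < s ==> s < b ==> \<bar>f' s y\<bar> <= g y"
    and g: "integrable M g" and meas: "f' s0 \<in> borel_measurable M"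
  shows "((%s. \<integral>y. f s y \<partial>M) has_real_derivative (\<integral>y. f' s0 y \<partial>M)) (at s0)"
  unfolding has_field_derivative_iff tendsto_at_iff_sequentially comp_def
proof (intro allI impI)
  fix X :: "nat => real"
  assume X: "\<forall>i. X i \<in> UNIV - {s0}" "X \<longlonglongrightarrow> s0"
  have ev: "\<forall>\<^sub>F n in sequentially. a < X n \<and> X n < b"
    using order_tendstoD[OF X(2)] s0 by (auto intro: eventually_conj)
  \<comment> \<open>The sequence may leave the interval at finitely many places, so it is shifted by
    \<open>N\<close> and the limit is transferred back at the end.\<close>
  then obtain N where N: "!!n. n >= N ==> a < X n \<and> X n < b"
    unfolding eventually_sequentially by blast
  have "(%n. \<integral>y. (f (X (n + N)) y - f s0 y) / (X (n + N) - s0) \<partial>M) \<longlonglongrightarrow> (\<integral>y. f' s0 y \<partial>M)"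
  proof (rule integral_dominated_convergence[where w=g])
    show "(%y. (f (X (n + N)) y - f s0 y) / (X (n + N) - s0)) \<in> borel_measurable M" for n
      using int[of "X (n + N)"] int[OF s0] N[of "n + N"] by auto
    show "AE y in M. (%n. (f (X (n + N)) y - f s0 y) / (X (n + N) - s0)) \<longlonglongrightarrow> f' s0 y"
    proof (rule AE_I2)
      fix y
      have "(%n. (f (X n) y - f s0 y) / (X n - s0)) \<longlonglongrightarrow> f' s0 y"
        using der[OF s0, of y] X unfolding has_field_derivative_iff tendsto_at_iff_sequentially comp_def
        by blast
      then show "(%n. (f (X (n + N)) y - f s0 y) / (X (n + N) - s0)) \<longlonglongrightarrow> f' s0 y"
        by (rule LIMSEQ_ignore_initial_segment)
    qed
    show "AE y in M. norm ((f (X (n + N)) y - f s0 y) / (X (n + N) - s0)) <= g y" for n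
    proof (rule AE_I2)
      fix y
      have "norm (f (X (n + N)) y - f s0 y) <= g y * norm (X (n + N) - s0)"
      proof (rule field_differentiable_bound[where S="{a<..<b}" and f'="%s. f' s y"])
        show "((%s. f s y) has_field_derivative f' s y) (at s within {a<..<b})" if "s \<in> {a<..<b}" for s
          using der that by (auto intro: has_field_derivative_at_within)
      qed (use bd s0 N[of "n + N"] in auto)
      moreover have "X (n + N) - s0 \<noteq> 0" using X(1) by auto
      ultimately show "norm ((f (X (n + N)) y - f s0 y) / (X (n + N) - s0)) <= g y"
        by (simp add: divide_le_eq abs_divide)
    qed
  qed (use g meas in auto)
  moreover have "(\<integral>y. (f (X (n + N)) y - f s0 y) / (X (n + N) - s0) \<partial>M)
     = ((\<integral>y. f (X (n + N)) y \<partial>M) - (\<integral>y. f s0 y \<partial>M)) / (X (n + N) - s0)" for n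
    using int[of "X (n + N)"] int[OF s0] N[of "n + N"] by simp
  ultimately show "(%n. ((\<integral>y. f (X n) y \<partial>M) - (\<integral>y. f s0 y \<partial>M)) / (X n - s0)) \<longlonglongrightarrow> (\<integral>y. f' s0 y \<partial>M)"
    by (simp only:) (rule LIMSEQ_offset)
qed

lemma DERIV_kernel_scale:
  fixes K :: "real^3 => real"
  assumes K: "!!x. K differentiable at x" and s: "s \<noteq> 0"
  shows "((%s. K ((1 / s) *\<^sub>R b)) has_real_derivative - (1 / s) * (grad K ((1 / s) *\<^sub>R b) \<bullet> ((1 / s) *\<^sub>R b))) (at s)"
proof -
  have "((%s. (1 / s) *\<^sub>R b) has_derivative (%h. (- h / s\<^sup>2) *\<^sub>R b)) (at s)"
    by (auto intro!: derivative_eq_intros simp: s power2_eq_square)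
  from has_derivative_compose[OF this has_derivative_grad[OF K]]
  show ?thesis
    by (rule has_derivative_imp_has_field_derivative) (simp add: power2_eq_square)
qed

lemma DERIV_conv:
  assumes v: "integrable lborel v" and K: "kern 1 K" and s0: "s0 > 0"
  shows "((%s. conv v K s x) has_real_derivative - (1 / s0) * conv v (euler 0 K) s0 x) (at s0)"
proof -
  have E: "kern 0 (euler 0 K)" using kern_euler[of 0 K] K by simp
  obtain B where B: "B > 0" "!!x. \<bar>euler 0 K x\<bar> <= B" using kern_bounded[OF E] by metis
  have dK: "K differentiable at x" for x using kernD(1)[OF K] by simp
  let ?a = "%s y. (1 / s) *\<^sub>R (x - y)"
  have "((%s. conv v K s x) has_real_derivative (LINT y|lborel. v y * (- (1 / s0) * euler 0 K (?a s0 y)))) (at s0)"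
    unfolding conv_def
  \<comment> \<open>On this interval \<open>1 / s\<close> is at most \<open>2 / s0\<close>, which
    gives a bound on the derivative independent of \<open>s\<close>.\<close>
  proof (rule has_real_derivative_integral[where a="s0 / 2" and b="s0 + 1" and g="%y. \<bar>v y\<bar> * (2 / s0 * B)"])
    fix s assume s: "s0 / 2 < s" "s < s0 + 1"
    show "integrable lborel (%y. v y * K (?a s y))" by (rule kern_conv_integrable[OF v K])
    fix y
    show "((%s. v y * K (?a s y)) has_real_derivative v y * (- (1 / s) * euler 0 K (?a s y))) (at s)"
      unfolding euler_def
      by (rule DERIV_cmult) (use DERIV_kernel_scale[OF dK, of s "x - y"] s s0 in simp)
    have "\<bar>1 / s\<bar> <= 2 / s0" using s s0 by (simp add: field_simps)
    from mult_mono[OF this B(2), of "?a s y"]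
    show "\<bar>v y * (- (1 / s) * euler 0 K (?a s y))\<bar> <= \<bar>v y\<bar> * (2 / s0 * B)"
      unfolding abs_mult using s0 by (intro mult_left_mono) auto
  next
    show "(%y. v y * (- (1 / s0) * euler 0 K (?a s0 y))) \<in> borel_measurable lborel"
      using v conv_measurable[OF kern_continuous[OF E], of s0 x] by auto
  qed (use s0 v in auto)
  moreover have "(LINT y|lborel. v y * (- (1 / s0) * euler 0 K (?a s0 y))) = - (1 / s0) * conv v (euler 0 K) s0 x"
    using conv_kern_cmult[of v "- (1 / s0)" "euler 0 K" s0 x] unfolding conv_def .
  ultimately show ?thesis by (simp only:)
qed

text \<open>The quotient rule combines the power of \<open>s\<close> and the derivative of the
  dilation into \<open>euler m K\<close>. When this is minus another kernel
  \<open>\<Lambda>\<close>, as for the mollifier with \<open>\<Lambda>\<close> a Laplacian, the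
  derivative is again a convolution, normalised by the next power.\<close>

lemma DERIV_conv_scaled:
  assumes v: "integrable lborel v" and K: "kern 1 K" and s0: "s0 > 0" and \<Lambda>: "euler (real m) K = (%y. - \<Lambda> y)"
  shows "((%s. conv v K s x / s ^ m) has_real_derivative conv v \<Lambda> s0 x / s0 ^ Suc m) (at s0)"
proof -
  have E: "kern 0 (euler 0 K)" using kern_euler[of 0 K] K by simp
  have eq: "\<Lambda> = (%y. - real m * K y + (-1) * euler 0 K y)"
    using \<Lambda> by (auto simp: euler_def fun_eq_iff) (smt (verit))
  have "conv v \<Lambda> s0 x = conv v (%y. - real m * K y) s0 x + conv v (%y. (-1) * euler 0 K y) s0 x"
    unfolding eq by (rule conv_kern_add[OF v kern_cmult[OF K] kern_cmult[OF E]])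
  then have c: "conv v \<Lambda> s0 x = - real m * conv v K s0 x - conv v (euler 0 K) s0 x"
    by (simp only: conv_kern_cmult)
  have "((%s. conv v K s x / s ^ m) has_real_derivative
      (- (1 / s0) * conv v (euler 0 K) s0 x * s0 ^ m - conv v K s0 x * (real m * s0 ^ (m - Suc 0))) / (s0 ^ m * s0 ^ m)) (at s0)"
    using s0 by (auto intro!: derivative_eq_intros DERIV_conv[OF v K])
  moreover have "(- (1 / s0) * conv v (euler 0 K) s0 x * s0 ^ m - conv v K s0 x * (real m * s0 ^ (m - Suc 0))) / (s0 ^ m * s0 ^ m)
     = conv v \<Lambda> s0 x / s0 ^ Suc m"
    unfolding c using s0 by (cases m) (simp_all add: field_simps)
  ultimately show ?thesis by simp
qed

section \<open>Integration by parts against a kernel\<close>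

lemma pd_kernel_affine:
  fixes K :: "real^3 => real"
  assumes K: "K differentiable at ((1 / s) *\<^sub>R (z - y))"
  shows "pd i (%y. K ((1 / s) *\<^sub>R (z - y))) y = - (1 / s) * pd i K ((1 / s) *\<^sub>R (z - y))"
    and "(%y. K ((1 / s) *\<^sub>R (z - y))) differentiable at y"
proof -
  have "((%y. (1 / s) *\<^sub>R (z - y)) has_derivative (%h. (1 / s) *\<^sub>R (- h))) (at y)"
    by (auto intro!: derivative_eq_intros)
  from has_derivative_compose[OF this has_derivative_grad[OF K]]
  have "((%y. K ((1 / s) *\<^sub>R (z - y))) has_derivative (%h. (- (1 / s) *\<^sub>R grad K ((1 / s) *\<^sub>R (z - y))) \<bullet> h)) (at y)"
    by simp
  then show "pd i (%y. K ((1 / s) *\<^sub>R (z - y))) y = - (1 / s) * pd i K ((1 / s) *\<^sub>R (z - y))"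
    "(%y. K ((1 / s) *\<^sub>R (z - y))) differentiable at y"
    using pd_inner[of _ _ y i] by (fastforce simp: grad_def, auto simp: differentiable_def)
qed

lemma Ck_kernel_affine:
  "Ck k UNIV K ==> Ck k UNIV (%y. K ((1 / s) *\<^sub>R (z - y)))" for K :: "real^3 => real"
proof (induction k arbitrary: K)
  case 0 then show ?case by (auto intro!: continuous_on_compose2[of UNIV K] continuous_intros)
next
  case (Suc k)
  have d: "K differentiable at x" for x using Suc.prems by simp
  have "Ck k UNIV (%y. - (1 / s) * pd i K ((1 / s) *\<^sub>R (z - y)))" for i
    using Suc by (intro Ck_cmult) auto
  moreover have "pd i (%y. K ((1 / s) *\<^sub>R (z - y))) = (%y. - (1 / s) * pd i K ((1 / s) *\<^sub>R (z - y)))" for i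
    by (intro ext pd_kernel_affine d)
  ultimately show ?case using pd_kernel_affine(2)[OF d] by simp
qed

text \<open>Outside \<open>U\<close> the values of \<open>f\<close> are arbitrary, but there the
  kernel vanishes. The open sets \<open>U\<close> and the complement of \<open>cball z s\<close>
  cover the space, and on the second the product is zero.\<close>

lemma Ck_times_kernel:
  assumes "open U" "Ck k U f" "kern k K" "s > 0" "cball z s \<subseteq> U"
  shows "Ck k UNIV (%y. f y * K ((1 / s) *\<^sub>R (z - y)))"
proof (rule Ck_local)
  fix y :: "real^3"
  let ?F = "%y. f y * K ((1 / s) *\<^sub>R (z - y))"
  show "\<exists>V. open V \<and> y \<in> V \<and> Ck k V ?F"
  proof (cases "y \<in> U")
    case True
    have "Ck k U ?F"
      using assms Ck_kernel_affine[OF kernD(1)[OF assms(3)], of s z] by (intro Ck_mult) (auto intro: Ck_subset)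
    then show ?thesis using True assms(1) by blast
  next
    case False
    have "?F x = 0" if "x \<in> - cball z s" for x
    proof -
      have "norm ((1 / s) *\<^sub>R (z - x)) > 1"
        using that assms(4) by (simp add: dist_norm norm_scaleR_inverse)
      then show ?thesis using kernD(2)[OF assms(3)] by simp
    qed
    then have "Ck k (- cball z s) ?F"
      using Ck_cong[of "- cball z s" ?F "%_. 0" k] Ck_const by auto
    then show ?thesis using False assms(5) by (intro exI[of _ "- cball z s"]) auto
  qed
qed

text \<open>The partial derivative of \<open>f\<close> times the dilated kernel integrates to zero.
  The chain rule contributes \<open>- 1 / s\<close>, whose sign cancels the one from integration by
  parts.\<close>

lemma conv_ibp:
  assumes U: "open U" and f: "Ck 1 U f" and K: "kern 1 K" and s: "s > 0" "cball z s \<subseteq> U"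
  shows "conv f (pd i K) s z = s * conv (pd i f) K s z"
proof -
  let ?a = "%y. (1 / s) *\<^sub>R (z - y)"
  let ?F = "%y. f y * K (?a y)"
  have K0: "kern 0 (pd j K)" for j using kern_pd[of 0] K by simp
  have out: "L (?a y) = 0" if "kern k L" "y \<notin> U" for y k L
  proof -
    have "y \<notin> cball z s" using that(2) s by blast
    then have "norm (?a y) > 1" using s by (simp add: dist_norm norm_scaleR_inverse)
    then show ?thesis using kernD(2)[OF that(1)] by simp
  qed
  have F: "Ck 1 UNIV ?F" by (rule Ck_times_kernel[OF U f K s])
  have supp: "?F y = 0" if "norm y > norm z + s" for y
  proof -
    have "norm (z - y) > s" using that norm_triangle_ineq2[of y z] by (simp add: norm_minus_commute)
    then show ?thesis using kernD(2)[OF K] s by (simp add: norm_scaleR_inverse)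
  qed
  have dK: "K differentiable at y" for y using kernD(1)[OF K] by simp
  have pdF: "pd i ?F y = pd i f y * K (?a y) - (1 / s) * (f y * pd i K (?a y))" for y
  proof (cases "y \<in> U")
    case True
    then have "f differentiable at y" using f by simp
    then show ?thesis
      by (simp add: pd_mult[OF _ pd_kernel_affine(2)[OF dK]] pd_kernel_affine(1)[OF dK])
  next
    case False
    have "pd i ?F y = pd i (%_. 0) y"
    proof (rule pd_cong[of "- cball z s"])
      show "y \<in> - cball z s" using False s by auto
      fix x assume "x \<in> - cball z s"
      then have "norm (?a x) > 1" using s by (simp add: dist_norm norm_scaleR_inverse)
      then show "?F x = 0" using kernD(2)[OF K] by simp
    qed auto
    then show ?thesis using out[OF K False] out[OF K0 False] by (simp add: pd_const)
  qed
  have supp2: "g y * L (?a y) = 0" if "kern 0 L" "norm y > norm z + s" for g L y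
  proof -
    have "norm (z - y) > s" using that norm_triangle_ineq2[of y z] by (simp add: norm_minus_commute)
    then show ?thesis using kernD(2)[OF that(1)] s by (simp add: norm_scaleR_inverse)
  qed
  have I1: "integrable lborel (%y. pd i f y * K (?a y))"
    using Ck_times_kernel[OF U _ kern_mono[OF K] s, of 0 "pd i f"] f supp2[OF kern_mono[OF K]]
    by (intro integrable_compact_support[where R="norm z + s"]) auto
  have I2: "integrable lborel (%y. f y * pd i K (?a y))"
    using Ck_times_kernel[OF U _ K0 s, of f] Ck_continuous_on[OF f] supp2[OF K0]
    by (intro integrable_compact_support[where R="norm z + s"]) auto
  have "0 = (LINT y|lborel. pd i ?F y)" using integral_pd_eq_0[OF F supp] by simp
  also have "... = conv (pd i f) K s z - (1 / s) * conv f (pd i K) s z"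
    unfolding pdF conv_def using I1 I2 by (simp add: Bochner_Integration.integral_diff)
  finally show ?thesis using s by (simp add: field_simps)
qed

section \<open>The mollifier, its potential, and the scale identity\<close>

definition bump :: "nat => real^3 => real" where
  "bump m z = (max 0 (1 - z \<bullet> z)) ^ m"

lemma DERIV_max_power:
  "((%t::real. (max 0 t) ^ Suc (Suc m)) has_real_derivative real (Suc (Suc m)) * (max 0 t) ^ Suc m) (at t)"
proof -
  consider "t > 0" | "t < 0" | "t = 0" by linarith
  then show ?thesis
  proof cases
    case 1
    have "((%t::real. t ^ Suc (Suc m)) has_real_derivative real (Suc (Suc m)) * (max 0 t) ^ Suc m) (at t)"
      using DERIV_pow[of "Suc (Suc m)" t] 1 by (simp add: max_absorb2)
    then show ?thesis
      by (rule has_field_derivative_transform_within_open[where S="{0<..}"]) (use 1 in auto)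
  next
    case 2
    have "((%t::real. 0) has_real_derivative real (Suc (Suc m)) * (max 0 t) ^ Suc m) (at t)"
      using 2 by simp
    then show ?thesis
      by (rule has_field_derivative_transform_within_open[where S="{..<0}"]) (use 2 in auto)
  next
    case 3
    have "((%h::real. (max 0 h) ^ Suc m) \<longlongrightarrow> 0) (at 0)"
      by (auto intro!: tendsto_eq_intros)
    then have "((%h::real. ((max 0 h) ^ Suc (Suc m) - (max 0 0) ^ Suc (Suc m)) / h) \<longlongrightarrow> 0) (at 0)"
      by (rule Lim_transform_eventually)
        (auto simp: eventually_at_filter max_def intro!: always_eventually)
    then show ?thesis unfolding 3 DERIV_def by simp
  qed
qed

lemma bump_has_derivative:
  "(bump (Suc (Suc m)) has_derivative (%h. ((- 2 * real (Suc (Suc m)) * bump (Suc m) z) *\<^sub>R z) \<bullet> h)) (at z)"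
proof -
  have "((%z. 1 - z \<bullet> z) has_derivative (%h. - (2 * (z \<bullet> h)))) (at z)" for z :: "real^3"
    by (auto intro!: derivative_eq_intros simp: inner_commute)
  from has_derivative_compose[OF this DERIV_max_power[unfolded has_field_derivative_def]]
  have "((%z. (max 0 (1 - z \<bullet> z)) ^ Suc (Suc m)) has_derivative
     (%h. real (Suc (Suc m)) * (max 0 (1 - z \<bullet> z)) ^ Suc m * - (2 * (z \<bullet> h)))) (at z)" .
  then show ?thesis unfolding bump_def by (rule has_derivative_eq_rhs) (simp add: fun_eq_iff algebra_simps)
qed

text \<open>The gradient of a power of \<open>1 - z \<bullet> z\<close> is a multiple of
  \<open>z\<close> times the next lower power. This exact relation between consecutive bumps links
  the potential to the mollifier, at the price of only finitely many derivatives.\<close>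

lemma pd_bump: "pd i (bump (Suc (Suc m))) = (%z. (- 2 * real (Suc (Suc m))) * (z $ i * bump (Suc m) z))"
  by (rule ext) (simp add: pd_inner[OF bump_has_derivative] mult_ac)

lemma Ck_bump: "Ck k UNIV (bump (Suc k))"
proof (induction k)
  case 0
  show ?case unfolding bump_def by (auto intro!: continuous_intros)
next
  case (Suc k)
  have "Ck k UNIV (%z. (- 2 * real (Suc (Suc k))) * (z $ i * bump (Suc k) z))" for i
    by (intro Ck_cmult Ck_mult Ck_coord Suc open_UNIV)
  then show ?case using bump_has_derivative by (simp only: Ck.simps pd_bump) (auto simp: differentiable_def)
qed

lemma kern_bump: "kern k (bump (Suc k))"
proof -
  have "bump (Suc k) x = 0" if "norm x > 1" for x
  proof -
    have "x \<bullet> x > 1" using that by (simp add: power2_norm_eq_inner[symmetric] one_less_power)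
    then show ?thesis by (simp add: bump_def)
  qed
  then show ?thesis using Ck_bump by (simp add: kern_def)
qed

definition bump_mass :: real where "bump_mass = (LINT y|lborel. bump 8 y)"

lemma bump_mass_pos: "bump_mass > 0"
proof -
  have I: "integrable lborel (bump 8)"
  proof -
    have "kern 7 (bump 8)" using kern_bump[of 7] by simp
    from integrable_compact_support[OF kern_continuous[OF this] kernD(2)[OF this]] show ?thesis .
  qed
  have I2: "integrable lborel (%y::real^3. (3/4)^8 * indicator (cball 0 (1/2)) y :: real)"
    by (intro integrable_mult_right integrable_real_indicator)
      (use emeasure_bounded_finite[OF bounded_cball, of "0::real^3" "1/2"] in auto)
  have "(LINT y|lborel. (3/4)^8 * indicator (cball (0::real^3) (1/2)) y) <= bump_mass"
    unfolding bump_mass_def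
  proof (rule integral_mono[OF I2 I])
    fix y :: "real^3"
    show "(3/4)^8 * indicator (cball 0 (1/2)) y <= bump 8 y"
    proof (cases "norm y <= 1/2")
      case True
      have "y \<bullet> y <= (1/2)\<^sup>2" unfolding power2_norm_eq_inner[symmetric] by (rule power_mono[OF True]) simp
      then have "3/4 <= max 0 (1 - y \<bullet> y)" by (simp add: power2_eq_square)
      then have "(3/4) ^ 8 <= max 0 (1 - y \<bullet> y) ^ 8" by (rule power_mono) simp
      moreover have "indicator (cball 0 (1/2)) y = (1::real)" using True by simp
      ultimately show ?thesis by (simp only: bump_def mult_1_right)
    qed (simp add: bump_def)
  qed
  moreover have "(LINT y|lborel. (3/4)^8 * indicator (cball (0::real^3) (1/2)) y) = (3/4::real)^8 * (unit_ball_vol 3 * (1/2)^3)"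
    by (simp add: content_cball)
  moreover have "unit_ball_vol 3 > 0" by simp
  ultimately show ?thesis by (smt (verit) mult_pos_pos zero_less_power zero_less_divide_iff)
qed

text \<open>The exponent 8 leaves seven continuous derivatives: enough for five derivatives in
  \<open>mol\<close> and two more in the Taylor expansion of the kernel.\<close>

definition mollifier :: "real^3 => real" where "mollifier z = (1 / bump_mass) * bump 8 z"
text \<open>The divisor 18 is twice the exponent 9, so that the gradient becomes exactly
  \<open>- z\<close> times the mollifier.\<close>

definition potential :: "real^3 => real" where "potential z = (1 / (18 * bump_mass)) * bump 9 z"

lemma kern_mollifier: "kern 7 mollifier"
  unfolding mollifier_def using kern_bump[of 7] by (intro kern_cmult) simp

lemma kern_potential: "kern 8 potential"
  unfolding potential_def using kern_bump[of 8] by (intro kern_cmult) simp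

lemma pd_potential: "pd i potential = (%z. - (z $ i * mollifier z))"
proof
  fix z
  have d: "bump 9 differentiable at z" using Ck_bump[of 8] Ck_diff_at[of 7 UNIV "bump 9" z] by (simp add: numeral_eq_Suc)
  have "pd i potential z = (1 / (18 * bump_mass)) * pd i (bump 9) z"
    unfolding potential_def by (rule pd_cmult[OF d])
  also have "pd i (bump 9) z = - 18 * (z $ i * bump 8 z)"
    using fun_cong[OF pd_bump[of i 7], of z] by (simp add: numeral_eq_Suc)
  finally show "pd i potential z = - (z $ i * mollifier z)" by (simp add: mollifier_def)
qed

lemma integral_mollifier: "(LINT y|lborel. mollifier y) = 1"
  unfolding mollifier_def using bump_mass_pos by (simp add: bump_mass_def[symmetric])

lemma laplacian_pd:
  fixes f :: "real^3 => real"
  assumes U: "open U" and f: "Ck 3 U f" and x: "x \<in> U"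
  shows "laplacian (pd i f) x = pd i (laplacian f) x"
proof -
  have f2: "Ck 2 U (pd j f)" for j using f by (simp add: numeral_3_eq_3 numeral_2_eq_2)
  have f2': "Ck 2 U f" using f Ck_mono[of 3 U f 2] by simp
  have "pd i (laplacian f) x = (\<Sum>j\<in>UNIV. pd i (pd j (pd j f)) x)"
    unfolding laplacian_def by (rule pd_sum) (use f x in \<open>auto simp: numeral_3_eq_3\<close>)
  also have "... = (\<Sum>j\<in>UNIV. pd j (pd j (pd i f)) x)"
  proof (rule sum.cong)
    fix j
    have "pd i (pd j (pd j f)) x = pd j (pd i (pd j f)) x" by (rule pd_commute[OF U f2 x])
    also have "... = pd j (pd j (pd i f)) x"
      by (rule pd_cong[OF U x]) (rule pd_commute[OF U f2'])
    finally show "pd i (pd j (pd j f)) x = pd j (pd j (pd i f)) x" .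
  qed simp
  finally show ?thesis by (simp add: laplacian_def)
qed

lemma laplacian_cong:
  assumes "open U" "x \<in> U" "!!y. y \<in> U ==> f y = g y"
  shows "laplacian f x = laplacian g x"
  unfolding laplacian_def by (intro sum.cong refl pd_cong[OF assms(1,2)] pd_cong[OF assms(1) _ assms(3)])

lemma Ck_laplacian: "open U ==> Ck (k + 2) U f ==> Ck k U (laplacian f)"
  unfolding laplacian_def[abs_def] by (intro Ck_sum) auto

lemma laplacian_pds:
  fixes f :: "real^3 => real"
  assumes U: "open U" and x: "x \<in> U"
  shows "Ck (length is + 2) U f ==> laplacian (pds is f) x = pds is (laplacian f) x"
proof (induction "is" arbitrary: f)
  case (Cons i "is")
  have f3: "Ck 3 U f" using Cons.prems Ck_mono[of "length (i # is) + 2" U f 3] by simp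
  have "laplacian (pds is (pd i f)) x = pds is (laplacian (pd i f)) x" using Cons by simp
  also have "... = pds is (pd i (laplacian f)) x"
    by (rule pds_cong[OF U _ x]) (rule laplacian_pd[OF U f3])
  finally show ?case by simp
qed simp

text \<open>The Laplacian is the divergence of \<open>- z\<close> times the mollifier, that is,
  minus the Euler operator with the dimension 3 as parameter. Through it the scale derivative of a
  mollification becomes a convolution with a Laplacian.\<close>

lemma laplacian_potential: "laplacian potential = (%z. - euler 3 mollifier z)"
proof
  fix z
  have d: "mollifier differentiable at z" for z
    using kernD(1)[OF kern_mollifier] Ck_diff_at[of 6 UNIV mollifier z] by simp
  have "pd i (pd i potential) z = - (z $ i * pd i mollifier z + mollifier z)" for i
  proof -
    have "pd i (pd i potential) z = pd i (%z. (-1) * (z $ i * mollifier z)) z" unfolding pd_potential by simp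
    also have "... = (-1) * pd i (%z. z $ i * mollifier z) z"
      by (rule pd_cmult) (intro differentiable_mult differentiable_coord d)
    finally show ?thesis by (simp add: pd_mult[OF differentiable_coord d] pd_coord)
  qed
  then show "laplacian potential z = - euler 3 mollifier z"
    unfolding laplacian_def euler_alt by (simp add: sum.distrib sum_negf sum_subtractf)
qed

lemma pds_euler:
  "Ck (Suc (length is)) UNIV K ==> pds is (euler a K) = euler (a + real (length is)) (pds is K)"
proof (induction "is" arbitrary: a K)
  case (Cons i "is")
  have "Ck 2 UNIV K" by (rule Ck_mono[OF Cons.prems]) simp
  then have "pds (i # is) (euler a K) = pds is (euler (a + 1) (pd i K))" by (simp add: pd_euler)
  also have "... = euler (a + 1 + real (length is)) (pds is (pd i K))"
    using Cons by simp
  finally show ?case by (simp add: add_ac)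
qed simp

text \<open>Differentiation commutes with the Laplacian and raises the parameter of
  \<open>euler\<close> by one each time, in step with the power \<open>3 + length is\<close> that
  normalises \<open>mol\<close>.\<close>

lemma euler_pds_mollifier:
  assumes "length is <= 6"
  shows "euler (real (3 + length is)) (pds is mollifier) = (%z. - laplacian (pds is potential) z)"
proof -
  have m: "Ck (Suc (length is)) UNIV mollifier"
    by (rule Ck_mono[OF kernD(1)[OF kern_mollifier]]) (use assms in simp)
  have p: "Ck (length is + 2) UNIV potential"
    using kernD(1)[OF kern_potential] Ck_mono[of 8 UNIV potential "length is + 2"] assms by simp
  have "laplacian (pds is potential) z = pds is (laplacian potential) z" for z
    by (rule laplacian_pds[OF open_UNIV UNIV_I p])
  moreover have "pds is (%z. - K z) z = - pds is K z" if "Ck (length is) UNIV K" for z and K :: "real^3 => real"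
    using that
  proof (induction "is" arbitrary: K)
    case (Cons i "is")
    have "pd i (%z. - K z) = (%z. - pd i K z)"
      using pd_cmult[of K _ i "-1"] Cons.prems by auto
    then show ?case using Cons by simp
  qed simp
  ultimately have "laplacian (pds is potential) z = - pds is (euler 3 mollifier) z" for z
    unfolding laplacian_potential using kernD(1)[OF kern_euler[of "length is" mollifier 3]] m kernD[OF kern_mollifier]
    by (simp add: kern_def)
  then show ?thesis using pds_euler[OF m, of 3] by (simp add: add.commute)
qed

lemma conv_const:
  fixes K :: "real^3 => real"
  assumes K: "kern k K" and s: "s > 0"
  shows "conv (%_. 1) K s x = s ^ 3 * (LINT y|lborel. K y)"
proof -
  have "lborel = density (distr lborel borel (%y. x + (- s) *\<^sub>R y)) (%_. ennreal (\<bar>- s\<bar> ^ DIM(real^3)))"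
    by (rule lborel_affine) (use s in simp)
  then have L: "(lborel :: (real^3) measure) = density (distr lborel borel (%y. x + (- s) *\<^sub>R y)) (%_. ennreal (s ^ 3))"
    using s by simp
  have m: "(%y. K ((1 / s) *\<^sub>R (x - y))) \<in> borel_measurable borel"
    by (rule conv_measurable[OF kern_continuous[OF K]])
  have "conv (%_. 1) K s x = (LINT y|density (distr lborel borel (%y. x + (- s) *\<^sub>R y)) (%_. ennreal (s ^ 3)). K ((1 / s) *\<^sub>R (x - y)))"
    unfolding conv_def using L by simp
  also have "... = (LINT y|distr lborel borel (%y. x + (- s) *\<^sub>R y). s ^ 3 *\<^sub>R K ((1 / s) *\<^sub>R (x - y)))"
    using m s by (subst integral_density) auto
  also have "... = (LINT y|lborel. s ^ 3 *\<^sub>R K ((1 / s) *\<^sub>R (x - (x + (- s) *\<^sub>R y))))"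
    using m by (subst integral_distr) auto
  also have "... = s ^ 3 * (LINT y|lborel. K y)" using s by simp
  finally show ?thesis .
qed

lemma conv_mollifier_tendsto:
  assumes v: "integrable lborel v" and c: "isCont v x"
  shows "((%s. conv v mollifier s x / s ^ 3) \<longlongrightarrow> v x) (at_right 0)"
proof (rule tendstoI)
  fix e :: real assume e: "e > 0"
  obtain B where B: "B > 0" "!!x. \<bar>mollifier x\<bar> <= B" using kern_bounded[OF kern_mollifier] by metis
  \<comment> \<open>With this tolerance \<open>conv_bound\<close> yields exactly
    \<open>e / 2 * s ^ 3\<close>.\<close>
  define e' where "e' = e / (2 * B * unit_ball_vol 3)"
  have ub: "unit_ball_vol 3 > 0" by simp
  have e': "e' > 0" using e B(1) ub by (simp add: e'_def)
  obtain d where d: "d > 0" "!!y. dist y x < d ==> dist (v y) (v x) < e'"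
    using c e' unfolding continuous_at_eps_delta by metis
  have "dist (conv v mollifier s x / s ^ 3) (v x) < e" if s: "0 < s" "s < d" for s
  proof -
    let ?w = "%y. if y \<in> cball x s then v y - v x else 0"
    have "conv (%_. v x) mollifier s x = v x * conv (%_. 1) mollifier s x"
      unfolding conv_def by simp
    then have 1: "conv (%_. v x) mollifier s x = v x * s ^ 3"
      using conv_const[OF kern_mollifier s(1)] integral_mollifier by simp
    have 2: "conv ?w mollifier s x = conv v mollifier s x - v x * s ^ 3"
    proof -
      have i: "integrable lborel (%y. v y * mollifier ((1 / s) *\<^sub>R (x - y)))"
        by (rule kern_conv_integrable[OF v kern_mollifier])
      have "integrable lborel (%y. mollifier ((1 / s) *\<^sub>R (x - y)))"
      proof (rule integrable_compact_support[where R="norm x + s"])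
        show "continuous_on UNIV (%y. mollifier ((1 / s) *\<^sub>R (x - y)))"
          using Ck_continuous_on[OF Ck_kernel_affine[OF kernD(1)[OF kern_mollifier]]] .
        fix y :: "real^3" assume "norm y > norm x + s"
        then have "norm (x - y) > s" using norm_triangle_ineq2[of y x] by (simp add: norm_minus_commute)
        then show "mollifier ((1 / s) *\<^sub>R (x - y)) = 0"
          using kernD(2)[OF kern_mollifier] s by (simp add: norm_scaleR_inverse)
      qed
      then have j: "integrable lborel (%y. v x * mollifier ((1 / s) *\<^sub>R (x - y)))" by simp
      have "conv ?w mollifier s x = conv (%y. v y - v x) mollifier s x"
        by (rule conv_cong[OF kern_mollifier s(1)]) simp
      also have "... = conv v mollifier s x - conv (%_. v x) mollifier s x"
        unfolding conv_def using i j by (simp add: left_diff_distrib)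
      finally show ?thesis using 1 by simp
    qed
    have "\<bar>conv ?w mollifier s x\<bar> <= e' * B * unit_ball_vol 3 * s ^ 3"
    proof (rule conv_bound[OF kern_mollifier s(1) B(2)])
      fix y assume "y \<in> cball x s"
      then show "\<bar>?w y\<bar> <= e'" using d(2)[of y] s by (simp add: dist_commute dist_real_def less_imp_le)
    qed
    also have "... = e / 2 * s ^ 3" using B(1) less_imp_neq[OF ub] by (simp add: e'_def)
    finally have "\<bar>conv v mollifier s x - v x * s ^ 3\<bar> <= e / 2 * s ^ 3" unfolding 2 .
    moreover have "conv v mollifier s x / s ^ 3 - v x = (conv v mollifier s x - v x * s ^ 3) / s ^ 3"
      using s by (simp add: field_simps)
    ultimately have "dist (conv v mollifier s x / s ^ 3) (v x) <= e / 2"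
      using s by (simp add: dist_real_def divide_le_eq)
    then show ?thesis using e by simp
  qed
  then show "\<forall>\<^sub>F s in at_right 0. dist (conv v mollifier s x / s ^ 3) (v x) < e"
    unfolding eventually_at_right_field using d(1) by blast
qed

section \<open>Reflection in a plane through the origin\<close>

definition reflect :: "real^3 => real^3 => real^3" where
  "reflect n y = y - (2 * (n \<bullet> y)) *\<^sub>R n"

lemma linear_reflect: "linear (reflect n)"
  by (rule linearI) (simp_all add: reflect_def inner_add_right algebra_simps)

lemma reflect_simps: "reflect n (x - y) = reflect n x - reflect n y" "reflect n (c *\<^sub>R x) = c *\<^sub>R reflect n x"
    "reflect n (x + y) = reflect n x + reflect n y"
  using linear_reflect by (simp_all add: linear_diff linear_scale linear_add)

lemma reflect_reflect: "norm n = 1 ==> reflect n (reflect n y) = y"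
  using power2_norm_eq_inner[of n] by (simp add: reflect_def inner_diff_right algebra_simps)

lemma reflect_inner: "reflect n x \<bullet> y = x \<bullet> reflect n y"
  by (simp add: reflect_def inner_diff_right inner_diff_left inner_commute)

lemma norm_reflect: "norm n = 1 ==> norm (reflect n y) = norm y"
  by (simp add: norm_eq_sqrt_inner reflect_inner reflect_reflect)

lemma inner_normal_reflect: "norm n = 1 ==> n \<bullet> reflect n y = - (n \<bullet> y)"
  using power2_norm_eq_inner[of n] by (simp add: reflect_def inner_diff_right)

lemma reflect_has_derivative: "(reflect n has_derivative reflect n) (at x)"
  by (intro bounded_linear_imp_has_derivative linear_conv_bounded_linear[THEN iffD1] linear_reflect)

lemma reflect_comp_has_derivative:
  fixes K :: "real^3 => real"
  assumes "K differentiable at (reflect n y)"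
  shows "((%y. K (reflect n y)) has_derivative (%h. reflect n (grad K (reflect n y)) \<bullet> h)) (at y)"
  using has_derivative_compose[OF reflect_has_derivative has_derivative_grad[OF assms]]
  by (simp add: reflect_inner)

lemma grad_reflect:
  "K differentiable at (reflect n y) ==> grad (%y. K (reflect n y)) y = reflect n (grad K (reflect n y))"
  by (rule grad_eq[OF reflect_comp_has_derivative])

lemma pd_reflect:
  assumes "K differentiable at (reflect n y)"
  shows "pd i (%y. K (reflect n y)) y = (\<Sum>a\<in>UNIV. (reflect n (axis a 1) $ i) * pd a K (reflect n y))"
proof -
  have eq: "reflect n g $ i = (\<Sum>a\<in>UNIV. (reflect n (axis a 1) $ i) * g $ a)" for g :: "real^3"
  proof -
    have "linear (%g. reflect n g $ i)" by (rule linearI) (simp_all add: reflect_simps)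
    from linear_inner_axis[OF this, of g] show ?thesis by (simp add: inner_vec_def)
  qed
  show ?thesis
    unfolding pd_inner[OF reflect_comp_has_derivative[OF assms]] eq[of "grad K (reflect n y)"]
    by (simp only: grad_def vec_lambda_beta)
qed

lemma Ck_reflect: "Ck k UNIV K ==> Ck k UNIV (%y. K (reflect n y))" for K :: "real^3 => real"
proof (induction k arbitrary: K)
  case 0
  have "continuous_on UNIV (reflect n)" by (intro linear_continuous_on linear_conv_bounded_linear[THEN iffD1] linear_reflect)
  then show ?case using 0 continuous_on_compose2[of UNIV K UNIV "reflect n"] by simp
next
  case (Suc k)
  have d: "K differentiable at x" for x using Suc.prems by simp
  have "Ck k UNIV (%y. \<Sum>a\<in>UNIV. (reflect n (axis a 1) $ i) * pd a K (reflect n y))" for i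
    using Suc by (intro Ck_sum Ck_cmult) auto
  then have "Ck k UNIV (pd i (%y. K (reflect n y)))" for i using pd_reflect[OF d] by presburger
  moreover have "(%y. K (reflect n y)) differentiable at x" for x
    using reflect_comp_has_derivative[OF d] differentiableI by blast
  ultimately show ?case by simp
qed

lemma kern_reflect: "kern k K ==> norm n = 1 ==> kern k (%y. K (reflect n y))"
  unfolding kern_def by (auto simp: norm_reflect intro: Ck_reflect)

text \<open>The sum over \<open>i\<close> of products of matrix entries gives inner products of
  reflected axes. These are Kronecker deltas because the reflection is symmetric and its own
  inverse.\<close>

lemma laplacian_reflect:
  fixes K :: "real^3 => real"
  assumes K: "Ck 2 UNIV K" and n: "norm n = 1"
  shows "laplacian (%y. K (reflect n y)) y = laplacian K (reflect n y)"
proof -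
  let ?c = "%a i. reflect n (axis a 1) $ i"
  have d: "K differentiable at x" "pd a K differentiable at x" for a x
    using K by (auto simp: numeral_2_eq_2)
  have dr: "(%y. pd a K (reflect n y)) differentiable at x" for a x
    using reflect_comp_has_derivative[OF d(2)] differentiableI by blast
  have "pd i (pd i (%y. K (reflect n y))) y = (\<Sum>a\<in>UNIV. \<Sum>b\<in>UNIV. (?c a i * ?c b i) * pd b (pd a K) (reflect n y))" for i
  proof -
    have "pd i (pd i (%y. K (reflect n y))) y = pd i (%y. \<Sum>a\<in>UNIV. ?c a i * pd a K (reflect n y)) y"
      using pd_reflect[OF d(1)] by presburger
    also have "... = (\<Sum>a\<in>UNIV. pd i (%y. ?c a i * pd a K (reflect n y)) y)"
      by (rule pd_sum) (auto intro!: differentiable_mult dr)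
    also have "... = (\<Sum>a\<in>UNIV. ?c a i * (\<Sum>b\<in>UNIV. ?c b i * pd b (pd a K) (reflect n y)))"
      by (simp only: pd_cmult[OF dr] pd_reflect[OF d(2)])
    finally show ?thesis by (simp add: sum_distrib_left mult.assoc)
  qed
  then have "laplacian (%y. K (reflect n y)) y =
      (\<Sum>i\<in>UNIV. \<Sum>a\<in>UNIV. \<Sum>b\<in>UNIV. (?c a i * ?c b i) * pd b (pd a K) (reflect n y))"
    by (simp add: laplacian_def)
  also have "... = (\<Sum>a\<in>UNIV. \<Sum>b\<in>UNIV. \<Sum>i\<in>UNIV. (?c a i * ?c b i) * pd b (pd a K) (reflect n y))"
    by (subst sum.swap) (intro sum.cong refl sum.swap)
  also have "... = (\<Sum>a\<in>UNIV. \<Sum>b\<in>UNIV. (reflect n (axis a 1) \<bullet> reflect n (axis b 1)) * pd b (pd a K) (reflect n y))"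
    by (simp add: inner_vec_def sum_distrib_right)
  also have "... = (\<Sum>a\<in>UNIV. \<Sum>b\<in>UNIV. (if b = a then pd b (pd a K) (reflect n y) else 0))"
    by (intro sum.cong) (auto simp: reflect_inner reflect_reflect[OF n] inner_axis_axis)
  also have "... = laplacian K (reflect n y)" by (simp add: laplacian_def)
  finally show ?thesis .
qed

text \<open>The radial derivative commutes with every linear change of variables, so a reflected
  kernel obeys the same scale identity as the kernel.\<close>

lemma euler_reflect:
  "K differentiable at (reflect n y) ==> euler a (%y. K (reflect n y)) y = euler a K (reflect n y)"
  by (simp add: euler_def grad_reflect reflect_inner)

section \<open>Mollified derivatives of an extension by zero\<close>

definition zext :: "(real^3) set => (real^3 => real) => real^3 => real" where
  "zext U u y = (if y \<in> U then u y else 0)"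

lemma zext_integrable:
  assumes "open U" "bounded U" "continuous_on U u" "!!y. y \<in> U ==> \<bar>u y\<bar> <= M"
  shows "integrable lborel (zext U u)"
proof (rule Bochner_Integration.integrable_bound[where f="%y. M * indicator U y :: real"])
  have "emeasure lborel U < \<infinity>" by (rule emeasure_bounded_finite[OF assms(2)])
  then show "integrable lborel (%y. M * indicator U y :: real)"
    using assms(1) by (intro integrable_mult_right integrable_real_indicator) auto
  have "zext U u \<in> borel_measurable borel"
    unfolding zext_def[abs_def]
    by (rule borel_measurable_continuous_on_if) (use assms in auto)
  then show "zext U u \<in> borel_measurable lborel" by simp
  show "AE y in lborel. norm (zext U u y) <= norm (M * indicator U y :: real)"
    using assms(4) by (intro AE_I2) (auto simp: zext_def indicator_def intro: order_trans[OF _ abs_ge_self])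
qed

text \<open>Parts are integrated starting from the last index, which reverses the list. This is why
  \<open>mol [j, i]\<close> approximates \<open>pds [i, j]\<close> further on.\<close>

lemma conv_pds_ibp:
  assumes U: "open U" and s: "s > 0" "cball z s \<subseteq> U"
  shows "Ck (length is) U f ==> kern (length is) K ==>
    conv f (pds is K) s z = s ^ length is * conv (pds (rev is) f) K s z"
proof (induction "is" arbitrary: f rule: rev_induct)
  case (snoc j "is")
  have f1: "Ck 1 U f" by (rule Ck_mono[OF snoc.prems(1)]) simp
  have K1: "kern 1 (pds is K)" using kern_pds[of "is" 1 K] snoc.prems(2) by simp
  have "conv f (pds (is @ [j]) K) s z = s * conv (pd j f) (pds is K) s z"
    unfolding pds_snoc by (rule conv_ibp[OF U f1 K1 s])
  also have "conv (pd j f) (pds is K) s z = s ^ length is * conv (pds (rev is) (pd j f)) K s z"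
    using snoc.prems kern_mono by (intro snoc.IH) auto
  finally show ?case by simp
qed simp

lemma conv_sum_kern:
  assumes "integrable lborel v" "finite S" "!!j. j \<in> S ==> kern k (K j)"
  shows "conv v (%x. \<Sum>j\<in>S. K j x) s x = (\<Sum>j\<in>S. conv v (K j) s x)"
  using assms(2,3)
proof (induction S rule: finite_induct)
  case (insert a F)
  have "kern k (%x. \<Sum>j\<in>F. K j x)" using insert by (intro kern_sum) auto
  then have "conv v (%x. K a x + (\<Sum>j\<in>F. K j x)) s x = conv v (K a) s x + conv v (%x. \<Sum>j\<in>F. K j x) s x"
    using insert by (intro conv_kern_add[OF assms(1)]) auto
  then show ?case using insert by simp
qed (simp add: conv_def)

lemma kern_laplacian: "kern (k + 2) K ==> kern k (laplacian K)"
  unfolding laplacian_def[abs_def] by (intro kern_sum kern_pd) auto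

text \<open>Each of the two integrations by parts brings a factor \<open>s\<close>; the equation
  then turns the Laplacian of \<open>v\<close> into \<open>g\<close>, to which further derivatives
  can be moved.\<close>

lemma conv_laplacian:
  assumes v: "integrable lborel v" and U: "open U" "Ck 2 U v" and K: "kern 2 K"
    and s: "s > 0" "cball z s \<subseteq> U" and g: "!!y. y \<in> U ==> laplacian v y = g y"
  shows "conv v (laplacian K) s z = s\<^sup>2 * conv g K s z"
proof -
  have K0: "kern 0 (pd j (pd j K))" for j using K by (intro kern_pd) (simp add: numeral_2_eq_2)
  have K0': "kern 0 K" using kern_mono[OF K] by simp
  let ?a = "%y. (1 / s) *\<^sub>R (z - y)"
  have I: "integrable lborel (%y. pd j (pd j v) y * K (?a y))" for j
  proof -
    have "Ck 0 UNIV (%y. pd j (pd j v) y * K (?a y))"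
      using U K0' s by (intro Ck_times_kernel[OF U(1)]) (auto simp: numeral_2_eq_2)
    then have c: "continuous_on UNIV (%y. pd j (pd j v) y * K (?a y))" by simp
    have "pd j (pd j v) y * K (?a y) = 0" if "norm y > norm z + s" for y
    proof -
      have "norm (z - y) > s" using that norm_triangle_ineq2[of y z] by (simp add: norm_minus_commute)
      then show ?thesis using kernD(2)[OF K] s by (simp add: norm_scaleR_inverse)
    qed
    then show ?thesis using c integrable_compact_support[of "%y. pd j (pd j v) y * K (?a y)" "norm z + s"] by blast
  qed
  have "conv v (laplacian K) s z = (\<Sum>j\<in>UNIV. conv v (pd j (pd j K)) s z)"
    unfolding laplacian_def[abs_def] by (rule conv_sum_kern[OF v finite K0])
  also have "... = (\<Sum>j\<in>UNIV. s\<^sup>2 * conv (pd j (pd j v)) K s z)"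
  proof (rule sum.cong[OF HOL.refl])
    fix j
    show "conv v (pd j (pd j K)) s z = s\<^sup>2 * conv (pd j (pd j v)) K s z"
      using conv_pds_ibp[OF U(1) s, of "[j, j]" v K] U(2) K by (simp add: numeral_2_eq_2)
  qed
  also have "... = s\<^sup>2 * (\<Sum>j\<in>UNIV. conv (pd j (pd j v)) K s z)" by (simp add: sum_distrib_left)
  also have "(\<Sum>j\<in>UNIV. conv (pd j (pd j v)) K s z) = conv (laplacian v) K s z"
    unfolding conv_def laplacian_def sum_distrib_right
    by (rule Bochner_Integration.integral_sum[symmetric]) (rule I)
  also have "conv (laplacian v) K s z = conv g K s z"
    by (rule conv_cong[OF K s(1)]) (use g s in auto)
  finally show ?thesis .
qed

lemma pds_append: "pds (is @ js) u = pds js (pds is u)" by (simp add: pds_def)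

text \<open>This is the derivative \<open>pds is\<close> of the mollification of \<open>v\<close> at
  scale \<open>s\<close>: the dimension accounts for \<open>s ^ 3\<close> and every derivative for
  one more power.\<close>

definition mol :: "3 list => (real^3 => real) => real => real^3 => real" where
  "mol is v s x = conv v (pds is mollifier) s x / s ^ (3 + length is)"

lemma DERIV_mol:
  assumes v: "integrable lborel v" and l: "length is <= 5" and s: "s > 0"
  shows "((%s. mol is v s x) has_real_derivative conv v (laplacian (pds is potential)) s x / s ^ (4 + length is)) (at s)"
proof -
  have "kern 1 (pds is mollifier)"
    by (rule kern_pds) (use l kern_mono[OF kern_mollifier] in auto)
  from DERIV_conv_scaled[OF v this s euler_pds_mollifier[of "is"]] l
  show ?thesis unfolding mol_def by simp
qed

lemma pd_mol:
  assumes v: "integrable lborel v" and l: "length is <= 5"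
  shows "pd k (mol is v s) x = mol (is @ [k]) v s x" and "mol is v s differentiable at x"
proof -
  have K: "kern 2 (pds is mollifier)"
    by (rule kern_pds) (use l kern_mono[OF kern_mollifier] in auto)
  note d = conv_differentiable[OF v K]
  have m: "mol is v s = (%x. (1 / s ^ (3 + length is)) * conv v (pds is mollifier) s x)"
    by (simp add: mol_def[abs_def])
  show "pd k (mol is v s) x = mol (is @ [k]) v s x"
    unfolding m by (subst pd_cmult[OF d]) (simp add: mol_def pd_conv[OF v K] pds_snoc eval_nat_numeral mult_ac)
  show "mol is v s differentiable at x"
    unfolding m by (intro differentiable_mult differentiable_const d)
qed

lemma uniform_constant:
  assumes S: "finite S" and ex: "!!a. a \<in> S ==> \<exists>C>0. P a C"
    and mono: "!!a C D. P a C ==> C <= D ==> P a D"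
  shows "\<exists>C>0::real. \<forall>a\<in>S. P a C"
proof -
  obtain f where f: "!!a. a \<in> S ==> f a > 0 \<and> P a (f a)" using bchoice[of S "%a C. C > 0 \<and> P a C"] ex by auto
  show ?thesis
  proof (intro exI[of _ "1 + sum f S"] conjI ballI)
    have "sum f S >= 0" using f by (intro sum_nonneg) (simp add: less_imp_le)
    then show "1 + sum f S > 0" by simp
    fix a assume a: "a \<in> S"
    have "f a <= sum f S" by (rule member_le_sum[OF a _ S]) (use f in \<open>simp add: less_imp_le\<close>)
    then show "P a (1 + sum f S)" by (intro mono[OF conjunct2[OF f[OF a]]]) simp
  qed
qed

lemma finite_lists: "finite {is :: 3 list. length is = n}" "finite {is :: 3 list. length is <= n}"
  using finite_lists_length_eq[of "UNIV :: 3 set" n] finite_lists_length_le[of "UNIV :: 3 set" n] by auto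

lemma kern_const_exists:
  "\<exists>C>0. \<forall>is\<in>{is :: 3 list. length is <= 6}. \<forall>x. \<bar>pds is potential x\<bar> <= C \<and> \<bar>pds is mollifier x\<bar> <= C"
proof (rule uniform_constant[OF finite_lists(2)])
  fix "is" :: "3 list" assume l: "is \<in> {is. length is <= 6}"
  have "kern 0 (pds is potential)" "kern 0 (pds is mollifier)"
    by (rule kern_pds, use l kern_mono[OF kern_potential] kern_mono[OF kern_mollifier] in auto)+
  then obtain B B' where B: "B > 0" "!!x. \<bar>pds is potential x\<bar> <= B" "!!x. \<bar>pds is mollifier x\<bar> <= B'"
    using kern_bounded by metis
  show "\<exists>C>0. \<forall>x. \<bar>pds is potential x\<bar> <= C \<and> \<bar>pds is mollifier x\<bar> <= C"
    by (rule exI[of _ "max B B'"]) (use B in \<open>auto simp: le_max_iff_disj\<close>)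
qed (meson order_trans)

definition kern_const where
  "kern_const = (SOME C. C > 0 \<and> (\<forall>is\<in>{is :: 3 list. length is <= 6}. \<forall>x. \<bar>pds is potential x\<bar> <= C \<and> \<bar>pds is mollifier x\<bar> <= C))"

lemma kern_const: "kern_const > 0" "length is <= 6 ==> \<bar>pds is potential x\<bar> <= kern_const"
  "length is <= 6 ==> \<bar>pds is mollifier x\<bar> <= kern_const"
  using someI_ex[OF kern_const_exists, folded kern_const_def] by auto

text \<open>Two of the derivatives on the kernel are moved to \<open>\<Delta>v\<close>.\<close>

lemma DERIV_mol_bound:
  assumes n: "n <= 3" and a: "length is = n" "integrable lborel v" "open U" "Ck 2 U v" "Ck 2 U g"
    "!!y. y \<in> U ==> laplacian v y = g y" "!!i j y. y \<in> U ==> \<bar>pd i (pd j g) y\<bar> <= M" "s > 0" "cball x s \<subseteq> U"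
  shows "\<bar>conv v (laplacian (pds (is @ [i, j]) potential)) s x / s ^ (6 + n)\<bar> <= kern_const * unit_ball_vol 3 * M * s ^ 3 / s ^ (2 + n)"
proof -
  have K: "kern 2 (pds (is @ [i, j]) potential)"
    by (rule kern_pds) (use a(1) n kern_mono[OF kern_potential] in auto)
  have K2: "kern 2 (pds is potential)"
    by (rule kern_pds) (use a(1) n kern_mono[OF kern_potential] in auto)
  have "conv v (laplacian (pds (is @ [i, j]) potential)) s x = s\<^sup>2 * conv g (pds (is @ [i, j]) potential) s x"
    by (rule conv_laplacian[OF a(2,3,4) K a(8,9,6)])
  also have "conv g (pds (is @ [i, j]) potential) s x = s\<^sup>2 * conv (pds [j, i] g) (pds is potential) s x"
    unfolding pds_append using conv_pds_ibp[OF a(3,8,9), of "[i, j]" g "pds is potential"] a(5) K2 by (simp add: numeral_2_eq_2)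
  finally have "conv v (laplacian (pds (is @ [i, j]) potential)) s x
    = s ^ 4 * conv (pds [j, i] g) (pds is potential) s x" by (simp add: eval_nat_numeral)
  moreover have "s ^ (6 + n) = s ^ 4 * s ^ (2 + n)"
    by (simp only: power_add[symmetric] add.assoc[symmetric]) simp
  ultimately have eq: "conv v (laplacian (pds (is @ [i, j]) potential)) s x / s ^ (6 + n)
    = conv (pds [j, i] g) (pds is potential) s x / s ^ (2 + n)"
    using a(8) by (simp only:) simp
  have "\<bar>conv (pds [j, i] g) (pds is potential) s x\<bar> <= M * kern_const * unit_ball_vol 3 * s ^ 3"
    by (rule conv_bound[OF K2 a(8) kern_const(2)]) (use a n in auto)
  then show ?thesis unfolding eq using a(8) by (simp add: abs_divide divide_right_mono mult_ac)
qed

section \<open>Third derivatives in the interior\<close>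

locale interior =
  fixes U :: "(real^3) set" and u g :: "real^3 => real" and M :: real
  assumes openU: "open U" and bdU: "bounded U" and u2: "Ck 2 U u" and g2: "Ck 2 U g"
    and lap: "!!x. x \<in> U ==> laplacian u x = g x"
    and ubd: "!!x. x \<in> U ==> \<bar>u x\<bar> <= M"
    and gbd: "!!i j x. x \<in> U ==> \<bar>pd i (pd j g) x\<bar> <= M"
begin

abbreviation v where "v \<equiv> zext U u"

lemma v_int: "integrable lborel v"
  by (rule zext_integrable[OF openU bdU Ck_continuous_on[OF u2] ubd])

lemma v_eq: "y \<in> U ==> v y = u y" by (simp add: zext_def)

lemma v2: "Ck 2 U v" using Ck_cong[OF openU, of v u 2] v_eq u2 by blast

lemma lap_v: "y \<in> U ==> laplacian v y = g y"
  using laplacian_cong[OF openU, of y v u] v_eq lap by simp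

lemma pds_v: "y \<in> U ==> pds is v y = pds is u y"
  by (rule pds_cong[OF openU]) (simp_all add: v_eq)

lemma mol_tendsto:
  assumes x: "x \<in> U"
  shows "((%s. mol [j, i] v s x) \<longlongrightarrow> pds [i, j] u x) (at_right 0)"
proof -
  obtain d where d: "d > 0" "cball x d \<subseteq> U" using openU x open_contains_cball by metis
  \<comment> \<open>Second derivatives of \<open>u\<close> are continuous in \<open>U\<close> but
    perhaps unbounded there, so they are restricted to a ball with closure in \<open>U\<close>
    before the approximate identity is applied.\<close>
  let ?w = "zext (ball x d) (pds [i, j] u)"
  have c: "continuous_on U (pds [i, j] u)" using u2 by (simp add: numeral_2_eq_2)
  have "compact (pds [i, j] u ` cball x d)"
    by (intro compact_continuous_image continuous_on_subset[OF c d(2)]) auto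
  then obtain B where B: "\<forall>y\<in>pds [i, j] u ` cball x d. norm y <= B"
    using compact_imp_bounded[of "pds [i, j] u ` cball x d"] unfolding bounded_iff by auto
  have wi: "integrable lborel ?w"
  proof (rule zext_integrable[where M=B])
    show "continuous_on (ball x d) (pds [i, j] u)" by (rule continuous_on_subset[OF c]) (use d in auto)
  qed (use B in auto)
  have "continuous_on (ball x d) (pds [i, j] u)" by (rule continuous_on_subset[OF c]) (use d in auto)
  then have "continuous_on (ball x d) ?w" by (rule continuous_on_eq) (simp add: zext_def)
  then have "isCont ?w x" using d continuous_on_eq_continuous_at[OF open_ball] by (meson centre_in_ball)
  from conv_mollifier_tendsto[OF wi this]
  have "((%s. conv ?w mollifier s x / s ^ 3) \<longlongrightarrow> pds [i, j] u x) (at_right 0)"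
    using d by (simp add: zext_def)
  moreover have "\<forall>\<^sub>F s in at_right 0. conv ?w mollifier s x / s ^ 3 = mol [j, i] v s x"
    unfolding eventually_at_right_field
  proof (intro exI[of _ d] conjI allI impI)
    fix s assume s: "0 < s" "s < d"
    have sub: "cball x s \<subseteq> U" using s d by auto
    have k: "kern 2 mollifier" using kern_mollifier kern_mono by force
    have "conv v (pds [j, i] mollifier) s x = s\<^sup>2 * conv (pds [i, j] v) mollifier s x"
      using conv_pds_ibp[OF openU s(1) sub, of "[j, i]" v mollifier] v2 k by (simp add: numeral_2_eq_2)
    also have "conv (pds [i, j] v) mollifier s x = conv ?w mollifier s x"
    proof (rule conv_cong[OF kern_mollifier s(1)])
      fix y assume y: "y \<in> cball x s"
      then have "y \<in> ball x d" "y \<in> U" using s sub by auto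
      then show "pds [i, j] v y = ?w y" using pds_v[of y "[i, j]"] by (simp add: zext_def)
    qed
    finally show "conv ?w mollifier s x / s ^ 3 = mol [j, i] v s x"
      unfolding mol_def using s(1) by (simp add: eval_nat_numeral)
  qed (rule d(1))
  ultimately show ?thesis by (rule Lim_transform_eventually)
qed

text \<open>The mollified third derivatives are Lipschitz in the scale, hence converge locally uniformly.\<close>

definition scale_const where "scale_const = kern_const * unit_ball_vol 3 * \<bar>M\<bar> + 1"

lemma scale_const: "scale_const > 0" using kern_const(1) by (simp add: scale_const_def add_nonneg_pos)

lemma mol3_lipschitz:
  assumes a: "0 < r" "r <= s" "cball x s \<subseteq> U"
  shows "\<bar>mol [i, j, k] v s x - mol [i, j, k] v r x\<bar> <= scale_const * (s - r)"
proof -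
  have "norm (mol [i, j, k] v s x - mol [i, j, k] v r x) <= scale_const * norm (s - r)"
  proof (rule field_differentiable_bound[where S="{r..s}"])
    fix t assume t: "t \<in> {r..s}"
    then have t': "t > 0" "cball x t \<subseteq> U" using a by auto
    show "((%s. mol [i, j, k] v s x) has_field_derivative conv v (laplacian (pds [i, j, k] potential)) t x / t ^ 7) (at t within {r..s})"
      using DERIV_mol[OF v_int, of "[i, j, k]" t x] t'(1) by (auto intro: has_field_derivative_at_within)
    have "\<bar>conv v (laplacian (pds ([i] @ [j, k]) potential)) t x / t ^ (6 + 1)\<bar> <= kern_const * unit_ball_vol 3 * \<bar>M\<bar> * t ^ 3 / t ^ (2 + 1)"
      by (rule DERIV_mol_bound[OF _ _ v_int openU v2 g2 lap_v _ t']) (use order_trans[OF gbd abs_ge_self] in auto)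
    then show "norm (conv v (laplacian (pds [i, j, k] potential)) t x / t ^ 7) <= scale_const"
      using t'(1) by (simp add: scale_const_def)
  qed (use a in auto)
  then show ?thesis using a by simp
qed

text \<open>The limits of the mollified third derivatives are recognised as derivatives of the
  second derivatives of \<open>u\<close> by termwise differentiation of a sequence. The quantitative
  part is the Lipschitz bound in the scale with the smaller scale sent to zero.\<close>

theorem interior_C3:
  "Ck 3 U u"
  "s > 0 ==> cball x s \<subseteq> U ==> \<bar>pds [i, j, k] u x - mol [j, i, k] v s x\<bar> <= scale_const * s"
proof -
  define C where "C = scale_const"
  note C = scale_const[folded C_def] mol3_lipschitz[folded C_def]
  define \<tau> where "\<tau> n = 1 / real (Suc n)" for n
  have \<tau>: "\<tau> n > 0" for n by (simp add: \<tau>_def)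
  have \<tau>0: "\<tau> \<longlonglongrightarrow> 0" unfolding \<tau>_def by (rule LIMSEQ_inverse_real_of_nat[unfolded inverse_eq_divide])
  have conv: "convergent (%n. mol [j, i, k] v (\<tau> n) x)" if xU: "x \<in> U" for i j k x
  proof (rule Cauchy_convergent, rule metric_CauchyI)
    fix e :: real assume e: "e > 0"
    obtain d where d: "d > 0" "cball x d \<subseteq> U" using openU xU open_contains_cball by metis
    have "\<forall>\<^sub>F n in sequentially. \<tau> n < min d (e / C)"
      by (rule order_tendstoD(2)[OF \<tau>0]) (use d e C(1) in simp)
    then obtain N where N: "!!n. n >= N ==> \<tau> n < min d (e / C)" unfolding eventually_sequentially by blast
    have w: "\<bar>mol [j, i, k] v (\<tau> m) x - mol [j, i, k] v (\<tau> n) x\<bar> < e" if "m >= N" "\<tau> n <= \<tau> m" for m n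
    proof -
      have "cball x (\<tau> m) \<subseteq> U" using N[OF that(1)] d by auto
      then have "\<bar>mol [j, i, k] v (\<tau> m) x - mol [j, i, k] v (\<tau> n) x\<bar> <= C * (\<tau> m - \<tau> n)" by (rule C(2)[OF \<tau> that(2)])
      also have "... <= C * \<tau> m" using \<tau>[of n] C(1) by simp
      also have "... < e" using N[OF that(1)] C(1) by (simp add: field_simps)
      finally show ?thesis .
    qed
    show "\<exists>N. \<forall>m\<ge>N. \<forall>n\<ge>N. dist (mol [j, i, k] v (\<tau> m) x) (mol [j, i, k] v (\<tau> n) x) < e"
      using w by (intro exI[of _ N]) (metis dist_real_def abs_minus_commute linear)
  qed
  define L where "L i j k x = lim (%n. mol [j, i, k] v (\<tau> n) x)" for i j k x
  have L: "(%n. mol [j, i, k] v (\<tau> n) x) \<longlonglongrightarrow> L i j k x" if "x \<in> U" for i j k x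
    using conv[OF that] unfolding L_def convergent_LIMSEQ_iff .
  have LC: "\<bar>mol [j, i, k] v s x - L i j k x\<bar> <= C * s" if s: "s > 0" "cball x s \<subseteq> U" for i j k s x
  proof (rule tendsto_upperbound[OF tendsto_rabs[OF tendsto_diff[OF tendsto_const L]]])
    show "x \<in> U" using s by auto
    have "\<forall>\<^sub>F n in sequentially. \<tau> n < s" by (rule order_tendstoD(2)[OF \<tau>0]) (use s in simp)
    then show "\<forall>\<^sub>F n in sequentially. \<bar>mol [j, i, k] v s x - mol [j, i, k] v (\<tau> n) x\<bar> <= C * s"
    proof (rule eventually_mono)
      fix n assume "\<tau> n < s"
      then have "\<bar>mol [j, i, k] v s x - mol [j, i, k] v (\<tau> n) x\<bar> <= C * (s - \<tau> n)" using C(2)[OF \<tau> _ s(2)] by simp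
      also have "... <= C * s" using C(1) \<tau>[of n] by simp
      finally show "\<bar>mol [j, i, k] v s x - mol [j, i, k] v (\<tau> n) x\<bar> <= C * s" .
    qed
  qed simp
  have loc: "(pds [i, j] u has_derivative (%h. (\<chi> k. L i j k x) \<bullet> h)) (at x) \<and> isCont (L i j k) x"
    if x: "x \<in> U" for i j k x
  proof -
    obtain d where d: "d > 0" "cball x d \<subseteq> U" using openU x open_contains_cball by metis
    \<comment> \<open>Half the radius, so that about every point of \<open>S\<close> a ball of the
      same radius \<open>d / 2\<close> still lies in \<open>U\<close> and the convergence is uniform
      on \<open>S\<close>.\<close>
    define S where "S = ball x (d / 2)"
    have S: "convex S" "open S" "x \<in> S" using d by (auto simp: S_def)
    have sub: "cball y (d / 2) \<subseteq> U" if "y \<in> S" for y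
    proof
      fix z assume "z \<in> cball y (d / 2)"
      then have "dist x z <= d" using that dist_triangle[of x z y] by (auto simp: S_def)
      then show "z \<in> U" using d by auto
    qed
    then have SU: "y \<in> U" if "y \<in> S" for y using that d by (meson centre_in_cball half_gt_zero less_imp_le subsetD)
    have ev: "\<forall>\<^sub>F n in sequentially. \<forall>y\<in>S. \<bar>mol [j, i, k] v (\<tau> n) y - L i j k y\<bar> <= e" if e: "e > 0" for e k
    proof -
      have "\<forall>\<^sub>F n in sequentially. \<tau> n < min (d / 2) (e / C)"
        by (rule order_tendstoD(2)[OF \<tau>0]) (use d e C(1) in simp)
      then show ?thesis
      proof (rule eventually_mono, intro ballI)
        fix n y assume n: "\<tau> n < min (d / 2) (e / C)" and y: "y \<in> S"
        have "cball y (\<tau> n) \<subseteq> cball y (d / 2)" using n by (intro subset_cball) simp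
        then have "cball y (\<tau> n) \<subseteq> U" using sub[OF y] by blast
        from LC[OF \<tau> this] have "\<bar>mol [j, i, k] v (\<tau> n) y - L i j k y\<bar> <= C * \<tau> n" .
        also have "... <= e" using n C(1) by (simp add: field_simps)
        finally show "\<bar>mol [j, i, k] v (\<tau> n) y - L i j k y\<bar> <= e" .
      qed
    qed
    have lim: "(%n. mol [j, i] v (\<tau> n) y) \<longlonglongrightarrow> pds [i, j] u y" if "y \<in> S" for y
    proof -
      have "filterlim \<tau> (at_right 0) sequentially"
        unfolding filterlim_at using \<tau>0 \<tau> by (auto simp: less_le)
      from filterlim_compose[OF mol_tendsto[OF SU[OF that]] this] show ?thesis .
    qed
    have "\<exists>G. \<forall>y\<in>S. (%n. mol [j, i] v (\<tau> n) y) \<longlonglongrightarrow> G y \<and> (G has_derivative (%h. (\<chi> k. L i j k y) \<bullet> h)) (at y within S)"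
    proof (rule has_derivative_sequence[OF S(1)])
      show "(mol [j, i] v (\<tau> n) has_derivative (%h. (\<chi> k. mol [j, i, k] v (\<tau> n) y) \<bullet> h)) (at y within S)" for n y
        using has_derivative_grad[OF pd_mol(2)[OF v_int, of "[j, i]" "\<tau> n" y]] pd_mol(1)[OF v_int, of "[j, i]" _ "\<tau> n" y]
        by (auto simp: grad_def intro: has_derivative_at_withinI)
      fix e :: real assume e: "e > 0"
      have "\<forall>\<^sub>F n in sequentially. \<forall>k\<in>UNIV. \<forall>y\<in>S. \<bar>mol [j, i, k] v (\<tau> n) y - L i j k y\<bar> <= e / 3"
        by (rule eventually_ball_finite) (use ev[of "e / 3"] e in auto)
      then show "\<forall>\<^sub>F n in sequentially. \<forall>y\<in>S. \<forall>h. norm ((\<chi> k. mol [j, i, k] v (\<tau> n) y) \<bullet> h - (\<chi> k. L i j k y) \<bullet> h) <= e * norm h"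
      proof (rule eventually_mono, intro ballI allI)
        fix n y and h :: "real^3"
        assume a: "\<forall>k\<in>UNIV. \<forall>y\<in>S. \<bar>mol [j, i, k] v (\<tau> n) y - L i j k y\<bar> <= e / 3" and y: "y \<in> S"
        let ?D = "(\<chi> k. mol [j, i, k] v (\<tau> n) y) - (\<chi> k. L i j k y)"
        have "norm ?D <= (\<Sum>k\<in>UNIV. \<bar>?D $ k\<bar>)" by (rule norm_le_l1_cart)
        also have "... <= (\<Sum>k\<in>(UNIV :: 3 set). e / 3)" by (rule sum_mono) (use a y in auto)
        finally have "norm ?D <= e" by simp
        then have "norm ?D * norm h <= e * norm h" by (rule mult_right_mono) simp
        then show "norm ((\<chi> k. mol [j, i, k] v (\<tau> n) y) \<bullet> h - (\<chi> k. L i j k y) \<bullet> h) <= e * norm h"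
          using Cauchy_Schwarz_ineq2[of ?D h] by (simp add: inner_diff_left)
      qed
    qed (use S(3) lim[OF S(3)] in auto)
    then obtain G where G: "!!y. y \<in> S ==> (%n. mol [j, i] v (\<tau> n) y) \<longlonglongrightarrow> G y"
      "!!y. y \<in> S ==> (G has_derivative (%h. (\<chi> k. L i j k y) \<bullet> h)) (at y within S)" by blast
    have "(G has_derivative (%h. (\<chi> k. L i j k x) \<bullet> h)) (at x)"
      using G(2)[OF S(3)] at_within_open[OF S(3,2)] by simp
    then have 1: "(pds [i, j] u has_derivative (%h. (\<chi> k. L i j k x) \<bullet> h)) (at x)"
      by (rule has_derivative_transform_within_open[OF _ S(2,3)]) (use LIMSEQ_unique[OF G(1) lim] in blast)
    have "continuous_on S (L i j k)"
    proof (rule uniform_limit_theorem[where F=sequentially and f="%n. mol [j, i, k] v (\<tau> n)"])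
      show "\<forall>\<^sub>F n in sequentially. continuous_on S (mol [j, i, k] v (\<tau> n))"
        by (intro always_eventually allI continuous_at_imp_continuous_on ballI
            differentiable_imp_continuous_within pd_mol(2)[OF v_int]) simp
      show "uniform_limit S (%n. mol [j, i, k] v (\<tau> n)) (L i j k) sequentially"
      proof (rule uniform_limitI)
        fix e :: real assume "e > 0"
        then have "e / 2 > 0" by simp
        from ev[OF this, of k] show "\<forall>\<^sub>F n in sequentially. \<forall>y\<in>S. dist (mol [j, i, k] v (\<tau> n) y) (L i j k y) < e"
          by (rule eventually_mono) (use \<open>e > 0\<close> in \<open>force simp: dist_real_def\<close>)
      qed
    qed simp
    then have "isCont (L i j k) x" using S continuous_on_eq_continuous_at by blast
    with 1 show ?thesis by blast
  qed
  have eqL: "pds [i, j, k] u x = L i j k x" if "x \<in> U" for i j k x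
    using pd_inner[OF conjunct1[OF loc[OF that]], of k i j] by simp
  have cL: "continuous_on U (pd k (pd j (pd i u)))" for i j k
  proof -
    have "continuous_on U (L i j k)" by (rule continuous_at_imp_continuous_on) (use loc in blast)
    then show ?thesis using eqL by (simp cong: continuous_on_cong)
  qed
  have dL: "pd j (pd i u) differentiable at x" if "x \<in> U" for i j x
    using conjunct1[OF loc[OF that, of i j]] by (auto simp: differentiable_def)
  show "Ck 3 U u" using u2 dL cL by (simp add: numeral_3_eq_3 numeral_2_eq_2)
  assume a: "0 < s" "cball x s \<subseteq> U"
  then have xU: "x \<in> U" by auto
  show "\<bar>pds [i, j, k] u x - mol [j, i, k] v s x\<bar> <= scale_const * s"
    unfolding eqL[OF xU] C_def[symmetric] using LC[OF a, of j i k] by (simp only: abs_minus_commute)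
qed

end

section \<open>Thin layers along the boundary and a divergence estimate\<close>

lemma continuous_times_kernel_integrable:
  assumes "open U" "continuous_on U f" "kern k K" "s > 0" "cball z s \<subseteq> U"
  shows "integrable lborel (%y. f y * K ((1 / s) *\<^sub>R (z - y)))"
proof (rule integrable_compact_support[where R="norm z + s"])
  show "continuous_on UNIV (%y. f y * K ((1 / s) *\<^sub>R (z - y)))"
    using Ck_times_kernel[OF assms(1) _ kern_mono[OF assms(3)] assms(4,5), of 0 f] assms(2) by simp
  fix y :: "real^3"
  assume "norm y > norm z + s"
  then have "norm (z - y) > s" using norm_triangle_ineq2[of y z] by (simp add: norm_minus_commute)
  then show "f y * K ((1 / s) *\<^sub>R (z - y)) = 0" using kernD(2)[OF assms(3)] assms(4) by (simp add: norm_scaleR_inverse)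
qed

text \<open>A continuously differentiable step from 0 to 1 between 1 and 2: its derivative
  \<open>hcut'\<close> is the tent with peak 2 at 3/2 and integral 1.\<close>

definition hcut :: "real => real" where
  "hcut t = 2 * ((max 0 (t - 1))\<^sup>2 - 2 * (max 0 (t - 3/2))\<^sup>2 + (max 0 (t - 2))\<^sup>2)"
definition hcut' :: "real => real" where
  "hcut' t = 4 * (max 0 (t - 1) - 2 * max 0 (t - 3/2) + max 0 (t - 2))"

lemma DERIV_hcut: "(hcut has_real_derivative hcut' t) (at t)"
proof -
  have d: "((%t. (max 0 (t - a))\<^sup>2) has_real_derivative 2 * max 0 (t - a)) (at t)" for a
  proof -
    have "((%t. t - a) has_real_derivative 1) (at t)" by (auto intro!: derivative_eq_intros)
    from DERIV_chain2[OF DERIV_max_power[of 0 "t - a"] this]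
    show ?thesis by (simp add: power2_eq_square numeral_2_eq_2)
  qed
  show ?thesis unfolding hcut_def hcut'_def
    by (rule derivative_eq_intros d refl | simp)+
qed

lemma continuous_hcut': "continuous_on S hcut'"
  unfolding hcut'_def by (intro continuous_intros)

lemma hcut'_simps: "hcut' t >= 0" "t >= 2 ==> hcut' t = 0" "t <= 1 ==> hcut' t = 0"
  by (auto simp: hcut'_def max_def)

lemma hcut_simps: "t <= 1 ==> hcut t = 0" "t >= 2 ==> hcut t = 1"
proof -
  show "t <= 1 ==> hcut t = 0" by (simp add: hcut_def max_def)
  assume "t >= 2"
  then have "hcut t = 2 * ((t - 1)\<^sup>2 - 2 * (t - 3/2)\<^sup>2 + (t - 2)\<^sup>2)" by (simp add: hcut_def max_def)
  then show "hcut t = 1" by (simp add: power2_eq_square field_simps)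
qed

lemma hcut_mono: "a <= b ==> hcut a <= hcut b"
  by (rule DERIV_nonneg_imp_nondecreasing) (use DERIV_hcut hcut'_simps(1) in blast)+

lemma hcut_bounds: "0 <= hcut t" "hcut t <= 1"
  using hcut_mono[of "min t 0" t] hcut_mono[of t "max t 2"] hcut_simps(1)[of "min t 0"] hcut_simps(2)[of "max t 2"] by auto

lemma hcut_comp:
  assumes "Ck 1 V \<rho>" "open V"
  shows "y \<in> V ==> pd i (%y. hcut (\<rho> y / \<epsilon>)) y = hcut' (\<rho> y / \<epsilon>) / \<epsilon> * pd i \<rho> y"
    and "Ck 1 V (%y. hcut (\<rho> y / \<epsilon>))"
proof -
  have D: "((%y. hcut (\<rho> y / \<epsilon>)) has_derivative (%h. ((hcut' (\<rho> y / \<epsilon>) / \<epsilon>) *\<^sub>R grad \<rho> y) \<bullet> h)) (at y)"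
    if "y \<in> V" for y
  proof -
    have "\<rho> differentiable at y" using assms that by simp
    from has_derivative_divide[OF has_derivative_grad[OF this] has_derivative_const[of \<epsilon>]]
    have "((%y. \<rho> y / \<epsilon>) has_derivative (%h. (grad \<rho> y \<bullet> h) / \<epsilon>)) (at y)" if "\<epsilon> \<noteq> 0"
      using that by simp
    \<comment> \<open>For \<epsilon> = 0 both quotients are zero by convention.\<close>
    then have "((%y. \<rho> y / \<epsilon>) has_derivative (%h. (grad \<rho> y \<bullet> h) / \<epsilon>)) (at y)"
      by (cases "\<epsilon> = 0") simp_all
    from has_derivative_compose[OF this DERIV_hcut[unfolded has_field_derivative_def]]
    show ?thesis by (rule has_derivative_eq_rhs) simp
  qed
  show pd: "y \<in> V ==> pd i (%y. hcut (\<rho> y / \<epsilon>)) y = hcut' (\<rho> y / \<epsilon>) / \<epsilon> * pd i \<rho> y" for y i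
    using pd_inner[OF D, of y i] by (simp add: grad_def)
  have c: "continuous_on V (%y. \<rho> y / \<epsilon>)"
    using continuous_on_divide[OF Ck_continuous_on[OF assms(1)] continuous_on_const, of \<epsilon>]
    by (cases "\<epsilon> = 0") simp_all
  have "continuous_on V (%y. hcut' (\<rho> y / \<epsilon>) * (1 / \<epsilon>) * pd i \<rho> y)" for i
    using assms(1) by (intro continuous_intros continuous_on_compose2[OF continuous_hcut' c]) auto
  then have "continuous_on V (pd i (%y. hcut (\<rho> y / \<epsilon>)))" for i
    using pd by (simp cong: continuous_on_cong)
  then show "Ck 1 V (%y. hcut (\<rho> y / \<epsilon>))" using D by (auto simp: differentiable_def)
qed

text \<open>The fixed direction \<open>\<nu>\<close>, along which \<open>\<rho>\<close> rises at
  least at rate \<open>m\<close> all over the ball, takes the place of coordinates that flatten the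
  boundary: points are moved along \<open>\<nu>\<close>, and \<open>\<rho>\<close> tells on which
  side of the boundary they are.\<close>

locale defining_function =
  fixes \<Omega> :: "(real^3) set" and \<rho> :: "real^3 => real" and c :: "real^3" and R m :: real and \<nu> :: "real^3"
  assumes open\<Omega>: "open \<Omega>" and bd\<Omega>: "bounded \<Omega>" and m: "m > 0"
    and \<rho>1: "Ck 1 (ball c R) \<rho>"
    and unit\<nu>: "norm \<nu> = 1" and transversal: "!!y. y \<in> ball c R ==> m <= grad \<rho> y \<bullet> \<nu>"
    and in\<Omega>: "!!y. y \<in> ball c R ==> y \<in> \<Omega> \<longleftrightarrow> \<rho> y > 0"
    and bdry: "!!y. y \<in> ball c R ==> y \<in> frontier \<Omega> \<longleftrightarrow> \<rho> y = 0"
begin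

text \<open>\<open>hcut' (\<rho> y / \<epsilon>) / \<epsilon>\<close> is a density on the layer
  where \<open>\<rho>\<close> lies between \<open>\<epsilon>\<close> and
  \<open>2 * \<epsilon>\<close>, a smeared substitute for surface measure. The bound is uniform in
  \<epsilon> and expresses that the boundary has area of order at most \<open>s\<^sup>2\<close> in a
  ball of radius \<open>s\<close>.\<close>

definition mass_const :: real where
  "mass_const = (SOME K. K > 0 \<and> (\<forall>\<epsilon>>0. \<forall>s>0. \<forall>x. cball x (2 * s) \<subseteq> ball c R -->
     integrable lborel (%y. indicator (cball x s) y * (hcut' (\<rho> y / \<epsilon>) / \<epsilon>)) \<and>
     (LINT y|lborel. indicator (cball x s) y * (hcut' (\<rho> y / \<epsilon>) / \<epsilon>)) <= K * s\<^sup>2))"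

text \<open>The area of the boundary in a ball, tested against the divergence of \<open>\<eta> h(\<rho>/\<epsilon>) \<nu>\<close> with a bump \<open>\<eta>\<close>.\<close>

lemma layer_mass_exists:
  "\<exists>K. K > 0 \<and> (\<forall>\<epsilon>>0. \<forall>s>0. \<forall>x. cball x (2 * s) \<subseteq> ball c R -->
     integrable lborel (%y. indicator (cball x s) y * (hcut' (\<rho> y / \<epsilon>) / \<epsilon>)) \<and>
     (LINT y|lborel. indicator (cball x s) y * (hcut' (\<rho> y / \<epsilon>) / \<epsilon>)) <= K * s\<^sup>2)"
proof -
  have K: "kern 1 (bump 2)" using kern_bump[of 1] by (simp add: numeral_2_eq_2)
  have K0: "kern 0 (pd i (bump 2))" for i using kern_pd[of 0 "bump 2" i] K by simp
  obtain B0 where B0: "B0 > 0" "!!x. norm (grad (bump 2) x) <= B0"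
    using kern_grad_bounded[of 0 "bump 2"] K by auto
  then have B: "\<bar>pd i (bump 2) x\<bar> <= B0" for i x using pd_le_norm_grad order_trans by blast
  \<comment> \<open>12 is three directions times the 4 in
    \<open>(2 * s) ^ 3 / (2 * s) = 4 * s\<^sup>2\<close>; the factor 16/9 inverts the lower bound
    9/16 of the bump, and the division by \<open>m\<close> the rate of \<open>\<rho>\<close> along
    \<open>\<nu>\<close>.\<close>
  define K' where "K' = 16 / 9 * (12 * B0 * unit_ball_vol 3) / m"
  show ?thesis
  proof (intro exI[of _ K'] conjI allI impI)
    show "K' > 0" using B0(1) m by (simp add: K'_def)
    fix \<epsilon> s :: real and x
    assume a: "\<epsilon> > 0" "s > 0" "cball x (2 * s) \<subseteq> ball c R"
    let ?f = "%y. hcut (\<rho> y / \<epsilon>)"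
    let ?k = "%y. bump 2 ((1 / (2 * s)) *\<^sub>R (x - y))"
    have s2: "2 * s > 0" using a by simp
    note f1 = hcut_comp(2)[OF \<rho>1 open_ball, of \<epsilon>]
    have cf: "continuous_on (ball c R) (%y. hcut' (\<rho> y / \<epsilon>) / \<epsilon>)"
      by (intro continuous_on_divide continuous_on_compose2[OF continuous_hcut'[of UNIV]] Ck_continuous_on[OF \<rho>1]
            continuous_on_const) (use a in auto)
    have I0: "integrable lborel (%y. (hcut' (\<rho> y / \<epsilon>) / \<epsilon>) * ?k y)"
      by (rule continuous_times_kernel_integrable[OF open_ball cf K s2 a(3)])
    have Ii: "integrable lborel (%y. pd i ?f y * ?k y)" for i
      by (rule continuous_times_kernel_integrable[OF open_ball _ K s2 a(3)]) (use f1 in simp)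
    have kn: "0 <= ?k y" for y by (simp add: bump_def)
    \<comment> \<open>The bump has radius \<open>2 * s\<close>, so on \<open>cball x s\<close> its
      argument has norm at most 1/2 and its value is at least
      \<open>(1 - 1/4)\<^sup>2\<close>.\<close>
    have k916: "9 / 16 * indicator (cball x s) y <= ?k y" for y
    proof (cases "y \<in> cball x s")
      case True
      let ?a = "(1 / (2 * s)) *\<^sub>R (x - y)"
      have "norm ?a = norm (x - y) / (2 * s)" unfolding norm_scaleR using a(2) by simp
      also have "... <= 1 / 2" using True a(2) by (simp add: dist_norm field_simps)
      finally have "norm ?a <= 1 / 2" .
      then have "(norm ?a)\<^sup>2 <= (1 / 2)\<^sup>2" by (rule power_mono) simp
      moreover have "(1 / 2)\<^sup>2 = (1 / 4 :: real)" by (simp add: power2_eq_square)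
      ultimately have "?a \<bullet> ?a <= 1 / 4" by (simp only: power2_norm_eq_inner)
      then have "3 / 4 <= 1 - ?a \<bullet> ?a" by linarith
      then have "3 / 4 <= max 0 (1 - ?a \<bullet> ?a)" by (rule order_trans) (rule max.cobounded2)
      then have "(3 / 4)\<^sup>2 <= (max 0 (1 - ?a \<bullet> ?a))\<^sup>2" by (rule power_mono) simp
      moreover have "(3 / 4)\<^sup>2 = (9 / 16 :: real)" by (simp add: power2_eq_square)
      ultimately show ?thesis using True unfolding bump_def by (simp only:) simp
    qed (use kn in simp)
    have out: "?k y = 0" if "y \<notin> ball c R" for y
    proof -
      have "y \<notin> cball x (2 * s)" using that a(3) by blast
      then have "norm ((1 / (2 * s)) *\<^sub>R (x - y)) > 1"
        using norm_scaleR_inverse[OF s2, of "x - y"] by (simp add: dist_norm)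
      then show ?thesis using kernD(2)[OF K] by simp
    qed
    have meas: "(%y. indicator (cball x s) y * (hcut' (\<rho> y / \<epsilon>) / \<epsilon>)) \<in> borel_measurable borel"
    proof -
      have "(%y. if y \<in> cball x s then hcut' (\<rho> y / \<epsilon>) / \<epsilon> else 0) \<in> borel_measurable borel"
        by (rule borel_measurable_continuous_on_if[OF _ continuous_on_subset[OF cf]]) (use a(2,3) in auto)
      moreover have "(%y. if y \<in> cball x s then hcut' (\<rho> y / \<epsilon>) / \<epsilon> else 0)
         = (%y. indicator (cball x s) y * (hcut' (\<rho> y / \<epsilon>) / \<epsilon>))" by (rule ext) simp
      ultimately show ?thesis by (simp only:)
    qed
    have le: "\<bar>9 / 16 * (indicator (cball x s) y * (hcut' (\<rho> y / \<epsilon>) / \<epsilon>))\<bar> <= (hcut' (\<rho> y / \<epsilon>) / \<epsilon>) * ?k y" for y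
      using mult_right_mono[OF k916[of y], of "hcut' (\<rho> y / \<epsilon>) / \<epsilon>"] hcut'_simps(1)[of "\<rho> y / \<epsilon>"] a(1)
      by (simp add: mult_ac)
    have "integrable lborel (%y. 9 / 16 * (indicator (cball x s) y * (hcut' (\<rho> y / \<epsilon>) / \<epsilon>)))"
    proof (rule Bochner_Integration.integrable_bound[OF I0])
      show "(%y. 9 / 16 * (indicator (cball x s) y * (hcut' (\<rho> y / \<epsilon>) / \<epsilon>))) \<in> borel_measurable lborel"
        unfolding measurable_lborel2 by (rule borel_measurable_times[OF borel_measurable_const meas])
      show "AE y in lborel. norm (9 / 16 * (indicator (cball x s) y * (hcut' (\<rho> y / \<epsilon>) / \<epsilon>)))
          <= norm ((hcut' (\<rho> y / \<epsilon>) / \<epsilon>) * ?k y)"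
        unfolding real_norm_def by (rule AE_I2) (rule order_trans[OF le abs_ge_self])
    qed
    then have "9 / 16 = (0::real) \<or> integrable lborel (%y. indicator (cball x s) y * (hcut' (\<rho> y / \<epsilon>) / \<epsilon>))"
      by (simp only: integrable_mult_left_iff)
    then show I1: "integrable lborel (%y. indicator (cball x s) y * (hcut' (\<rho> y / \<epsilon>) / \<epsilon>))"
      by (rule disjE) (simp, assumption)
    have "m * (9 / 16 * (LINT y|lborel. indicator (cball x s) y * (hcut' (\<rho> y / \<epsilon>) / \<epsilon>)))
      = (LINT y|lborel. m * (9 / 16 * (indicator (cball x s) y * (hcut' (\<rho> y / \<epsilon>) / \<epsilon>))))" by simp
    also have "... <= (LINT y|lborel. (\<Sum>i\<in>UNIV. \<nu> $ i * (pd i ?f y * ?k y)))"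
    proof (rule integral_mono)
      show "integrable lborel (%y. m * (9 / 16 * (indicator (cball x s) y * (hcut' (\<rho> y / \<epsilon>) / \<epsilon>))))"
        by (intro integrable_mult_right I1)
      show "integrable lborel (%y. \<Sum>i\<in>UNIV. \<nu> $ i * (pd i ?f y * ?k y))"
        by (intro Bochner_Integration.integrable_sum integrable_mult_right Ii)
      fix y
      show "m * (9 / 16 * (indicator (cball x s) y * (hcut' (\<rho> y / \<epsilon>) / \<epsilon>))) <= (\<Sum>i\<in>UNIV. \<nu> $ i * (pd i ?f y * ?k y))"
      proof (cases "y \<in> ball c R")
        case True
        have "(\<Sum>i\<in>UNIV. \<nu> $ i * (pd i ?f y * ?k y)) = (grad \<rho> y \<bullet> \<nu>) * ((hcut' (\<rho> y / \<epsilon>) / \<epsilon>) * ?k y)"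
          unfolding hcut_comp(1)[OF \<rho>1 open_ball True] inner_vec_def sum_distrib_right
          by (rule sum.cong) (simp_all add: grad_def)
        moreover have "m * (9 / 16 * (indicator (cball x s) y * (hcut' (\<rho> y / \<epsilon>) / \<epsilon>))) <= (grad \<rho> y \<bullet> \<nu>) * ((hcut' (\<rho> y / \<epsilon>) / \<epsilon>) * ?k y)"
          by (rule mult_mono[OF transversal[OF True] order_trans[OF abs_ge_self le]])
            (use m transversal[OF True] hcut'_simps(1)[of "\<rho> y / \<epsilon>"] a(1) in auto)
        ultimately show ?thesis by simp
      next
        case False
        moreover have "cball x s \<subseteq> cball x (2 * s)" using a(2) by (intro subset_cball) simp
        ultimately have "y \<notin> cball x s" using a(3) by blast
        then show ?thesis using out[OF False] by simp
      qed
    qed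
    also have "... = (\<Sum>i\<in>UNIV. \<nu> $ i * conv (pd i ?f) (bump 2) (2 * s) x)"
      unfolding conv_def by (subst Bochner_Integration.integral_sum) (auto intro: Ii)
    also have "... <= (\<Sum>i\<in>(UNIV::3 set). 4 * B0 * unit_ball_vol 3 * s\<^sup>2)"
    proof (rule sum_mono)
      fix i :: 3
      have "\<bar>conv ?f (pd i (bump 2)) (2 * s) x\<bar> <= 1 * B0 * unit_ball_vol 3 * (2 * s) ^ 3"
        by (rule conv_bound[OF K0 s2 B]) (use hcut_bounds in simp)
      then have "\<bar>conv (pd i ?f) (bump 2) (2 * s) x\<bar> <= 4 * B0 * unit_ball_vol 3 * s\<^sup>2"
        unfolding conv_ibp[OF open_ball f1 K s2 a(3)] using a(2)
        by (simp add: abs_mult power2_eq_square power3_eq_cube mult_ac)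
      moreover have "\<bar>\<nu> $ i\<bar> <= 1" using component_le_norm_cart[of \<nu> i] unit\<nu> by simp
      ultimately have "\<bar>\<nu> $ i\<bar> * \<bar>conv (pd i ?f) (bump 2) (2 * s) x\<bar> <= 1 * (4 * B0 * unit_ball_vol 3 * s\<^sup>2)"
        by (intro mult_mono) auto
      then show "\<nu> $ i * conv (pd i ?f) (bump 2) (2 * s) x <= 4 * B0 * unit_ball_vol 3 * s\<^sup>2"
        by (simp add: abs_mult[symmetric])
    qed
    finally have "m * (9 / 16 * (LINT y|lborel. indicator (cball x s) y * (hcut' (\<rho> y / \<epsilon>) / \<epsilon>)))
        <= (\<Sum>i\<in>(UNIV::3 set). 4 * B0 * unit_ball_vol 3 * s\<^sup>2)" .
    moreover have "J <= 16 / 9 * X / m" if "m * (9 / 16 * J) <= X" for J X :: real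
      using that m by (simp add: field_simps)
    ultimately have "(LINT y|lborel. indicator (cball x s) y * (hcut' (\<rho> y / \<epsilon>) / \<epsilon>))
        <= 16 / 9 * (\<Sum>i\<in>(UNIV::3 set). 4 * B0 * unit_ball_vol 3 * s\<^sup>2) / m" by blast
    also have "... = K' * s\<^sup>2" unfolding K'_def by simp
    finally show "(LINT y|lborel. indicator (cball x s) y * (hcut' (\<rho> y / \<epsilon>) / \<epsilon>)) <= K' * s\<^sup>2" .
  qed
qed

lemmas layer_mass = someI_ex[OF layer_mass_exists, folded mass_const_def]

end

context defining_function
begin

text \<open>Multiplied by \<open>hcut (\<rho> y / \<epsilon>)\<close> the field vanishes near the
  boundary, and its divergence integrates to zero. The derivative of the cutoff leaves the flux, the
  inner product of the field with \<open>grad \<rho>\<close>, times the layer density, which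
  \<open>layer_mass\<close> controls; then \<epsilon> tends to zero. The flux is bounded by
  \<open>B\<close> only in the limit at the boundary, hence the tolerance \<eta>.\<close>

lemma divergence_bound:
  fixes F :: "3 => real^3 => real"
  assumes F: "!!i. Ck 1 \<Omega> (F i)" and s: "s > 0" "cball x (2 * s) \<subseteq> ball c R"
    and supp: "!!i y. y \<in> \<Omega> ==> y \<notin> cball x s ==> F i y = 0"
    and divb: "!!y. y \<in> \<Omega> ==> \<bar>\<Sum>i\<in>UNIV. pd i (F i) y\<bar> <= D"
    and D: "D >= 0" and B: "B >= 0"
    and flux: "!!\<eta>. \<eta> > 0 ==> \<exists>\<delta>>0. \<forall>y\<in>\<Omega> \<inter> cball x s. \<rho> y < \<delta> --> \<bar>\<Sum>i\<in>UNIV. F i y * pd i \<rho> y\<bar> <= B + \<eta>"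
  shows "\<bar>LINT y|lborel. indicator \<Omega> y * (\<Sum>i\<in>UNIV. pd i (F i) y)\<bar> <= B * mass_const * s\<^sup>2"
proof -
  let ?W = "\<Omega> \<inter> ball c R"
  have W: "open ?W" using open\<Omega> by auto
  have sub: "cball x s \<subseteq> ball c R"
  proof -
    have "cball x s \<subseteq> cball x (2 * s)" using s by (intro subset_cball) simp
    then show ?thesis using s(2) by blast
  qed
  define dF where "dF y = (\<Sum>i\<in>UNIV. pd i (F i) y)" for y
  define fl where "fl y = (\<Sum>i\<in>UNIV. F i y * pd i \<rho> y)" for y
  have pd0: "pd i (F i) y = 0" if "y \<in> \<Omega>" "y \<notin> cball x s" for i y
  proof -
    have "pd i (F i) y = pd i (%_. 0) y"
      by (rule pd_cong[of "\<Omega> \<inter> - cball x s"]) (use open\<Omega> that supp in auto)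
    then show ?thesis by (simp add: pd_const)
  qed
  have dF0: "dF y = 0" if "y \<in> \<Omega>" "y \<notin> cball x s" for y using pd0[OF that] by (simp add: dF_def)
  have fl0: "fl y = 0" if "y \<in> \<Omega>" "y \<notin> cball x s" for y using supp[OF that] by (simp add: fl_def)
  define X where "X \<epsilon> i y = (if y \<in> ?W then hcut (\<rho> y / \<epsilon>) * F i y else 0)" for \<epsilon> i y
  define a where "a \<epsilon> y = (if y \<in> ?W then hcut (\<rho> y / \<epsilon>) * dF y else 0)" for \<epsilon> y
  define b where "b \<epsilon> y = (if y \<in> ?W then hcut' (\<rho> y / \<epsilon>) / \<epsilon> * fl y else 0)" for \<epsilon> y
  have \<rho>W: "Ck 1 ?W \<rho>" by (rule Ck_subset[OF \<rho>1]) simp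
  have FW: "Ck 1 ?W (F i)" for i by (rule Ck_subset[OF F]) simp
  have c\<rho>: "continuous_on (ball c R) \<rho>" by (rule Ck_continuous_on[OF \<rho>1])
  \<comment> \<open>Off \<open>?W\<close> there are two cases: in the chart ball
    \<open>\<rho>\<close> is at most 0 at \<open>y\<close>, so the cutoff vanishes nearby; outside
    it the field vanishes because its support lies in \<open>cball x s\<close>.\<close>
  have zero: "\<exists>V. open V \<and> y \<in> V \<and> (\<forall>z\<in>V. \<forall>i. X \<epsilon> i z = 0)" if e: "\<epsilon> > 0" and y: "y \<notin> ?W" for \<epsilon> y
  proof (cases "y \<in> ball c R")
    case True
    let ?V = "ball c R \<inter> \<rho> -` {..<\<epsilon>}"
    have "open ?V" by (rule continuous_open_preimage[OF c\<rho> open_ball open_lessThan])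
    moreover have "y \<in> ?V" using True y in\<Omega>[OF True] e by auto
    moreover have "X \<epsilon> i z = 0" if "z \<in> ?V" for i z
    proof -
      have "\<rho> z / \<epsilon> <= 1" using that e by simp
      then show ?thesis by (simp add: X_def hcut_simps)
    qed
    ultimately show ?thesis by blast
  next
    case False
    then have "y \<in> - cball x s" using sub by blast
    moreover have "X \<epsilon> i z = 0" if "z \<in> - cball x s" for i z using that supp by (auto simp: X_def)
    ultimately show ?thesis by (intro exI[of _ "- cball x s"]) auto
  qed
  have XC: "Ck 1 UNIV (X \<epsilon> i)" if e: "\<epsilon> > 0" for \<epsilon> i
  proof (rule Ck_local)
    fix y :: "real^3"
    show "\<exists>V. open V \<and> y \<in> V \<and> Ck 1 V (X \<epsilon> i)"
    proof (cases "y \<in> ?W")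
      case True
      have "Ck 1 ?W (%y. hcut (\<rho> y / \<epsilon>) * F i y)"
        by (intro Ck_mult W hcut_comp(2) \<rho>W FW)
      then have "Ck 1 ?W (X \<epsilon> i)" by (rule Ck_cong_imp[OF W, rotated]) (simp add: X_def)
      then show ?thesis using W True by blast
    next
      case False
      obtain V where V: "open V" "y \<in> V" "!!z. z \<in> V ==> X \<epsilon> i z = 0" using zero[OF e False] by blast
      have "Ck 1 V (X \<epsilon> i)" by (rule Ck_cong_imp[OF V(1) _ Ck_const[of 1 V 0]]) (simp add: V(3))
      then show ?thesis using V by blast
    qed
  qed
  have pdX: "(\<Sum>i\<in>UNIV. pd i (X \<epsilon> i) y) = a \<epsilon> y + b \<epsilon> y" if e: "\<epsilon> > 0" for \<epsilon> y
  proof (cases "y \<in> ?W")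
    case True
    have "pd i (X \<epsilon> i) y = hcut (\<rho> y / \<epsilon>) * pd i (F i) y + hcut' (\<rho> y / \<epsilon>) / \<epsilon> * (F i y * pd i \<rho> y)" for i
    proof -
      have "pd i (X \<epsilon> i) y = pd i (%y. hcut (\<rho> y / \<epsilon>) * F i y) y"
        by (rule pd_cong[OF W True]) (simp add: X_def)
      also have "... = hcut (\<rho> y / \<epsilon>) * pd i (F i) y + pd i (%y. hcut (\<rho> y / \<epsilon>)) y * F i y"
        by (rule pd_mult) (use hcut_comp(2)[OF \<rho>W W, of \<epsilon>] FW True in auto)
      finally show ?thesis unfolding hcut_comp(1)[OF \<rho>W W True] by simp
    qed
    then show ?thesis using True by (simp add: a_def b_def dF_def fl_def sum.distrib sum_distrib_left)
  next
    case False
    obtain V where V: "open V" "y \<in> V" "!!z i. z \<in> V ==> X \<epsilon> i z = 0" using zero[OF e False] by blast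
    have "pd i (X \<epsilon> i) y = pd i (%_. 0) y" for i by (rule pd_cong[OF V(1,2)]) (simp add: V(3))
    then show ?thesis unfolding a_def b_def if_not_P[OF False] by (simp add: pd_const)
  qed
  have Xsupp: "X \<epsilon> i y = 0" if "norm y > norm x + s" for \<epsilon> i y
  proof -
    have "y \<notin> cball x s" using that norm_triangle_ineq2[of y x] by (simp add: dist_norm norm_minus_commute)
    then show ?thesis using supp by (simp add: X_def)
  qed
  have cDF: "continuous_on ?W dF" unfolding dF_def using FW by (intro continuous_on_sum) auto
  have aint: "integrable lborel (a \<epsilon>)" and ab: "\<bar>a \<epsilon> y\<bar> <= D * indicator (cball x s) y" for \<epsilon> y
  proof -
    show ab: "\<bar>a \<epsilon> y\<bar> <= D * indicator (cball x s) y" for y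
    proof (cases "y \<in> ?W")
      case True
      then have "\<bar>hcut (\<rho> y / \<epsilon>) * dF y\<bar> <= 1 * D"
        unfolding abs_mult using hcut_bounds[of "\<rho> y / \<epsilon>"] divb[of y] by (intro mult_mono) (auto simp: dF_def)
      moreover have "dF y = 0" if "y \<notin> cball x s" using dF0[OF _ that] True by simp
      ultimately show ?thesis using True by (auto simp: a_def indicator_def)
    next
      case False
      then show ?thesis using D unfolding a_def if_not_P[OF False] by simp
    qed
    have "continuous_on ?W (%y. hcut (\<rho> y / \<epsilon>) * dF y)"
      by (intro continuous_on_mult cDF Ck_continuous_on[OF hcut_comp(2)[OF \<rho>W W]])
    then have m: "a \<epsilon> \<in> borel_measurable borel"
      unfolding a_def[abs_def] by (intro borel_measurable_continuous_on_if) (use W in auto)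
    have i: "integrable lborel (%y. D * indicator (cball x s) y :: real)"
      by (intro integrable_mult_right integrable_real_indicator)
        (use emeasure_bounded_finite[OF bounded_cball, of x s] in auto)
    show "integrable lborel (a \<epsilon>)"
    proof (rule Bochner_Integration.integrable_bound[OF i])
      show "a \<epsilon> \<in> borel_measurable lborel" using m by simp
      show "AE y in lborel. norm (a \<epsilon> y) <= norm (D * indicator (cball x s) y :: real)"
        unfolding real_norm_def by (rule AE_I2) (rule order_trans[OF ab abs_ge_self])
    qed
  qed
  have Xint: "integrable lborel (pd i (X \<epsilon> i))" if e: "\<epsilon> > 0" for \<epsilon> i
  proof (rule integrable_compact_support[where R="norm x + s"])
    show "continuous_on UNIV (pd i (X \<epsilon> i))" using XC[OF e] by simp
    fix y :: "real^3" assume y: "norm y > norm x + s"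
    have "open {y :: real^3. norm y > norm x + s}" by (intro open_Collect_less continuous_intros)
    then have "pd i (X \<epsilon> i) y = pd i (%_. 0) y"
      by (rule pd_cong) (use y Xsupp in auto)
    then show "pd i (X \<epsilon> i) y = 0" by (simp add: pd_const)
  qed
  have bint: "integrable lborel (b \<epsilon>)" "(LINT y|lborel. a \<epsilon> y) = - (LINT y|lborel. b \<epsilon> y)" if e: "\<epsilon> > 0" for \<epsilon>
  proof -
    have 1: "integrable lborel (%y. \<Sum>i\<in>UNIV. pd i (X \<epsilon> i) y)"
      by (intro Bochner_Integration.integrable_sum Xint[OF e])
    then have "integrable lborel (%y. (\<Sum>i\<in>UNIV. pd i (X \<epsilon> i) y) - a \<epsilon> y)"
      by (rule Bochner_Integration.integrable_diff[OF _ aint])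
    then show b: "integrable lborel (b \<epsilon>)" unfolding pdX[OF e] by simp
    have "(LINT y|lborel. (\<Sum>i\<in>UNIV. pd i (X \<epsilon> i) y)) = (\<Sum>i\<in>UNIV. (LINT y|lborel. pd i (X \<epsilon> i) y))"
      by (rule Bochner_Integration.integral_sum) (rule Xint[OF e])
    also have "... = 0"
      by (rule sum.neutral) (use integral_pd_eq_0[OF XC[OF e] Xsupp] in blast)
    finally show "(LINT y|lborel. a \<epsilon> y) = - (LINT y|lborel. b \<epsilon> y)"
      unfolding pdX[OF e] using aint b by simp
  qed
  have key: "\<bar>LINT y|lborel. indicator \<Omega> y * dF y\<bar> <= (B + \<eta>) * (mass_const * s\<^sup>2)" if \<eta>: "\<eta> > 0" for \<eta>
  proof -
    obtain \<delta> where \<delta>: "\<delta> > 0" "!!y. y \<in> \<Omega> ==> y \<in> cball x s ==> \<rho> y < \<delta> ==> \<bar>fl y\<bar> <= B + \<eta>"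
      using flux[OF \<eta>] unfolding fl_def by blast
    \<comment> \<open>The density lives where \<open>\<rho> y < 2 * \<epsilon>\<close>, and
      \<open>2 * \<epsilon> <= \<delta>\<close> puts this layer inside the set where the flux is at
      most \<open>B + \<eta>\<close>.\<close>
    have est: "\<bar>LINT y|lborel. a \<epsilon> y\<bar> <= (B + \<eta>) * (mass_const * s\<^sup>2)" if e: "\<epsilon> > 0" "2 * \<epsilon> <= \<delta>" for \<epsilon>
    proof -
      note lm = layer_mass[THEN conjunct2, rule_format, OF e(1) s]
      have "\<bar>LINT y|lborel. a \<epsilon> y\<bar> = \<bar>LINT y|lborel. b \<epsilon> y\<bar>" using bint(2)[OF e(1)] by simp
      also have "... <= (LINT y|lborel. (B + \<eta>) * (indicator (cball x s) y * (hcut' (\<rho> y / \<epsilon>) / \<epsilon>)))"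
      proof (rule order_trans[OF integral_abs_bound integral_mono])
        show "integrable lborel (%y. \<bar>b \<epsilon> y\<bar>)" using bint(1)[OF e(1)] by simp
        show "integrable lborel (%y. (B + \<eta>) * (indicator (cball x s) y * (hcut' (\<rho> y / \<epsilon>) / \<epsilon>)))"
          by (rule integrable_mult_right) (rule lm[THEN conjunct1])
        fix y
        have h0: "0 <= hcut' (\<rho> y / \<epsilon>) / \<epsilon>" using hcut'_simps(1) e(1) by simp
        show "\<bar>b \<epsilon> y\<bar> <= (B + \<eta>) * (indicator (cball x s) y * (hcut' (\<rho> y / \<epsilon>) / \<epsilon>))"
        proof (cases "y \<in> ?W \<and> y \<in> cball x s \<and> \<rho> y < 2 * \<epsilon>")
          case True
          then have "\<bar>fl y\<bar> <= B + \<eta>" using \<delta>(2)[of y] e(2) by auto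
          then have "hcut' (\<rho> y / \<epsilon>) / \<epsilon> * \<bar>fl y\<bar> <= hcut' (\<rho> y / \<epsilon>) / \<epsilon> * (B + \<eta>)"
            by (rule mult_left_mono) (rule h0)
          moreover have "b \<epsilon> y = hcut' (\<rho> y / \<epsilon>) / \<epsilon> * fl y" using True by (simp add: b_def)
          moreover have "indicator (cball x s) y = (1::real)" using True by simp
          ultimately show ?thesis
            by (simp only: abs_mult abs_of_nonneg[OF h0] mult_1_left mult.commute[of "B + \<eta>"])
        next
          case False
          have "b \<epsilon> y = 0"
          proof (cases "y \<in> ?W")
            case W: True
            have "fl y = 0 \<or> hcut' (\<rho> y / \<epsilon>) = 0"
              using False W fl0[of y] hcut'_simps(2)[of "\<rho> y / \<epsilon>"] e(1) by (auto simp: field_simps)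
            then show ?thesis by (auto simp: b_def)
          next
            case W: False
            show ?thesis unfolding b_def by (rule if_not_P[OF W])
          qed
          moreover have "0 <= (B + \<eta>) * (indicator (cball x s) y * (hcut' (\<rho> y / \<epsilon>) / \<epsilon>))"
            by (intro mult_nonneg_nonneg h0 indicator_pos_le) (use B \<eta> in simp)
          ultimately show ?thesis by (simp only: abs_zero)
        qed
      qed
      also have "... = (B + \<eta>) * (LINT y|lborel. indicator (cball x s) y * (hcut' (\<rho> y / \<epsilon>) / \<epsilon>))"
        by (rule integral_mult_right_zero)
      also have "... <= (B + \<eta>) * (mass_const * s\<^sup>2)"
        by (rule mult_left_mono[OF lm[THEN conjunct2]]) (use B \<eta> in simp)
      finally show ?thesis .
    qed
    define \<tau> where "\<tau> n = 1 / real (Suc n)" for n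
    have \<tau>: "\<tau> n > 0" for n by (simp add: \<tau>_def)
    have \<tau>0: "\<tau> \<longlonglongrightarrow> 0" unfolding \<tau>_def by (rule LIMSEQ_inverse_real_of_nat[unfolded inverse_eq_divide])
    have "(%n. LINT y|lborel. a (\<tau> n) y) \<longlonglongrightarrow> (LINT y|lborel. indicator \<Omega> y * dF y)"
    proof (rule integral_dominated_convergence[where w="%y. D * indicator (cball x s) y"])
      have "continuous_on \<Omega> dF" unfolding dF_def using F by (intro continuous_on_sum) auto
      then have "(%y. if y \<in> \<Omega> then dF y else 0) \<in> borel_measurable borel"
        by (intro borel_measurable_continuous_on_if) (use open\<Omega> in auto)
      moreover have "(%y. if y \<in> \<Omega> then dF y else 0) = (%y. indicator \<Omega> y * dF y)" by (rule ext) simp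
      ultimately show "(%y. indicator \<Omega> y * dF y) \<in> borel_measurable lborel" by simp
      show "a (\<tau> n) \<in> borel_measurable lborel" for n using aint by (rule borel_measurable_integrable)
      show "integrable lborel (%y. D * indicator (cball x s) y :: real)"
        by (intro integrable_mult_right integrable_real_indicator)
          (use emeasure_bounded_finite[OF bounded_cball, of x s] in auto)
      show "AE y in lborel. norm (a (\<tau> n) y) <= D * indicator (cball x s) y" for n
        unfolding real_norm_def by (rule AE_I2) (rule ab)
      show "AE y in lborel. (%n. a (\<tau> n) y) \<longlonglongrightarrow> indicator \<Omega> y * dF y"
      proof (rule AE_I2)
        fix y
        show "(%n. a (\<tau> n) y) \<longlonglongrightarrow> indicator \<Omega> y * dF y"
        proof (cases "y \<in> ?W")
          case True
          then have "\<rho> y > 0" using in\<Omega> by auto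
          then have "\<forall>\<^sub>F n in sequentially. \<tau> n < \<rho> y / 2" by (intro order_tendstoD(2)[OF \<tau>0]) simp
          then have "\<forall>\<^sub>F n in sequentially. a (\<tau> n) y = indicator \<Omega> y * dF y"
          proof (rule eventually_mono)
            fix n assume "\<tau> n < \<rho> y / 2"
            then have "2 <= \<rho> y / \<tau> n" using \<tau>[of n] by (simp add: field_simps)
            then show "a (\<tau> n) y = indicator \<Omega> y * dF y" using True by (simp add: a_def hcut_simps)
          qed
          then show ?thesis by (rule tendsto_eventually)
        next
          case False
          have z: "indicator \<Omega> y * dF y = 0"
          proof (cases "y \<in> \<Omega>")
            case True
            then have "y \<notin> cball x s" using False sub by blast
            then show ?thesis using dF0[OF True] by simp
          qed simp
          show ?thesis unfolding a_def if_not_P[OF False] z by (rule tendsto_const)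
        qed
      qed
    qed
    then have "(%n. \<bar>LINT y|lborel. a (\<tau> n) y\<bar>) \<longlonglongrightarrow> \<bar>LINT y|lborel. indicator \<Omega> y * dF y\<bar>"
      by (rule tendsto_rabs)
    moreover have "\<forall>\<^sub>F n in sequentially. \<bar>LINT y|lborel. a (\<tau> n) y\<bar> <= (B + \<eta>) * (mass_const * s\<^sup>2)"
    proof -
      have "\<forall>\<^sub>F n in sequentially. \<tau> n < \<delta> / 2" by (intro order_tendstoD(2)[OF \<tau>0]) (use \<delta> in simp)
      then show ?thesis by (rule eventually_mono) (use est[OF \<tau>] in simp)
    qed
    ultimately show ?thesis by (rule tendsto_upperbound) simp
  qed
  have "\<bar>LINT y|lborel. indicator \<Omega> y * dF y\<bar> <= B * (mass_const * s\<^sup>2)"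
  proof (rule field_le_epsilon)
    fix e :: real assume e: "e > 0"
    have P: "mass_const * s\<^sup>2 > 0" using layer_mass s by simp
    have "(B + e / (mass_const * s\<^sup>2)) * (mass_const * s\<^sup>2) = B * (mass_const * s\<^sup>2) + e"
      using less_imp_neq[OF P] by (simp add: distrib_right)
    then show "\<bar>LINT y|lborel. indicator \<Omega> y * dF y\<bar> <= B * (mass_const * s\<^sup>2) + e"
      using key[of "e / (mass_const * s\<^sup>2)"] e P by (metis divide_pos_pos)
  qed
  then show ?thesis unfolding dF_def by (simp add: mult.assoc)
qed

end

section \<open>Green's identity with a symmetric kernel\<close>

lemma reflection_symmetric_grad:
  fixes Q :: "real^3 => real"
  assumes Q: "!!y. Q differentiable at y" and n: "norm n = 1"
    and sym: "!!y. Q (x0 + reflect n (y - x0)) = Q y" and y: "n \<bullet> (y - x0) = 0"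
  shows "grad Q y \<bullet> n = 0"
proof -
  have S: "x0 + reflect n (y - x0) = y" using y by (simp add: reflect_def)
  have "((%y. x0 + reflect n (y - x0)) has_derivative reflect n) (at y)"
    unfolding reflect_simps
    using has_derivative_add[OF has_derivative_const[of x0] has_derivative_diff[OF reflect_has_derivative[of n y] has_derivative_const[of "reflect n x0"]]]
    by simp
  from has_derivative_compose[OF this has_derivative_grad[OF Q]]
  have "(Q has_derivative (%h. reflect n (grad Q y) \<bullet> h)) (at y)"
    unfolding S sym by (simp add: reflect_inner)
  \<comment> \<open>Being fixed by the reflection, the gradient has a normal component equal to its
    own negative.\<close>
  then have "reflect n (grad Q y) = grad Q y" using grad_eq by metis
  then have "n \<bullet> grad Q y = - (n \<bullet> grad Q y)" using inner_normal_reflect[OF n] by metis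
  then show ?thesis by (simp add: inner_commute)
qed

context defining_function
begin

text \<open>Green's identity for \<open>w\<close> and \<open>Q\<close>, with all sizes counted in
  powers of \<open>\<sigma>\<close>. On the boundary \<open>w\<close> times the gradient of
  \<open>Q\<close> would be of order \<open>\<tau> * b * \<sigma>\<close>. The symmetry of
  \<open>Q\<close> reduces its normal derivative to order \<open>b\<close>, so that the flux is of
  order \<open>\<tau> * b * \<sigma>\<^sup>2\<close> and, over an area of order
  \<open>\<sigma>\<^sup>2\<close>, matches the volume integral of \<open>Q\<close> times the
  Laplacian of \<open>w\<close>.\<close>

lemma green_estimate:
  fixes w wb Q :: "real^3 => real" and pb :: "real^3 => real^3"
  assumes \<sigma>: "\<sigma> > 0" and A: "A >= 0" and \<tau>: "\<tau> >= 0" and b: "b >= 0"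
    and sub: "cball x0 (6 * \<sigma>) \<subseteq> ball c R" and w2: "Ck 2 \<Omega> w"
    and w0: "!!y. y \<in> \<Omega> ==> y \<in> cball x0 (3 * \<sigma>) ==> \<bar>w y\<bar> <= \<tau> * \<sigma>\<^sup>2"
    and wl: "!!y. y \<in> \<Omega> ==> y \<in> cball x0 (3 * \<sigma>) ==> \<bar>laplacian w y\<bar> <= \<tau> * \<sigma>"
    and wb: "continuous_on (closure \<Omega> \<inter> cball x0 (3 * \<sigma>)) wb" "!!y. y \<in> \<Omega> ==> wb y = w y"
    and pb: "continuous_on (closure \<Omega> \<inter> cball x0 (3 * \<sigma>)) pb" "!!y. y \<in> \<Omega> ==> pb y = grad w y"
    and wf: "!!y. y \<in> frontier \<Omega> ==> y \<in> cball x0 (3 * \<sigma>) ==> \<bar>wb y\<bar> <= \<tau> * \<sigma>\<^sup>2"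
    and pf: "!!y. y \<in> frontier \<Omega> ==> y \<in> cball x0 (3 * \<sigma>) ==> \<bar>pb y \<bullet> grad \<rho> y\<bar> <= \<tau> * \<sigma>\<^sup>2"
    and n: "norm n = 1" and r: "0 <= r" "r <= A"
    and nf: "!!y. y \<in> frontier \<Omega> ==> y \<in> cball x0 (3 * \<sigma>) ==> \<bar>n \<bullet> (y - x0)\<bar> <= A * \<sigma>\<^sup>2"
    and gf: "!!y. y \<in> frontier \<Omega> ==> y \<in> cball x0 (3 * \<sigma>) ==> norm (grad \<rho> y - r *\<^sub>R n) <= A * \<sigma>"
    and Q: "Ck 2 UNIV Q" and Qb: "!!y. \<bar>Q y\<bar> <= b" "!!i y. \<bar>pd i Q y\<bar> <= b / \<sigma>"
      "!!i j y. \<bar>pd i (pd j Q) y\<bar> <= b / \<sigma>\<^sup>2"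
    and Qs: "!!y. y \<notin> cball x0 (3 * \<sigma>) ==> Q y = 0"
    and sym: "!!y. Q (x0 + reflect n (y - x0)) = Q y"
  shows "\<bar>LINT y|lborel. indicator \<Omega> y * (w y * laplacian Q y)\<bar>
     <= (27 * unit_ball_vol 3 + 9 * mass_const * (9 * A\<^sup>2 + 3 * A + 1)) * (\<tau> * b * \<sigma> ^ 4)"
proof -
  let ?K = "cball x0 (3 * \<sigma>)"
  have subK: "?K \<subseteq> ball c R"
  proof -
    have "?K \<subseteq> cball x0 (6 * \<sigma>)" using \<sigma> by (intro subset_cball) simp
    then show ?thesis using sub by blast
  qed
  define F where "F i y = w y * pd i Q y - Q y * pd i w y" for i y
  have w1: "Ck 1 \<Omega> w" by (rule Ck_mono[OF w2]) simp
  have pw1: "Ck 1 \<Omega> (pd i w)" for i using w2 by (simp add: numeral_2_eq_2)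
  have Q1: "Ck 1 V Q" for V using Ck_mono[OF Q, of 1] Ck_subset[of 1 UNIV Q V] by simp
  have pQ1: "Ck 1 V (pd i Q)" for i V
    using Q Ck_subset[of 1 UNIV "pd i Q" V] by (simp add: numeral_2_eq_2)
  have dQ: "Q differentiable at y" "pd i Q differentiable at y" for i y
    using Q1[of UNIV] pQ1[of UNIV i] by auto
  have dw: "w differentiable at y" "pd i w differentiable at y" if "y \<in> \<Omega>" for i y
    using w1 pw1[of i] that by auto
  have F1: "Ck 1 \<Omega> (F i)" for i
    unfolding F_def by (intro Ck_diff Ck_mult open\<Omega> w1 pw1 Q1 pQ1)
  have out: "open (- ?K)" by (rule open_Compl[OF closed_cball])
  have pQ0: "pd i Q y = 0" if "y \<notin> ?K" for i y
  proof -
    have "pd i Q y = pd i (%_. 0) y" by (rule pd_cong[OF out]) (use that Qs in auto)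
    then show ?thesis by (simp add: pd_const)
  qed
  have lQ0: "laplacian Q y = 0" if "y \<notin> ?K" for y
  proof -
    have "laplacian Q y = laplacian (%_. 0) y" by (rule laplacian_cong[OF out]) (use that Qs in auto)
    then show ?thesis by (simp add: laplacian_def pd_const)
  qed
  have lQ: "\<bar>laplacian Q y\<bar> <= 3 * (b / \<sigma>\<^sup>2)" for y
  proof -
    have "\<bar>laplacian Q y\<bar> <= (\<Sum>i\<in>UNIV. \<bar>pd i (pd i Q) y\<bar>)" unfolding laplacian_def by (rule sum_abs)
    also have "... <= (\<Sum>i\<in>(UNIV::3 set). b / \<sigma>\<^sup>2)" by (rule sum_mono) (rule Qb(3))
    finally show ?thesis by simp
  qed
  have dF: "(\<Sum>i\<in>UNIV. pd i (F i) y) = w y * laplacian Q y - Q y * laplacian w y" if y: "y \<in> \<Omega>" for y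
  proof -
    have "pd i (F i) y = w y * pd i (pd i Q) y - Q y * pd i (pd i w) y" for i
      unfolding F_def
      by (subst pd_diff) (auto intro!: differentiable_mult dQ dw[OF y] simp: pd_mult dQ dw[OF y])
    then show ?thesis by (simp add: laplacian_def sum_subtractf sum_distrib_left)
  qed
  have b1: "\<bar>w y * laplacian Q y\<bar> <= 3 * \<tau> * b" if "y \<in> \<Omega>" for y
  proof (cases "y \<in> ?K")
    case True
    have "\<bar>w y\<bar> * \<bar>laplacian Q y\<bar> <= (\<tau> * \<sigma>\<^sup>2) * (3 * (b / \<sigma>\<^sup>2))"
      by (intro mult_mono w0 lQ) (use that True \<tau> in auto)
    then show ?thesis using \<sigma> by (simp add: abs_mult)
  qed (use lQ0 \<tau> b in simp)
  have b2: "\<bar>Q y * laplacian w y\<bar> <= \<tau> * \<sigma> * b * indicator ?K y" if "y \<in> \<Omega>" for y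
  proof (cases "y \<in> ?K")
    case True
    have "\<bar>Q y\<bar> * \<bar>laplacian w y\<bar> <= b * (\<tau> * \<sigma>)"
      by (intro mult_mono Qb wl) (use that True b in auto)
    then show ?thesis using True by (simp add: abs_mult mult_ac)
  qed (use Qs in simp)
  have i1: "integrable lborel (zext \<Omega> (%y. w y * laplacian Q y))"
  proof (rule zext_integrable[OF open\<Omega> bd\<Omega> _ b1])
    have "continuous_on \<Omega> (laplacian Q)"
      using Ck_laplacian[of UNIV 0 Q] Q continuous_on_subset[of UNIV "laplacian Q" \<Omega>] by (simp add: numeral_2_eq_2)
    then show "continuous_on \<Omega> (%y. w y * laplacian Q y)"
      by (intro continuous_on_mult Ck_continuous_on[OF w1])
  qed
  have b2': "\<bar>Q y * laplacian w y\<bar> <= \<tau> * \<sigma> * b" if "y \<in> \<Omega>" for y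
    using b2[OF that] \<tau> \<sigma> b by (auto simp: indicator_def split: if_splits intro: order_trans)
  have i2: "integrable lborel (zext \<Omega> (%y. Q y * laplacian w y))"
  proof (rule zext_integrable[OF open\<Omega> bd\<Omega> _ b2'])
    have "continuous_on \<Omega> (laplacian w)"
      using Ck_laplacian[OF open\<Omega>, of 0 w] w2 by (simp add: numeral_2_eq_2)
    then show "continuous_on \<Omega> (%y. Q y * laplacian w y)"
      by (intro continuous_on_mult Ck_continuous_on[OF Q1])
  qed
  define B where "B = \<tau> * b * \<sigma>\<^sup>2 * (9 * A\<^sup>2 + 3 * A + 1)"
  have B0: "B >= 0" using \<tau> b A by (simp add: B_def)
  have gQ: "norm (grad Q y) <= 3 * (b / \<sigma>)" for y by (rule norm_grad_le) (rule Qb(2))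
  \<comment> \<open>Comparison with the foot point \<open>y'\<close> of \<open>y\<close> in the
    plane of symmetry, where the normal derivative of \<open>Q\<close> vanishes.\<close>
  have normal: "\<bar>grad Q y \<bullet> n\<bar> <= 9 * (b / \<sigma>\<^sup>2) * \<bar>n \<bullet> (y - x0)\<bar>" for y
  proof -
    define y' where "y' = y - (n \<bullet> (y - x0)) *\<^sub>R n"
    have "n \<bullet> n = 1" using n by (simp add: norm_eq_1)
    then have "n \<bullet> (y' - x0) = 0" by (simp add: y'_def inner_diff_right)
    then have z: "grad Q y' \<bullet> n = 0" by (rule reflection_symmetric_grad[OF dQ(1) n sym])
    have yy: "norm (y - y') = \<bar>n \<bullet> (y - x0)\<bar>" using n by (simp add: y'_def)
    have "\<bar>(pd i Q y - pd i Q y') * n $ i\<bar> <= 3 * (b / \<sigma>\<^sup>2) * \<bar>n \<bullet> (y - x0)\<bar> * 1" for i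
    proof -
      have "\<bar>pd i Q y - pd i Q y'\<bar> <= 3 * (b / \<sigma>\<^sup>2) * norm (y - y')"
        by (rule mvt_grad[where U=UNIV, OF subset_UNIV dQ(2) norm_grad_le[OF Qb(3)]])
      moreover have "\<bar>n $ i\<bar> <= 1" using component_le_norm_cart[of n i] n by simp
      ultimately show ?thesis unfolding abs_mult yy by (intro mult_mono) (use b in auto)
    qed
    then have "(\<Sum>i\<in>UNIV. \<bar>(pd i Q y - pd i Q y') * n $ i\<bar>) <= (\<Sum>i\<in>(UNIV::3 set). 3 * (b / \<sigma>\<^sup>2) * \<bar>n \<bullet> (y - x0)\<bar>)"
      by (intro sum_mono) simp
    moreover have "grad Q y \<bullet> n - grad Q y' \<bullet> n = (\<Sum>i\<in>UNIV. (pd i Q y - pd i Q y') * n $ i)"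
      by (simp add: inner_vec_def grad_def left_diff_distrib sum_subtractf)
    moreover have "(\<Sum>i\<in>(UNIV::3 set). 3 * (b / \<sigma>\<^sup>2) * \<bar>n \<bullet> (y - x0)\<bar>) = 9 * (b / \<sigma>\<^sup>2) * \<bar>n \<bullet> (y - x0)\<bar>" by simp
    ultimately show ?thesis using z sum_abs[of "%i. (pd i Q y - pd i Q y') * n $ i" UNIV] by linarith
  qed
  define fl where "fl y = (\<Sum>i\<in>UNIV. (wb y * pd i Q y - Q y * pb y $ i) * pd i \<rho> y)" for y
  have flF: "(\<Sum>i\<in>UNIV. F i y * pd i \<rho> y) = fl y" if "y \<in> \<Omega>" for y
    using wb(2)[OF that] pb(2)[OF that] by (simp add: F_def fl_def grad_def)
  have fl_alt: "fl y = wb y * (grad Q y \<bullet> grad \<rho> y) - Q y * (pb y \<bullet> grad \<rho> y)" for y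
    unfolding fl_def inner_vec_def
    by (simp add: grad_def sum_distrib_left sum_subtractf left_diff_distrib mult.assoc)
  have fl_front: "\<bar>fl y\<bar> <= B" if y: "y \<in> frontier \<Omega>" "y \<in> ?K" for y
  proof -
    \<comment> \<open>In the first summand the smallness \<open>A * \<sigma>\<close> of
      \<open>grad \<rho> y - r *\<^sub>R n\<close> compensates the \<open>1 / \<sigma>\<close> of
      the gradient; in the second the distance \<open>A * \<sigma>\<^sup>2\<close> from the plane
      compensates \<open>1 / \<sigma>\<^sup>2\<close>.\<close>
    have "grad Q y \<bullet> grad \<rho> y = grad Q y \<bullet> (grad \<rho> y - r *\<^sub>R n) + r * (grad Q y \<bullet> n)"
      by (simp add: inner_diff_right)
    moreover have "\<bar>grad Q y \<bullet> (grad \<rho> y - r *\<^sub>R n)\<bar> <= (3 * (b / \<sigma>)) * (A * \<sigma>)"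
      by (rule order_trans[OF Cauchy_Schwarz_ineq2 mult_mono[OF gQ gf[OF y]]]) (use b \<sigma> in auto)
    moreover have "\<bar>r * (grad Q y \<bullet> n)\<bar> <= A * (9 * (b / \<sigma>\<^sup>2) * (A * \<sigma>\<^sup>2))"
      unfolding abs_mult
      by (rule mult_mono[OF _ order_trans[OF normal mult_left_mono[OF nf[OF y]]]]) (use r b A in auto)
    ultimately have 1: "\<bar>grad Q y \<bullet> grad \<rho> y\<bar> <= b * (9 * A\<^sup>2 + 3 * A)"
      using \<sigma> by (simp add: power2_eq_square field_simps)
    have "\<bar>wb y * (grad Q y \<bullet> grad \<rho> y)\<bar> <= (\<tau> * \<sigma>\<^sup>2) * (b * (9 * A\<^sup>2 + 3 * A))"
      unfolding abs_mult by (rule mult_mono[OF wf[OF y] 1]) (use \<tau> in auto)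
    moreover have "\<bar>Q y * (pb y \<bullet> grad \<rho> y)\<bar> <= b * (\<tau> * \<sigma>\<^sup>2)"
      unfolding abs_mult by (rule mult_mono[OF Qb(1) pf[OF y]]) (use b in auto)
    moreover have "B = (\<tau> * \<sigma>\<^sup>2) * (b * (9 * A\<^sup>2 + 3 * A)) + b * (\<tau> * \<sigma>\<^sup>2)"
      by (simp add: B_def algebra_simps)
    ultimately show ?thesis unfolding fl_alt by linarith
  qed
  have Ksub: "closure \<Omega> \<inter> ?K \<subseteq> ball c R" using subK by blast
  have cfl: "continuous_on (closure \<Omega> \<inter> ?K) fl"
  proof -
    have "continuous_on (closure \<Omega> \<inter> ?K) (pd i \<rho>)" for i
      by (rule continuous_on_subset[OF _ Ksub]) (use \<rho>1 in simp)
    moreover have "continuous_on (closure \<Omega> \<inter> ?K) (pd i Q)" for i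
      by (rule Ck_continuous_on[OF pQ1])
    ultimately show ?thesis unfolding fl_def
      by (intro continuous_on_sum continuous_on_mult continuous_on_diff wb(1) Ck_continuous_on[OF Q1]
          continuous_on_component pb(1))
  qed
  \<comment> \<open>The points of the compact set where the flux is at least
    \<open>B + \<eta>\<close> lie inside \<open>\<Omega>\<close>, because on the frontier it is at
    most \<open>B\<close>. If there are any, \<open>\<rho>\<close> has a positive minimum on them,
    and this is the required \<delta>.\<close>
  have flux: "\<exists>\<delta>>0. \<forall>y\<in>\<Omega> \<inter> ?K. \<rho> y < \<delta> --> \<bar>\<Sum>i\<in>UNIV. F i y * pd i \<rho> y\<bar> <= B + \<eta>" if \<eta>: "\<eta> > 0" for \<eta>
  proof -
    have cK: "compact (closure \<Omega> \<inter> ?K)" by (intro closed_Int_compact closed_closure compact_cball)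
    define S where "S = (closure \<Omega> \<inter> ?K) \<inter> (%y. \<bar>fl y\<bar>) -` {B + \<eta>..}"
    have "closed S" unfolding S_def
      by (rule continuous_closed_preimage[OF continuous_on_rabs[OF cfl] compact_imp_closed[OF cK] closed_atLeast])
    then have cS: "compact S" using compact_Int_closed[OF cK] S_def by (metis inf.absorb_iff2 inf_le1)
    have S\<Omega>: "y \<in> \<Omega>" if "y \<in> S" for y
    proof (rule ccontr)
      assume "y \<notin> \<Omega>"
      then have "y \<in> frontier \<Omega>" using that open\<Omega> by (auto simp: S_def frontier_def interior_open)
      then show False using fl_front[of y] that \<eta> by (auto simp: S_def)
    qed
    have S\<rho>: "\<rho> y > 0" if "y \<in> S" for y
      using S\<Omega>[OF that] in\<Omega>[of y] that Ksub by (auto simp: S_def)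
    have c\<rho>: "continuous_on S \<rho>"
      by (rule continuous_on_subset[OF Ck_continuous_on[OF \<rho>1]]) (use Ksub in \<open>auto simp: S_def\<close>)
    have mem: "y \<in> S" if "y \<in> \<Omega>" "y \<in> ?K" "\<not> \<bar>fl y\<bar> <= B + \<eta>" for y
      using that closure_subset[of \<Omega>] by (auto simp: S_def)
    show ?thesis
    proof (cases "S = {}")
      case True
      then show ?thesis using mem flF by (intro exI[of _ 1]) fastforce
    next
      case False
      obtain y0 where y0: "y0 \<in> S" "!!y. y \<in> S ==> \<rho> y0 <= \<rho> y"
        using continuous_attains_inf[OF cS False c\<rho>] by blast
      show ?thesis
      proof (intro exI[of _ "\<rho> y0"] conjI ballI impI)
        show "\<rho> y0 > 0" by (rule S\<rho>[OF y0(1)])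
        fix y assume y: "y \<in> \<Omega> \<inter> ?K" "\<rho> y < \<rho> y0"
        then have "y \<notin> S" using y0(2)[of y] by auto
        then show "\<bar>\<Sum>i\<in>UNIV. F i y * pd i \<rho> y\<bar> <= B + \<eta>"
          using mem[of y] y flF[of y] by auto
      qed
    qed
  qed
  have main: "\<bar>LINT y|lborel. indicator \<Omega> y * (\<Sum>i\<in>UNIV. pd i (F i) y)\<bar> <= B * mass_const * (3 * \<sigma>)\<^sup>2"
  proof (rule divergence_bound[where D="3 * \<tau> * b + \<tau> * \<sigma> * b"])
    show "cball x0 (2 * (3 * \<sigma>)) \<subseteq> ball c R" using sub by simp
    show "F i y = 0" if "y \<notin> ?K" for i y using pQ0[OF that] Qs[OF that] by (simp add: F_def)
    show "\<bar>\<Sum>i\<in>UNIV. pd i (F i) y\<bar> <= 3 * \<tau> * b + \<tau> * \<sigma> * b" if "y \<in> \<Omega>" for y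
      unfolding dF[OF that] using b1[OF that] b2'[OF that] by linarith
    show "0 <= 3 * \<tau> * b + \<tau> * \<sigma> * b" using \<tau> \<sigma> b by simp
  qed (use \<sigma> F1 B0 flux in auto)
  have eq: "(LINT y|lborel. indicator \<Omega> y * (w y * laplacian Q y))
    = (LINT y|lborel. indicator \<Omega> y * (\<Sum>i\<in>UNIV. pd i (F i) y)) + (LINT y|lborel. zext \<Omega> (%y. Q y * laplacian w y) y)"
  proof -
    have "indicator \<Omega> y * (\<Sum>i\<in>UNIV. pd i (F i) y) = zext \<Omega> (%y. w y * laplacian Q y) y - zext \<Omega> (%y. Q y * laplacian w y) y" for y
      using dF[of y] by (simp add: zext_def)
    moreover have "indicator \<Omega> y * (w y * laplacian Q y) = zext \<Omega> (%y. w y * laplacian Q y) y" for y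
      by (simp add: zext_def)
    moreover have "(LINT y|lborel. zext \<Omega> (%y. w y * laplacian Q y) y - zext \<Omega> (%y. Q y * laplacian w y) y)
       = (LINT y|lborel. zext \<Omega> (%y. w y * laplacian Q y) y) - (LINT y|lborel. zext \<Omega> (%y. Q y * laplacian w y) y)"
      by (rule Bochner_Integration.integral_diff[OF i1 i2])
    ultimately show ?thesis by (simp only: diff_add_cancel)
  qed
  have "\<bar>LINT y|lborel. zext \<Omega> (%y. Q y * laplacian w y) y\<bar> <= (LINT y|lborel. \<tau> * \<sigma> * b * indicator ?K y)"
  proof (rule order_trans[OF integral_abs_bound integral_mono])
    show "integrable lborel (%y. \<bar>zext \<Omega> (%y. Q y * laplacian w y) y\<bar>)" using i2 by simp
    show "integrable lborel (%y. \<tau> * \<sigma> * b * indicator ?K y :: real)"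
      by (intro integrable_mult_right integrable_real_indicator)
        (use emeasure_bounded_finite[OF bounded_cball, of x0 "3 * \<sigma>"] in auto)
    show "\<bar>zext \<Omega> (%y. Q y * laplacian w y) y\<bar> <= \<tau> * \<sigma> * b * indicator ?K y" for y
      using b2[of y] \<tau> \<sigma> b by (simp add: zext_def)
  qed
  also have "... = \<tau> * \<sigma> * b * (unit_ball_vol 3 * (3 * \<sigma>) ^ 3)" using \<sigma> by (simp add: content_cball)
  finally have "\<bar>LINT y|lborel. indicator \<Omega> y * (w y * laplacian Q y)\<bar>
     <= B * mass_const * (3 * \<sigma>)\<^sup>2 + \<tau> * \<sigma> * b * (unit_ball_vol 3 * (3 * \<sigma>) ^ 3)"
    unfolding eq using main by linarith
  also have "... = (27 * unit_ball_vol 3 + 9 * mass_const * (9 * A\<^sup>2 + 3 * A + 1)) * (\<tau> * b * \<sigma> ^ 4)"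
    unfolding B_def by (simp add: power2_eq_square eval_nat_numeral algebra_simps)
  finally show ?thesis .
qed

end

lemma abs_reflect_axis: "norm n = 1 ==> \<bar>reflect n (axis a 1) $ i\<bar> <= 1"
  using component_le_norm_cart[of "reflect n (axis a 1)" i] norm_reflect[of n "axis a 1"] by simp

lemma pd_reflect_bound:
  fixes K :: "real^3 => real"
  assumes n: "norm n = 1" and K: "!!y. K differentiable at y" and B: "!!i y. \<bar>pd i K y\<bar> <= B"
  shows "\<bar>pd i (%y. K (reflect n y)) y\<bar> <= 3 * B"
proof -
  have "\<bar>reflect n (axis a 1) $ i * pd a K (reflect n y)\<bar> <= 1 * B" for a
    unfolding abs_mult by (rule mult_mono[OF abs_reflect_axis[OF n] B]) auto
  then have "(\<Sum>a\<in>UNIV. \<bar>reflect n (axis a 1) $ i * pd a K (reflect n y)\<bar>) <= (\<Sum>a\<in>(UNIV::3 set). B)"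
    by (intro sum_mono) simp
  then show ?thesis unfolding pd_reflect[OF K] by (intro order_trans[OF sum_abs]) simp
qed

lemma pd2_reflect_bound:
  fixes K :: "real^3 => real"
  assumes n: "norm n = 1" and K: "Ck 2 UNIV K" and B: "!!i j y. \<bar>pd i (pd j K) y\<bar> <= B"
  shows "\<bar>pd i (pd j (%y. K (reflect n y))) y\<bar> <= 9 * B"
proof -
  have d: "K differentiable at x" "pd a K differentiable at x" for a x
    using K by (auto simp: numeral_2_eq_2)
  have dr: "(%y. pd a K (reflect n y)) differentiable at x" for a x
    using reflect_comp_has_derivative[OF d(2)] differentiableI by blast
  have "pd j (%y. K (reflect n y)) = (%y. \<Sum>a\<in>UNIV. reflect n (axis a 1) $ j * pd a K (reflect n y))"
    by (rule ext) (rule pd_reflect[OF d(1)])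
  then have "pd i (pd j (%y. K (reflect n y))) y = (\<Sum>a\<in>UNIV. pd i (%y. reflect n (axis a 1) $ j * pd a K (reflect n y)) y)"
    by (simp add: pd_sum differentiable_mult dr)
  also have "... = (\<Sum>a\<in>UNIV. reflect n (axis a 1) $ j * pd i (%y. pd a K (reflect n y)) y)"
    by (simp only: pd_cmult[OF dr])
  also have "\<bar>...\<bar> <= (\<Sum>a\<in>UNIV. \<bar>reflect n (axis a 1) $ j * pd i (%y. pd a K (reflect n y)) y\<bar>)" by (rule sum_abs)
  also have "... <= (\<Sum>a\<in>(UNIV::3 set). 1 * (3 * B))"
    unfolding abs_mult
    by (intro sum_mono mult_mono abs_reflect_axis[OF n] pd_reflect_bound[OF n d(2) B]) auto
  finally show ?thesis by simp
qed

lemma laplacian_kernel_affine: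
  fixes K :: "real^3 => real"
  assumes K: "Ck 2 UNIV K"
  shows "laplacian (%y. K ((1 / s) *\<^sub>R (z - y))) y = (1 / s)\<^sup>2 * laplacian K ((1 / s) *\<^sub>R (z - y))"
    and "pd i (pd j (%y. K ((1 / s) *\<^sub>R (z - y)))) y = (1 / s)\<^sup>2 * pd i (pd j K) ((1 / s) *\<^sub>R (z - y))"
proof -
  have d: "K differentiable at x" "pd a K differentiable at x" for a x
    using K by (auto simp: numeral_2_eq_2)
  have *: "pd i (pd j (%y. K ((1 / s) *\<^sub>R (z - y)))) y = (1 / s)\<^sup>2 * pd i (pd j K) ((1 / s) *\<^sub>R (z - y))" for i j
  proof -
    have "pd j (%y. K ((1 / s) *\<^sub>R (z - y))) = (%y. - (1 / s) * pd j K ((1 / s) *\<^sub>R (z - y)))"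
      by (rule ext) (rule pd_kernel_affine(1)[OF d(1)])
    then have "pd i (pd j (%y. K ((1 / s) *\<^sub>R (z - y)))) y = - (1 / s) * pd i (%y. pd j K ((1 / s) *\<^sub>R (z - y))) y"
      using pd_cmult[OF pd_kernel_affine(2)[OF d(2)]] by presburger
    also have "... = - (1 / s) * (- (1 / s) * pd i (pd j K) ((1 / s) *\<^sub>R (z - y)))"
      by (simp only: pd_kernel_affine(1)[OF d(2)])
    finally show ?thesis by (simp add: power2_eq_square)
  qed
  show "pd i (pd j (%y. K ((1 / s) *\<^sub>R (z - y)))) y = (1 / s)\<^sup>2 * pd i (pd j K) ((1 / s) *\<^sub>R (z - y))" by (rule *)
  show "laplacian (%y. K ((1 / s) *\<^sub>R (z - y))) y = (1 / s)\<^sup>2 * laplacian K ((1 / s) *\<^sub>R (z - y))"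
    unfolding laplacian_def by (simp only: * sum_distrib_left)
qed

context defining_function
begin

text \<open>\<open>n\<close> is the inner normal at \<open>x0\<close>; \<open>wb\<close> and \<open>pb\<close> extend \<open>w\<close> and its gradient to the boundary.\<close>

definition remainder_bound where
  "remainder_bound A \<alpha> r0 x0 n r w wb pb \<longleftrightarrow>
     norm n = 1 \<and> 0 <= r \<and> r <= A \<and> cball x0 (6 * r0) \<subseteq> ball c R \<and> Ck 2 \<Omega> w \<and>
     continuous_on (closure \<Omega> \<inter> cball x0 (3 * r0)) wb \<and> continuous_on (closure \<Omega> \<inter> cball x0 (3 * r0)) pb \<and>
     (\<forall>y\<in>\<Omega>. \<bar>w y\<bar> <= A \<and> wb y = w y \<and> pb y = grad w y) \<and>
     (\<forall>y\<in>\<Omega> \<inter> cball x0 (3 * r0). \<bar>w y\<bar> <= A * norm (y - x0) powr (2 + \<alpha>) \<and>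
        \<bar>laplacian w y\<bar> <= A * norm (y - x0) powr (1 + \<alpha>)) \<and>
     (\<forall>y\<in>frontier \<Omega> \<inter> cball x0 (3 * r0). \<bar>wb y\<bar> <= A * norm (y - x0) powr (2 + \<alpha>) \<and>
        \<bar>pb y \<bullet> grad \<rho> y\<bar> <= A * norm (y - x0) powr (2 + \<alpha>) \<and>
        \<bar>n \<bullet> (y - x0)\<bar> <= A * (norm (y - x0))\<^sup>2 \<and> norm (grad \<rho> y - r *\<^sub>R n) <= A * norm (y - x0))"

text \<open>The constant of \<open>green_estimate\<close> with \<open>9 * A\<close> for
  \<open>A\<close>, from distances up to \<open>3 * \<sigma>\<close>; \<open>27 * A\<close> comes
  from \<open>\<tau>\<close> and \<open>10 * B\<close> from the kernel together with its
  reflection.\<close>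

definition green_const where
  "green_const A B = (27 * unit_ball_vol 3 + 9 * mass_const * (9 * (9 * A)\<^sup>2 + 3 * (9 * A) + 1)) * (27 * A) * (10 * B)"

lemma mass_const_pos: "mass_const > 0" using layer_mass by simp

lemma green_const_pos: "A > 0 ==> B > 0 ==> green_const A B > 0"
  unfolding green_const_def using mass_const_pos by (intro mult_pos_pos add_pos_pos) auto

text \<open>\<open>Q\<close> is the kernel about \<open>z\<close> plus the reflected kernel about
  the mirror image of \<open>z\<close> in the tangent plane at \<open>x0\<close>, so it is invariant
  under reflection in that plane. Since \<open>z\<close> is within \<open>2 * \<sigma>\<close> of
  \<open>x0\<close>, both kernels live in the ball of radius \<open>3 * \<sigma>\<close> about
  \<open>x0\<close>.\<close>

lemma reflected_green_estimate:
  assumes G4: "kern 2 G4" and B: "B > 0" "!!y. \<bar>G4 y\<bar> <= B" "!!i y. \<bar>pd i G4 y\<bar> <= B" "!!i j y. \<bar>pd i (pd j G4) y\<bar> <= B"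
    and A: "A > 0" and \<alpha>: "0 < \<alpha>" "\<alpha> < 1"
    and RB: "remainder_bound A \<alpha> r0 x0 n r w wb pb" and z: "dist z x0 <= 2 * \<sigma>" and \<sigma>: "0 < \<sigma>" "\<sigma> <= r0"
  shows "\<bar>conv (zext \<Omega> w) (laplacian G4) \<sigma> z
        + conv (zext \<Omega> w) (%y. laplacian G4 (reflect n y)) \<sigma> (x0 + reflect n (z - x0))\<bar> <= green_const A B * \<sigma> powr \<alpha> * \<sigma> ^ 6"
proof -
  define Cg where "Cg = 27 * unit_ball_vol 3 + 9 * mass_const * (9 * (9 * A)\<^sup>2 + 3 * (9 * A) + 1)"
  note rb = RB[unfolded remainder_bound_def]
  have n: "norm n = 1" and r: "0 <= r" "r <= A" and w2: "Ck 2 \<Omega> w" using rb by auto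
  let ?G = "%y. G4 (reflect n y)"
  let ?z = "x0 + reflect n (z - x0)"
  have GR: "kern 2 ?G" by (rule kern_reflect[OF G4 n])
  note C2 = kernD(1)[OF G4] and C2R = kernD(1)[OF GR]
  have dG: "G4 differentiable at y" "?G differentiable at y" for y
    using C2 C2R by (auto simp: numeral_2_eq_2)
  define Q1 where "Q1 y = G4 ((1 / \<sigma>) *\<^sub>R (z - y))" for y
  define Q2 where "Q2 y = ?G ((1 / \<sigma>) *\<^sub>R (?z - y))" for y
  define Q where "Q y = Q1 y + Q2 y" for y
  have Q1C: "Ck 2 UNIV Q1" unfolding Q1_def by (rule Ck_kernel_affine[OF C2])
  have Q2C: "Ck 2 UNIV Q2" unfolding Q2_def using Ck_kernel_affine[OF C2R] .
  have dQ: "Q1 differentiable at y" "Q2 differentiable at y" "pd i Q1 differentiable at y" "pd i Q2 differentiable at y" for i y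
    using Q1C Q2C by (auto simp: numeral_2_eq_2)
  have pdQ: "pd i Q = (%y. pd i Q1 y + pd i Q2 y)" for i
    unfolding Q_def[abs_def] by (rule ext) (rule pd_add[OF dQ(1,2)])
  have pd2Q: "pd i (pd j Q) y = pd i (pd j Q1) y + pd i (pd j Q2) y" for i j y
    unfolding pdQ[of j] by (rule pd_add[OF dQ(3,4)])
  have lapQ: "laplacian Q y = (1 / \<sigma>)\<^sup>2 * (laplacian G4 ((1 / \<sigma>) *\<^sub>R (z - y)) + laplacian G4 (reflect n ((1 / \<sigma>) *\<^sub>R (?z - y))))" for y
  proof -
    have "laplacian Q y = laplacian Q1 y + laplacian Q2 y"
      unfolding laplacian_def pd2Q by (rule sum.distrib)
    also have "laplacian Q1 y = (1 / \<sigma>)\<^sup>2 * laplacian G4 ((1 / \<sigma>) *\<^sub>R (z - y))"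
      unfolding Q1_def by (rule laplacian_kernel_affine(1)[OF C2])
    also have "laplacian Q2 y = (1 / \<sigma>)\<^sup>2 * laplacian ?G ((1 / \<sigma>) *\<^sub>R (?z - y))"
      unfolding Q2_def by (rule laplacian_kernel_affine(1)[OF C2R])
    also have "laplacian ?G ((1 / \<sigma>) *\<^sub>R (?z - y)) = laplacian G4 (reflect n ((1 / \<sigma>) *\<^sub>R (?z - y)))"
      by (rule laplacian_reflect[OF C2 n])
    finally show ?thesis by (simp only: distrib_left)
  qed
  have K0: "kern 0 (laplacian G4)" using kern_laplacian[of 0 G4] G4 by (simp add: numeral_2_eq_2)
  have K0R: "kern 0 (%y. laplacian G4 (reflect n y))" by (rule kern_reflect[OF K0 n])
  have vint: "integrable lborel (zext \<Omega> w)"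
    by (rule zext_integrable[OF open\<Omega> bd\<Omega> Ck_continuous_on[OF w2], of A]) (use rb in auto)
  have conv_eq: "conv (zext \<Omega> w) (laplacian G4) \<sigma> z + conv (zext \<Omega> w) (%y. laplacian G4 (reflect n y)) \<sigma> ?z
     = \<sigma>\<^sup>2 * (LINT y|lborel. indicator \<Omega> y * (w y * laplacian Q y))"
  proof -
    have "conv (zext \<Omega> w) (laplacian G4) \<sigma> z + conv (zext \<Omega> w) (%y. laplacian G4 (reflect n y)) \<sigma> ?z
      = (LINT y|lborel. zext \<Omega> w y * laplacian G4 ((1 / \<sigma>) *\<^sub>R (z - y)) + zext \<Omega> w y * laplacian G4 (reflect n ((1 / \<sigma>) *\<^sub>R (?z - y))))"
      unfolding conv_def
      by (rule Bochner_Integration.integral_add[symmetric, OF kern_conv_integrable[OF vint K0] kern_conv_integrable[OF vint K0R]])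
    also have "... = (LINT y|lborel. \<sigma>\<^sup>2 * (indicator \<Omega> y * (w y * laplacian Q y)))"
    proof (rule Bochner_Integration.integral_cong[OF HOL.refl])
      fix y
      have "laplacian G4 ((1 / \<sigma>) *\<^sub>R (z - y)) + laplacian G4 (reflect n ((1 / \<sigma>) *\<^sub>R (?z - y))) = \<sigma>\<^sup>2 * laplacian Q y"
        unfolding lapQ using \<sigma> by (simp only: mult.assoc[symmetric] power_mult_distrib[symmetric]) simp
      then show "zext \<Omega> w y * laplacian G4 ((1 / \<sigma>) *\<^sub>R (z - y)) + zext \<Omega> w y * laplacian G4 (reflect n ((1 / \<sigma>) *\<^sub>R (?z - y)))
        = \<sigma>\<^sup>2 * (indicator \<Omega> y * (w y * laplacian Q y))"
        unfolding distrib_left[symmetric] by (simp add: zext_def)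
    qed
    finally show ?thesis by simp
  qed
  \<comment> \<open>27 bounds \<open>3 powr (2 + \<alpha>)\<close>, as \<alpha> < 1.\<close>
  define \<tau> where "\<tau> = 27 * A * \<sigma> powr \<alpha>"
  have \<tau>: "\<tau> >= 0" using A by (simp add: \<tau>_def)
  have p2: "A * norm (y - x0) powr (2 + \<alpha>) <= \<tau> * \<sigma>\<^sup>2" and p1: "A * norm (y - x0) powr (1 + \<alpha>) <= \<tau> * \<sigma>"
    if "y \<in> cball x0 (3 * \<sigma>)" for y
  proof -
    have y: "norm (y - x0) <= 3 * \<sigma>" using that by (simp add: dist_norm norm_minus_commute)
    have three: "(3::real) powr \<alpha> <= 3" using powr_mono[of \<alpha> 1 "3::real"] \<alpha> by simp
    have 2: "norm (y - x0) powr (2 + \<alpha>) <= (3 * \<sigma>) powr (2 + \<alpha>)"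
      and 1: "norm (y - x0) powr (1 + \<alpha>) <= (3 * \<sigma>) powr (1 + \<alpha>)"
      using y \<alpha> by (auto intro!: powr_mono2)
    have e2: "(3 * \<sigma>) powr (2 + \<alpha>) = 3 powr \<alpha> * (9 * (\<sigma> powr \<alpha> * \<sigma>\<^sup>2))"
      using \<sigma> by (simp add: powr_add powr_mult power2_eq_square)
    have e1: "(3 * \<sigma>) powr (1 + \<alpha>) = 3 powr \<alpha> * (3 * (\<sigma> powr \<alpha> * \<sigma>))"
      using \<sigma> by (simp add: powr_add powr_mult)
    have "3 powr \<alpha> * (9 * (\<sigma> powr \<alpha> * \<sigma>\<^sup>2)) <= 3 * (9 * (\<sigma> powr \<alpha> * \<sigma>\<^sup>2))"
      by (rule mult_right_mono[OF three]) simp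
    from order_trans[OF 2[unfolded e2] this]
    have "norm (y - x0) powr (2 + \<alpha>) <= 27 * \<sigma> powr \<alpha> * \<sigma>\<^sup>2" by (simp add: mult.assoc)
    from mult_left_mono[OF this, of A] show "A * norm (y - x0) powr (2 + \<alpha>) <= \<tau> * \<sigma>\<^sup>2"
      using A by (simp add: \<tau>_def mult_ac)
    have "3 powr \<alpha> * (3 * (\<sigma> powr \<alpha> * \<sigma>)) <= 3 * (3 * (\<sigma> powr \<alpha> * \<sigma>))"
      by (rule mult_right_mono[OF three]) (use \<sigma> in simp)
    from order_trans[OF 1[unfolded e1] this]
    have "norm (y - x0) powr (1 + \<alpha>) <= 9 * (\<sigma> powr \<alpha> * \<sigma>)" by simp
    moreover have "9 * (\<sigma> powr \<alpha> * \<sigma>) <= 27 * \<sigma> powr \<alpha> * \<sigma>" using \<sigma> by simp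
    ultimately have "norm (y - x0) powr (1 + \<alpha>) <= 27 * \<sigma> powr \<alpha> * \<sigma>" by linarith
    from mult_left_mono[OF this, of A] show "A * norm (y - x0) powr (1 + \<alpha>) <= \<tau> * \<sigma>"
      using A by (simp add: \<tau>_def mult_ac)
  qed
  have sub3: "cball x0 (3 * \<sigma>) \<subseteq> cball x0 (3 * r0)" using \<sigma> by (intro subset_cball) simp
  have sub6: "cball x0 (6 * \<sigma>) \<subseteq> cball x0 (6 * r0)" using \<sigma> by (intro subset_cball) simp
  have ny: "norm (y - x0) <= 3 * \<sigma>" if "y \<in> cball x0 (3 * \<sigma>)" for y
    using that by (simp add: dist_norm norm_minus_commute)
  have Qout: "Q y = 0" if y: "y \<notin> cball x0 (3 * \<sigma>)" for y
  proof -
    have y3: "norm (y - x0) > 3 * \<sigma>" using y by (simp add: dist_norm norm_minus_commute)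
    have zn: "norm (z - x0) <= 2 * \<sigma>" using z by (simp add: dist_norm)
    then have zn': "norm (reflect n (z - x0)) <= 2 * \<sigma>" using norm_reflect[OF n] by simp
    have a: "norm (z - y) > \<sigma>"
      using norm_triangle_ineq2[of "y - x0" "z - x0"] y3 zn by (simp add: norm_minus_commute)
    have b: "norm (?z - y) > \<sigma>"
      using norm_triangle_ineq2[of "y - x0" "reflect n (z - x0)"] y3 zn' by (simp add: norm_minus_commute algebra_simps)
    have "Q1 y = 0" unfolding Q1_def
      by (rule kernD(2)[OF G4]) (use a norm_scaleR_inverse[OF \<sigma>(1), of "z - y"] in blast)
    moreover have "Q2 y = 0" unfolding Q2_def
      by (rule kernD(2)[OF GR]) (use b norm_scaleR_inverse[OF \<sigma>(1), of "?z - y"] in blast)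
    ultimately show ?thesis by (simp add: Q_def)
  qed
  have sym: "Q (x0 + reflect n (y - x0)) = Q y" for y
  proof -
    have a: "z - (x0 + reflect n (y - x0)) = reflect n (?z - y)"
      using reflect_reflect[OF n] by (simp add: reflect_simps algebra_simps)
    have b: "reflect n (?z - (x0 + reflect n (y - x0))) = z - y"
      using reflect_reflect[OF n] by (simp add: reflect_simps algebra_simps)
    show ?thesis unfolding Q_def Q1_def Q2_def a reflect_simps(2) b by simp
  qed
  have si: "\<bar>1 / \<sigma>\<bar> = 1 / \<sigma>" "(1 / \<sigma>)\<^sup>2 >= 0" using \<sigma> by auto
  have est: "\<bar>LINT y|lborel. indicator \<Omega> y * (w y * laplacian Q y)\<bar> <= Cg * (\<tau> * (10 * B) * \<sigma> ^ 4)"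
    unfolding Cg_def
  proof (rule green_estimate[OF \<sigma>(1) _ \<tau>, where A="9 * A" and n=n and r=r and wb=wb and pb=pb])
    show "cball x0 (6 * \<sigma>) \<subseteq> ball c R" using sub6 rb by blast
    show "\<bar>w y\<bar> <= \<tau> * \<sigma>\<^sup>2" if "y \<in> \<Omega>" "y \<in> cball x0 (3 * \<sigma>)" for y
      using rb that sub3 p2[OF that(2)] by (meson IntI order_trans subsetD)
    show "\<bar>laplacian w y\<bar> <= \<tau> * \<sigma>" if "y \<in> \<Omega>" "y \<in> cball x0 (3 * \<sigma>)" for y
      using rb that sub3 p1[OF that(2)] by (meson IntI order_trans subsetD)
    show "continuous_on (closure \<Omega> \<inter> cball x0 (3 * \<sigma>)) wb" "continuous_on (closure \<Omega> \<inter> cball x0 (3 * \<sigma>)) pb"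
      using rb sub3 by (auto elim!: continuous_on_subset)
    show "wb y = w y" "pb y = grad w y" if "y \<in> \<Omega>" for y using rb that by auto
    fix y assume y: "y \<in> frontier \<Omega>" "y \<in> cball x0 (3 * \<sigma>)"
    then have f: "\<bar>wb y\<bar> <= A * norm (y - x0) powr (2 + \<alpha>)" "\<bar>pb y \<bullet> grad \<rho> y\<bar> <= A * norm (y - x0) powr (2 + \<alpha>)"
      "\<bar>n \<bullet> (y - x0)\<bar> <= A * (norm (y - x0))\<^sup>2" "norm (grad \<rho> y - r *\<^sub>R n) <= A * norm (y - x0)"
      using rb sub3 by auto
    show "\<bar>wb y\<bar> <= \<tau> * \<sigma>\<^sup>2" "\<bar>pb y \<bullet> grad \<rho> y\<bar> <= \<tau> * \<sigma>\<^sup>2" using f(1,2) p2[OF y(2)] by linarith+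
    have "(norm (y - x0))\<^sup>2 <= (3 * \<sigma>)\<^sup>2" by (rule power_mono[OF ny[OF y(2)]]) simp
    then have "A * (norm (y - x0))\<^sup>2 <= A * (3 * \<sigma>)\<^sup>2" by (rule mult_left_mono) (use A in simp)
    also have "A * (3 * \<sigma>)\<^sup>2 = 9 * A * \<sigma>\<^sup>2" by (simp add: power2_eq_square)
    finally show "\<bar>n \<bullet> (y - x0)\<bar> <= 9 * A * \<sigma>\<^sup>2" using f(3) by linarith
    from mult_left_mono[OF ny[OF y(2)], of A] show "norm (grad \<rho> y - r *\<^sub>R n) <= 9 * A * \<sigma>"
      using f(4) A mult_pos_pos[OF A \<sigma>(1)] by linarith
  next
    show "Ck 2 UNIV Q" unfolding Q_def[abs_def] by (rule Ck_add[OF open_UNIV Q1C Q2C])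
    show "\<bar>Q y\<bar> <= 10 * B" for y
      unfolding Q_def Q1_def Q2_def
      using B(2)[of "(1 / \<sigma>) *\<^sub>R (z - y)"] B(2)[of "reflect n ((1 / \<sigma>) *\<^sub>R (?z - y))"] B(1) by linarith
    show "\<bar>pd i Q y\<bar> <= 10 * B / \<sigma>" for i y
    proof -
      have 1: "\<bar>pd i Q1 y\<bar> <= 1 / \<sigma> * B"
        unfolding Q1_def pd_kernel_affine(1)[OF dG(1)] abs_mult abs_minus_cancel si(1)
        by (rule mult_left_mono[OF B(3)]) (use \<sigma> in simp)
      have 2: "\<bar>pd i Q2 y\<bar> <= 1 / \<sigma> * (3 * B)"
        unfolding Q2_def pd_kernel_affine(1)[OF dG(2)] abs_mult abs_minus_cancel si(1)
        by (rule mult_left_mono[OF pd_reflect_bound[OF n dG(1) B(3)]]) (use \<sigma> in simp)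
      have "1 / \<sigma> * B + 1 / \<sigma> * (3 * B) <= 10 * B / \<sigma>" using \<sigma> B(1) by (simp add: field_simps)
      then show ?thesis unfolding pdQ using 1 2 by linarith
    qed
    \<comment> \<open>Two derivatives of the reflected kernel are sums over nine pairs of axes; with
      the kernel itself this makes the factor 10.\<close>
    show "\<bar>pd i (pd j Q) y\<bar> <= 10 * B / \<sigma>\<^sup>2" for i j y
    proof -
      have 1: "\<bar>pd i (pd j Q1) y\<bar> <= (1 / \<sigma>)\<^sup>2 * B"
        unfolding Q1_def laplacian_kernel_affine(2)[OF C2] abs_mult abs_of_nonneg[OF si(2)]
        by (rule mult_left_mono[OF B(4) si(2)])
      have 2: "\<bar>pd i (pd j Q2) y\<bar> <= (1 / \<sigma>)\<^sup>2 * (9 * B)"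
        unfolding Q2_def laplacian_kernel_affine(2)[OF C2R] abs_mult abs_of_nonneg[OF si(2)]
        by (rule mult_left_mono[OF pd2_reflect_bound[OF n C2 B(4)] si(2)])
      have "(1 / \<sigma>)\<^sup>2 * B + (1 / \<sigma>)\<^sup>2 * (9 * B) = 10 * B / \<sigma>\<^sup>2" using \<sigma> by (simp add: field_simps power2_eq_square)
      then show ?thesis unfolding pd2Q using 1 2 by linarith
    qed
  qed (use A B(1) w2 n r Qout sym in auto)
  have "\<bar>\<sigma>\<^sup>2 * (LINT y|lborel. indicator \<Omega> y * (w y * laplacian Q y))\<bar> <= \<sigma>\<^sup>2 * (Cg * (\<tau> * (10 * B) * \<sigma> ^ 4))"
    unfolding abs_mult using est by (simp add: mult_left_mono)
  also have "... = green_const A B * \<sigma> powr \<alpha> * \<sigma> ^ 6"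
    unfolding green_const_def Cg_def \<tau>_def by (simp add: eval_nat_numeral mult_ac)
  finally show "\<bar>conv (zext \<Omega> w) (laplacian G4) \<sigma> z + conv (zext \<Omega> w) (%y. laplacian G4 (reflect n y)) \<sigma> ?z\<bar>
    <= green_const A B * \<sigma> powr \<alpha> * \<sigma> ^ 6" unfolding conv_eq .
qed

end

section \<open>Fourth derivatives of the mollification as the scale shrinks\<close>

lemma integrate_powr_bound:
  fixes V V' :: "real => real"
  assumes \<alpha>: "\<alpha> < 1" and s: "0 < s" "s <= r0" and r0: "r0 <= 1" and K: "K >= 0" and Cr: "\<bar>V r0\<bar> <= Cr"
    and der: "!!\<sigma>. s <= \<sigma> ==> \<sigma> <= r0 ==> (V has_real_derivative V' \<sigma>) (at \<sigma>)"
    and bd: "!!\<sigma>. s <= \<sigma> ==> \<sigma> <= r0 ==> \<bar>V' \<sigma>\<bar> <= K * \<sigma> powr (\<alpha> - 2)"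
  shows "\<bar>V s\<bar> <= (Cr + K / (1 - \<alpha>)) * s powr (\<alpha> - 1)"
proof -
  \<comment> \<open>Up to sign a primitive of the bound on \<open>V'\<close>: \<open>V - P\<close>
    is nondecreasing and \<open>V + P\<close> nonincreasing. As \<alpha> < 1, the value of
    \<open>P\<close> at the small scale \<open>s\<close> dominates.\<close>
  define P where "P \<sigma> = K / (1 - \<alpha>) * \<sigma> powr (\<alpha> - 1)" for \<sigma>
  have dP: "(P has_real_derivative - (K * \<sigma> powr (\<alpha> - 2))) (at \<sigma>)" if "\<sigma> > 0" for \<sigma>
  proof -
    have "((%\<sigma>. \<sigma> powr (\<alpha> - 1)) has_real_derivative (\<alpha> - 1) * \<sigma> powr (\<alpha> - 1 - 1)) (at \<sigma>)"
      by (rule has_real_derivative_powr[OF that])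
    from DERIV_cmult[OF this, of "K / (1 - \<alpha>)"]
    have "(P has_real_derivative K / (1 - \<alpha>) * ((\<alpha> - 1) * \<sigma> powr (\<alpha> - 1 - 1))) (at \<sigma>)"
      unfolding P_def .
    moreover have "K / (1 - \<alpha>) * ((\<alpha> - 1) * \<sigma> powr (\<alpha> - 1 - 1)) = - (K * \<sigma> powr (\<alpha> - 2))"
      using \<alpha> by (simp add: field_simps)
    ultimately show ?thesis by simp
  qed
  have P0: "0 <= P \<sigma>" for \<sigma> using \<alpha> K by (simp add: P_def)
  have "V s - P s <= V r0 - P r0"
  proof (rule DERIV_nonneg_imp_nondecreasing[OF s(2)])
    fix \<sigma> assume \<sigma>: "s <= \<sigma>" "\<sigma> <= r0"
    then have "((%\<sigma>. V \<sigma> - P \<sigma>) has_real_derivative V' \<sigma> - - (K * \<sigma> powr (\<alpha> - 2))) (at \<sigma>)"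
      using s by (intro DERIV_diff der dP) auto
    then show "\<exists>y. ((%\<sigma>. V \<sigma> - P \<sigma>) has_real_derivative y) (at \<sigma>) \<and> 0 <= y"
      using bd[OF \<sigma>] by (intro exI[of _ "V' \<sigma> - - (K * \<sigma> powr (\<alpha> - 2))"]) auto
  qed
  moreover have "V r0 + P r0 <= V s + P s"
  proof (rule DERIV_nonpos_imp_nonincreasing[OF s(2)])
    fix \<sigma> assume \<sigma>: "s <= \<sigma>" "\<sigma> <= r0"
    then have "((%\<sigma>. V \<sigma> + P \<sigma>) has_real_derivative V' \<sigma> + - (K * \<sigma> powr (\<alpha> - 2))) (at \<sigma>)"
      using s by (intro DERIV_add der dP) auto
    then show "\<exists>y. ((%\<sigma>. V \<sigma> + P \<sigma>) has_real_derivative y) (at \<sigma>) \<and> y <= 0"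
      using bd[OF \<sigma>] by (intro exI[of _ "V' \<sigma> + - (K * \<sigma> powr (\<alpha> - 2))"]) auto
  qed
  moreover have "Cr * 1 <= Cr * s powr (\<alpha> - 1)"
  proof (rule mult_left_mono)
    have "s powr 0 <= s powr (\<alpha> - 1)" by (rule powr_mono') (use \<alpha> s r0 in auto)
    then show "1 <= s powr (\<alpha> - 1)" using s by simp
  qed (use Cr in simp)
  ultimately show ?thesis using P0[of r0] P0[of s] Cr unfolding distrib_right P_def[symmetric] by linarith
qed

text \<open>In the interior the rate is of order \<open>1 / s\<close>. For \<open>s <= 1\<close> and
  \<alpha> < 1 this is below the rate \<open>s powr (\<alpha> - 2)\<close> that holds near the
  boundary, so one differential inequality serves at all scales.\<close>

lemma mol4_rate:
  assumes l: "length is = 4" and \<alpha>: "\<alpha> < 1" and a: "integrable lborel v" "open U" "Ck 2 U v" "Ck 2 U g"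
    "!!y. y \<in> U ==> laplacian v y = g y" "!!i j y. y \<in> U ==> \<bar>pd i (pd j g) y\<bar> <= M"
    and s: "s > 0" "s <= 1" "cball x s \<subseteq> U" and M: "M >= 0"
  shows "\<bar>conv v (laplacian (pds is potential)) s x / s ^ 8\<bar> <= kern_const * unit_ball_vol 3 * M * s powr (\<alpha> - 2)"
proof -
  obtain a b i j where isl: "is = [a, b] @ [i, j]"
    using l by (auto simp: numeral_eq_Suc length_Suc_conv)
  have "\<bar>conv v (laplacian (pds is potential)) s x / s ^ (6 + 2)\<bar> <= kern_const * unit_ball_vol 3 * M * s ^ 3 / s ^ (2 + 2)"
    unfolding isl by (rule DERIV_mol_bound[OF _ _ a s(1,3)]) auto
  also have "... = kern_const * unit_ball_vol 3 * M * (1 / s)" using s(1) by (simp add: eval_nat_numeral)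
  also have "... <= kern_const * unit_ball_vol 3 * M * s powr (\<alpha> - 2)"
  proof (rule mult_left_mono)
    have "1 / s = s powr (- 1)" using s(1) by (simp add: powr_minus inverse_eq_divide)
    also have "... <= s powr (\<alpha> - 2)" by (rule powr_mono') (use \<alpha> s in auto)
    finally show "1 / s <= s powr (\<alpha> - 2)" .
  qed (use kern_const(1) M in simp)
  finally show ?thesis by simp
qed

context defining_function
begin

text \<open>The first summand bounds the value at scale \<open>r0\<close>, twice because of the
  reflected kernel and with \<open>7 = 3 + 4\<close>; the second comes from integrating the rate of
  change.\<close>

definition mol4_const where
  "mol4_const A \<alpha> r0 = 2 * (A * kern_const * unit_ball_vol 3 * r0 ^ 3) / r0 ^ 7
     + (green_const A kern_const + kern_const * unit_ball_vol 3 * A) / (1 - \<alpha>)"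

lemma mol4_const_nonneg: "A > 0 ==> \<alpha> < 1 ==> r0 > 0 ==> mol4_const A \<alpha> r0 >= 0"
  using green_const_pos[OF _ kern_const(1), of A] kern_const(1) by (auto simp: mol4_const_def intro!: add_nonneg_nonneg divide_nonneg_pos)

text \<open>To the mollified derivative at \<open>z\<close> is added the one with the reflected
  kernel at the mirror image of \<open>z\<close>. Up to scale \<open>d / 2\<close> the added term
  vanishes, since the ball about the mirror image misses \<open>\<Omega>\<close>, and the interior
  rate applies; beyond it \<open>z\<close> is within \<open>2 * \<sigma>\<close> of
  \<open>x0\<close> and \<open>reflected_green_estimate\<close> takes over. At the scale
  \<open>s\<close> itself only the wanted term is left.\<close>

lemma mol4_estimate:
  assumes A: "A > 0" and \<alpha>: "0 < \<alpha>" "\<alpha> < 1" and r0: "0 < r0" "r0 <= 1" and l: "length is = 4"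
    and RB: "remainder_bound A \<alpha> r0 x0 n r w wb pb" and gw: "Ck 2 \<Omega> gw"
      "\<forall>y\<in>\<Omega>. laplacian w y = gw y" "\<forall>i j. \<forall>y\<in>\<Omega>. \<bar>pd i (pd j gw) y\<bar> <= A"
    and d: "dist z x0 = d" "ball z d \<subseteq> \<Omega>" and extr: "!!y. y \<in> cball (x0 + reflect n (z - x0)) (d / 2) ==> y \<notin> \<Omega>"
    and s: "0 < s" "s <= d / 2" "s <= r0"
  shows "\<bar>mol is (zext \<Omega> w) s z\<bar> <= mol4_const A \<alpha> r0 * s powr (\<alpha> - 1)"
proof -
  let ?G = "pds is potential" and ?\<kappa> = "pds is mollifier"
  have kG: "kern 2 ?G" by (rule kern_pds) (use l kern_mono[OF kern_potential] in auto)
  have k\<kappa>: "kern 2 ?\<kappa>" by (rule kern_pds) (use l kern_mono[OF kern_mollifier] in auto)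
  have k\<kappa>1: "kern 1 ?\<kappa>" by (rule kern_mono[OF k\<kappa>]) simp
  have GB: "\<bar>?G y\<bar> <= kern_const" "\<bar>pd i ?G y\<bar> <= kern_const" "\<bar>pd i (pd j ?G) y\<bar> <= kern_const" for i j y
    using kern_const(2)[of "is" y] kern_const(2)[of "is @ [i]" y] kern_const(2)[of "is @ [j] @ [i]" y] l
    by (auto simp: pds_append)
  have MB: "\<bar>pds is mollifier y\<bar> <= kern_const" for y using kern_const(3) l by simp
  have eu: "euler (real 7) ?\<kappa> = (%z. - laplacian ?G z)"
    using euler_pds_mollifier[of "is"] l by simp
  define C0 where "C0 = kern_const * unit_ball_vol 3"
  define C1 where "C1 = green_const A kern_const"
  define K where "K = C1 + C0 * A"
  define Cr where "Cr = 2 * (A * kern_const * unit_ball_vol 3 * r0 ^ 3) / r0 ^ 7"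
  have C0: "C0 > 0" and C1: "C1 > 0" using kern_const(1) green_const_pos[OF A kern_const(1)] by (auto simp: C0_def C1_def)
  have K: "K > 0" using C1 C0 A by (simp add: K_def add_pos_pos)
  note rb = RB[unfolded remainder_bound_def]
  have n: "norm n = 1" and w2: "Ck 2 \<Omega> w" and wA: "!!y. y \<in> \<Omega> ==> \<bar>w y\<bar> <= A" using rb by auto
  let ?v = "zext \<Omega> w" and ?z = "x0 + reflect n (z - x0)"
  let ?\<kappa>R = "%y. ?\<kappa> (reflect n y)" and ?LR = "%y. laplacian ?G (reflect n y)"
  have vint: "integrable lborel ?v"
    by (rule zext_integrable[OF open\<Omega> bd\<Omega> Ck_continuous_on[OF w2] wA])
  have k\<kappa>R: "kern 1 ?\<kappa>R" by (rule kern_reflect[OF k\<kappa>1 n])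
  have d\<kappa>: "?\<kappa> differentiable at y" for y using kernD(1)[OF k\<kappa>1] by simp
  have euR: "euler (real 7) ?\<kappa>R = (%y. - ?LR y)"
    by (rule ext) (simp only: euler_reflect[OF d\<kappa>] eu)
  define V where "V \<sigma> = conv ?v ?\<kappa> \<sigma> z / \<sigma> ^ 7 + conv ?v ?\<kappa>R \<sigma> ?z / \<sigma> ^ 7" for \<sigma>
  define V' where "V' \<sigma> = conv ?v (laplacian ?G) \<sigma> z / \<sigma> ^ 8 + conv ?v ?LR \<sigma> ?z / \<sigma> ^ 8" for \<sigma>
  have der: "(V has_real_derivative V' \<sigma>) (at \<sigma>)" if "\<sigma> > 0" for \<sigma>
  proof -
    have "((%\<sigma>. conv ?v ?\<kappa> \<sigma> z / \<sigma> ^ 7) has_real_derivative conv ?v (laplacian ?G) \<sigma> z / \<sigma> ^ Suc 7) (at \<sigma>)"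
      by (rule DERIV_conv_scaled[OF vint k\<kappa>1 that eu])
    moreover have "((%\<sigma>. conv ?v ?\<kappa>R \<sigma> ?z / \<sigma> ^ 7) has_real_derivative conv ?v ?LR \<sigma> ?z / \<sigma> ^ Suc 7) (at \<sigma>)"
      by (rule DERIV_conv_scaled[OF vint k\<kappa>R that euR])
    ultimately have "((%\<sigma>. conv ?v ?\<kappa> \<sigma> z / \<sigma> ^ 7 + conv ?v ?\<kappa>R \<sigma> ?z / \<sigma> ^ 7) has_real_derivative
        conv ?v (laplacian ?G) \<sigma> z / \<sigma> ^ Suc 7 + conv ?v ?LR \<sigma> ?z / \<sigma> ^ Suc 7) (at \<sigma>)"
      by (rule DERIV_add)
    moreover have "Suc 7 = 8" by simp
    ultimately show ?thesis unfolding V_def[abs_def] V'_def by (simp only:)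
  qed
  have refl0: "conv ?v L \<sigma> ?z = 0" if "\<sigma> > 0" "\<sigma> <= d / 2" "kern k L" for \<sigma> L k
  proof -
    have "conv ?v L \<sigma> ?z = conv (%_. 0) L \<sigma> ?z"
      by (rule conv_cong[OF that(3,1)]) (use that(2) extr in \<open>auto simp: zext_def\<close>)
    then show ?thesis by (simp add: conv_def)
  qed
  have K0: "kern 0 (laplacian ?G)" using kern_laplacian[of 0 ?G] kG by (simp add: numeral_2_eq_2)
  have K0R: "kern 0 ?LR" by (rule kern_reflect[OF K0 n])
  have bd: "\<bar>V' \<sigma>\<bar> <= K * \<sigma> powr (\<alpha> - 2)" if \<sigma>: "s <= \<sigma>" "\<sigma> <= r0" for \<sigma>
  proof -
    have \<sigma>0: "\<sigma> > 0" using \<sigma> s by simp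
    have pw: "\<sigma> powr (\<alpha> - 2) = \<sigma> powr \<alpha> / \<sigma>\<^sup>2" using \<sigma>0 by (simp add: powr_diff)
    show ?thesis
    proof (cases "\<sigma> <= d / 2")
      case True
      have sub: "cball z \<sigma> \<subseteq> \<Omega>" using True \<sigma>0 d(2) by (intro order_trans[OF _ d(2)]) auto
      have v2: "Ck 2 \<Omega> ?v" by (rule Ck_cong_imp[OF open\<Omega> _ w2]) (simp add: zext_def)
      have lv: "laplacian ?v y = gw y" if "y \<in> \<Omega>" for y
        using laplacian_cong[OF open\<Omega> that, of ?v w] gw(2) that by (simp add: zext_def)
      have "\<bar>V' \<sigma>\<bar> = \<bar>conv ?v (laplacian ?G) \<sigma> z / \<sigma> ^ 8\<bar>" unfolding V'_def refl0[OF \<sigma>0 True K0R] by simp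
      also have "... <= C0 * A * \<sigma> powr (\<alpha> - 2)"
        unfolding C0_def by (rule mol4_rate[OF l \<alpha>(2) vint open\<Omega> v2 gw(1) lv _ \<sigma>0 _ sub]) (use gw(3) \<sigma> r0 A in auto)
      also have "... <= K * \<sigma> powr (\<alpha> - 2)" unfolding K_def using C1 by (intro mult_right_mono) auto
      finally show ?thesis .
    next
      case False
      then have dz: "dist z x0 <= 2 * \<sigma>" using d(1) by simp
      have "\<bar>V' \<sigma>\<bar> = \<bar>conv ?v (laplacian ?G) \<sigma> z + conv ?v ?LR \<sigma> ?z\<bar> / \<sigma> ^ 8"
        unfolding V'_def using \<sigma>0 by (simp add: add_divide_distrib[symmetric] abs_divide)
      also have "... <= C1 * \<sigma> powr \<alpha> * \<sigma> ^ 6 / \<sigma> ^ 8"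
        unfolding C1_def by (rule divide_right_mono[OF reflected_green_estimate[OF kG kern_const(1) GB A \<alpha> RB dz \<sigma>0 \<sigma>(2)]]) (use \<sigma>0 in simp)
      also have "... = C1 * \<sigma> powr (\<alpha> - 2)" unfolding pw using \<sigma>0 by (simp add: eval_nat_numeral)
      also have "... <= K * \<sigma> powr (\<alpha> - 2)" unfolding K_def using C0 A by (intro mult_right_mono) auto
      finally show ?thesis .
    qed
  qed
  have Vs: "V s = mol is ?v s z"
    unfolding V_def mol_def using refl0[OF s(1,2) k\<kappa>R] l by simp
  have Vr: "\<bar>V r0\<bar> <= Cr"
  proof -
    have vA: "\<bar>?v y\<bar> <= A" for y using wA[of y] A by (simp add: zext_def)
    have 1: "\<bar>conv ?v ?\<kappa> r0 z\<bar> <= A * kern_const * unit_ball_vol 3 * r0 ^ 3"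
      by (rule conv_bound[OF k\<kappa> r0(1) MB vA])
    have 2: "\<bar>conv ?v ?\<kappa>R r0 ?z\<bar> <= A * kern_const * unit_ball_vol 3 * r0 ^ 3"
      by (rule conv_bound[OF k\<kappa>R r0(1) MB vA])
    have "\<bar>V r0\<bar> = \<bar>conv ?v ?\<kappa> r0 z + conv ?v ?\<kappa>R r0 ?z\<bar> / r0 ^ 7"
      unfolding V_def using r0 by (simp add: add_divide_distrib[symmetric] abs_divide)
    also have "... <= 2 * (A * kern_const * unit_ball_vol 3 * r0 ^ 3) / r0 ^ 7"
      by (rule divide_right_mono) (use 1 2 r0 in linarith, use r0 in simp)
    finally show ?thesis by (simp add: Cr_def)
  qed
  have "\<bar>V s\<bar> <= (Cr + K / (1 - \<alpha>)) * s powr (\<alpha> - 1)"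
    by (rule integrate_powr_bound[OF \<alpha>(2) s(1,3) r0(2) _ Vr der bd]) (use K s in auto)
  then show ?thesis unfolding Vs Cr_def K_def C1_def C0_def mol4_const_def .
qed

end

section \<open>Polynomials described by their derivatives\<close>

primrec Pol :: "nat => (real^3 => real) => bool" where
  "Pol 0 p \<longleftrightarrow> (\<exists>c. p = (%_. c))"
| "Pol (Suc k) p \<longleftrightarrow> (\<forall>x. p differentiable at x) \<and> (\<forall>i. Pol k (pd i p))"

lemma Pol_const: "Pol k (%_. c)"
  by (induction k arbitrary: c) (auto simp: pd_const)

lemma Pol_Suc: "Pol k p ==> Pol (Suc k) p"
  by (induction k arbitrary: p) (auto simp: pd_const)

lemma Pol_mono: "Pol j p ==> j <= k ==> Pol k p"
  by (induction k) (auto simp: le_Suc_eq dest: Pol_Suc simp del: Pol.simps)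

lemma Pol_add: "Pol k p ==> Pol k q ==> Pol k (%x. p x + q x)"
proof (induction k arbitrary: p q)
  case (Suc k)
  then have "pd i (%x. p x + q x) = (%x. pd i p x + pd i q x)" for i by (intro HOL.ext pd_add) auto
  then show ?case using Suc by (auto intro: differentiable_add)
qed auto

lemma Pol_cmult: "Pol k p ==> Pol k (%x. c * p x)"
proof (induction k arbitrary: p)
  case (Suc k)
  then have "pd i (%x. c * p x) = (%x. c * pd i p x)" for i by (intro HOL.ext pd_cmult) auto
  then show ?case using Suc by (auto intro: differentiable_mult)
qed auto

lemma Pol_Ck: "Pol k p ==> Ck m UNIV p"
proof (induction k arbitrary: p m)
  case 0 then show ?case by (auto intro: Ck_const)
next
  case (Suc k)
  then show ?case by (cases m) (auto intro!: continuous_at_imp_continuous_on differentiable_imp_continuous_within)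
qed

lemma Pol_pds_0: "Pol k p ==> k < length is ==> pds is p = (%_. 0)"
proof (induction "is" arbitrary: k p)
  case (Cons i "is")
  show ?case
  proof (cases k)
    case 0
    then have "Pol 0 (pd i p)" and "pd i p = (%_. 0)" using Cons.prems by (auto simp: pd_const)
    moreover have "pds is (%_. 0::real) = (%_. 0)" for "is" by (induction "is") (auto simp: pd_const)
    ultimately show ?thesis by simp
  next
    case (Suc k')
    have "pds is (pd i p) = (%_. 0)"
      by (rule Cons.IH[of k']) (use Suc Cons.prems in auto)
    then show ?thesis by simp
  qed
qed simp

text \<open>Homogeneous polynomials of degree \<open>k\<close> in \<open>y - x0\<close>; \<open>C\<close> bounds all the derivatives as well.\<close>

primrec form :: "nat => real => real^3 => (real^3 => real) => bool" where
  "form 0 C x0 f \<longleftrightarrow> (\<exists>c. f = (%_. c) \<and> \<bar>c\<bar> <= C)"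
| "form (Suc k) C x0 f \<longleftrightarrow> (\<forall>x. f differentiable at x) \<and> (\<forall>x. \<bar>f x\<bar> <= C * norm (x - x0) ^ Suc k) \<and>
     (\<forall>i. form k C x0 (pd i f))"

lemma form_bound: "form k C x0 f ==> \<bar>f x\<bar> <= C * norm (x - x0) ^ k"
  by (cases k) auto

lemma form_Pol: "form k C x0 f ==> Pol k f"
  by (induction k arbitrary: f) auto

lemma form_differentiable: "form k C x0 f ==> f differentiable at x"
  by (cases k) auto

lemma form_mono: "form k C x0 f ==> C <= D ==> form k D x0 f"
proof (induction k arbitrary: f)
  case (Suc k)
  have "\<bar>f x\<bar> <= D * norm (x - x0) ^ Suc k" for x
    using Suc.prems mult_right_mono[OF Suc.prems(2), of "norm (x - x0) ^ Suc k"] order_trans by fastforce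
  then show ?case using Suc by auto
qed auto

lemma form_add: "form k C x0 f ==> form k D x0 g ==> form k (C + D) x0 (%x. f x + g x)"
proof (induction k arbitrary: f g)
  case 0
  then obtain c d where "f = (%_. c)" "\<bar>c\<bar> <= C" "g = (%_. d)" "\<bar>d\<bar> <= D" by auto
  then show ?case by (auto intro!: exI[of _ "c + d"])
next
  case (Suc k)
  then have "pd i (%x. f x + g x) = (%x. pd i f x + pd i g x)" for i by (intro HOL.ext pd_add) auto
  moreover have "\<bar>f x + g x\<bar> <= (C + D) * norm (x - x0) ^ Suc k" for x
    using form_bound[OF Suc.prems(1), of x] form_bound[OF Suc.prems(2), of x] unfolding distrib_right by linarith
  ultimately show ?case using Suc by (auto intro: differentiable_add)
qed

lemma form_nonneg: "form k C x0 f ==> 0 <= C"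
proof (induction k arbitrary: f)
  case 0 then show ?case by auto
next
  case (Suc k) then show ?case by auto
qed

lemma form_cmult: "form k C x0 f ==> \<bar>c\<bar> <= D ==> form k (D * C) x0 (%x. c * f x)"
proof (induction k arbitrary: f)
  case 0
  then obtain d where d: "f = (%_. d)" "\<bar>d\<bar> <= C" by auto
  have "\<bar>c * d\<bar> <= D * C" unfolding abs_mult using d 0 by (intro mult_mono) auto
  then show ?case using d by auto
next
  case (Suc k)
  then have "pd i (%x. c * f x) = (%x. c * pd i f x)" for i by (intro HOL.ext pd_cmult) auto
  moreover have "\<bar>c * f x\<bar> <= D * C * norm (x - x0) ^ Suc k" for x
    unfolding abs_mult mult.assoc using form_bound[OF Suc.prems(1), of x] Suc.prems(2) by (intro mult_mono) auto
  ultimately show ?case using Suc by (auto intro: differentiable_mult)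
qed

text \<open>Each partial derivative of the product is a sum of two products of lower total degree,
  so the constant doubles with every degree. The induction is on \<open>a + b\<close>; a factor of
  degree 0 is constant and its derivative drops out.\<close>

lemma form_mult: "form a A x0 f ==> form b B x0 g ==> form (a + b) (2 ^ (a + b) * (A * B)) x0 (%x. f x * g x)"
proof (induction "a + b" arbitrary: a b f g)
  case 0
  then obtain c d where cd: "f = (%_. c)" "\<bar>c\<bar> <= A" "g = (%_. d)" "\<bar>d\<bar> <= B" by auto
  have "\<bar>c * d\<bar> <= A * B" unfolding abs_mult using cd by (intro mult_mono) auto
  then show ?case using 0 cd by auto
next
  case (Suc n)
  have A: "0 <= A" and B: "0 <= B" using form_nonneg Suc.prems by blast+
  have d: "f differentiable at x" "g differentiable at x" for x
    using form_differentiable Suc.prems by blast+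
  have pd: "pd i (%x. f x * g x) = (%x. f x * pd i g x + pd i f x * g x)" for i
    by (rule HOL.ext) (rule pd_mult[OF d])
  have zero: "form n (2 ^ n * (A * B)) x0 (%_. 0)"
  proof -
    have "form m D x0 (%_. 0)" if "0 <= D" for m D using that by (induction m) (auto simp: pd_const)
    then show ?thesis using A B by simp
  qed
  have 1: "form n (2 ^ n * (A * B)) x0 (%x. f x * pd i g x)" for i
  proof (cases b)
    case 0
    then have "pd i g = (%_. 0)" using Suc.prems(2) by (auto simp: pd_const)
    then show ?thesis using zero by simp
  next
    case (Suc b')
    then show ?thesis using Suc.hyps(1)[of a b' f "pd i g"] Suc.hyps(2) Suc.prems by simp
  qed
  have 2: "form n (2 ^ n * (A * B)) x0 (%x. pd i f x * g x)" for i
  proof (cases a)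
    case 0
    then have "pd i f = (%_. 0)" using Suc.prems(1) by (auto simp: pd_const)
    then show ?thesis using zero by simp
  next
    case (Suc a')
    then show ?thesis using Suc.hyps(1)[of a' b "pd i f" g] Suc.hyps(2) Suc.prems by simp
  qed
  have "form n (2 ^ Suc n * (A * B)) x0 (pd i (%x. f x * g x))" for i
    unfolding pd by (rule form_mono[OF form_add[OF 1 2]]) simp
  moreover have "\<bar>f x * g x\<bar> <= 2 ^ Suc n * (A * B) * norm (x - x0) ^ Suc n" for x
  proof -
    have "\<bar>f x * g x\<bar> <= (A * norm (x - x0) ^ a) * (B * norm (x - x0) ^ b)"
      unfolding abs_mult
      by (intro mult_mono form_bound[OF Suc.prems(1)] form_bound[OF Suc.prems(2)]) (use A in auto)
    also have "... = 1 * ((A * B) * norm (x - x0) ^ Suc n)" unfolding Suc.hyps(2) by (simp add: power_add mult_ac)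
    also have "... <= 2 ^ Suc n * ((A * B) * norm (x - x0) ^ Suc n)"
      by (intro mult_right_mono one_le_power) (use A B in auto)
    finally show ?thesis by (simp add: mult.assoc)
  qed
  moreover have "(%x. f x * g x) differentiable at x" for x by (intro differentiable_mult d)
  ultimately have "form (Suc n) (2 ^ Suc n * (A * B)) x0 (%x. f x * g x)" by simp
  then show ?case using Suc.hyps(2) by simp
qed

lemma inner_shift_has_derivative: "((%y. a \<bullet> (y - x0)) has_derivative (%h. a \<bullet> h)) (at x)"
  by (auto intro!: derivative_eq_intros)

lemma pd_inner_shift: "pd i (%y. a \<bullet> (y - x0)) = (%_. a $ i)"
  by (rule HOL.ext) (rule pd_inner[OF inner_shift_has_derivative])

lemma form_inner: "norm a <= C ==> form 1 C x0 (%y. a \<bullet> (y - x0))"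
proof -
  assume a: "norm a <= C"
  have "\<bar>a \<bullet> (y - x0)\<bar> <= C * norm (y - x0)" for y
    using Cauchy_Schwarz_ineq2[of a "y - x0"] mult_right_mono[OF a norm_ge_zero, of "y - x0"] by linarith
  moreover have "\<bar>a $ i\<bar> <= C" for i using component_le_norm_cart[of a i] a by linarith
  moreover have "(%y. a \<bullet> (y - x0)) differentiable at x" for x
    using inner_shift_has_derivative[of a x0 x] unfolding differentiable_def by blast
  moreover have "form 0 C x0 (%_. a $ i)" if "\<bar>a $ i\<bar> <= C" for i using that by auto
  ultimately show ?thesis by (simp add: pd_inner_shift del: form.simps(1))
qed

lemma form_coord: "form 1 1 x0 (%y. (y - x0) $ i)"
proof -
  have "(%y. axis i 1 \<bullet> (y - x0)) = (%y. (y - x0) $ i)" by (simp add: inner_axis' fun_eq_iff)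
  then show ?thesis using form_inner[of "axis i 1" 1 x0] by simp
qed

lemma pd_coord_shift: "pd j (%y. (y - x0) $ i) = (%_. if i = j then 1 else 0)"
proof -
  have "(%y. axis i 1 \<bullet> (y - x0)) = (%y. (y - x0) $ i)" by (simp add: inner_axis' fun_eq_iff)
  then show ?thesis using pd_inner_shift[of j "axis i 1" x0] by (auto simp: axis_def)
qed

lemma form_sum:
  assumes "finite S" "!!j. j \<in> S ==> form k C x0 (f j)" "0 <= C"
  shows "form k (real (card S) * C) x0 (%x. \<Sum>j\<in>S. f j x)"
  using assms(1,2)
proof (induction S rule: finite_induct)
  case empty
  have "form m 0 x0 (%_. 0)" for m by (induction m) (auto simp: pd_const)
  then show ?case by simp
next
  case (insert a F)
  then show ?case using form_add[of k C x0 "f a" "real (card F) * C" "%x. \<Sum>j\<in>F. f j x"]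
    by (simp add: distrib_right)
qed

lemma conv_add_fun:
  assumes "integrable lborel v" "Ck 0 UNIV p" "kern k K" "s > 0"
  shows "conv (%y. v y + p y) K s x = conv v K s x + conv p K s x"
  unfolding conv_def distrib_right
  using kern_conv_integrable[OF assms(1,3)] continuous_times_kernel_integrable[OF open_UNIV _ assms(3,4), of p x] assms(2)
  by simp

text \<open>Moved onto the cubic polynomial, the four derivatives annihilate it. Only the ball
  \<open>cball z s\<close> inside \<open>U\<close> matters, so the polynomial can be added back
  without being cut off at the boundary.\<close>

lemma mol_subtract_Pol:
  assumes U: "open U" "bounded U" and u: "continuous_on U u" "!!y. y \<in> U ==> \<bar>u y\<bar> <= M"
    and P: "Pol 3 P" and l: "length is = 4" and s: "s > 0" "cball z s \<subseteq> U"
    and w: "!!y. y \<in> U ==> \<bar>u y - P y\<bar> <= A"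
  shows "mol is (zext U u) s z = mol is (zext U (%y. u y - P y)) s z"
proof -
  have k: "kern 4 mollifier" by (rule kern_mono[OF kern_mollifier]) simp
  have k0: "kern 0 (pds is mollifier)" by (rule kern_pds) (use l k in simp)
  have i: "integrable lborel (zext U (%y. u y - P y))"
    by (rule zext_integrable[OF U _ w])
      (intro continuous_on_diff u Ck_continuous_on[OF Ck_subset[OF Pol_Ck[OF P, of 0]]] subset_UNIV)
  have "conv (zext U u) (pds is mollifier) s z = conv (%y. zext U (%y. u y - P y) y + P y) (pds is mollifier) s z"
    by (rule conv_cong[OF k0 s(1)]) (use s(2) in \<open>auto simp: zext_def\<close>)
  also have "... = conv (zext U (%y. u y - P y)) (pds is mollifier) s z + conv P (pds is mollifier) s z"
    by (rule conv_add_fun[OF i Pol_Ck[OF P] k0 s(1)])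
  also have "conv P (pds is mollifier) s z = s ^ length is * conv (pds (rev is) P) mollifier s z"
    by (rule conv_pds_ibp[OF open_UNIV s(1) subset_UNIV Pol_Ck[OF P]]) (use k l in simp)
  also have "pds (rev is) P = (%_. 0)" by (rule Pol_pds_0[OF P]) (use l in simp)
  finally show ?thesis unfolding mol_def by (simp add: conv_def)
qed

context interior
begin

text \<open>The two points are at most the scale \<delta> apart. Passing to the mollification costs
  \<open>scale_const * \<delta>\<close> at each end, and the mollified derivative varies by its
  gradient, of order \<open>\<delta> powr (\<alpha> - 1)\<close>, times a length of at most
  \<delta>.\<close>

lemma third_derivative_hoelder_step:
  assumes \<alpha>: "0 < \<alpha>" "\<alpha> < 1"
    and a: "norm (x - y) <= \<delta>" "0 < \<delta>" "\<delta> <= 1" "cball x \<delta> \<subseteq> U" "cball y \<delta> \<subseteq> U" "B >= 0"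
    and b: "!!l z. z \<in> closed_segment x y ==> \<bar>mol [j, i, k, l] v \<delta> z\<bar> <= B * \<delta> powr (\<alpha> - 1)"
  shows "\<bar>pds [i, j, k] u x - pds [i, j, k] u y\<bar> <= (2 * scale_const + 3 * B) * \<delta> powr \<alpha>"
proof -
  have 1: "\<bar>pds [i, j, k] u x - mol [j, i, k] v \<delta> x\<bar> <= scale_const * \<delta>" by (rule interior_C3(2)[OF a(2,4)])
  have 2: "\<bar>pds [i, j, k] u y - mol [j, i, k] v \<delta> y\<bar> <= scale_const * \<delta>" by (rule interior_C3(2)[OF a(2,5)])
  have 3: "\<bar>mol [j, i, k] v \<delta> x - mol [j, i, k] v \<delta> y\<bar> <= 3 * (B * \<delta> powr (\<alpha> - 1)) * norm (x - y)"
  proof (rule mvt_grad[where U=UNIV])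
    show "mol [j, i, k] v \<delta> differentiable at z" for z by (rule pd_mol(2)[OF v_int]) simp
    fix z assume z: "z \<in> closed_segment x y"
    show "norm (grad (mol [j, i, k] v \<delta>) z) <= 3 * (B * \<delta> powr (\<alpha> - 1))"
      by (rule norm_grad_le) (use b[OF z] pd_mol(1)[OF v_int, of "[j, i, k]"] in simp)
  qed simp
  have "3 * (B * \<delta> powr (\<alpha> - 1)) * norm (x - y) <= 3 * (B * \<delta> powr (\<alpha> - 1)) * \<delta>"
    by (rule mult_left_mono[OF a(1)]) (use a(6) in simp)
  also have "... = 3 * B * \<delta> powr \<alpha>" using a(2) by (simp add: powr_diff)
  finally have 4: "3 * (B * \<delta> powr (\<alpha> - 1)) * norm (x - y) <= 3 * B * \<delta> powr \<alpha>" .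
  have "\<delta> powr 1 <= \<delta> powr \<alpha>" by (rule powr_mono') (use \<alpha> a in auto)
  then have "scale_const * \<delta> <= scale_const * \<delta> powr \<alpha>" using a(2) scale_const by simp
  then have "\<bar>pds [i, j, k] u x - pds [i, j, k] u y\<bar> <= 2 * (scale_const * \<delta> powr \<alpha>) + 3 * B * \<delta> powr \<alpha>"
    using 1 2 3 4 by linarith
  then show "\<bar>pds [i, j, k] u x - pds [i, j, k] u y\<bar> <= (2 * scale_const + 3 * B) * \<delta> powr \<alpha>"
    by (simp add: distrib_right mult.assoc)
qed

end

section \<open>The cubic corrector\<close>

definition quad :: "(3 => 3 => real) => real^3 => real^3 => real" where
  "quad S x0 y = (\<Sum>j\<in>UNIV. \<Sum>k\<in>UNIV. S j k * ((y - x0) $ j * (y - x0) $ k))"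

lemma pd_quad: "pd i (quad S x0) = (%y. (\<chi> k. S i k + S k i) \<bullet> (y - x0))"
proof
  fix y
  have dc: "(%y. (y - x0) $ j) differentiable at y" for j using form_differentiable[OF form_coord] by blast
  have dcc: "(%y. (y - x0) $ j * (y - x0) $ k) differentiable at y" for j k by (intro differentiable_mult dc)
  have dS: "(%y. S j k * ((y - x0) $ j * (y - x0) $ k)) differentiable at y" for j k
    by (intro differentiable_mult differentiable_const dc)
  have 1: "pd i (%y. S j k * ((y - x0) $ j * (y - x0) $ k)) y
      = S j k * ((y - x0) $ j * (if k = i then 1 else 0) + (if j = i then 1 else 0) * (y - x0) $ k)" for j k
    by (simp only: pd_cmult[OF dcc] pd_mult[OF dc dc] pd_coord_shift)
  have 2: "pd i (%y. \<Sum>k\<in>UNIV. S j k * ((y - x0) $ j * (y - x0) $ k)) y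
      = (\<Sum>k\<in>UNIV. S j k * ((y - x0) $ j * (if k = i then 1 else 0) + (if j = i then 1 else 0) * (y - x0) $ k))" for j
    by (subst pd_sum) (simp_all only: finite dS 1)
  have "pd i (quad S x0) y = (\<Sum>j\<in>UNIV. \<Sum>k\<in>UNIV. S j k * ((y - x0) $ j * (if k = i then 1 else 0) + (if j = i then 1 else 0) * (y - x0) $ k))"
    unfolding quad_def[abs_def] by (subst pd_sum) (simp_all only: finite 2, intro differentiable_sum dS ballI finite)
  also have "... = (\<chi> k. S i k + S k i) \<bullet> (y - x0)"
    using exhaust_3[of i] unfolding inner_vec_def sum_3 by (elim disjE) (simp_all add: algebra_simps)
  finally show "pd i (quad S x0) y = (\<chi> k. S i k + S k i) \<bullet> (y - x0)" .
qed

lemma form_quad: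
  assumes S: "!!j k. \<bar>S j k\<bar> <= B" and B: "B >= 0"
  shows "form 2 (36 * B) x0 (quad S x0)"
proof -
  have "form (1 + 1) (2 ^ (1 + 1) * (1 * 1)) x0 (%y. (y - x0) $ j * (y - x0) $ k)" for j k
    by (rule form_mult[OF form_coord form_coord])
  then have "form 2 4 x0 (%y. (y - x0) $ j * (y - x0) $ k)" for j k by (simp add: numeral_2_eq_2)
  then have "form 2 (B * 4) x0 (%y. S j k * ((y - x0) $ j * (y - x0) $ k))" for j k
    by (rule form_cmult) (use S in auto)
  then have "form 2 (real (card (UNIV :: 3 set)) * (B * 4)) x0 (%y. \<Sum>k\<in>UNIV. S j k * ((y - x0) $ j * (y - x0) $ k))" for j
    by (rule form_sum[OF finite]) (use B in simp)
  then have "form 2 (real (card (UNIV :: 3 set)) * (real (card (UNIV :: 3 set)) * (B * 4))) x0 (quad S x0)"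
    unfolding quad_def[abs_def] by (rule form_sum[OF finite]) (use B in simp)
  then show ?thesis by (simp add: mult.commute)
qed

text \<open>The ansatz is \<open>P = - \<kappa> * l * q + l\<^sup>2 * s / 2 + b * l ^ 3\<close> with
  \<open>l = n \<bullet> (y - x0)\<close>, \<open>q = quad S x0\<close> and a linear form
  \<open>s\<close>. On the plane \<open>l = 0\<close> the first term has normal derivative
  \<open>- \<kappa> * q\<close> and the other two have none, so the boundary condition is met there
  exactly; \<open>s\<close> and \<open>b\<close> are free to adjust the Laplacian. The constant must
  not depend on the boundary point, hence the quantification over all data bounded by
  \<open>B\<close>.\<close>

lemma cubic_corrector:
  assumes B: "B > 0"
  shows "\<exists>C>0. \<forall>n \<kappa> S \<gamma> x0. norm n = 1 --> 0 < \<kappa> --> \<kappa> <= B --> 1 / \<kappa> <= B --> (\<forall>j k. \<bar>S j k\<bar> <= B) --> norm \<gamma> <= B -->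
    (\<exists>P. form 3 C x0 P \<and> (\<forall>y. laplacian P y = \<gamma> \<bullet> (y - x0)) \<and>
       (\<forall>y. \<bar>(\<Sum>i\<in>UNIV. (n $ i / \<kappa>) * pd i P y) + quad S x0 y\<bar>
          <= C * \<bar>n \<bullet> (y - x0)\<bar> * norm (y - x0)))"
proof -
  define Ba where "Ba = B + 2 * B * (18 * B)"
  define Bb where "Bb = (6 * B * B + 2 * Ba)"
  define Bq where "Bq = 36 * B"
  define C where "C = B * (2 ^ 3 * (1 * Bq)) + 1 / 2 * (2 ^ 3 * (2 ^ 2 * (1 * 1) * Ba)) + Bb * (2 ^ 3 * (2 ^ 2 * (1 * 1) * 1))
     + 3 * Bq + B * (Ba + 1 / 2 * Ba + 3 * Bb)"
  have pos: "Ba > 0" "Bb > 0" "Bq > 0" using B by (auto simp: Ba_def Bb_def Bq_def intro!: add_pos_pos mult_pos_pos)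
  have C1: "B * (2 ^ 3 * (1 * Bq)) + 1 / 2 * (2 ^ 3 * (2 ^ 2 * (1 * 1) * Ba)) + Bb * (2 ^ 3 * (2 ^ 2 * (1 * 1) * 1)) <= C"
    using pos B unfolding C_def by (auto intro!: add_nonneg_nonneg mult_nonneg_nonneg)
  have C2: "3 * Bq + B * (Ba + 1 / 2 * Ba + 3 * Bb) <= C"
    using pos B unfolding C_def by (auto intro!: add_nonneg_nonneg mult_nonneg_nonneg)
  have "0 < 3 * Bq + B * (Ba + 1 / 2 * Ba + 3 * Bb)"
    using pos B by (intro add_pos_pos mult_pos_pos) auto
  then have C0: "C > 0" using C2 by linarith
  show ?thesis
  proof (intro exI[of _ C] conjI allI impI)
    show "C > 0" by (rule C0)
    fix n \<gamma> x0 :: "real^3" and \<kappa> :: real and S :: "3 => 3 => real"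
    assume n: "norm n = 1" and \<kappa>: "0 < \<kappa>" "\<kappa> <= B" "1 / \<kappa> <= B" and S: "\<forall>j k. \<bar>S j k\<bar> <= B" and \<gamma>: "norm \<gamma> <= B"
    define W where "W i = (\<chi> k. S i k + S k i)" for i
    define trS where "trS = (\<Sum>i\<in>UNIV. S i i)"
    \<comment> \<open>The multiple of \<open>2 * \<kappa>\<close> cancels the mixed term of the
      gradients of \<open>ll\<close> and \<open>q\<close> in the Laplacian of
      \<open>- \<kappa> * P1 y\<close>; \<open>b\<close> then removes the remaining multiples of
      \<open>ll\<close>.\<close>
    define a where "a = \<gamma> + (2 * \<kappa>) *\<^sub>R (\<Sum>i\<in>UNIV. (n $ i) *\<^sub>R W i)"
    define b where "b = (2 * \<kappa> * trS - 2 * (n \<bullet> a)) / 6"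
    define ll where "ll y = n \<bullet> (y - x0)" for y
    define q where "q y = quad S x0 y" for y
    define s where "s y = a \<bullet> (y - x0)" for y
    have nn: "(\<Sum>i\<in>UNIV. n $ i * n $ i) = 1" using n by (simp add: norm_eq_1 inner_vec_def)
    have n1: "\<bar>n $ i\<bar> <= 1" for i using component_le_norm_cart[of n i] n by simp
    have W6: "norm (W i) <= 6 * B" for i
    proof -
      have "norm (W i) <= (\<Sum>k\<in>UNIV. \<bar>W i $ k\<bar>)" by (rule norm_le_l1_cart)
      also have "... <= (\<Sum>k\<in>(UNIV::3 set). 2 * B)"
      proof (rule sum_mono)
        fix k
        show "\<bar>W i $ k\<bar> <= 2 * B" using S[rule_format, of i k] S[rule_format, of k i] by (simp add: W_def)
      qed
      finally show ?thesis by simp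
    qed
    have aB: "norm a <= Ba"
    proof -
      have "norm (\<Sum>i\<in>UNIV. (n $ i) *\<^sub>R W i) <= (\<Sum>i\<in>(UNIV::3 set). 1 * (6 * B))"
        by (rule order_trans[OF norm_sum sum_mono]) (unfold norm_scaleR, intro mult_mono n1 W6, auto)
      then have "norm (\<Sum>i\<in>UNIV. (n $ i) *\<^sub>R W i) <= 18 * B" by simp
      then have "2 * \<kappa> * norm (\<Sum>i\<in>UNIV. (n $ i) *\<^sub>R W i) <= 2 * B * (18 * B)"
        using \<kappa> by (intro mult_mono) auto
      then show ?thesis
        using norm_triangle_ineq[of \<gamma> "(2 * \<kappa>) *\<^sub>R (\<Sum>i\<in>UNIV. (n $ i) *\<^sub>R W i)"] \<gamma> \<kappa>(1)
        unfolding a_def Ba_def by (simp add: abs_mult)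
    qed
    have na: "\<bar>n \<bullet> a\<bar> <= Ba" using Cauchy_Schwarz_ineq2[of n a] n aB by simp
    have bB: "\<bar>b\<bar> <= Bb"
    proof -
      have "\<bar>trS\<bar> <= (\<Sum>i\<in>(UNIV::3 set). B)" unfolding trS_def
        by (rule order_trans[OF sum_abs sum_mono]) (use S in auto)
      then have "\<bar>trS\<bar> <= 3 * B" by simp
      then have "\<bar>\<kappa> * trS\<bar> <= B * (3 * B)" unfolding abs_mult using \<kappa> by (intro mult_mono) auto
      then show ?thesis using na unfolding b_def Bb_def by simp
    qed
    have fll: "form 1 1 x0 ll" unfolding ll_def[abs_def] by (rule form_inner) (simp add: n)
    have fs: "form 1 Ba x0 s" unfolding s_def[abs_def] by (rule form_inner[OF aB])
    have fq: "form 2 Bq x0 q" unfolding q_def[abs_def] Bq_def by (rule form_quad) (use S B in auto)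
    have fllll: "form 2 (2 ^ 2 * (1 * 1)) x0 (%y. ll y * ll y)"
      using form_mult[OF fll fll] by (simp add: numeral_2_eq_2)
    define P1 where "P1 y = ll y * q y" for y
    define P2 where "P2 y = (ll y * ll y) * s y" for y
    define P3 where "P3 y = (ll y * ll y) * ll y" for y
    have e3: "1 + 2 = (3::nat)" "2 + 1 = (3::nat)" by auto
    have fP1: "form 3 (2 ^ 3 * (1 * Bq)) x0 P1"
      using form_mult[OF fll fq] unfolding P1_def[abs_def] e3 .
    have fP2: "form 3 (2 ^ 3 * (2 ^ 2 * (1 * 1) * Ba)) x0 P2"
      using form_mult[OF fllll fs] unfolding P2_def[abs_def] e3 .
    have fP3: "form 3 (2 ^ 3 * (2 ^ 2 * (1 * 1) * 1)) x0 P3"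
      using form_mult[OF fllll fll] unfolding P3_def[abs_def] e3 .
    define P where "P y = - \<kappa> * P1 y + 1 / 2 * P2 y + b * P3 y" for y
    have fP: "form 3 (B * (2 ^ 3 * (1 * Bq)) + 1 / 2 * (2 ^ 3 * (2 ^ 2 * (1 * 1) * Ba)) + Bb * (2 ^ 3 * (2 ^ 2 * (1 * 1) * 1))) x0 P"
      unfolding P_def[abs_def]
      by (intro form_add form_cmult fP1 fP2 fP3) (use \<kappa> bB in auto)
    have dll: "ll differentiable at y" and ds: "s differentiable at y" and dq: "q differentiable at y" for y
      using form_differentiable fll fs fq by blast+
    have pll: "pd i ll y = n $ i" and ps: "pd i s y = a $ i" for i y
      unfolding ll_def[abs_def] s_def[abs_def] pd_inner_shift by simp_all
    have pq: "pd i q = (%y. W i \<bullet> (y - x0))" for i unfolding q_def[abs_def] W_def by (rule pd_quad)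
    have dpq: "pd i q differentiable at y" for i y
      unfolding pq using inner_shift_has_derivative[of "W i" x0 y] unfolding differentiable_def by blast
    have ppq: "pd i (pd i q) y = W i $ i" for i y unfolding pq pd_inner_shift by simp
    have trW: "(\<Sum>i\<in>UNIV. W i $ i) = 2 * trS" by (simp add: W_def trS_def sum_distrib_left)
    have pP1: "pd i P1 = (%y. ll y * pd i q y + n $ i * q y)" for i
      unfolding P1_def[abs_def] by (rule HOL.ext) (simp only: pd_mult[OF dll dq] pll)
    have pllll: "pd i (%y. ll y * ll y) y = 2 * n $ i * ll y" for i y
      by (simp add: pd_mult[OF dll dll] pll)
    have dllll: "(%y. ll y * ll y) differentiable at y" for y by (intro differentiable_mult dll)
    have pP2: "pd i P2 = (%y. a $ i * (ll y * ll y) + (2 * n $ i) * (ll y * s y))" for i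
      unfolding P2_def[abs_def] by (rule HOL.ext) (simp add: pd_mult[OF dllll ds] pllll ps)
    have pP3: "pd i P3 = (%y. (3 * n $ i) * (ll y * ll y))" for i
      unfolding P3_def[abs_def] by (rule HOL.ext) (simp add: pd_mult[OF dllll dll] pllll pll)
    have ppP1: "pd i (pd i P1) y = ll y * W i $ i + 2 * n $ i * pd i q y" for i y
    proof -
      have "pd i (pd i P1) y = pd i (%y. ll y * pd i q y) y + pd i (%y. n $ i * q y) y"
        unfolding pP1 by (rule pd_add) (intro differentiable_mult differentiable_const dll dpq dq)+
      then show ?thesis by (simp add: pd_mult[OF dll dpq] pd_cmult[OF dq] pll ppq)
    qed
    have dlls: "(%y. ll y * s y) differentiable at y" for y by (intro differentiable_mult dll ds)
    have ppP2: "pd i (pd i P2) y = 4 * (n $ i * a $ i) * ll y + 2 * (n $ i * n $ i) * s y" for i y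
    proof -
      have "pd i (pd i P2) y = pd i (%y. a $ i * (ll y * ll y)) y + pd i (%y. (2 * n $ i) * (ll y * s y)) y"
        unfolding pP2 by (rule pd_add) (intro differentiable_mult differentiable_const dll ds)+
      then show ?thesis unfolding pd_cmult[OF dllll] pd_cmult[OF dlls] pllll pd_mult[OF dll ds] pll ps
        by (simp add: algebra_simps)
    qed
    have ppP3: "pd i (pd i P3) y = 6 * (n $ i * n $ i) * ll y" for i y
      unfolding pP3 by (simp add: pd_cmult[OF dllll] pllll)
    note dP = form_differentiable[OF fP1] form_differentiable[OF fP2] form_differentiable[OF fP3]
    have lin: "pd i (%y. - \<kappa> * f1 y + 1 / 2 * f2 y + b * f3 y) y = - \<kappa> * pd i f1 y + 1 / 2 * pd i f2 y + b * pd i f3 y"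
      if "f1 differentiable at y" "f2 differentiable at y" "f3 differentiable at y" for i y and f1 f2 f3 :: "real^3 => real"
    proof -
      have "pd i (%y. - \<kappa> * f1 y + 1 / 2 * f2 y + b * f3 y) y
          = pd i (%y. - \<kappa> * f1 y + 1 / 2 * f2 y) y + pd i (%y. b * f3 y) y"
        by (rule pd_add) (intro differentiable_add differentiable_mult differentiable_const that)+
      also have "pd i (%y. - \<kappa> * f1 y + 1 / 2 * f2 y) y = pd i (%y. - \<kappa> * f1 y) y + pd i (%y. 1 / 2 * f2 y) y"
        by (rule pd_add) (intro differentiable_mult differentiable_const that)+
      finally show ?thesis by (simp only: pd_cmult[OF that(1)] pd_cmult[OF that(2)] pd_cmult[OF that(3)])
    qed
    have pP: "pd i P = (%y. - \<kappa> * pd i P1 y + 1 / 2 * pd i P2 y + b * pd i P3 y)" for i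
      unfolding P_def[abs_def] by (rule HOL.ext) (rule lin[OF dP])
    have dpP: "pd i P1 differentiable at y" "pd i P2 differentiable at y" "pd i P3 differentiable at y" for i y
      using fP1 fP2 fP3 form_differentiable by (auto simp: numeral_3_eq_3)
    have ppP: "pd i (pd i P) y = - \<kappa> * pd i (pd i P1) y + 1 / 2 * pd i (pd i P2) y + b * pd i (pd i P3) y" for i y
      unfolding pP by (rule lin[OF dpP])
    define nq where "nq y = (\<Sum>i\<in>UNIV. n $ i * pd i q y)" for y
    have nq: "nq y = (\<Sum>i\<in>UNIV. (n $ i) *\<^sub>R W i) \<bullet> (y - x0)" for y
      unfolding nq_def pq by (simp add: inner_sum_left)
    have lap: "laplacian P y = \<gamma> \<bullet> (y - x0)" for y
    proof -
      have "laplacian P y = - \<kappa> * (ll y * (\<Sum>i\<in>UNIV. W i $ i) + 2 * nq y) + 1 / 2 * (4 * (\<Sum>i\<in>UNIV. n $ i * a $ i) * ll y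
          + 2 * (\<Sum>i\<in>UNIV. n $ i * n $ i) * s y) + b * (6 * (\<Sum>i\<in>UNIV. n $ i * n $ i) * ll y)"
        unfolding laplacian_def ppP ppP1 ppP2 ppP3 nq_def
        by (simp add: sum_3 algebra_simps)
      also have "... = - \<kappa> * (ll y * (2 * trS) + 2 * nq y) + 2 * (n \<bullet> a) * ll y + s y + 6 * b * ll y"
        unfolding trW nn by (simp add: inner_vec_def)
      also have "s y = \<gamma> \<bullet> (y - x0) + 2 * \<kappa> * nq y"
        unfolding s_def a_def nq by (simp add: inner_add_left)
      also have "6 * b = 2 * \<kappa> * trS - 2 * (n \<bullet> a)" by (simp add: b_def)
      finally show ?thesis by (simp add: algebra_simps)
    qed
    \<comment> \<open>The factor \<open>ll y\<close> appears because the condition holds on the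
      plane; its cofactor is a linear form in \<open>y - x0\<close> and gives the second factor
      \<open>norm (y - x0)\<close>.\<close>
    have dn: "(\<Sum>i\<in>UNIV. (n $ i / \<kappa>) * pd i P y) + q y
        = ll y * (- nq y + 1 / \<kappa> * (1 / 2 * (n \<bullet> a) * ll y + s y + 3 * b * ll y))" for y
    proof -
      have "(\<Sum>i\<in>UNIV. (n $ i / \<kappa>) * pd i P y)
        = (\<Sum>i\<in>UNIV. - (ll y * (n $ i * pd i q y)) - q y * (n $ i * n $ i)
            + 1 / \<kappa> * (1 / 2 * (n $ i * a $ i) * (ll y * ll y) + (n $ i * n $ i) * (ll y * s y) + 3 * b * (n $ i * n $ i) * (ll y * ll y)))"
        unfolding pP pP1 pP2 pP3 using \<kappa>(1) by (intro sum.cong HOL.refl) (simp add: field_simps)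
      also have "... = - (ll y * nq y) - q y * (\<Sum>i\<in>UNIV. n $ i * n $ i)
            + 1 / \<kappa> * (1 / 2 * (n \<bullet> a) * (ll y * ll y) + (\<Sum>i\<in>UNIV. n $ i * n $ i) * (ll y * s y) + 3 * b * (\<Sum>i\<in>UNIV. n $ i * n $ i) * (ll y * ll y))"
        unfolding nq_def inner_vec_def sum_3 by (simp add: algebra_simps)
      finally show ?thesis unfolding nn by (simp add: algebra_simps)
    qed
    show "\<exists>P. form 3 C x0 P \<and> (\<forall>y. laplacian P y = \<gamma> \<bullet> (y - x0)) \<and>
       (\<forall>y. \<bar>(\<Sum>i\<in>UNIV. (n $ i / \<kappa>) * pd i P y) + quad S x0 y\<bar>
          <= C * \<bar>n \<bullet> (y - x0)\<bar> * norm (y - x0))"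
    proof (intro exI[of _ P] conjI allI)
      show "form 3 C x0 P" by (rule form_mono[OF fP C1])
      show "laplacian P y = \<gamma> \<bullet> (y - x0)" for y by (rule lap)
      fix y
      define t where "t = norm (y - x0)"
      have t: "t >= 0" by (simp add: t_def)
      have "form 1 Bq x0 (pd i q)" for i using fq by (simp add: numeral_2_eq_2)
      then have pqb: "\<bar>pd i q y\<bar> <= Bq * t" for i using form_bound[of 1 Bq x0 "pd i q" y] by (simp add: t_def)
      have 1: "\<bar>nq y\<bar> <= 3 * Bq * t"
      proof -
        have "\<bar>nq y\<bar> <= (\<Sum>i\<in>(UNIV::3 set). 1 * (Bq * t))" unfolding nq_def
          by (rule order_trans[OF sum_abs sum_mono]) (unfold abs_mult, intro mult_mono n1 pqb, auto)
        then show ?thesis by simp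
      qed
      have l: "\<bar>ll y\<bar> <= t" using form_bound[OF fll, of y] by (simp add: t_def)
      have 2: "\<bar>1 / 2 * (n \<bullet> a) * ll y\<bar> <= 1 / 2 * Ba * t"
        unfolding abs_mult using na l by (intro mult_mono) auto
      have 3: "\<bar>s y\<bar> <= Ba * t" using form_bound[OF fs, of y] by (simp add: t_def)
      have 4: "\<bar>3 * b * ll y\<bar> <= 3 * Bb * t"
        unfolding abs_mult using bB l by (intro mult_mono) auto
      have "\<bar>1 / 2 * (n \<bullet> a) * ll y + s y + 3 * b * ll y\<bar> <= (Ba + 1 / 2 * Ba + 3 * Bb) * t"
        using 2 3 4 unfolding distrib_right by linarith
      then have "\<bar>1 / \<kappa> * (1 / 2 * (n \<bullet> a) * ll y + s y + 3 * b * ll y)\<bar> <= B * ((Ba + 1 / 2 * Ba + 3 * Bb) * t)"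
        unfolding abs_mult[of "1 / \<kappa>"] using \<kappa> B by (intro mult_mono) auto
      then have "\<bar>- nq y + 1 / \<kappa> * (1 / 2 * (n \<bullet> a) * ll y + s y + 3 * b * ll y)\<bar> <= (3 * Bq + B * (Ba + 1 / 2 * Ba + 3 * Bb)) * t"
        using 1 unfolding distrib_right[of "3 * Bq"] mult.assoc[of B] by linarith
      also have "... <= C * t" using C2 t by (rule mult_right_mono)
      finally have "\<bar>ll y\<bar> * \<bar>- nq y + 1 / \<kappa> * (1 / 2 * (n \<bullet> a) * ll y + s y + 3 * b * ll y)\<bar> <= \<bar>ll y\<bar> * (C * t)"
        by (rule mult_left_mono) simp
      then have "\<bar>(\<Sum>i\<in>UNIV. (n $ i / \<kappa>) * pd i P y) + q y\<bar> <= C * \<bar>ll y\<bar> * t"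
        unfolding dn abs_mult by (simp only: mult_ac)
      then show "\<bar>(\<Sum>i\<in>UNIV. (n $ i / \<kappa>) * pd i P y) + quad S x0 y\<bar>
          <= C * \<bar>n \<bullet> (y - x0)\<bar> * norm (y - x0)" unfolding q_def ll_def t_def .
    qed
  qed
qed

section \<open>Paths near the boundary and Taylor expansion at a boundary point\<close>

lemma eq_on_closure:
  fixes f g :: "real^3 => real"
  assumes "continuous_on (closure S) f" "continuous_on (closure S) g" "!!x. x \<in> S ==> f x = g x" "x \<in> closure S"
  shows "f x = g x"
proof -
  have "continuous_on (closure S) (%x. f x - g x)" by (rule continuous_on_diff[OF assms(1,2)])
  then have "f x - g x = 0"
    by (rule continuous_constant_on_closure) (use assms(3,4) in auto)
  then show ?thesis by simp
qed

lemma le_on_closure_ball: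
  fixes f g :: "real^3 => real"
  assumes f: "continuous_on (closure S) f" and g: "continuous_on (closure S) g"
    and le: "!!x. x \<in> S ==> x \<in> ball x0 r ==> f x <= g x" and x: "x \<in> closure S" "x \<in> ball x0 r"
  shows "f x <= g x"
proof -
  have "x \<in> closure (ball x0 r \<inter> S)" using open_Int_closure_subset[OF open_ball, of x0 r S] x by blast
  moreover have "continuous_on (closure (ball x0 r \<inter> S)) (%x. f x - g x)"
    by (rule continuous_on_subset[OF continuous_on_diff[OF f g]]) (simp add: closure_mono)
  ultimately have "f x - g x <= 0" using continuous_le_on_closure[of "ball x0 r \<inter> S" "%x. f x - g x" x 0] le by force
  then show ?thesis by simp
qed

lemma continuous_on_norm_powr: "s > 0 ==> continuous_on A (%y. norm (y - x0) powr s)" for x0 :: "real^3"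
  by (intro continuous_on_powr' continuous_intros) auto

lemma taylor_ball:
  fixes F :: "real^3 => real"
  assumes F: "!!z. z \<in> ball c R ==> F differentiable at z" "F x0 = 0"
    and g: "!!z. z \<in> ball c R ==> norm (grad F z) <= K * norm (z - x0) powr s"
    and x: "x0 \<in> ball c R" "y \<in> ball c R" and K: "K >= 0" "s >= 0"
  shows "\<bar>F y\<bar> <= K * norm (y - x0) powr (s + 1)"
proof (cases "y = x0")
  case False
  have seg: "closed_segment y x0 \<subseteq> ball c R"
    by (rule closed_segment_subset[OF x(2,1) convex_ball])
  have "\<bar>F y - F x0\<bar> <= (K * norm (y - x0) powr s) * norm (y - x0)"
  proof (rule mvt_grad[OF seg F(1)])
    fix z assume z: "z \<in> closed_segment y x0"
    have "norm (z - x0) <= norm (y - x0)" using segment_bound(2)[OF z] by (simp add: norm_minus_commute)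
    then have "K * norm (z - x0) powr s <= K * norm (y - x0) powr s" using K by (intro mult_left_mono powr_mono2) auto
    then show "norm (grad F z) <= K * norm (y - x0) powr s" using g[of z] z seg by (meson order_trans subsetD)
  qed
  then show ?thesis using F(2) False by (simp add: powr_add)
qed (simp add: F(2))

context defining_function
begin

lemma \<rho>_diff: "y \<in> ball c R ==> \<rho> differentiable at y" using \<rho>1 by simp

lemma lift: 
  assumes p: "p \<in> ball c R" "p + \<tau> *\<^sub>R \<nu> \<in> ball c R" and \<tau>: "\<tau> >= 0"
  shows "\<rho> (p + \<tau> *\<^sub>R \<nu>) >= \<rho> p + m * \<tau>"
proof -
  have seg: "p + s *\<^sub>R \<nu> \<in> ball c R" if "0 <= s" "s <= \<tau>" for s
  proof (cases "\<tau> = 0")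
    case False
    have "p + s *\<^sub>R \<nu> = (1 - s / \<tau>) *\<^sub>R p + (s / \<tau>) *\<^sub>R (p + \<tau> *\<^sub>R \<nu>)"
      using False by (simp add: algebra_simps)
    then have "p + s *\<^sub>R \<nu> \<in> closed_segment p (p + \<tau> *\<^sub>R \<nu>)"
      using that \<tau> False by (auto simp: closed_segment_def intro!: exI[of _ "s / \<tau>"])
    then show ?thesis using closed_segment_subset[OF p convex_ball] by blast
  qed (use that p in simp)
  have "\<rho> (p + 0 *\<^sub>R \<nu>) - m * 0 <= \<rho> (p + \<tau> *\<^sub>R \<nu>) - m * \<tau>"
  proof (rule DERIV_nonneg_imp_nondecreasing[OF \<tau>])
    fix s assume s: "0 <= s" "s <= \<tau>"
    have "((%s. \<rho> (p + s *\<^sub>R \<nu>) - m * s) has_real_derivative grad \<rho> (p + s *\<^sub>R \<nu>) \<bullet> \<nu> - m) (at s)"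
      by (intro DERIV_diff DERIV_line \<rho>_diff seg s) (auto intro!: derivative_eq_intros)
    then show "\<exists>y. ((%s. \<rho> (p + s *\<^sub>R \<nu>) - m * s) has_real_derivative y) (at s) \<and> 0 <= y"
      using transversal[OF seg[OF s]] by (intro exI[of _ "grad \<rho> (p + s *\<^sub>R \<nu>) \<bullet> \<nu> - m"]) auto
  qed
  then show ?thesis by simp
qed

text \<open>By \<open>lift\<close> the function \<open>\<rho>\<close> is at most 0 at distance
  \<open>\<bar>\<rho> p\<bar> / m\<close> below \<open>p\<close> along \<open>\<nu>\<close> and at
  least 0 at the same distance above. It will provide frontier points close to any given tangent
  direction.\<close>

lemma frontier_near:
  assumes p: "cball p (\<bar>\<rho> p\<bar> / m) \<subseteq> ball c R"
  obtains s where "\<bar>s\<bar> <= \<bar>\<rho> p\<bar> / m" "p + s *\<^sub>R \<nu> \<in> frontier \<Omega>"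
proof -
  let ?k = "\<bar>\<rho> p\<bar> / m"
  have k: "?k >= 0" using m by simp
  have B: "p + s *\<^sub>R \<nu> \<in> ball c R" if "\<bar>s\<bar> <= ?k" for s
    using p that unit\<nu> by (auto simp: dist_norm subset_iff)
  have "\<exists>s\<ge>- ?k. s <= ?k \<and> \<rho> (p + s *\<^sub>R \<nu>) = 0"
  proof (rule IVT')
    have "p + (- ?k) *\<^sub>R \<nu> \<in> ball c R" "p + (- ?k) *\<^sub>R \<nu> + ?k *\<^sub>R \<nu> \<in> ball c R" using B[of "- ?k"] B[of 0] k by auto
    from lift[OF this k] show "\<rho> (p + (- ?k) *\<^sub>R \<nu>) <= 0" using m by simp
    have "p \<in> ball c R" "p + ?k *\<^sub>R \<nu> \<in> ball c R" using B[of "?k"] B[of 0] k by auto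
    from lift[OF this k] show "0 <= \<rho> (p + ?k *\<^sub>R \<nu>)" using m by simp
    show "continuous_on {- ?k..?k} (%s. \<rho> (p + s *\<^sub>R \<nu>))"
    proof (rule continuous_on_compose2[of "ball c R"])
      show "continuous_on (ball c R) \<rho>" using Ck_continuous_on[OF \<rho>1] .
    qed (use B in \<open>auto intro!: continuous_intros\<close>)
  qed (use k in auto)
  then show ?thesis using that B bdry by (metis abs_le_iff minus_le_iff)
qed

end

text \<open>\<open>ub\<close> and \<open>gb\<close> are the continuous extensions of the derivatives
  of \<open>u\<close> and \<open>g\<close> to the closure; they carry the boundary values. A single
  \<open>M\<close> bounds the data of the solution, of the right side and of the boundary.\<close>

locale neumann_chart = interior \<Omega> u g M + defining_function \<Omega> \<rho> c R m \<nu>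
  for \<Omega> u g M \<rho> c R m \<nu> +
  fixes \<alpha> :: real and ub gb :: "3 list => real^3 => real"
  assumes \<alpha>: "0 < \<alpha>" "\<alpha> < 1" and M1: "M >= 1" and Rpos: "R > 0"
    and \<rho>3: "Ck 3 (ball c R) \<rho>"
    and \<rho>b: "!!is y. y \<in> ball c R ==> length is <= 3 ==> \<bar>pds is \<rho> y\<bar> <= M"
    and \<rho>h: "!!i j k x y. x \<in> ball c R ==> y \<in> ball c R ==> \<bar>pds [i, j, k] \<rho> x - pds [i, j, k] \<rho> y\<bar> <= M * norm (x - y) powr \<alpha>"
    and ub: "!!is. length is <= 2 ==> continuous_on (closure \<Omega>) (ub is)"
      "!!is y. length is <= 2 ==> y \<in> \<Omega> ==> ub is y = pds is u y"
    and ubd2: "!!is y. length is <= 2 ==> y \<in> \<Omega> ==> \<bar>pds is u y\<bar> <= M"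
    and uh: "!!i j x y. x \<in> \<Omega> ==> y \<in> \<Omega> ==> \<bar>pds [i, j] u x - pds [i, j] u y\<bar> <= M * norm (x - y) powr \<alpha>"
    and gb: "!!is. length is <= 1 ==> continuous_on (closure \<Omega>) (gb is)"
      "!!is y. length is <= 1 ==> y \<in> \<Omega> ==> gb is y = pds is g y"
    and gbd2: "!!is y. length is <= 1 ==> y \<in> \<Omega> ==> \<bar>pds is g y\<bar> <= M"
    and neumann: "!!y. y \<in> frontier \<Omega> ==> y \<in> ball c R ==> (\<Sum>i\<in>UNIV. ub [i] y * pd i \<rho> y) = 0"
begin

text \<open>\<open>3 * M\<close> bounds the slope of \<open>\<rho>\<close> and \<open>m\<close> its
  rise along \<open>\<nu>\<close>: after a rise by \<open>L * t\<close> a move of length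
  \<open>t\<close> in any direction keeps \<open>\<rho>\<close> positive, with \<open>m * t\<close>
  to spare thanks to the summand 1.\<close>

definition L where "L = 3 * M / m + 1"

lemma L1: "L >= 1" using M1 m by (simp add: L_def)

lemma grad\<rho>_le: "y \<in> ball c R ==> norm (grad \<rho> y) <= 3 * M"
  using \<rho>b[of y "[i]" for i] by (intro norm_grad_le) simp

lemma across:
  assumes b: "b \<in> ball c R" "p \<in> ball c R" "norm (p - b) <= t" "\<rho> b >= m * L * t" "t > 0"
  shows "p \<in> \<Omega>"
proof -
  have "\<bar>\<rho> b - \<rho> p\<bar> <= 3 * M * norm (b - p)"
    by (rule mvt_grad[where U="ball c R"])
      (use closed_segment_subset[OF b(1,2) convex_ball] grad\<rho>_le \<rho>_diff in auto)
  also have "... <= 3 * M * t" using b(3) M1 by (intro mult_left_mono) (auto simp: norm_minus_commute)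
  finally have "\<rho> p >= m * L * t - 3 * M * t" using b(4) by linarith
  also have "m * L * t - 3 * M * t = m * t" using m by (simp add: L_def field_simps)
  finally have "\<rho> p > 0" using m b(5) mult_pos_pos[of m t] by linarith
  then show ?thesis using in\<Omega>[OF b(2)] by simp
qed

lemma segment_memberE:
  assumes "z \<in> closed_segment (p + s *\<^sub>R \<nu>) (p + t *\<^sub>R \<nu>)" "s <= t"
  obtains r where "z = p + r *\<^sub>R \<nu>" "s <= r" "r <= t"
proof -
  obtain \<theta> where \<theta>: "0 <= \<theta>" "\<theta> <= 1" "z = (1 - \<theta>) *\<^sub>R (p + s *\<^sub>R \<nu>) + \<theta> *\<^sub>R (p + t *\<^sub>R \<nu>)"
    using assms(1) by (auto simp: closed_segment_def)
  have "z = p + (s + \<theta> * (t - s)) *\<^sub>R \<nu>" unfolding \<theta>(3) by (simp add: algebra_simps)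
  moreover have "0 <= \<theta> * (t - s)" "\<theta> * (t - s) <= 1 * (t - s)"
    using \<theta> assms(2) mult_right_mono[OF \<theta>(2), of "t - s"] by auto
  ultimately show ?thesis by (intro that[of "s + \<theta> * (t - s)"]) auto
qed

text \<open>The segment from \<open>y\<close> to the boundary point may leave
  \<open>\<Omega>\<close>. Instead \<open>y\<close> is raised by \<open>L * t\<close> along
  \<open>\<nu>\<close>, joined to the equally raised \<open>x0\<close>, and then lowered; this path
  has length at most \<open>(2 * L + 1) * t\<close> and stays in \<open>\<Omega>\<close> up to its
  end point.\<close>

lemma qc:
  fixes F Fb :: "real^3 => real"
  assumes x0: "x0 \<in> frontier \<Omega>" and y: "y \<in> \<Omega>" "norm (y - x0) <= t" and t: "t > 0"
    and sub: "cball x0 ((1 + L) * t) \<subseteq> ball c R"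
    and F: "!!z. z \<in> \<Omega> ==> F differentiable at z"
    and N: "!!z. z \<in> \<Omega> ==> z \<in> cball x0 ((1 + L) * t) ==> norm (grad F z) <= N"
    and Fb: "continuous_on (closure \<Omega>) Fb" "!!z. z \<in> \<Omega> ==> Fb z = F z"
  shows "\<bar>F y - Fb x0\<bar> <= (2 * L + 1) * N * t"
proof -
  have Lt: "L * t > 0" using L1 t by simp
  let ?C = "cball x0 ((1 + L) * t)"
  have inC: "p + r *\<^sub>R \<nu> \<in> ?C" if "norm (p - x0) <= t" "0 <= r" "r <= L * t" for p r
  proof -
    have "norm (p + r *\<^sub>R \<nu> - x0) <= norm (p - x0) + norm (r *\<^sub>R \<nu>)"
      using norm_triangle_ineq[of "p - x0" "r *\<^sub>R \<nu>"] by (simp add: algebra_simps)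
    also have "... <= t + L * t" using that unit\<nu> by simp
    finally show ?thesis by (simp add: dist_norm norm_minus_commute algebra_simps)
  qed
  have x0C: "x0 \<in> ?C" using inC[of x0 0] t Lt by simp
  have x0R: "x0 \<in> ball c R" using x0C sub by blast
  have yC: "y \<in> ?C" using inC[of y 0] y Lt by simp
  have \<rho>x0: "\<rho> x0 = 0" using bdry[of x0] x0 x0C sub by blast
  have \<rho>y: "\<rho> y > 0" using in\<Omega>[of y] y yC sub by blast
  have up_y: "y + r *\<^sub>R \<nu> \<in> \<Omega>" if "0 <= r" "r <= L * t" for r
  proof -
    have b: "y + r *\<^sub>R \<nu> \<in> ball c R" using inC[OF y(2) that] sub by blast
    have "\<rho> (y + r *\<^sub>R \<nu>) >= \<rho> y + m * r" by (rule lift[OF _ b that(1)]) (use yC sub in blast)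
    then show ?thesis using \<rho>y m that in\<Omega>[OF b] mult_nonneg_nonneg[of m r] by linarith
  qed
  have up_x: "x0 + r *\<^sub>R \<nu> \<in> \<Omega>" if "0 < r" "r <= L * t" for r
  proof -
    have b: "x0 + r *\<^sub>R \<nu> \<in> ball c R" using inC[of x0 r] that t sub by auto
    have "\<rho> (x0 + r *\<^sub>R \<nu>) >= \<rho> x0 + m * r" by (rule lift[OF x0R b]) (use that in simp)
    then show ?thesis using \<rho>x0 m that in\<Omega>[OF b] mult_pos_pos[of m r] by linarith
  qed
  let ?a = "y + (L * t) *\<^sub>R \<nu>" and ?b = "x0 + (L * t) *\<^sub>R \<nu>"
  have bR: "?b \<in> ball c R" using inC[of x0 "L * t"] t Lt sub by auto
  have \<rho>b: "\<rho> ?b >= m * L * t"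
    using lift[OF x0R bR] Lt \<rho>x0 by (simp add: mult.assoc)
  have s1: "\<bar>F (y + 0 *\<^sub>R \<nu>) - F ?a\<bar> <= N * norm (y + 0 *\<^sub>R \<nu> - ?a)"
  proof (rule mvt_grad[OF _ F])
    have *: "z \<in> \<Omega> \<and> z \<in> ?C" if "z \<in> closed_segment (y + 0 *\<^sub>R \<nu>) ?a" for z
      by (rule segment_memberE[OF that]) (use up_y inC[OF y(2)] Lt in auto)
    show "closed_segment (y + 0 *\<^sub>R \<nu>) ?a \<subseteq> \<Omega>" using * by blast
    show "norm (grad F z) <= N" if "z \<in> closed_segment (y + 0 *\<^sub>R \<nu>) ?a" for z
      using *[OF that] N by blast
  qed
  have s2: "\<bar>F ?a - F ?b\<bar> <= N * norm (?a - ?b)"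
  proof (rule mvt_grad[OF _ F])
    have *: "z \<in> \<Omega> \<and> z \<in> ?C" if z: "z \<in> closed_segment ?a ?b" for z
    proof -
      have "?a \<in> ?C" "?b \<in> ?C" using inC[OF y(2), of "L * t"] inC[of x0 "L * t"] t Lt by auto
      then have zC: "z \<in> ?C" using closed_segment_subset[OF _ _ convex_cball] z by blast
      have "norm (z - ?b) <= norm (?a - ?b)" using segment_bound(2)[OF z] by (simp add: norm_minus_commute)
      then have "norm (z - ?b) <= t" using y(2) by simp
      then show ?thesis using across[OF bR _ _ \<rho>b t] zC sub by blast
    qed
    show "closed_segment ?a ?b \<subseteq> \<Omega>" using * by blast
    show "norm (grad F z) <= N" if "z \<in> closed_segment ?a ?b" for z using *[OF that] N by blast
  qed
  have s3: "\<bar>F (x0 + r *\<^sub>R \<nu>) - F ?b\<bar> <= N * (L * t)" if r: "0 < r" "r <= L * t" for r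
  proof -
    have "\<bar>F (x0 + r *\<^sub>R \<nu>) - F ?b\<bar> <= N * norm (x0 + r *\<^sub>R \<nu> - ?b)"
    proof (rule mvt_grad[OF _ F])
      have *: "z \<in> \<Omega> \<and> z \<in> ?C" if "z \<in> closed_segment (x0 + r *\<^sub>R \<nu>) ?b" for z
        by (rule segment_memberE[OF that]) (use up_x inC[of x0] r t in auto)
      show "closed_segment (x0 + r *\<^sub>R \<nu>) ?b \<subseteq> \<Omega>" using * by blast
      show "norm (grad F z) <= N" if "z \<in> closed_segment (x0 + r *\<^sub>R \<nu>) ?b" for z
        using *[OF that] N by blast
    qed
    moreover have "norm (x0 + r *\<^sub>R \<nu> - ?b) = L * t - r"
    proof -
      have "x0 + r *\<^sub>R \<nu> - ?b = (r - L * t) *\<^sub>R \<nu>" by (simp add: algebra_simps)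
      then show ?thesis using unit\<nu> r by simp
    qed
    moreover have "0 <= N" using order_trans[OF norm_ge_zero N[OF y(1) yC]] .
    moreover from this have "N * (L * t - r) <= N * (L * t)" using r by (intro mult_left_mono) auto
    ultimately show ?thesis by (simp only:)
  qed
  \<comment> \<open>The last piece ends on the frontier, where the value of \<open>F\<close> itself
    carries no information; the limit along \<open>\<nu>\<close> leads to the extension
    \<open>Fb\<close>.\<close>
  have s4: "\<bar>Fb x0 - F ?b\<bar> <= N * (L * t)"
  proof (rule tendsto_upperbound)
    have cl: "x0 \<in> closure \<Omega>" using x0 by (simp add: frontier_def)
    have ev: "\<forall>\<^sub>F r in at_right 0. x0 + r *\<^sub>R \<nu> \<in> \<Omega> \<and> \<bar>Fb (x0 + r *\<^sub>R \<nu>) - F ?b\<bar> <= N * (L * t)"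
      unfolding eventually_at_right_field
      by (intro exI[of _ "L * t"] conjI Lt) (use up_x s3 Fb(2) in auto)
    have "((%r. x0 + r *\<^sub>R \<nu>) \<longlongrightarrow> x0 + 0 *\<^sub>R \<nu>) (at_right 0)" by (intro tendsto_intros)
    then have "((%r. Fb (x0 + r *\<^sub>R \<nu>)) \<longlongrightarrow> Fb x0) (at_right 0)"
      by (intro continuous_on_tendsto_compose[OF Fb(1) _ cl] eventually_mono[OF ev])
        (use closure_subset in auto)
    then show "((%r. \<bar>Fb (x0 + r *\<^sub>R \<nu>) - F ?b\<bar>) \<longlongrightarrow> \<bar>Fb x0 - F ?b\<bar>) (at_right 0)"
      by (intro tendsto_intros)
    show "\<forall>\<^sub>F r in at_right 0. \<bar>Fb (x0 + r *\<^sub>R \<nu>) - F ?b\<bar> <= N * (L * t)"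
      by (rule eventually_mono[OF ev]) simp
  qed simp
  have "\<bar>F y - F ?a\<bar> <= N * (L * t)" using s1 unit\<nu> Lt by simp
  moreover have "\<bar>F ?a - F ?b\<bar> <= N * t"
  proof -
    have "norm (?a - ?b) <= t" using y(2) by simp
    then have "N * norm (?a - ?b) <= N * t"
      by (rule mult_left_mono) (rule order_trans[OF norm_ge_zero N[OF y(1) yC]])
    then show ?thesis using s2 by linarith
  qed
  ultimately have "\<bar>F y - Fb x0\<bar> <= N * (L * t) + N * t + N * (L * t)"
    using s4 by linarith
  then show ?thesis by (simp add: algebra_simps)
qed

text \<open>One order of Taylor expansion at a boundary point, along the path of \<open>qc\<close>.
  The path reaches up to \<open>(1 + L) * norm (y - x0)\<close> from \<open>x0\<close>, which
  explains the factor \<open>(1 + L) powr s\<close>.\<close>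

lemma qc_taylor:
  fixes F Fb :: "real^3 => real"
  assumes x0: "x0 \<in> frontier \<Omega>" and y: "y \<in> \<Omega>" and r: "(1 + L) * norm (y - x0) <= r" "cball x0 r \<subseteq> ball c R"
    and F: "!!z. z \<in> \<Omega> ==> F differentiable at z"
    and N: "!!z. z \<in> \<Omega> ==> z \<in> cball x0 r ==> norm (grad F z) <= K * norm (z - x0) powr s"
    and Fb: "continuous_on (closure \<Omega>) Fb" "!!z. z \<in> \<Omega> ==> Fb z = F z" "Fb x0 = 0" and K: "K >= 0" "s >= 0"
  shows "\<bar>F y\<bar> <= (2 * L + 1) * (K * (1 + L) powr s) * norm (y - x0) powr (s + 1)"
proof -
  let ?t = "norm (y - x0)"
  have "y \<noteq> x0" using x0 y open\<Omega> by (auto simp: frontier_def interior_open)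
  then have t: "?t > 0" by simp
  have sub: "cball x0 ((1 + L) * ?t) \<subseteq> cball x0 r" using r(1) by (rule subset_cball)
  have "\<bar>F y - Fb x0\<bar> <= (2 * L + 1) * (K * ((1 + L) * ?t) powr s) * ?t"
  proof (rule qc[OF x0 y order_refl t _ F _ Fb(1,2)])
    show "cball x0 ((1 + L) * ?t) \<subseteq> ball c R" using sub r(2) by blast
    fix z assume z: "z \<in> \<Omega>" "z \<in> cball x0 ((1 + L) * ?t)"
    then have "norm (z - x0) <= (1 + L) * ?t" by (simp add: dist_norm norm_minus_commute)
    then have "K * norm (z - x0) powr s <= K * ((1 + L) * ?t) powr s"
      using K by (intro mult_left_mono powr_mono2) auto
    then show "norm (grad F z) <= K * ((1 + L) * ?t) powr s" using N[OF z(1)] z(2) sub by (meson order_trans subsetD)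
  qed
  also have "((1 + L) * ?t) powr s = (1 + L) powr s * ?t powr s" using L1 by (simp add: powr_mult)
  finally show ?thesis using Fb(3) t by (simp add: powr_add mult_ac)
qed

end

definition hrow :: "(3 => 3 => real) => 3 => real^3" where "hrow S i = (\<chi> k. S i k)"

lemma row_nth [simp]: "hrow S i $ k = S i k" by (simp add: hrow_def)

lemma norm_row: "(!!k. \<bar>S i k\<bar> <= B) ==> norm (hrow S i) <= 3 * B"
proof -
  assume S: "!!k. \<bar>S i k\<bar> <= B"
  have "norm (hrow S i) <= (\<Sum>k\<in>UNIV. \<bar>hrow S i $ k\<bar>)" by (rule norm_le_l1_cart)
  also have "... <= (\<Sum>k\<in>(UNIV::3 set). B)" by (rule sum_mono) (simp add: S)
  finally show ?thesis by simp
qed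

lemma pd_quad_sym:
  assumes "!!j k. S j k = S k j" shows "pd i (quad S x0) y = 2 * (hrow S i \<bullet> (y - x0))"
proof -
  have "(\<chi> k. S i k + S k i) = 2 *\<^sub>R hrow S i" using assms by (simp add: vec_eq_iff)
  then show ?thesis unfolding pd_quad by simp
qed

lemma quad_differentiable: "quad S x0 differentiable at y"
proof -
  have "form 2 (36 * (\<Sum>j\<in>UNIV. \<Sum>k\<in>UNIV. \<bar>S j k\<bar>)) x0 (quad S x0)"
  proof (rule form_quad)
    show "\<bar>S j k\<bar> <= (\<Sum>j\<in>UNIV. \<Sum>k\<in>UNIV. \<bar>S j k\<bar>)" for j k
    proof -
      have "\<bar>S j k\<bar> <= (\<Sum>k\<in>UNIV. \<bar>S j k\<bar>)" by (rule member_le_sum) auto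
      also have "... <= (\<Sum>j\<in>UNIV. \<Sum>k\<in>UNIV. \<bar>S j k\<bar>)"
        by (rule member_le_sum[where f="%j. \<Sum>k\<in>UNIV. \<bar>S j k\<bar>"]) (auto intro: sum_nonneg)
      finally show ?thesis .
    qed
  qed (auto intro!: sum_nonneg)
  then show ?thesis by (rule form_differentiable)
qed

lemma quad_bound: "(!!j k. \<bar>S j k\<bar> <= B) ==> B >= 0 ==> \<bar>quad S x0 y\<bar> <= 36 * B * (norm (y - x0))\<^sup>2"
  using form_bound[OF form_quad, of S B x0 y] by simp

lemma inner_shift_differentiable: "(%y. a \<bullet> (y - x0)) differentiable at y"
  using inner_shift_has_derivative differentiableI by blast

lemma pd_affine: "pd i (%y. a + b \<bullet> (y - x0)) = (%y. b $ i)"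
proof
  fix y
  have "pd i (%y. a + b \<bullet> (y - x0)) y = pd i (%y. a) y + pd i (%y. b \<bullet> (y - x0)) y"
    by (rule pd_add) (intro differentiable_const inner_shift_differentiable)+
  then show "pd i (%y. a + b \<bullet> (y - x0)) y = b $ i" by (simp add: pd_const pd_inner_shift)
qed

lemma pd_diff_affine:
  assumes "f differentiable at z" shows "pd k (%y. f y - a - b \<bullet> (y - x0)) z = pd k f z - b $ k"
proof -
  have "(%y. a + b \<bullet> (y - x0)) differentiable at z"
    by (intro differentiable_add differentiable_const inner_shift_differentiable)
  from pd_diff[OF assms this, of k] show ?thesis by (simp add: pd_affine diff_diff_eq)
qed

lemma pd_diff_jet:
  assumes f: "f differentiable at z" and S: "!!j k. S j k = S k j"
  shows "pd k (%y. f y - a - b \<bullet> (y - x0) - 1 / 2 * quad S x0 y) z = pd k f z - b $ k - hrow S k \<bullet> (z - x0)"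
proof -
  have "pd k (%y. f y - a - b \<bullet> (y - x0) - 1 / 2 * quad S x0 y) z
    = pd k (%y. f y - a - b \<bullet> (y - x0)) z - pd k (%y. 1 / 2 * quad S x0 y) z"
    by (rule pd_diff) (intro differentiable_diff differentiable_mult f differentiable_const inner_shift_differentiable quad_differentiable)+
  then show ?thesis by (simp only: pd_diff_affine[OF f] pd_cmult[OF quad_differentiable] pd_quad_sym[OF S])
qed

lemma norm_grad_le': "(!!i. \<bar>pd i f x\<bar> <= B * t) ==> norm (grad f x) <= 3 * B * t"
  using norm_grad_le[of f x "B * t"] by simp

context neumann_chart
begin

text \<open>The jets at a boundary point: gradient and Hessian of \<open>u\<close> and gradient of
  \<open>g\<close> through their extensions, second and third derivatives of \<open>\<rho>\<close>
  directly.\<close>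

definition pv where "pv x0 = (\<chi> i. ub [i] x0)"
definition Hc where "Hc x0 i j = ub [i, j] x0"
definition Ec where "Ec x0 i j = pds [i, j] \<rho> x0"
definition Tc where "Tc x0 i j k = pds [i, j, k] \<rho> x0"
definition \<gamma>v where "\<gamma>v x0 = (\<chi> i. gb [i] x0)"
definition T2 where "T2 x0 y = ub [] x0 + pv x0 \<bullet> (y - x0) + 1 / 2 * quad (Hc x0) x0 y"

text \<open>Constants of four applications of \<open>qc_taylor\<close>: first to the derivatives and
  then to the function, for \<open>u\<close> minus its second-order and for \<open>g\<close> minus
  its first-order Taylor polynomial.\<close>

definition K1 where "K1 = (2 * L + 1) * (3 * M * (1 + L) powr \<alpha>)"
definition K2 where "K2 = (2 * L + 1) * (3 * K1 * (1 + L) powr (\<alpha> + 1))"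
definition K3 where "K3 = (2 * L + 1) * (3 * M * (1 + L) powr 0)"
definition K4 where "K4 = (2 * L + 1) * (3 * K3 * (1 + L) powr 1)"

lemma K_nonneg: "0 <= K1" "0 <= K2" "0 <= K3" "0 <= K4"
  using L1 M1 by (auto simp: K1_def K2_def K3_def K4_def)

text \<open>Within \<open>r1\<close> the paths of \<open>qc_taylor\<close> stay in the ball of
  radius \<open>R / 3\<close> about \<open>x0\<close>; within \<open>r2\<close> they stay where the
  expansion valid up to \<open>r1\<close> can be integrated once more.\<close>

definition r1 where "r1 = R / (3 * (1 + L))"
definition r2 where "r2 = r1 / (1 + L)"

lemma r_pos: "0 < r2" "r2 <= r1" "r1 <= R / 6"
proof -
  have R1: "0 < r1" using L1 Rpos by (simp add: r1_def)
  then show "0 < r2" "r2 <= r1" using L1 by (simp_all add: r2_def field_simps)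
  have "R / (3 * (1 + L)) <= R / 6" by (rule divide_left_mono) (use L1 Rpos in auto)
  then show "r1 <= R / 6" by (simp add: r1_def)
qed

context
  fixes x0
  assumes x0: "x0 \<in> frontier \<Omega>" "x0 \<in> ball c (R / 2)"
begin

lemma x0R: "x0 \<in> ball c R" using x0(2) Rpos by auto

lemma x0cl: "x0 \<in> closure \<Omega>" using x0(1) by (simp add: frontier_def)

lemma sub3: "cball x0 (R / 3) \<subseteq> ball c R"
proof
  fix y assume "y \<in> cball x0 (R / 3)"
  then show "y \<in> ball c R" using x0(2) dist_triangle[of c y x0] Rpos by simp
qed

lemma Hc_sym: "Hc x0 i j = Hc x0 j i"
  unfolding Hc_def
  by (rule eq_on_closure[OF ub(1) ub(1) _ x0cl]) (use ub(2) pd_commute[OF openU u2] in auto)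

text \<open>The equation passes to the boundary by continuity. As a result the second-order Taylor
  polynomial has the constant Laplacian \<open>gb [] x0\<close>.\<close>

lemma trace_Hc: "(\<Sum>i\<in>UNIV. Hc x0 i i) = gb [] x0"
  unfolding Hc_def
proof (rule eq_on_closure[OF _ gb(1) _ x0cl])
  show "continuous_on (closure \<Omega>) (%x. \<Sum>i\<in>UNIV. ub [i, i] x)" by (intro continuous_on_sum ub(1)) simp
  show "(\<Sum>i\<in>UNIV. ub [i, i] x) = gb [] x" if "x \<in> \<Omega>" for x
    using that ub(2)[of "[i, i]" x for i] gb(2)[of "[]" x] lap[OF that] by (simp add: laplacian_def)
qed simp

lemma abs_ub: "length is <= 2 ==> \<bar>ub is x0\<bar> <= M"
  by (rule le_on_closure_ball[where S=\<Omega> and f="%x. \<bar>ub is x\<bar>" and ?x0.0=x0 and r=1])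
    (use ub ubd2 x0cl in \<open>auto intro!: continuous_intros\<close>)

lemma abs_gb: "length is <= 1 ==> \<bar>gb is x0\<bar> <= M"
  by (rule le_on_closure_ball[where S=\<Omega> and f="%x. \<bar>gb is x\<bar>" and ?x0.0=x0 and r=1])
    (use gb gbd2 x0cl in \<open>auto intro!: continuous_intros\<close>)

lemma Hc_hoelder:
  assumes y: "y \<in> \<Omega>" shows "\<bar>pds [i, j] u y - Hc x0 i j\<bar> <= M * norm (y - x0) powr \<alpha>"
  unfolding Hc_def
proof (rule le_on_closure_ball[where S=\<Omega> and f="%x. \<bar>pds [i, j] u y - ub [i, j] x\<bar>" and ?x0.0=x0 and r=1])
  show "continuous_on (closure \<Omega>) (%x. \<bar>pds [i, j] u y - ub [i, j] x\<bar>)"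
    by (intro continuous_intros ub(1)) simp
  have "continuous_on (closure \<Omega>) (%x. norm (x - y) powr \<alpha>)" by (rule continuous_on_norm_powr[OF \<alpha>(1)])
  then show "continuous_on (closure \<Omega>) (%x. M * norm (y - x) powr \<alpha>)"
    by (intro continuous_on_mult continuous_on_const) (simp add: norm_minus_commute)
  show "\<bar>pds [i, j] u y - ub [i, j] x\<bar> <= M * norm (y - x) powr \<alpha>" if "x \<in> \<Omega>" for x
    using uh[OF y that] ub(2)[of "[i, j]" x] that by simp
qed (use x0cl in auto)

lemma T2_differentiable: "T2 x0 differentiable at y"
  unfolding T2_def[abs_def]
  by (intro differentiable_add differentiable_mult differentiable_const inner_shift_differentiable quad_differentiable)

lemma pd_T2: "pd i (T2 x0) = (%y. pv x0 $ i + hrow (Hc x0) i \<bullet> (y - x0))"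
proof
  fix y
  have "pd i (T2 x0) y = pd i (%y. ub [] x0 + pv x0 \<bullet> (y - x0)) y + pd i (%y. 1 / 2 * quad (Hc x0) x0 y) y"
    unfolding T2_def[abs_def]
    by (rule pd_add) (intro differentiable_add differentiable_mult differentiable_const inner_shift_differentiable quad_differentiable)+
  then show "pd i (T2 x0) y = pv x0 $ i + hrow (Hc x0) i \<bullet> (y - x0)"
    by (simp only: pd_affine pd_cmult[OF quad_differentiable] pd_quad_sym[OF Hc_sym])
qed

lemma pd2_T2: "pd j (pd i (T2 x0)) y = Hc x0 i j"
  unfolding pd_T2 pd_affine by simp

lemma pd_T2_differentiable: "pd i (T2 x0) differentiable at y"
  unfolding pd_T2 by (intro differentiable_add differentiable_const inner_shift_differentiable)

lemma form_T2_parts: "Pol 3 (T2 x0)"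
proof -
  have "Pol 2 (quad (Hc x0) x0)"
    by (rule form_Pol[OF form_quad[where B=M]]) (use abs_ub M1 in \<open>auto simp: Hc_def\<close>)
  then have 1: "Pol 3 (%y. 1 / 2 * quad (Hc x0) x0 y)" by (intro Pol_cmult) (rule Pol_mono, auto)
  have "Pol 1 (%y. pv x0 \<bullet> (y - x0))" by (rule form_Pol[OF form_inner[OF order_refl]])
  then have 2: "Pol 3 (%y. pv x0 \<bullet> (y - x0))" by (rule Pol_mono) simp
  show ?thesis unfolding T2_def[abs_def] by (intro Pol_add Pol_const 1 2)
qed

lemma u_diff: "y \<in> \<Omega> ==> u differentiable at y" "y \<in> \<Omega> ==> pd i u differentiable at y"
  using u2 by (auto simp: numeral_2_eq_2)

lemma g_diff: "y \<in> \<Omega> ==> g differentiable at y" "y \<in> \<Omega> ==> pd i g differentiable at y"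
  using g2 by (auto simp: numeral_2_eq_2)

lemma jet_u1:
  assumes y: "y \<in> \<Omega>" "norm (y - x0) <= r1"
  shows "\<bar>pd i u y - pd i (T2 x0) y\<bar> <= K1 * norm (y - x0) powr (\<alpha> + 1)"
  unfolding K1_def
proof (rule qc_taylor[where F="%y. pd i u y - pd i (T2 x0) y" and Fb="%y. ub [i] y - pd i (T2 x0) y" and r="R / 3"])
  show "(1 + L) * norm (y - x0) <= R / 3" using y(2) L1 by (simp add: r1_def field_simps)
  show "cball x0 (R / 3) \<subseteq> ball c R" by (rule sub3)
  show "(%y. pd i u y - pd i (T2 x0) y) differentiable at z" if "z \<in> \<Omega>" for z
    by (intro differentiable_diff u_diff[OF that] pd_T2_differentiable)
  show "norm (grad (%y. pd i u y - pd i (T2 x0) y) z) <= 3 * M * norm (z - x0) powr \<alpha>" if "z \<in> \<Omega>" for z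
  proof (rule norm_grad_le')
    fix j
    show "\<bar>pd j (%y. pd i u y - pd i (T2 x0) y) z\<bar> <= M * norm (z - x0) powr \<alpha>"
      unfolding pd_diff[OF u_diff(2)[OF that] pd_T2_differentiable] pd2_T2
      using Hc_hoelder[OF that, of i j] by simp
  qed
  show "continuous_on (closure \<Omega>) (%y. ub [i] y - pd i (T2 x0) y)"
    unfolding pd_T2 by (intro continuous_intros ub(1)) simp
  show "ub [i] z - pd i (T2 x0) z = pd i u z - pd i (T2 x0) z" if "z \<in> \<Omega>" for z
    using ub(2)[of "[i]" z] that by simp
  show "ub [i] x0 - pd i (T2 x0) x0 = 0" unfolding pd_T2 by (simp add: pv_def)
qed (use x0 y \<alpha> M1 in auto)

lemma jet_u0:
  assumes y: "y \<in> \<Omega>" "norm (y - x0) <= r2"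
  shows "\<bar>u y - T2 x0 y\<bar> <= K2 * norm (y - x0) powr (\<alpha> + 1 + 1)"
  unfolding K2_def
proof (rule qc_taylor[where F="%y. u y - T2 x0 y" and Fb="%y. ub [] y - T2 x0 y" and r=r1])
  show "(1 + L) * norm (y - x0) <= r1" using y(2) L1 by (simp add: r2_def field_simps)
  have "r1 <= R / 3" using r_pos Rpos by simp
  then show "cball x0 r1 \<subseteq> ball c R" using sub3 by (meson order_trans subset_cball)
  show "(%y. u y - T2 x0 y) differentiable at z" if "z \<in> \<Omega>" for z
    by (intro differentiable_diff u_diff[OF that] T2_differentiable)
  show "norm (grad (%y. u y - T2 x0 y) z) <= 3 * K1 * norm (z - x0) powr (\<alpha> + 1)" if "z \<in> \<Omega>" "z \<in> cball x0 r1" for z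
  proof (rule norm_grad_le')
    fix i
    show "\<bar>pd i (%y. u y - T2 x0 y) z\<bar> <= K1 * norm (z - x0) powr (\<alpha> + 1)"
      unfolding pd_diff[OF u_diff(1)[OF that(1)] T2_differentiable]
      by (rule jet_u1[OF that(1)]) (use that(2) in \<open>simp add: dist_norm norm_minus_commute\<close>)
  qed
  show "continuous_on (closure \<Omega>) (%y. ub [] y - T2 x0 y)"
    by (intro continuous_on_diff ub(1) Ck_continuous_on[OF Ck_subset[OF Pol_Ck[OF form_T2_parts, of 0] subset_UNIV]]) simp
  show "ub [] z - T2 x0 z = u z - T2 x0 z" if "z \<in> \<Omega>" for z using ub(2)[of "[]" z] that by simp
  show "ub [] x0 - T2 x0 x0 = 0" by (simp add: T2_def quad_def)
qed (use x0 y \<alpha> K_nonneg in auto)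

lemma jet_g1:
  assumes y: "y \<in> \<Omega>" "norm (y - x0) <= r1"
  shows "\<bar>pd i g y - \<gamma>v x0 $ i\<bar> <= K3 * norm (y - x0) powr (0 + 1)"
  unfolding K3_def
proof (rule qc_taylor[where F="%y. pd i g y - \<gamma>v x0 $ i" and Fb="%y. gb [i] y - \<gamma>v x0 $ i" and r="R / 3"])
  show "(1 + L) * norm (y - x0) <= R / 3" using y(2) L1 by (simp add: r1_def field_simps)
  show "cball x0 (R / 3) \<subseteq> ball c R" by (rule sub3)
  show "(%y. pd i g y - \<gamma>v x0 $ i) differentiable at z" if "z \<in> \<Omega>" for z
    by (intro differentiable_diff g_diff[OF that] differentiable_const)
  show "norm (grad (%y. pd i g y - \<gamma>v x0 $ i) z) <= 3 * M * norm (z - x0) powr 0" if "z \<in> \<Omega>" for z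
  proof (rule norm_grad_le')
    fix j
    \<comment> \<open>\<open>0 powr 0\<close> is 0, so the factor
      \<open>norm (z - x0) powr 0\<close> is 1 only away from \<open>x0\<close>.\<close>
    have "z \<noteq> x0" using x0 that open\<Omega> by (auto simp: frontier_def interior_open)
    then show "\<bar>pd j (%y. pd i g y - \<gamma>v x0 $ i) z\<bar> <= M * norm (z - x0) powr 0"
      unfolding pd_diff[OF g_diff(2)[OF that] differentiable_const] using gbd[OF that, of j i] by (simp add: pd_const)
  qed
  show "continuous_on (closure \<Omega>) (%y. gb [i] y - \<gamma>v x0 $ i)" by (intro continuous_intros gb(1)) simp
  show "gb [i] z - \<gamma>v x0 $ i = pd i g z - \<gamma>v x0 $ i" if "z \<in> \<Omega>" for z using gb(2)[of "[i]" z] that by simp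
  show "gb [i] x0 - \<gamma>v x0 $ i = 0" by (simp add: \<gamma>v_def)
qed (use x0 y \<alpha> M1 in auto)

lemma jet_g0:
  assumes y: "y \<in> \<Omega>" "norm (y - x0) <= r2"
  shows "\<bar>g y - gb [] x0 - \<gamma>v x0 \<bullet> (y - x0)\<bar> <= K4 * norm (y - x0) powr (1 + 1)" (is "\<bar>?F y\<bar> <= _")
  unfolding K4_def
proof (rule qc_taylor[where F="?F" and Fb="%y. gb [] y - gb [] x0 - \<gamma>v x0 \<bullet> (y - x0)" and r=r1])
  show "(1 + L) * norm (y - x0) <= r1" using y(2) L1 by (simp add: r2_def field_simps)
  have "r1 <= R / 3" using r_pos Rpos by simp
  then show "cball x0 r1 \<subseteq> ball c R" using sub3 by (meson order_trans subset_cball)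
  show "?F differentiable at z" if "z \<in> \<Omega>" for z
    by (intro differentiable_diff g_diff[OF that] differentiable_const inner_shift_differentiable)
  show "norm (grad ?F z) <= 3 * K3 * norm (z - x0) powr 1" if "z \<in> \<Omega>" "z \<in> cball x0 r1" for z
    by (rule norm_grad_le') (use jet_g1[OF that(1)] that(2) in
      \<open>simp add: pd_diff_affine[OF g_diff(1)[OF that(1)]] dist_norm norm_minus_commute\<close>)
  show "continuous_on (closure \<Omega>) (%y. gb [] y - gb [] x0 - \<gamma>v x0 \<bullet> (y - x0))"
    by (intro continuous_intros gb(1)) simp
  show "gb [] z - gb [] x0 - \<gamma>v x0 \<bullet> (z - x0) = ?F z" if "z \<in> \<Omega>" for z
    using gb(2)[of "[]" z] that by simp
qed (use x0 y \<alpha> K_nonneg in auto)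

lemma Tc_sym: "Tc x0 i j k = Tc x0 i k j"
proof -
  have "Ck 2 (ball c R) (pd i \<rho>)" using \<rho>3 by (simp add: numeral_3_eq_3 numeral_2_eq_2)
  from pd_commute[OF open_ball this x0R] show ?thesis by (simp add: Tc_def)
qed

lemma Ec_sym: "Ec x0 j k = Ec x0 k j"
proof -
  have "Ck 2 (ball c R) \<rho>" using \<rho>3 Ck_mono[of 3 _ \<rho> 2] by simp
  from pd_commute[OF open_ball this x0R] show ?thesis by (simp add: Ec_def)
qed

lemma \<rho>_diffs:
  assumes "y \<in> ball c R"
  shows "\<rho> differentiable at y" "pd i \<rho> differentiable at y" "pd j (pd i \<rho>) differentiable at y"
  using \<rho>3 assms by (auto simp: numeral_3_eq_3)

lemma jet_\<rho>2:
  assumes y: "y \<in> ball c R"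
  shows "\<bar>pd j (pd i \<rho>) y - Ec x0 i j - hrow (Tc x0 i) j \<bullet> (y - x0)\<bar> <= 3 * M * norm (y - x0) powr (\<alpha> + 1)" (is "\<bar>?F y\<bar> <= _")
proof (rule taylor_ball[where F="?F" and c=c and R=R])
  show "?F differentiable at z" if "z \<in> ball c R" for z
    by (intro differentiable_diff \<rho>_diffs[OF that] differentiable_const inner_shift_differentiable)
  show "norm (grad ?F z) <= 3 * M * norm (z - x0) powr \<alpha>" if "z \<in> ball c R" for z
    by (rule norm_grad_le') (use \<rho>h[OF that x0R, of i j] in \<open>simp add: pd_diff_affine[OF \<rho>_diffs(3)[OF that]] Tc_def\<close>)
qed (use x0R y M1 \<alpha> in \<open>auto simp: Ec_def\<close>)

lemma jet_\<rho>1: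
  assumes y: "y \<in> ball c R"
  shows "\<bar>pd i \<rho> y - pd i \<rho> x0 - hrow (Ec x0) i \<bullet> (y - x0) - 1 / 2 * quad (Tc x0 i) x0 y\<bar>
    <= 9 * M * norm (y - x0) powr (\<alpha> + 1 + 1)" (is "\<bar>?F y\<bar> <= _")
proof (rule taylor_ball[where F="?F" and c=c and R=R])
  show "?F differentiable at z" if "z \<in> ball c R" for z
    by (intro differentiable_diff differentiable_mult \<rho>_diffs[OF that] differentiable_const inner_shift_differentiable quad_differentiable)
  show "norm (grad ?F z) <= 9 * M * norm (z - x0) powr (\<alpha> + 1)" if "z \<in> ball c R" for z
    using norm_grad_le'[of ?F z "3 * M"] jet_\<rho>2[OF that, of _ i]
    by (simp only: pd_diff_jet[OF \<rho>_diffs(2)[OF that] Tc_sym]) simp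
qed (use x0R y M1 \<alpha> in \<open>auto simp: quad_def\<close>)

lemma jet_\<rho>1':
  assumes y: "y \<in> ball c R"
  shows "\<bar>pd i \<rho> y - pd i \<rho> x0 - hrow (Ec x0) i \<bullet> (y - x0)\<bar> <= 9 * M * norm (y - x0) powr (1 + 1)" (is "\<bar>?F y\<bar> <= _")
proof (rule taylor_ball[where F="?F" and c=c and R=R])
  show "?F differentiable at z" if "z \<in> ball c R" for z
    by (intro differentiable_diff \<rho>_diffs[OF that] differentiable_const inner_shift_differentiable)
  show "norm (grad ?F z) <= 9 * M * norm (z - x0) powr 1" if "z \<in> ball c R" for z
  proof -
    have "\<bar>pd j (pd i \<rho>) z - Ec x0 i j\<bar> <= 3 * M * norm (z - x0)" for j
      unfolding Ec_def pds_Cons pds_Nil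
    proof (rule mvt_grad[where U="ball c R"])
      show seg: "closed_segment z x0 \<subseteq> ball c R" by (rule closed_segment_subset[OF that x0R convex_ball])
      show "norm (grad (pd j (pd i \<rho>)) w) <= 3 * M" if "w \<in> closed_segment z x0" for w
        by (rule norm_grad_le) (use \<rho>b[of w "[i, j, k]" for k] seg that in auto)
    qed (use \<rho>_diffs in blast)
    then show ?thesis using norm_grad_le'[of ?F z "3 * M"] by (simp add: pd_diff_affine[OF \<rho>_diffs(2)[OF that]])
  qed
qed (use x0R y M1 in auto)

lemma jet_\<rho>0':
  assumes y: "y \<in> ball c R"
  shows "\<bar>pd i \<rho> y - pd i \<rho> x0\<bar> <= 3 * M * norm (y - x0)"
proof (rule mvt_grad[where U="ball c R"])
  show seg: "closed_segment y x0 \<subseteq> ball c R" by (rule closed_segment_subset[OF y x0R convex_ball])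
  show "norm (grad (pd i \<rho>) w) <= 3 * M" if "w \<in> closed_segment y x0" for w
    by (rule norm_grad_le) (use \<rho>b[of w "[i, k]" for k] seg that in auto)
qed (use \<rho>_diffs in blast)

lemma jet_\<rho>0:
  assumes y: "y \<in> ball c R"
  shows "\<bar>\<rho> y - grad \<rho> x0 \<bullet> (y - x0) - 1 / 2 * quad (Ec x0) x0 y\<bar> <= 27 * M * norm (y - x0) powr (2 + 1)"
proof -
  let ?F = "%y. \<rho> y - 0 - grad \<rho> x0 \<bullet> (y - x0) - 1 / 2 * quad (Ec x0) x0 y"
  have "\<bar>?F y\<bar> <= 27 * M * norm (y - x0) powr (2 + 1)"
  proof (rule taylor_ball[where F="?F" and c=c and R=R])
    show "?F differentiable at z" if "z \<in> ball c R" for z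
      by (intro differentiable_diff differentiable_mult \<rho>_diffs[OF that] differentiable_const inner_shift_differentiable quad_differentiable)
    show "norm (grad ?F z) <= 27 * M * norm (z - x0) powr 2" if "z \<in> ball c R" for z
      using norm_grad_le'[of ?F z "9 * M"] jet_\<rho>1'[OF that]
      by (simp only: pd_diff_jet[OF \<rho>_diffs(1)[OF that] Ec_sym]) (simp add: grad_def)
    show "?F x0 = 0" using bdry[OF x0R] x0(1) by (simp add: quad_def)
  qed (use x0R y M1 in auto)
  then show ?thesis by simp
qed

end

end

section \<open>The Neumann condition expanded along the boundary\<close>

lemma abs_mult_le: "\<bar>a\<bar> <= A ==> \<bar>b\<bar> <= B ==> \<bar>a * b\<bar> <= A * B" for a :: real
  by (simp add: abs_mult mult_mono)

lemma laplacian_diff: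
  assumes U: "open U" "x \<in> U" and f: "Ck 2 U f" and g: "Ck 2 U g"
  shows "laplacian (%x. f x - g x) x = laplacian f x - laplacian g x"
proof -
  have "pd i (pd i (%x. f x - g x)) x = pd i (pd i f) x - pd i (pd i g) x" for i
  proof -
    have "pd i (pd i (%x. f x - g x)) x = pd i (%x. pd i f x - pd i g x) x"
      by (rule pd_cong[OF U]) (use f g in \<open>auto simp: numeral_2_eq_2 intro!: pd_diff\<close>)
    also have "... = pd i (pd i f) x - pd i (pd i g) x"
      by (rule pd_diff) (use f g U in \<open>auto simp: numeral_2_eq_2\<close>)
    finally show ?thesis .
  qed
  then show ?thesis by (simp add: laplacian_def sum_subtractf)
qed

lemma quad_add: "quad (%j k. A j k + B j k) x0 y = quad A x0 y + quad B x0 y"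
  by (simp add: quad_def sum_3 algebra_simps)

lemma quad_diff: "quad (%j k. A j k - B j k) x0 y = quad A x0 y - quad B x0 y"
  by (simp add: quad_def sum_3 algebra_simps)

lemma quad_cmult: "quad (%j k. a * A j k) x0 y = a * quad A x0 y"
  by (simp add: quad_def sum_3 algebra_simps)

lemma quad_sum: "quad (%j k. \<Sum>i\<in>(UNIV::3 set). A i j k) x0 y = (\<Sum>i\<in>UNIV. quad (A i) x0 y)"
  by (simp only: sum_3 quad_add)

lemma quad_product: "quad (%j k. A i j * B i k) x0 y = (hrow A i \<bullet> (y - x0)) * (hrow B i \<bullet> (y - x0))"
  by (simp add: quad_def inner_vec_def sum_product mult_ac)

context neumann_chart
begin

text \<open>Bounds everything that \<open>cubic_corrector\<close> receives: the norm of
  \<open>grad \<rho> x0\<close> and its inverse, the gradient of \<open>g\<close>, and the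
  coefficients \<open>Sc\<close>.\<close>

definition SB where "SB = 3 * M + 1 / m + 9 * M\<^sup>2 / 2 + 9 * M ^ 3 / m"

context
  fixes x0
  assumes x0: "x0 \<in> frontier \<Omega>" "x0 \<in> ball c (R / 2)"
begin

lemmas x0_facts = x0R[OF x0] x0cl[OF x0] sub3[OF x0]

lemma rho_x0: "\<rho> x0 = 0" using bdry[of x0] x0 x0_facts by blast

lemma norm_grad_x0: "m <= norm (grad \<rho> x0)" "norm (grad \<rho> x0) <= 3 * M"
proof -
  show "norm (grad \<rho> x0) <= 3 * M" by (rule grad\<rho>_le[OF x0_facts(1)])
  have "m <= grad \<rho> x0 \<bullet> \<nu>" by (rule transversal[OF x0_facts(1)])
  also have "... <= norm (grad \<rho> x0) * norm \<nu>" by (rule norm_cauchy_schwarz)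
  finally show "m <= norm (grad \<rho> x0)" using unit\<nu> by simp
qed

lemma H_le: "\<bar>Hc x0 i j\<bar> <= M" using abs_ub[OF x0, of "[i, j]"] by (simp add: Hc_def)
lemma p_le: "\<bar>pv x0 $ i\<bar> <= M" using abs_ub[OF x0, of "[i]"] by (simp add: pv_def)
lemma E_le: "\<bar>Ec x0 i j\<bar> <= M" using \<rho>b[OF x0_facts(1), of "[i, j]"] by (simp add: Ec_def)
lemma T_le: "\<bar>Tc x0 i j k\<bar> <= M" using \<rho>b[OF x0_facts(1), of "[i, j, k]"] by (simp add: Tc_def)

lemma row_le: "(!!k. \<bar>S i k\<bar> <= M) ==> \<bar>hrow S i \<bullet> h\<bar> <= 3 * M * norm h"
  using norm_row[of S i M] by (meson Cauchy_Schwarz_ineq2 mult_right_mono norm_ge_zero order_trans)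

lemma jet_u1b:
  assumes y: "y \<in> closure \<Omega>" "norm (y - x0) < r1"
  shows "\<bar>ub [i] y - pd i (T2 x0) y\<bar> <= K1 * norm (y - x0) powr (\<alpha> + 1)"
proof (rule le_on_closure_ball[where S=\<Omega> and ?x0.0=x0 and r=r1 and f="%y. \<bar>ub [i] y - pd i (T2 x0) y\<bar>"])
  show "continuous_on (closure \<Omega>) (%y. \<bar>ub [i] y - pd i (T2 x0) y\<bar>)"
    unfolding pd_T2[OF x0] by (intro continuous_intros ub(1)) simp
  show "continuous_on (closure \<Omega>) (%y. K1 * norm (y - x0) powr (\<alpha> + 1))"
    by (intro continuous_on_mult continuous_on_const continuous_on_norm_powr) (use \<alpha> in simp)
  fix y assume "y \<in> \<Omega>" "y \<in> ball x0 r1"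
  then show "\<bar>ub [i] y - pd i (T2 x0) y\<bar> <= K1 * norm (y - x0) powr (\<alpha> + 1)"
    using jet_u1[OF x0, of y i] ub(2)[of "[i]" y] by (simp add: dist_norm norm_minus_commute)
qed (use y in \<open>auto simp: dist_norm norm_minus_commute\<close>)

text \<open>The linear coefficient at \<open>x0\<close> of the inner product of
  \<open>grad u\<close> and \<open>grad \<rho>\<close>, a function that vanishes on the
  frontier.\<close>

definition c1 where "c1 = (\<chi> j. \<Sum>i\<in>UNIV. Hc x0 i j * pd i \<rho> x0 + pv x0 $ i * Ec x0 i j)"

lemma c1_inner: "c1 \<bullet> h = (\<Sum>i\<in>UNIV. (hrow (Hc x0) i \<bullet> h) * pd i \<rho> x0 + pv x0 $ i * (hrow (Ec x0) i \<bullet> h))"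
  by (simp add: c1_def inner_vec_def sum_3 algebra_simps)

lemma norm_c1: "norm c1 <= 18 * M\<^sup>2"
proof -
  have "\<bar>c1 $ j\<bar> <= 6 * M\<^sup>2" for j
  proof -
    have "\<bar>c1 $ j\<bar> <= (\<Sum>i\<in>UNIV. \<bar>Hc x0 i j * pd i \<rho> x0 + pv x0 $ i * Ec x0 i j\<bar>)" by (simp add: c1_def sum_abs)
    also have "... <= (\<Sum>i\<in>(UNIV::3 set). M * M + M * M)"
    proof (rule sum_mono)
      fix i
      have "\<bar>Hc x0 i j * pd i \<rho> x0\<bar> <= M * M" by (rule abs_mult_le[OF H_le]) (use \<rho>b[OF x0_facts(1), of "[i]"] in simp)
      moreover have "\<bar>pv x0 $ i * Ec x0 i j\<bar> <= M * M" by (rule abs_mult_le[OF p_le E_le])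
      ultimately show "\<bar>Hc x0 i j * pd i \<rho> x0 + pv x0 $ i * Ec x0 i j\<bar> <= M * M + M * M" by linarith
    qed
    finally show ?thesis by (simp add: power2_eq_square)
  qed
  then have "norm c1 <= (\<Sum>j\<in>(UNIV::3 set). 6 * M\<^sup>2)" by (intro order_trans[OF norm_le_l1_cart] sum_mono)
  then show ?thesis by simp
qed

lemma p_grad: "(\<Sum>i\<in>UNIV. pv x0 $ i * pd i \<rho> x0) = 0"
  using neumann[OF x0(1) x0_facts(1)] by (simp add: pv_def)

context
  fixes y t
  assumes y: "y \<in> frontier \<Omega>" and t: "t = norm (y - x0)" "t < r2" "t <= 1"
begin

lemma y_facts: "y \<in> ball c R" "y \<in> closure \<Omega>" "t >= 0" "norm (y - x0) < r1"
  "t\<^sup>2 <= t powr (1 + \<alpha>)" "t ^ 3 <= t powr (2 + \<alpha>)" "t * t powr (\<alpha> + 1) = t powr (2 + \<alpha>)"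
proof -
  have "dist x0 y < R / 3" using t r_pos Rpos by (simp add: dist_norm norm_minus_commute)
  then have "y \<in> cball x0 (R / 3)" by simp
  then show "y \<in> ball c R" using x0_facts(3) by blast
  show "y \<in> closure \<Omega>" using y by (simp add: frontier_def)
  show t0: "t >= 0" using t by simp
  show "norm (y - x0) < r1" using t r_pos by simp
  have p: "t powr (real n) <= t powr s" if "s <= real n" "s > 0" for n s
    by (cases "t = 0") (use that t0 t(3) in \<open>auto intro!: powr_mono'\<close>)
  have e: "t powr (real n) = t ^ n" if "n > 0" for n
    using powr_realpow'[OF t0, of n] that by simp
  show "t\<^sup>2 <= t powr (1 + \<alpha>)" using p[of "1 + \<alpha>" 2] e[of 2] \<alpha> by simp
  show "t ^ 3 <= t powr (2 + \<alpha>)" using p[of "2 + \<alpha>" 3] e[of 3] \<alpha> by simp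
  show "t * t powr (\<alpha> + 1) = t powr (2 + \<alpha>)"
    using powr_add[of t 1 "\<alpha> + 1"] t0 by (simp add: add.commute add.left_commute)
qed

lemma bdry_jets:
  "\<bar>ub [i] y - (pv x0 $ i + hrow (Hc x0) i \<bullet> (y - x0))\<bar> <= K1 * t powr (\<alpha> + 1)"
  "\<bar>pd i \<rho> y\<bar> <= M" "\<bar>pd i \<rho> y - pd i \<rho> x0\<bar> <= 3 * M * t"
  "\<bar>pd i \<rho> y - pd i \<rho> x0 - hrow (Ec x0) i \<bullet> (y - x0)\<bar> <= 9 * M * t\<^sup>2"
  "\<bar>pd i \<rho> y - pd i \<rho> x0 - hrow (Ec x0) i \<bullet> (y - x0) - 1 / 2 * quad (Tc x0 i) x0 y\<bar> <= 9 * M * t powr (2 + \<alpha>)"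
  "\<bar>hrow (Hc x0) i \<bullet> (y - x0)\<bar> <= 3 * M * t"
proof -
  note t' = t(1)[symmetric]
  show "\<bar>ub [i] y - (pv x0 $ i + hrow (Hc x0) i \<bullet> (y - x0))\<bar> <= K1 * t powr (\<alpha> + 1)"
    using jet_u1b[OF y_facts(2,4), of i] by (simp add: pd_T2[OF x0] t')
  show "\<bar>pd i \<rho> y\<bar> <= M" using \<rho>b[OF y_facts(1), of "[i]"] by simp
  show "\<bar>pd i \<rho> y - pd i \<rho> x0\<bar> <= 3 * M * t" using jet_\<rho>0'[OF x0 y_facts(1), of i] by (simp add: t')
  have "t powr 2 = t\<^sup>2" using powr_realpow'[OF y_facts(3), of 2] by simp
  then show "\<bar>pd i \<rho> y - pd i \<rho> x0 - hrow (Ec x0) i \<bullet> (y - x0)\<bar> <= 9 * M * t\<^sup>2"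
    using jet_\<rho>1'[OF x0 y_facts(1), of i] by (simp add: t')
  have "\<alpha> + 1 + 1 = 2 + \<alpha>" by simp
  then show "\<bar>pd i \<rho> y - pd i \<rho> x0 - hrow (Ec x0) i \<bullet> (y - x0) - 1 / 2 * quad (Tc x0 i) x0 y\<bar> <= 9 * M * t powr (2 + \<alpha>)"
    using jet_\<rho>1[OF x0 y_facts(1), of i] by (simp only: t')
  show "\<bar>hrow (Hc x0) i \<bullet> (y - x0)\<bar> <= 3 * M * t" unfolding t by (rule row_le[OF H_le])
qed

text \<open>The product of the gradients vanishes exactly at \<open>y\<close> and at
  \<open>x0\<close>. Therefore its linear part equals minus the Taylor error, of order
  \<open>1 + \<alpha>\<close> because the Hessian of \<open>u\<close> is only Hoelder
  continuous.\<close>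

lemma c1_small: "\<bar>c1 \<bullet> (y - x0)\<bar> <= 3 * (K1 * M + 18 * M\<^sup>2) * t powr (1 + \<alpha>)"
proof -
  let ?h = "y - x0"
  have *: "\<bar>ub [i] y * pd i \<rho> y - pv x0 $ i * pd i \<rho> x0 - ((hrow (Hc x0) i \<bullet> ?h) * pd i \<rho> x0 + pv x0 $ i * (hrow (Ec x0) i \<bullet> ?h))\<bar>
      <= (K1 * M + 18 * M\<^sup>2) * t powr (1 + \<alpha>)" for i
  proof -
    have a: "\<bar>(ub [i] y - (pv x0 $ i + hrow (Hc x0) i \<bullet> ?h)) * pd i \<rho> y\<bar> <= (K1 * t powr (\<alpha> + 1)) * M"
      by (rule abs_mult_le[OF bdry_jets(1,2)])
    have b: "\<bar>pv x0 $ i * (pd i \<rho> y - pd i \<rho> x0 - hrow (Ec x0) i \<bullet> ?h)\<bar> <= M * (9 * M * t\<^sup>2)"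
      by (rule abs_mult_le[OF p_le bdry_jets(4)])
    have c: "\<bar>(hrow (Hc x0) i \<bullet> ?h) * (pd i \<rho> y - pd i \<rho> x0)\<bar> <= (3 * M * t) * (3 * M * t)"
      by (rule abs_mult_le[OF bdry_jets(6,3)])
    have "ub [i] y * pd i \<rho> y - pv x0 $ i * pd i \<rho> x0 - ((hrow (Hc x0) i \<bullet> ?h) * pd i \<rho> x0 + pv x0 $ i * (hrow (Ec x0) i \<bullet> ?h))
      = (ub [i] y - (pv x0 $ i + hrow (Hc x0) i \<bullet> ?h)) * pd i \<rho> y + pv x0 $ i * (pd i \<rho> y - pd i \<rho> x0 - hrow (Ec x0) i \<bullet> ?h)
        + (hrow (Hc x0) i \<bullet> ?h) * (pd i \<rho> y - pd i \<rho> x0)" by (simp add: algebra_simps)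
    then have "\<bar>ub [i] y * pd i \<rho> y - pv x0 $ i * pd i \<rho> x0 - ((hrow (Hc x0) i \<bullet> ?h) * pd i \<rho> x0 + pv x0 $ i * (hrow (Ec x0) i \<bullet> ?h))\<bar>
      <= (K1 * t powr (\<alpha> + 1)) * M + M * (9 * M * t\<^sup>2) + (3 * M * t) * (3 * M * t)" using a b c by linarith
    also have "... = K1 * M * t powr (1 + \<alpha>) + 18 * M\<^sup>2 * t\<^sup>2" by (simp add: power2_eq_square algebra_simps)
    also have "... <= K1 * M * t powr (1 + \<alpha>) + 18 * M\<^sup>2 * t powr (1 + \<alpha>)"
      using y_facts(5) by (intro add_left_mono mult_left_mono) auto
    finally show ?thesis by (simp add: algebra_simps)
  qed
  have eq: "c1 \<bullet> ?h = - (\<Sum>i\<in>UNIV. ub [i] y * pd i \<rho> y - pv x0 $ i * pd i \<rho> x0 - ((hrow (Hc x0) i \<bullet> ?h) * pd i \<rho> x0 + pv x0 $ i * (hrow (Ec x0) i \<bullet> ?h)))"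
    using neumann[OF y y_facts(1)] p_grad by (simp add: sum_subtractf c1_inner)
  have "\<bar>c1 \<bullet> ?h\<bar> <= (\<Sum>i\<in>(UNIV::3 set). (K1 * M + 18 * M\<^sup>2) * t powr (1 + \<alpha>))"
    unfolding eq abs_minus_cancel by (rule order_trans[OF sum_abs sum_mono[OF *]])
  then show ?thesis by (simp add: algebra_simps)
qed

text \<open>\<open>\<rho>\<close> vanishes at \<open>y\<close>, so its linear part is minus half of
  its quadratic form up to third order. In particular the frontier departs quadratically from the
  tangent plane.\<close>

lemma grad_inner_small:
  "\<bar>grad \<rho> x0 \<bullet> (y - x0) + 1 / 2 * quad (Ec x0) x0 y\<bar> <= 27 * M * t ^ 3"
  "\<bar>grad \<rho> x0 \<bullet> (y - x0)\<bar> <= 45 * M * t\<^sup>2"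
proof -
  have "\<rho> y = 0" using bdry[OF y_facts(1)] y by simp
  moreover have "t powr (2 + 1) = t ^ 3" using powr_realpow'[OF y_facts(3), of 3] by simp
  ultimately show *: "\<bar>grad \<rho> x0 \<bullet> (y - x0) + 1 / 2 * quad (Ec x0) x0 y\<bar> <= 27 * M * t ^ 3"
    using jet_\<rho>0[OF x0 y_facts(1)] by (simp add: t(1)[symmetric])
  have "\<bar>quad (Ec x0) x0 y\<bar> <= 36 * M * t\<^sup>2" unfolding t(1) by (rule quad_bound[OF E_le]) (use M1 in simp)
  moreover have "M * t ^ 3 <= M * t\<^sup>2"
    using M1 y_facts(3) t(3) by (intro mult_left_mono power_decreasing) auto
  ultimately show "\<bar>grad \<rho> x0 \<bullet> (y - x0)\<bar> <= 45 * M * t\<^sup>2" using * by linarith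
qed

end

text \<open>At \<open>x0 + t *\<^sub>R \<tau>\<close> the value of \<open>\<rho>\<close> is of order
  \<open>t\<^sup>2\<close>, so \<open>frontier_near\<close> finds a frontier point at such a
  distance. There \<open>c1_small\<close> applies; after division by \<open>t\<close> an error of
  order \<open>t powr \<alpha>\<close> remains, which tends to zero.\<close>

lemma c1_tangent:
  assumes \<tau>: "\<tau> \<bullet> grad \<rho> x0 = 0" "norm \<tau> = 1" shows "c1 \<bullet> \<tau> = 0"
proof -
  \<comment> \<open>\<open>\<bar>\<rho>\<bar>\<close> is at most \<open>45 * M * t\<^sup>2\<close>
    at the tangential point, and \<open>frontier_near\<close> divides by \<open>m\<close>.\<close>
  define K where "K = 45 * M / m"
  have K: "K >= 1"
  proof -
    have "m <= 3 * M" using norm_grad_x0 by linarith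
    then show ?thesis using m by (simp add: K_def)
  qed
  define Q where "Q = 3 * (K1 * M + 18 * M\<^sup>2) * (1 + K) powr (1 + \<alpha>) + norm c1 * K"
  \<comment> \<open>Keeps the frontier point, at distance at most \<open>(1 + K) * t\<close> from
    \<open>x0\<close>, within 1 and within \<open>r2\<close>.\<close>
  define t0 where "t0 = min (1 / (1 + K)) (r2 / (2 * (1 + K)))"
  have t0: "t0 > 0" using K r_pos by (simp add: t0_def)
  have bd: "\<bar>c1 \<bullet> \<tau>\<bar> <= Q * t powr \<alpha>" if t: "0 < t" "t < t0" for t
  proof -
    have t1: "(1 + K) * t < 1" "(1 + K) * t < r2"
    proof -
      have "(1 + K) * t < (1 + K) * t0" using t K by (intro mult_strict_left_mono) auto
      moreover have "(1 + K) * t0 <= (1 + K) * (1 / (1 + K))" "(1 + K) * t0 <= (1 + K) * (r2 / (2 * (1 + K)))"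
        using K by (intro mult_left_mono; simp add: t0_def)+
      moreover have "(1 + K) * (1 / (1 + K)) = 1" "(1 + K) * (r2 / (2 * (1 + K))) = r2 / 2" using K by (simp_all add: field_simps)
      ultimately show "(1 + K) * t < 1" "(1 + K) * t < r2" using r_pos by linarith+
    qed
    have tK: "0 <= K * t" "K * t <= 1" "t <= 1" "K * t\<^sup>2 <= K * t"
    proof -
      show Kt: "0 <= K * t" using t K by simp
      show "K * t <= 1" "t <= 1" using t1(1) t Kt by (auto simp: distrib_right)
      then show "K * t\<^sup>2 <= K * t" using Kt mult_left_le[of t "K * t"] by (simp add: power2_eq_square)
    qed
    let ?p = "x0 + t *\<^sub>R \<tau>"
    have pR: "?p \<in> ball c R"
    proof -
      have "t < R / 3" using t1 t K r_pos Rpos by (simp add: algebra_simps) (use tK in linarith)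
      then have "?p \<in> cball x0 (R / 3)" using t \<tau>(2) by (simp add: dist_norm)
      then show ?thesis using x0_facts(3) by blast
    qed
    have \<rho>p: "\<bar>\<rho> ?p\<bar> <= 45 * M * t\<^sup>2"
    proof -
      have "\<bar>\<rho> ?p - grad \<rho> x0 \<bullet> (?p - x0) - 1 / 2 * quad (Ec x0) x0 ?p\<bar> <= 27 * M * norm (?p - x0) powr (2 + 1)"
        by (rule jet_\<rho>0[OF x0 pR])
      moreover have "norm (?p - x0) powr (2 + 1) = t ^ 3" using t \<tau>(2) powr_realpow'[of t 3] by simp
      moreover have "grad \<rho> x0 \<bullet> (?p - x0) = 0" using \<tau>(1) by (simp add: inner_commute)
      moreover have "\<bar>quad (Ec x0) x0 ?p\<bar> <= 36 * M * (norm (?p - x0))\<^sup>2" by (rule quad_bound[OF E_le]) (use M1 in simp)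
      moreover have "M * t ^ 3 <= M * t\<^sup>2" using M1 t tK by (intro mult_left_mono power_decreasing) auto
      ultimately show ?thesis using \<tau>(2) t by simp
    qed
    then have \<rho>m: "\<bar>\<rho> ?p\<bar> / m <= K * t\<^sup>2" using m by (simp add: K_def field_simps)
    have "cball ?p (\<bar>\<rho> ?p\<bar> / m) \<subseteq> ball c R"
    proof
      fix z assume "z \<in> cball ?p (\<bar>\<rho> ?p\<bar> / m)"
      then have "dist ?p z <= K * t" using \<rho>m tK by simp
      moreover have "dist x0 ?p = t" using t \<tau>(2) by (simp add: dist_norm)
      ultimately have "dist x0 z <= (1 + K) * t" using dist_triangle[of x0 z ?p] by (simp add: algebra_simps)
      then have "z \<in> cball x0 (R / 3)" using t1 r_pos Rpos by simp
      then show "z \<in> ball c R" using x0_facts(3) by blast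
    qed
    from frontier_near[OF this] obtain s where s: "\<bar>s\<bar> <= \<bar>\<rho> ?p\<bar> / m" "?p + s *\<^sub>R \<nu> \<in> frontier \<Omega>" .
    let ?y = "?p + s *\<^sub>R \<nu>"
    have s': "\<bar>s\<bar> <= K * t\<^sup>2" using s(1) \<rho>m by simp
    have hy: "?y - x0 = t *\<^sub>R \<tau> + s *\<^sub>R \<nu>" by simp
    have "norm (?y - x0) <= norm (t *\<^sub>R \<tau>) + norm (s *\<^sub>R \<nu>)" unfolding hy by (rule norm_triangle_ineq)
    then have ny: "norm (?y - x0) <= (1 + K) * t" using \<tau>(2) unit\<nu> s' tK t by (simp add: algebra_simps)
    have "\<bar>c1 \<bullet> (?y - x0)\<bar> <= 3 * (K1 * M + 18 * M\<^sup>2) * norm (?y - x0) powr (1 + \<alpha>)"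
      by (rule c1_small[OF s(2) HOL.refl]) (use ny t1 in auto)
    also have "... <= 3 * (K1 * M + 18 * M\<^sup>2) * ((1 + K) * t) powr (1 + \<alpha>)"
      using ny \<alpha> K_nonneg M1 by (intro mult_left_mono powr_mono2) auto
    also have "((1 + K) * t) powr (1 + \<alpha>) = (1 + K) powr (1 + \<alpha>) * (t * t powr \<alpha>)"
      using K t by (simp add: powr_mult powr_add)
    finally have 1: "\<bar>c1 \<bullet> (?y - x0)\<bar> <= 3 * (K1 * M + 18 * M\<^sup>2) * ((1 + K) powr (1 + \<alpha>) * (t * t powr \<alpha>))" .
    have "\<bar>s * (c1 \<bullet> \<nu>)\<bar> <= (K * t\<^sup>2) * (norm c1 * 1)"
      by (rule abs_mult_le[OF s']) (use Cauchy_Schwarz_ineq2[of c1 \<nu>] unit\<nu> in simp)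
    also have "... <= (K * (t * t powr \<alpha>)) * (norm c1 * 1)"
    proof (rule mult_right_mono[OF mult_left_mono])
      have "t powr 1 <= t powr \<alpha>" using tK t \<alpha> by (intro powr_mono') auto
      then show "t\<^sup>2 <= t * t powr \<alpha>" using t by (simp add: power2_eq_square)
    qed (use K in auto)
    finally have 2: "\<bar>s * (c1 \<bullet> \<nu>)\<bar> <= (K * (t * t powr \<alpha>)) * (norm c1 * 1)" .
    have "t * (c1 \<bullet> \<tau>) = c1 \<bullet> (?y - x0) - s * (c1 \<bullet> \<nu>)" unfolding hy by (simp add: inner_add_right)
    then have "\<bar>t * (c1 \<bullet> \<tau>)\<bar> <= \<bar>c1 \<bullet> (?y - x0)\<bar> + \<bar>s * (c1 \<bullet> \<nu>)\<bar>" by linarith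
    also have "... <= Q * t powr \<alpha> * t" using 1 2 unfolding Q_def by (simp add: algebra_simps)
    finally show ?thesis using t by (simp add: abs_mult)
  qed
  have "\<bar>c1 \<bullet> \<tau>\<bar> <= 0"
  proof (rule tendsto_lowerbound)
    have "((%t. Q * t powr \<alpha>) \<longlongrightarrow> Q * 0 powr \<alpha>) (at_right 0)"
      by (intro tendsto_intros tendsto_powr' ) (use \<alpha> in \<open>auto simp: eventually_at_right_field intro!: exI[of _ 1]\<close>)
    then show "((%t. Q * t powr \<alpha>) \<longlongrightarrow> 0) (at_right 0)" by simp
    show "\<forall>\<^sub>F t in at_right 0. \<bar>c1 \<bullet> \<tau>\<bar> <= Q * t powr \<alpha>"
      unfolding eventually_at_right_field using bd t0 by (intro exI[of _ t0]) auto
  qed simp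
  then show ?thesis by simp
qed

text \<open>A Lagrange multiplier: the linear coefficient of a function that vanishes on the level
  set of \<open>\<rho>\<close> is a multiple of \<open>grad \<rho> x0\<close>, and \<theta> is this
  multiple.\<close>

definition \<theta> where "\<theta> = (c1 \<bullet> grad \<rho> x0) / (norm (grad \<rho> x0))\<^sup>2"

lemma c1_eq: "c1 = \<theta> *\<^sub>R grad \<rho> x0"
proof (rule ccontr)
  assume ne: "c1 \<noteq> \<theta> *\<^sub>R grad \<rho> x0"
  define v where "v = c1 - \<theta> *\<^sub>R grad \<rho> x0"
  have g: "grad \<rho> x0 \<noteq> 0" using norm_grad_x0 m by auto
  have v: "v \<noteq> 0" using ne by (simp add: v_def)
  have vg: "v \<bullet> grad \<rho> x0 = 0"
    using g by (simp add: v_def \<theta>_def inner_diff_left power2_norm_eq_inner)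
  have "c1 \<bullet> ((1 / norm v) *\<^sub>R v) = 0" by (rule c1_tangent) (use v vg in auto)
  then have "c1 \<bullet> v = 0" using v by simp
  moreover have "c1 \<bullet> v = v \<bullet> v" using vg by (simp add: v_def inner_diff_left inner_diff_right inner_commute)
  ultimately show False using v by simp
qed

lemma \<theta>_le: "\<bar>\<theta>\<bar> <= 18 * M\<^sup>2 / m"
proof -
  have "\<bar>\<theta>\<bar> * m <= \<bar>\<theta>\<bar> * norm (grad \<rho> x0)" using norm_grad_x0 by (intro mult_left_mono) auto
  also have "... = norm c1" by (subst c1_eq) simp
  finally show ?thesis using norm_c1 m by (simp add: field_simps)
qed

text \<open>The quadratic part on the frontier of the inner product of the gradients of
  \<open>T2 x0\<close> and \<open>\<rho>\<close>. Its last term arises from the linear part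
  \<open>\<theta> * (grad \<rho> x0 \<bullet> (y - x0))\<close>, which the equation
  \<open>\<rho> y = 0\<close> of the frontier turns into a quadratic form up to third order.\<close>

definition Sc where "Sc j k = (\<Sum>i\<in>UNIV. Hc x0 i j * Ec x0 i k + 1 / 2 * (pv x0 $ i * Tc x0 i j k)) - 1 / 2 * (\<theta> * Ec x0 j k)"

lemma Sc_le: "\<bar>Sc j k\<bar> <= SB"
proof -
  have "\<bar>Hc x0 i j * Ec x0 i k + 1 / 2 * (pv x0 $ i * Tc x0 i j k)\<bar> <= 3 / 2 * M\<^sup>2" for i
    using abs_mult_le[OF H_le[of i j] E_le[of i k]] abs_mult_le[OF p_le[of i] T_le[of i j k]]
    unfolding power2_eq_square by linarith
  then have "\<bar>\<Sum>i\<in>UNIV. Hc x0 i j * Ec x0 i k + 1 / 2 * (pv x0 $ i * Tc x0 i j k)\<bar> <= (\<Sum>i\<in>(UNIV::3 set). 3 / 2 * M\<^sup>2)"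
    by (intro order_trans[OF sum_abs sum_mono])
  moreover have "\<bar>\<theta> * Ec x0 j k\<bar> <= 18 * M\<^sup>2 / m * M" by (rule abs_mult_le[OF \<theta>_le E_le])
  moreover have "18 * M\<^sup>2 / m * M = 18 * M ^ 3 / m" by (simp add: power2_eq_square power3_eq_cube)
  moreover have "(\<Sum>i\<in>(UNIV::3 set). 3 / 2 * M\<^sup>2) = 9 * M\<^sup>2 / 2" by simp
  ultimately have "\<bar>Sc j k\<bar> <= 9 * M\<^sup>2 / 2 + 9 * M ^ 3 / m" unfolding Sc_def by linarith
  then show ?thesis using M1 m unfolding SB_def by (smt (verit) divide_pos_pos)
qed

lemma quad_Sc: "quad Sc x0 y = (\<Sum>i\<in>UNIV. (hrow (Hc x0) i \<bullet> (y - x0)) * (hrow (Ec x0) i \<bullet> (y - x0))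
    + 1 / 2 * (pv x0 $ i * quad (Tc x0 i) x0 y)) - 1 / 2 * (\<theta> * quad (Ec x0) x0 y)"
  unfolding Sc_def[abs_def]
  by (simp only: quad_diff quad_sum quad_add quad_product quad_cmult)

end

end

section \<open>The remainder after subtraction of the cubic polynomial\<close>

lemma powr_le_of_le_one:
  fixes t :: real
  assumes "0 <= t" "t <= 1" "n > 0" "s <= real n" "s > 0" shows "t ^ n <= t powr s"
proof -
  have "t powr (real n) <= t powr s" by (cases "t = 0") (use assms in \<open>auto intro!: powr_mono'\<close>)
  then show ?thesis using powr_realpow'[of t n] assms by simp
qed

context neumann_chart
begin

abbreviation unit_grad where "unit_grad x \<equiv> (1 / norm (grad \<rho> x)) *\<^sub>R grad \<rho> x"

text \<open>The conclusion of \<open>cubic_corrector\<close> when \<open>n / \<kappa>\<close> is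
  \<open>grad \<rho> x0\<close>, that is, when \<open>\<kappa>\<close> is the inverse of the norm of
  this gradient.\<close>

definition corrector where "corrector C x0 P \<longleftrightarrow> form 3 C x0 P \<and> (\<forall>y. laplacian P y = \<gamma>v x0 \<bullet> (y - x0)) \<and>
  (\<forall>y. \<bar>(\<Sum>i\<in>UNIV. pd i \<rho> x0 * pd i P y) + quad (Sc x0) x0 y\<bar> <= C * (\<bar>grad \<rho> x0 \<bullet> (y - x0)\<bar> / m) * norm (y - x0))"

definition approximates where "approximates A r0 x0 P \<longleftrightarrow> Pol 3 P \<and> (\<exists>gw wb pb. Ck 2 \<Omega> gw \<and>
  (\<forall>y\<in>\<Omega>. laplacian (%y. u y - P y) y = gw y) \<and> (\<forall>i j. \<forall>y\<in>\<Omega>. \<bar>pd i (pd j gw) y\<bar> <= A) \<and>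
  remainder_bound A \<alpha> r0 x0 (unit_grad x0) (norm (grad \<rho> x0)) (%y. u y - P y) wb pb)"

context
  fixes x0 C P3
  assumes x0: "x0 \<in> frontier \<Omega>" "x0 \<in> ball c (R / 2)"
    and P3_corrector: "corrector C x0 P3"
begin

lemma P3: "form 3 C x0 P3" "laplacian P3 y = \<gamma>v x0 \<bullet> (y - x0)"
  "\<bar>(\<Sum>i\<in>UNIV. pd i \<rho> x0 * pd i P3 y) + quad (Sc x0) x0 y\<bar> <= C * (\<bar>grad \<rho> x0 \<bullet> (y - x0)\<bar> / m) * norm (y - x0)"
  using P3_corrector by (auto simp: corrector_def)

lemma C_nonneg: "C >= 0" using form_nonneg[OF P3(1)] .

lemma P3_le: "\<bar>P3 y\<bar> <= C * norm (y - x0) ^ 3" "\<bar>pd i P3 y\<bar> <= C * (norm (y - x0))\<^sup>2"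
  using P3(1) by (auto simp: numeral_3_eq_3 numeral_2_eq_2)

lemma Ck_T2: "Ck k U (T2 x0)" and Ck_P3: "Ck k U P3"
  using Ck_subset[OF Pol_Ck[OF form_T2_parts[OF x0]]] Ck_subset[OF Pol_Ck[OF form_Pol[OF P3(1)]]] by auto

text \<open>On the frontier the terms of order 0 vanish by the Neumann condition at
  \<open>x0\<close>, those of order 1 are turned by \<theta> into terms of order 2, and these the
  corrector cancels. Four errors of order \<open>2 + \<alpha>\<close> are left: \<open>D\<close>
  from the expansion of the product, \<open>S1\<close> from freezing \<open>grad \<rho>\<close> at
  \<open>x0\<close>, \<open>S2\<close> from the corrector, and \<open>S3\<close> from the expansion
  of \<open>\<rho>\<close> on the frontier.\<close>

lemma corrected_gradient:
  assumes y: "y \<in> frontier \<Omega>" and t: "t = norm (y - x0)" "t < r2" "t <= 1"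
  shows "\<bar>\<Sum>i\<in>UNIV. (pd i (T2 x0) y + pd i P3 y) * pd i \<rho> y\<bar>
    <= (27 * M * (18 * M\<^sup>2 / m) + 108 * M\<^sup>2 + C * (45 * M / m) + 9 * M * C) * t powr (2 + \<alpha>)"
proof -
  note yf = y_facts[OF x0 y t] and jt = bdry_jets[OF x0 y t]
  let ?h = "y - x0" and ?T = "t powr (2 + \<alpha>)"
  let ?H = "%i. hrow (Hc x0) i \<bullet> ?h" and ?E = "%i. hrow (Ec x0) i \<bullet> ?h"
    and ?Q = "%i. quad (Tc x0 i) x0 y"
  define D where "D = (\<Sum>i\<in>UNIV. (pv x0 $ i + ?H i) * pd i \<rho> y - pv x0 $ i * pd i \<rho> x0
        - (?H i * pd i \<rho> x0 + pv x0 $ i * ?E i) - (?H i * ?E i + 1 / 2 * (pv x0 $ i * ?Q i)))"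
  have D: "\<bar>D\<bar> <= 108 * M\<^sup>2 * ?T"
  proof -
    have "\<bar>(pv x0 $ i + ?H i) * pd i \<rho> y - pv x0 $ i * pd i \<rho> x0
        - (?H i * pd i \<rho> x0 + pv x0 $ i * ?E i) - (?H i * ?E i + 1 / 2 * (pv x0 $ i * ?Q i))\<bar> <= 36 * M\<^sup>2 * ?T" for i
    proof -
      have a: "\<bar>pv x0 $ i * (pd i \<rho> y - pd i \<rho> x0 - ?E i - 1 / 2 * ?Q i)\<bar> <= M * (9 * M * ?T)"
        by (rule abs_mult_le[OF p_le[OF x0] jt(5)])
      have "\<bar>?H i * (pd i \<rho> y - pd i \<rho> x0 - ?E i)\<bar> <= (3 * M * t) * (9 * M * t\<^sup>2)"
        by (rule abs_mult_le[OF jt(6,4)])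
      also have "... = 27 * M\<^sup>2 * t ^ 3" by (simp add: power2_eq_square power3_eq_cube)
      also have "... <= 27 * M\<^sup>2 * ?T" using yf(6) by (intro mult_left_mono) auto
      finally have b: "\<bar>?H i * (pd i \<rho> y - pd i \<rho> x0 - ?E i)\<bar> <= 27 * M\<^sup>2 * ?T" .
      have "(pv x0 $ i + ?H i) * pd i \<rho> y - pv x0 $ i * pd i \<rho> x0
        - (?H i * pd i \<rho> x0 + pv x0 $ i * ?E i) - (?H i * ?E i + 1 / 2 * (pv x0 $ i * ?Q i))
        = pv x0 $ i * (pd i \<rho> y - pd i \<rho> x0 - ?E i - 1 / 2 * ?Q i) + ?H i * (pd i \<rho> y - pd i \<rho> x0 - ?E i)"
        by (simp add: algebra_simps)
      also have "\<bar>...\<bar> <= M * (9 * M * ?T) + 27 * M\<^sup>2 * ?T" using a b by linarith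
      also have "M * (9 * M * ?T) + 27 * M\<^sup>2 * ?T = 36 * M\<^sup>2 * ?T" by (simp add: power2_eq_square)
      finally show ?thesis .
    qed
    then have "\<bar>D\<bar> <= (\<Sum>i\<in>(UNIV::3 set). 36 * M\<^sup>2 * ?T)" unfolding D_def by (intro order_trans[OF sum_abs sum_mono])
    then show ?thesis by simp
  qed
  define S1 where "S1 = (\<Sum>i\<in>UNIV. pd i P3 y * (pd i \<rho> y - pd i \<rho> x0))"
  have S1: "\<bar>S1\<bar> <= 9 * M * C * ?T"
  proof -
    have "\<bar>pd i P3 y * (pd i \<rho> y - pd i \<rho> x0)\<bar> <= (C * t\<^sup>2) * (3 * M * t)" for i
      unfolding t(1) by (rule abs_mult_le[OF P3_le(2) jt(3)[unfolded t(1)]])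
    then have "\<bar>S1\<bar> <= (\<Sum>i\<in>(UNIV::3 set). (C * t\<^sup>2) * (3 * M * t))" unfolding S1_def by (intro order_trans[OF sum_abs sum_mono])
    also have "... = 9 * M * C * t ^ 3" by (simp add: power2_eq_square power3_eq_cube)
    also have "... <= 9 * M * C * ?T" using yf(6) M1 C_nonneg by (intro mult_left_mono) auto
    finally show ?thesis .
  qed
  define S2 where "S2 = (\<Sum>i\<in>UNIV. pd i \<rho> x0 * pd i P3 y) + quad (Sc x0) x0 y"
  have S2: "\<bar>S2\<bar> <= C * (45 * M / m) * ?T"
  proof -
    have "\<bar>S2\<bar> <= C * (\<bar>grad \<rho> x0 \<bullet> (y - x0)\<bar> / m) * t" unfolding S2_def t(1) by (rule P3(3))
    also have "... <= C * (45 * M * t\<^sup>2 / m) * t"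
      using grad_inner_small(2)[OF x0 y t] C_nonneg m yf(3) by (intro mult_right_mono mult_left_mono divide_right_mono) auto
    also have "... = C * (45 * M / m) * t ^ 3" by (simp add: power2_eq_square power3_eq_cube)
    also have "... <= C * (45 * M / m) * ?T" using yf(6) M1 C_nonneg m by (intro mult_left_mono) auto
    finally show ?thesis .
  qed
  define S3 where "S3 = \<theta> x0 * (grad \<rho> x0 \<bullet> ?h + 1 / 2 * quad (Ec x0) x0 y)"
  have S3: "\<bar>S3\<bar> <= 27 * M * (18 * M\<^sup>2 / m) * ?T"
  proof -
    have "\<bar>S3\<bar> <= (18 * M\<^sup>2 / m) * (27 * M * t ^ 3)"
      unfolding S3_def by (rule abs_mult_le[OF \<theta>_le[OF x0] grad_inner_small(1)[OF x0 y t]])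
    also have "... = 27 * M * (18 * M\<^sup>2 / m) * t ^ 3" by simp
    also have "... <= 27 * M * (18 * M\<^sup>2 / m) * ?T" using yf(6) M1 m by (intro mult_left_mono) auto
    finally show ?thesis .
  qed
  have c1: "(\<Sum>i\<in>UNIV. ?H i * pd i \<rho> x0 + pv x0 $ i * ?E i) = \<theta> x0 * (grad \<rho> x0 \<bullet> ?h)"
    by (subst c1_inner[OF x0, symmetric], subst c1_eq[OF x0]) simp
  have "(\<Sum>i\<in>UNIV. (pd i (T2 x0) y + pd i P3 y) * pd i \<rho> y)
      = D + (\<Sum>i\<in>UNIV. pv x0 $ i * pd i \<rho> x0) + (\<Sum>i\<in>UNIV. ?H i * pd i \<rho> x0 + pv x0 $ i * ?E i)
       + (\<Sum>i\<in>UNIV. ?H i * ?E i + 1 / 2 * (pv x0 $ i * ?Q i)) + S1 + (\<Sum>i\<in>UNIV. pd i \<rho> x0 * pd i P3 y)"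
    unfolding D_def S1_def pd_T2[OF x0] by (simp add: sum.distrib[symmetric] sum_subtractf[symmetric] algebra_simps)
  also have "... = D + S1 + S2 + S3"
  proof -
    have "D + 0 + th * G + A + s + P = D + s + (P + (A - 1 / 2 * (th * q))) + th * (G + 1 / 2 * q)"
      for th G A s P q :: real by (simp add: algebra_simps)
    then show ?thesis unfolding c1 p_grad[OF x0] S2_def S3_def quad_Sc[OF x0] .
  qed
  finally show ?thesis using D S1 S2 S3 unfolding distrib_right by linarith
qed

context
  fixes Dm
  assumes Dm: "!!y. y \<in> \<Omega> ==> norm (y - x0) <= Dm"
begin

text \<open>One constant for all the conditions of \<open>remainder_bound\<close>, as the sum of the
  single bounds. It depends on \<open>C\<close> and on the bound \<open>Dm\<close> for distances in
  the domain, but not on \<open>x0\<close>, so it serves for all boundary points of the half ball at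
  once.\<close>

definition Am where "Am = 10 * M + (2 * M + 3 * M * Dm + 18 * M * Dm\<^sup>2 + C * Dm ^ 3) + (K2 + C) + K4
  + (27 * M * (18 * M\<^sup>2 / m) + 108 * M\<^sup>2 + C * (45 * M / m) + 9 * M * C) + 45 * M / m"

definition w where "w y = u y - (T2 x0 y + P3 y)"
definition gw where "gw y = g y - (gb [] x0 + \<gamma>v x0 \<bullet> (y - x0))"
definition wb where "wb y = ub [] y - (T2 x0 y + P3 y)"
definition pb where "pb y = (\<chi> i. ub [i] y - (pd i (T2 x0) y + pd i P3 y))"

lemma Dm_nonneg: "Dm >= 0"
proof -
  have "\<Omega> \<noteq> {}" using x0(1) by auto
  then show ?thesis using Dm norm_ge_zero order_trans by (meson ex_in_conv)
qed

lemma Am_ge: "10 * M <= Am" "2 * M + 3 * M * Dm + 18 * M * Dm\<^sup>2 + C * Dm ^ 3 <= Am" "K2 + C <= Am" "K4 <= Am"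
  "27 * M * (18 * M\<^sup>2 / m) + 108 * M\<^sup>2 + C * (45 * M / m) + 9 * M * C <= Am" "45 * M / m <= Am"
proof -
  have "0 <= M" "0 <= 2 * M + 3 * M * Dm + 18 * M * Dm\<^sup>2 + C * Dm ^ 3" "0 <= K2 + C" "0 <= K4"
    "0 <= 27 * M * (18 * M\<^sup>2 / m) + 108 * M\<^sup>2 + C * (45 * M / m) + 9 * M * C" "0 <= 45 * M / m"
    using M1 m C_nonneg K_nonneg Dm_nonneg by auto
  then show "10 * M <= Am" "2 * M + 3 * M * Dm + 18 * M * Dm\<^sup>2 + C * Dm ^ 3 <= Am" "K2 + C <= Am" "K4 <= Am"
  "27 * M * (18 * M\<^sup>2 / m) + 108 * M\<^sup>2 + C * (45 * M / m) + 9 * M * C <= Am" "45 * M / m <= Am"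
    unfolding Am_def by linarith+
qed

lemma Ck_P: "Ck k U (%y. T2 x0 y + P3 y)"
  using Ck_subset[OF Ck_add[OF open_UNIV Ck_T2 Ck_P3]] by simp

lemma Ck_w: "Ck 2 \<Omega> w"
  unfolding w_def[abs_def] by (rule Ck_diff[OF open\<Omega> u2 Ck_P])

lemma pd_P: "pd i (%y. T2 x0 y + P3 y) = (%y. pd i (T2 x0) y + pd i P3 y)"
  using Ck_T2[of 1 UNIV] Ck_P3[of 1 UNIV] by (auto intro!: pd_add)

lemma grad_w: "y \<in> \<Omega> ==> grad w y = pb y"
proof -
  assume y: "y \<in> \<Omega>"
  have "pd i w y = pd i u y - (pd i (T2 x0) y + pd i P3 y)" for i
  proof -
    have "(%y. T2 x0 y + P3 y) differentiable at y" using Ck_P[of 1 UNIV] by simp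
    from pd_diff[OF u_diff(1)[OF x0 y] this, of i] show ?thesis unfolding w_def[abs_def] by (simp only: pd_P)
  qed
  then show ?thesis using ub(2)[of "[i]" y for i] y by (simp add: grad_def pb_def)
qed

lemma laplacian_w: "y \<in> \<Omega> ==> laplacian w y = gw y"
proof -
  assume y: "y \<in> \<Omega>"
  have "laplacian w y = laplacian u y - laplacian (%y. T2 x0 y + P3 y) y"
    unfolding w_def[abs_def] by (rule laplacian_diff[OF open\<Omega> y u2 Ck_P])
  also have "laplacian (%y. T2 x0 y + P3 y) y = (\<Sum>i\<in>UNIV. pd i (pd i (T2 x0)) y + pd i (pd i P3) y)"
    unfolding laplacian_def pd_P
    by (rule sum.cong[OF HOL.refl], rule pd_add) (use Ck_T2[of 2 UNIV] Ck_P3[of 2 UNIV] in \<open>auto simp: numeral_2_eq_2\<close>)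
  also have "... = gb [] x0 + \<gamma>v x0 \<bullet> (y - x0)"
    using P3(2)[of y] by (simp add: sum.distrib pd2_T2[OF x0] trace_Hc[OF x0] laplacian_def)
  finally show ?thesis using lap[OF y] by (simp add: gw_def)
qed

lemma Ck_gw: "Ck 2 \<Omega> gw"
proof -
  have "Pol 1 (%y. gb [] x0 + \<gamma>v x0 \<bullet> (y - x0))" by (intro Pol_add Pol_const form_Pol[OF form_inner[OF order_refl]])
  from Ck_diff[OF open\<Omega> g2 Ck_subset[OF Pol_Ck[OF this] subset_UNIV]] show ?thesis unfolding gw_def[abs_def] .
qed

lemma pd2_gw: "y \<in> \<Omega> ==> \<bar>pd i (pd j gw) y\<bar> <= Am"
proof -
  assume y: "y \<in> \<Omega>"
  have "pd j (%y. gb [] x0 + \<gamma>v x0 \<bullet> (y - x0)) z = \<gamma>v x0 $ j" for z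
  proof -
    have "pd j (%y. gb [] x0 + \<gamma>v x0 \<bullet> (y - x0)) z = pd j (%y. gb [] x0) z + pd j (%y. \<gamma>v x0 \<bullet> (y - x0)) z"
      by (rule pd_add) (intro differentiable_const inner_shift_differentiable)+
    then show ?thesis by (simp add: pd_const pd_inner_shift)
  qed
  then have 1: "pd j gw z = pd j g z - \<gamma>v x0 $ j" if "z \<in> \<Omega>" for z
    unfolding gw_def[abs_def]
    by (subst pd_diff) (use g_diff(1)[OF x0 that] in \<open>auto intro!: differentiable_add inner_shift_differentiable\<close>)
  have "pd i (pd j gw) y = pd i (%z. pd j g z - \<gamma>v x0 $ j) y" by (rule pd_cong[OF open\<Omega> y 1])
  also have "... = pd i (pd j g) y" by (subst pd_diff) (use g_diff(2)[OF x0 y] in \<open>auto simp: pd_const\<close>)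
  finally show ?thesis using gbd[OF y, of i j] Am_ge(1) M1 by simp
qed

lemma w_bound: "y \<in> \<Omega> ==> \<bar>w y\<bar> <= Am"
proof -
  assume y: "y \<in> \<Omega>"
  let ?t = "norm (y - x0)"
  have t: "?t <= Dm" "0 <= ?t" using Dm[OF y] by auto
  have u: "\<bar>u y\<bar> <= M" using ubd2[of "[]" y] y by simp
  have 0: "\<bar>ub [] x0\<bar> <= M" using abs_ub[OF x0, of "[]"] by simp
  have "norm (pv x0) <= 3 * M" 
    using norm_le_l1_cart[of "pv x0"] p_le[OF x0, of 1] p_le[OF x0, of 2] p_le[OF x0, of 3] by (simp add: sum_3)
  then have 1: "\<bar>pv x0 \<bullet> (y - x0)\<bar> <= 3 * M * Dm"
    using t M1 by (intro order_trans[OF Cauchy_Schwarz_ineq2] mult_mono) auto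
  have "\<bar>quad (Hc x0) x0 y\<bar> <= 36 * M * ?t\<^sup>2" by (rule quad_bound[OF H_le[OF x0]]) (use M1 in simp)
  also have "... <= 36 * M * Dm\<^sup>2" using t M1 by (intro mult_left_mono power_mono) auto
  finally have 2: "\<bar>quad (Hc x0) x0 y\<bar> <= 36 * M * Dm\<^sup>2" .
  have "\<bar>P3 y\<bar> <= C * ?t ^ 3" by (rule P3_le)
  also have "... <= C * Dm ^ 3" using t C_nonneg by (intro mult_left_mono power_mono) auto
  finally have 3: "\<bar>P3 y\<bar> <= C * Dm ^ 3" .
  have "\<bar>w y\<bar> <= 2 * M + 3 * M * Dm + 18 * M * Dm\<^sup>2 + C * Dm ^ 3"
    unfolding w_def T2_def using u 0 1 2 3 by linarith
  then show ?thesis using Am_ge(2) by linarith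
qed

lemma w_small:
  assumes y: "y \<in> \<Omega>" "norm (y - x0) <= r2" "norm (y - x0) <= 1"
  shows "\<bar>w y\<bar> <= Am * norm (y - x0) powr (2 + \<alpha>)" "\<bar>gw y\<bar> <= Am * norm (y - x0) powr (1 + \<alpha>)"
proof -
  let ?t = "norm (y - x0)"
  have 1: "?t ^ 3 <= ?t powr (2 + \<alpha>)" "?t\<^sup>2 <= ?t powr (1 + \<alpha>)"
    by (rule powr_le_of_le_one, use y \<alpha> in auto)+
  have "\<alpha> + 1 + 1 = 2 + \<alpha>" by simp
  then have "\<bar>u y - T2 x0 y\<bar> <= K2 * ?t powr (2 + \<alpha>)" using jet_u0[OF x0 y(1,2)] by simp
  moreover have "\<bar>P3 y\<bar> <= C * ?t powr (2 + \<alpha>)"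
    by (rule order_trans[OF P3_le(1) mult_left_mono[OF 1(1) C_nonneg]])
  ultimately have "\<bar>w y\<bar> <= (K2 + C) * ?t powr (2 + \<alpha>)" unfolding w_def distrib_right by linarith
  also have "... <= Am * ?t powr (2 + \<alpha>)" by (rule mult_right_mono[OF Am_ge(3)]) simp
  finally show "\<bar>w y\<bar> <= Am * ?t powr (2 + \<alpha>)" .
  have "?t powr (1 + 1) = ?t\<^sup>2" using powr_realpow'[of ?t 2] by simp
  then have "\<bar>gw y\<bar> <= K4 * ?t\<^sup>2" using jet_g0[OF x0 y(1,2)] by (simp add: gw_def algebra_simps)
  also have "... <= Am * ?t powr (1 + \<alpha>)" using Am_ge(4) K_nonneg 1 by (intro mult_mono) auto
  finally show "\<bar>gw y\<bar> <= Am * ?t powr (1 + \<alpha>)" .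
qed

lemma remainder:
  assumes r0: "0 < r0" "r0 <= 1 / 4" "r0 <= r2 / 4"
  shows "remainder_bound Am \<alpha> r0 x0 (unit_grad x0) (norm (grad \<rho> x0)) w wb pb"
  unfolding remainder_bound_def
proof (intro conjI ballI)
  let ?r = "norm (grad \<rho> x0)"
  have r: "m <= ?r" "?r <= 3 * M" using norm_grad_x0[OF x0] by auto
  then have r_pos': "?r > 0" using m by linarith
  show "norm ((1 / ?r) *\<^sub>R grad \<rho> x0) = 1" using r_pos' by simp
  show "0 <= ?r" by simp
  show "?r <= Am" using r Am_ge(1) M1 by linarith
  have "6 * r0 <= R / 3" using r0 r_pos Rpos by linarith
  then show "cball x0 (6 * r0) \<subseteq> ball c R" using sub3[OF x0] subset_cball by blast
  show "Ck 2 \<Omega> w" by (rule Ck_w)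
  have cwb: "continuous_on (closure \<Omega>) wb" unfolding wb_def[abs_def]
    by (intro continuous_on_diff ub(1) Ck_continuous_on[OF Ck_P]) simp
  then show "continuous_on (closure \<Omega> \<inter> cball x0 (3 * r0)) wb" by (rule continuous_on_subset) simp
  have cP: "continuous_on (closure \<Omega>) (pd i P3)" for i
    using Ck_P3[of 1 "closure \<Omega>"] by simp
  have "continuous_on (closure \<Omega>) pb" unfolding pb_def[abs_def] pd_T2[OF x0]
    by (intro continuous_intros ub(1) cP) simp
  then show "continuous_on (closure \<Omega> \<inter> cball x0 (3 * r0)) pb" by (rule continuous_on_subset) simp
  fix y
  show "\<bar>w y\<bar> <= Am" "wb y = w y" "pb y = grad w y" if y: "y \<in> \<Omega>"
    using w_bound[OF y] ub(2)[of "[]" y] y grad_w[OF y] by (auto simp: wb_def w_def)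
  show "\<bar>w y\<bar> <= Am * norm (y - x0) powr (2 + \<alpha>)" "\<bar>laplacian w y\<bar> <= Am * norm (y - x0) powr (1 + \<alpha>)"
    if y: "y \<in> \<Omega> \<inter> cball x0 (3 * r0)"
    using w_small[of y] y r0 laplacian_w[of y] by (auto simp: dist_norm norm_minus_commute)
  assume y: "y \<in> frontier \<Omega> \<inter> cball x0 (3 * r0)"
  let ?t = "norm (y - x0)"
  have fr: "y \<in> frontier \<Omega>" and tr: "?t < r2" "?t <= 1" "?t < 4 * r0"
    using y r0 r_pos by (auto simp: dist_norm norm_minus_commute)
  note yf = y_facts[OF x0 fr HOL.refl tr(1,2)]
  show "\<bar>wb y\<bar> <= Am * ?t powr (2 + \<alpha>)"
  \<comment> \<open>\<open>le_on_closure_ball\<close> works with an open ball, so the radius is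
    enlarged to \<open>4 * r0\<close> to contain the closed ball of radius
    \<open>3 * r0\<close>.\<close>
  proof (rule le_on_closure_ball[where S=\<Omega> and ?x0.0=x0 and r="4 * r0" and f="%y. \<bar>wb y\<bar>"])
    show "continuous_on (closure \<Omega>) (%y. \<bar>wb y\<bar>)" by (intro continuous_intros cwb)
    show "continuous_on (closure \<Omega>) (%y. Am * norm (y - x0) powr (2 + \<alpha>))"
      by (intro continuous_on_mult continuous_on_const continuous_on_norm_powr) (use \<alpha> in simp)
    show "\<bar>wb y\<bar> <= Am * norm (y - x0) powr (2 + \<alpha>)" if "y \<in> \<Omega>" "y \<in> ball x0 (4 * r0)" for y
      using w_small(1)[OF that(1)] that r0 ub(2)[of "[]" y] by (auto simp: dist_norm norm_minus_commute wb_def w_def)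
  qed (use tr yf in \<open>auto simp: dist_norm norm_minus_commute\<close>)
  have "pb y \<bullet> grad \<rho> y = (\<Sum>i\<in>UNIV. ub [i] y * pd i \<rho> y) - (\<Sum>i\<in>UNIV. (pd i (T2 x0) y + pd i P3 y) * pd i \<rho> y)"
    by (simp add: pb_def grad_def inner_vec_def left_diff_distrib sum_subtractf)
  also have "... = - (\<Sum>i\<in>UNIV. (pd i (T2 x0) y + pd i P3 y) * pd i \<rho> y)" using neumann[OF fr yf(1)] by simp
  finally have "\<bar>pb y \<bullet> grad \<rho> y\<bar> <= (27 * M * (18 * M\<^sup>2 / m) + 108 * M\<^sup>2 + C * (45 * M / m) + 9 * M * C) * ?t powr (2 + \<alpha>)"
    using corrected_gradient[OF fr HOL.refl tr(1,2)] by simp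
  also have "... <= Am * ?t powr (2 + \<alpha>)" by (rule mult_right_mono[OF Am_ge(5)]) simp
  finally show "\<bar>pb y \<bullet> grad \<rho> y\<bar> <= Am * ?t powr (2 + \<alpha>)" .
  have "\<bar>(1 / ?r) *\<^sub>R grad \<rho> x0 \<bullet> (y - x0)\<bar> = \<bar>grad \<rho> x0 \<bullet> (y - x0)\<bar> / ?r" by simp
  also have "... <= 45 * M * ?t\<^sup>2 / m"
    using grad_inner_small(2)[OF x0 fr HOL.refl tr(1,2)] r m by (intro frac_le) auto
  also have "... <= Am * ?t\<^sup>2"
  proof -
    from mult_right_mono[OF Am_ge(6), of "?t\<^sup>2"] show ?thesis by simp
  qed
  finally show "\<bar>(1 / ?r) *\<^sub>R grad \<rho> x0 \<bullet> (y - x0)\<bar> <= Am * ?t\<^sup>2" .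
  have eq: "grad \<rho> y - ?r *\<^sub>R ((1 / ?r) *\<^sub>R grad \<rho> x0) = grad \<rho> y - grad \<rho> x0" using r_pos' by simp
  have "norm (grad \<rho> y - grad \<rho> x0) <= (\<Sum>i\<in>(UNIV::3 set). \<bar>(grad \<rho> y - grad \<rho> x0) $ i\<bar>)" by (rule norm_le_l1_cart)
  also have "... <= (\<Sum>i\<in>(UNIV::3 set). 3 * M * ?t)"
    using bdry_jets(3)[OF x0 fr HOL.refl tr(1,2)] by (intro sum_mono) (simp add: grad_def)
  also have "... = 9 * M * ?t" by simp
  also have "... <= Am * ?t" by (rule mult_right_mono) (use Am_ge(1) M1 in auto)
  finally show "norm (grad \<rho> y - ?r *\<^sub>R ((1 / ?r) *\<^sub>R grad \<rho> x0)) <= Am * ?t" unfolding eq .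
qed

end

end

lemma corrector_exists:
  "\<exists>C>0. \<forall>x0. x0 \<in> frontier \<Omega> --> x0 \<in> ball c (R / 2) --> (\<exists>P. corrector C x0 P)"
proof -
  have SBge: "3 * M <= SB" "1 / m <= SB" "SB > 0"
  proof -
    have "0 <= 9 * M\<^sup>2 / 2" "0 <= 9 * M ^ 3 / m" "0 < 1 / m" using M1 m by auto
    then show "3 * M <= SB" "1 / m <= SB" "SB > 0" using M1 unfolding SB_def by linarith+
  qed
  obtain C where C: "C > 0" "!!n \<kappa> S \<gamma> x0. norm n = 1 ==> 0 < \<kappa> ==> \<kappa> <= SB ==> 1 / \<kappa> <= SB ==> (\<forall>j k. \<bar>S j k\<bar> <= SB) ==> norm \<gamma> <= SB ==>
    (\<exists>P. form 3 C x0 P \<and> (\<forall>y. laplacian P y = \<gamma> \<bullet> (y - x0)) \<and>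
       (\<forall>y. \<bar>(\<Sum>i\<in>UNIV. (n $ i / \<kappa>) * pd i P y) + quad S x0 y\<bar>
          <= C * \<bar>n \<bullet> (y - x0)\<bar> * norm (y - x0)))"
    using cubic_corrector[OF SBge(3)] by auto
  show ?thesis
  proof (intro exI[of _ C] conjI allI impI C(1))
    fix x0 assume x0: "x0 \<in> frontier \<Omega>" "x0 \<in> ball c (R / 2)"
    let ?r = "norm (grad \<rho> x0)"
    have r: "m <= ?r" "?r <= 3 * M" using norm_grad_x0[OF x0] by auto
    then have rp: "?r > 0" using m by linarith
    let ?n = "(1 / ?r) *\<^sub>R grad \<rho> x0"
    have "norm (\<gamma>v x0) <= 3 * M"
    proof -
      have "\<bar>\<gamma>v x0 $ i\<bar> <= M" for i using abs_gb[OF x0, of "[i]"] by (simp add: \<gamma>v_def)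
      then have "norm (\<gamma>v x0) <= (\<Sum>i\<in>(UNIV::3 set). M)" by (intro order_trans[OF norm_le_l1_cart] sum_mono)
      then show ?thesis by simp
    qed
    moreover have "1 / ?r <= 1 / m" using r m by (intro frac_le) auto
    moreover have "1 / (1 / ?r) = ?r" by simp
    moreover have "norm ?n = 1" using rp by simp
    moreover have "0 < 1 / ?r" using rp by simp
    moreover have "\<forall>j k. \<bar>Sc x0 j k\<bar> <= SB" using Sc_le[OF x0] by blast
    ultimately obtain P where P: "form 3 C x0 P" "\<forall>y. laplacian P y = \<gamma>v x0 \<bullet> (y - x0)"
      "!!y. \<bar>(\<Sum>i\<in>UNIV. (?n $ i / (1 / ?r)) * pd i P y) + quad (Sc x0) x0 y\<bar> <= C * \<bar>?n \<bullet> (y - x0)\<bar> * norm (y - x0)"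
      using C(2)[of ?n "1 / ?r" "Sc x0" "\<gamma>v x0" x0] SBge r by auto
    have "?n $ i / (1 / ?r) = pd i \<rho> x0" for i using rp by (simp add: grad_def)
    moreover have "C * \<bar>?n \<bullet> (y - x0)\<bar> * norm (y - x0) <= C * (\<bar>grad \<rho> x0 \<bullet> (y - x0)\<bar> / m) * norm (y - x0)" for y
    proof -
      have "\<bar>?n \<bullet> (y - x0)\<bar> = \<bar>grad \<rho> x0 \<bullet> (y - x0)\<bar> / ?r" by simp
      also have "... <= \<bar>grad \<rho> x0 \<bullet> (y - x0)\<bar> / m" using r m by (intro frac_le) auto
      finally show ?thesis using C(1) by (intro mult_right_mono mult_left_mono) auto
    qed
    ultimately have "\<bar>(\<Sum>i\<in>UNIV. pd i \<rho> x0 * pd i P y) + quad (Sc x0) x0 y\<bar> <= C * (\<bar>grad \<rho> x0 \<bullet> (y - x0)\<bar> / m) * norm (y - x0)" for y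
      using P(3)[of y] by (simp only:) (meson order_trans)
    then show "\<exists>P. corrector C x0 P" using P(1,2) unfolding corrector_def by blast
  qed
qed

lemma remainder_exists:
  obtains A where "A > 0"
    "!!x0 r0. x0 \<in> frontier \<Omega> ==> x0 \<in> ball c (R / 2) ==> 0 < r0 ==> r0 <= 1 / 4 ==> r0 <= r2 / 4 ==> \<exists>P. approximates A r0 x0 P"
proof -
  obtain C where C: "C > 0" "!!x0. x0 \<in> frontier \<Omega> ==> x0 \<in> ball c (R / 2) ==> (\<exists>P. corrector C x0 P)"
    using corrector_exists by auto
  obtain B where B: "!!y. y \<in> closure \<Omega> ==> norm y <= B"
    using bounded_closure[OF bd\<Omega>] by (auto simp: bounded_iff)
  have D: "norm (y - x0) <= 2 * B" if "x0 \<in> frontier \<Omega>" "y \<in> \<Omega>" for x0 y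
  proof -
    have "norm x0 <= B" "norm y <= B" using B that closure_subset by (auto simp: frontier_def)
    then show ?thesis using norm_triangle_ineq4[of y x0] by simp
  qed
  show ?thesis
  \<comment> \<open>Positivity of the constant is derived from \<open>Am_ge\<close>, whose context
    contains a frontier point; if the half ball has none, the claim is void.\<close>
  proof (cases "frontier \<Omega> \<inter> ball c (R / 2) = {}")
    case True
    have F: "x0 \<in> frontier \<Omega> ==> x0 \<in> ball c (R / 2) ==> Z" for x0 Z using True by blast
    show ?thesis by (rule that[OF zero_less_one], rule F)
  next
    case False
    then obtain x1 where x1: "x1 \<in> frontier \<Omega>" "x1 \<in> ball c (R / 2)" by blast
    obtain P1 where P1: "corrector C x1 P1" using C(2)[OF x1] by blast
    show ?thesis
    proof (rule that[of "Am C (2 * B)"])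
      show "Am C (2 * B) > 0"
        using Am_ge(1)[OF x1 P1 D[OF x1(1)]] M1 by linarith
      fix x0 r0 assume x0: "x0 \<in> frontier \<Omega>" "x0 \<in> ball c (R / 2)" and r0: "0 < r0" "r0 <= 1 / 4" "r0 <= r2 / 4"
      obtain P where P: "corrector C x0 P" using C(2)[OF x0] by blast
      note ctx = x0 P D[OF x0(1)]
      have w: "w x0 P = (%y. u y - (T2 x0 y + P y))" by (rule HOL.ext) (rule w_def[OF ctx])
      show "\<exists>P. approximates (Am C (2 * B)) r0 x0 P"
        unfolding approximates_def
      proof (rule exI[of _ "%y. T2 x0 y + P y"], rule conjI[OF Pol_add[OF form_T2_parts[OF x0] form_Pol[OF P3(1)[OF x0 P]]]],
          rule exI[of _ "gw x0"], rule exI[of _ "wb x0 P"], rule exI[of _ "pb x0 P"], intro conjI ballI allI)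
        show "Ck 2 \<Omega> (gw x0)" using Ck_gw[OF ctx] .
        show "laplacian (%y. u y - (T2 x0 y + P y)) y = gw x0 y" if "y \<in> \<Omega>" for y
          using laplacian_w[OF ctx that] unfolding w .
        show "\<bar>pd i (pd j (gw x0)) y\<bar> <= Am C (2 * B)" if "y \<in> \<Omega>" for i j y using pd2_gw[OF ctx that] .
        show "remainder_bound (Am C (2 * B)) \<alpha> r0 x0 (unit_grad x0) (norm (grad \<rho> x0)) (%y. u y - (T2 x0 y + P y)) (wb x0 P) (pb x0 P)"
          using remainder[OF ctx r0] unfolding w .
      qed
    qed
  qed
qed

end

section \<open>Hoelder bounds for the third derivatives, in the interior and at the boundary\<close>

lemma near_frontier_ball:
  fixes \<Omega> :: "(real^3) set"
  assumes "open \<Omega>" "z \<in> \<Omega>" "frontier \<Omega> \<noteq> {}"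
  shows "ball z (infdist z (frontier \<Omega>)) \<subseteq> \<Omega>"
proof (rule ccontr)
  assume "\<not> ?thesis"
  then obtain y where y: "y \<in> ball z (infdist z (frontier \<Omega>))" "y \<notin> \<Omega>" by blast
  then have "ball z (infdist z (frontier \<Omega>)) \<inter> frontier \<Omega> \<noteq> {}"
  proof (intro connected_Int_frontier connected_ball)
    have "z \<in> ball z (infdist z (frontier \<Omega>))" using y(1) le_less_trans[OF zero_le_dist, of z y] by simp
    then show "ball z (infdist z (frontier \<Omega>)) \<inter> \<Omega> \<noteq> {}" using assms(2) by blast
    show "ball z (infdist z (frontier \<Omega>)) - \<Omega> \<noteq> {}" using y by blast
  qed
  then obtain w where "w \<in> frontier \<Omega>" "dist z w < infdist z (frontier \<Omega>)" by auto
  then show False using infdist_le[of w "frontier \<Omega>" z] by simp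
qed

text \<open>Tested with a small multiple of \<open>e\<close> minus the component \<open>w\<close> of
  \<open>r\<close> orthogonal to \<open>e\<close>, the hypothesis forces \<open>w\<close> to vanish.
  This is the first-order condition at a nearest boundary point.\<close>

lemma minimum_direction:
  fixes r e :: "real^3"
  assumes e: "norm e = 1" and d: "!!v. v \<bullet> e > 0 ==> r \<bullet> v >= 0"
  shows "r = norm r *\<^sub>R e"
proof -
  define w where "w = r - (r \<bullet> e) *\<^sub>R e"
  have ee: "e \<bullet> e = 1" using e by (simp add: norm_eq_1)
  have we: "w \<bullet> e = 0" using ee by (simp add: w_def inner_diff_left)
  have "w \<bullet> w = 0"
  proof (rule ccontr)
    assume "w \<bullet> w \<noteq> 0"
    then have ww: "w \<bullet> w > 0" by (simp add: order_less_le)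
    define \<epsilon> where "\<epsilon> = (w \<bullet> w) / (2 * (\<bar>r \<bullet> e\<bar> + 1))"
    have \<epsilon>: "\<epsilon> > 0" using ww by (simp add: \<epsilon>_def)
    have "r \<bullet> (\<epsilon> *\<^sub>R e - w) >= 0" by (rule d) (use \<epsilon> ee we in \<open>simp add: inner_diff_left\<close>)
    moreover have "r \<bullet> w = w \<bullet> w" using we by (simp add: w_def inner_diff_left inner_diff_right inner_commute)
    ultimately have "w \<bullet> w <= \<epsilon> * (r \<bullet> e)" by (simp add: inner_diff_right)
    also have "... <= \<epsilon> * (\<bar>r \<bullet> e\<bar> + 1)" using \<epsilon> by (intro mult_left_mono) auto
    also have "... = (w \<bullet> w) / 2" by (simp add: \<epsilon>_def field_simps)
    finally show False using ww by simp
  qed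
  then have r: "r = (r \<bullet> e) *\<^sub>R e" by (simp add: w_def)
  have "r \<bullet> e >= 0" by (rule d) (simp add: ee)
  then have "norm r = r \<bullet> e" by (subst r) (use e in simp)
  then show ?thesis using r by simp
qed

context interior
begin

lemma mol4_interior:
  assumes \<alpha>: "0 < \<alpha>" "\<alpha> < 1" and r0: "0 < r0" "r0 <= 1" and l: "length is = 4" and M: "M > 0"
    and z: "cball z r0 \<subseteq> U" and s: "0 < s" "s <= r0"
  shows "\<bar>mol is v s z\<bar> <= (M * kern_const * unit_ball_vol 3 * r0 ^ 3 / r0 ^ 7 + kern_const * unit_ball_vol 3 * M / (1 - \<alpha>)) * s powr (\<alpha> - 1)"
proof (rule integrate_powr_bound[OF \<alpha>(2) s r0(2)])
  show "0 <= kern_const * unit_ball_vol 3 * M" using kern_const(1) M by simp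
  have k: "kern 1 (pds is mollifier)" by (rule kern_pds) (use l kern_mono[OF kern_mollifier] in auto)
  have "\<bar>conv v (pds is mollifier) r0 z\<bar> <= M * kern_const * unit_ball_vol 3 * r0 ^ 3"
    by (rule conv_bound[OF k r0(1) kern_const(3)]) (use l ubd M in \<open>auto simp: zext_def\<close>)
  then show "\<bar>mol is v r0 z\<bar> <= M * kern_const * unit_ball_vol 3 * r0 ^ 3 / r0 ^ 7"
    unfolding mol_def abs_divide using r0 l by (simp add: divide_right_mono)
  fix \<sigma> assume \<sigma>: "s <= \<sigma>" "\<sigma> <= r0"
  then have \<sigma>0: "\<sigma> > 0" using s by simp
  show "((%\<sigma>. mol is v \<sigma> z) has_real_derivative conv v (laplacian (pds is potential)) \<sigma> z / \<sigma> ^ 8) (at \<sigma>)"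
    using DERIV_mol[OF v_int _ \<sigma>0, of "is" z] l by simp
  have "cball z \<sigma> \<subseteq> U" using z subset_cball[OF \<sigma>(2)] by blast
  then show "\<bar>conv v (laplacian (pds is potential)) \<sigma> z / \<sigma> ^ 8\<bar> <= kern_const * unit_ball_vol 3 * M * \<sigma> powr (\<alpha> - 2)"
    by (intro mol4_rate[OF l \<alpha>(2) v_int openU v2 g2 lap_v gbd \<sigma>0]) (use \<sigma> r0 M in auto)
qed

lemma interior_third_derivative_hoelder:
  assumes M: "M > 0" and \<alpha>: "0 < \<alpha>" "\<alpha> < 1" and x0: "x0 \<in> U"
  obtains r K where "r > 0" "!!i j k x y. x \<in> ball x0 r ==> y \<in> ball x0 r ==>
    \<bar>pds [i, j, k] u x - pds [i, j, k] u y\<bar> <= K * norm (x - y) powr \<alpha>"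
proof -
  obtain e where e: "e > 0" "ball x0 e \<subseteq> U" using openU x0 open_contains_ball by blast
  define r0 where "r0 = min 1 (e / 4)"
  have r0: "0 < r0" "r0 <= 1" "4 * r0 <= e" using e by (auto simp: r0_def)
  define B where "B = M * kern_const * unit_ball_vol 3 * r0 ^ 3 / r0 ^ 7 + kern_const * unit_ball_vol 3 * M / (1 - \<alpha>)"
  have B: "B >= 0" using M kern_const(1) r0 \<alpha> by (simp add: B_def)
  have sub: "cball z r0 \<subseteq> U" if "z \<in> ball x0 r0" for z
  proof
    fix y assume "y \<in> cball z r0"
    then have "dist x0 y < e" using that r0 dist_triangle[of x0 y z] by simp
    then show "y \<in> U" using e by auto
  qed
  show ?thesis
  proof (rule that[of "r0 / 2" "2 * scale_const + 3 * B"])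
    show "r0 / 2 > 0" using r0 by simp
    fix i j k x y assume xy: "x \<in> ball x0 (r0 / 2)" "y \<in> ball x0 (r0 / 2)"
    show "\<bar>pds [i, j, k] u x - pds [i, j, k] u y\<bar> <= (2 * scale_const + 3 * B) * norm (x - y) powr \<alpha>"
    proof (cases "x = y")
      case False
      let ?\<delta> = "norm (x - y)"
      have \<delta>: "0 < ?\<delta>" "?\<delta> <= r0" using False xy dist_triangle[of x y x0] by (auto simp: dist_norm norm_minus_commute)
      have s: "cball x ?\<delta> \<subseteq> U" "cball y ?\<delta> \<subseteq> U"
        using sub[of x] sub[of y] xy r0 subset_cball[OF \<delta>(2)] by (auto simp: less_trans)
      show ?thesis
      proof (rule third_derivative_hoelder_step[OF \<alpha> order_refl \<delta>(1) _ s B])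
        fix l z assume "z \<in> closed_segment x y"
        then have "z \<in> ball x0 (r0 / 2)" using closed_segment_subset[OF xy convex_ball] by blast
        then have "z \<in> ball x0 r0" using r0 by auto
        then show "\<bar>mol [j, i, k, l] v ?\<delta> z\<bar> <= B * ?\<delta> powr (\<alpha> - 1)"
          unfolding B_def by (intro mol4_interior[OF \<alpha> r0(1,2) _ M sub \<delta>]) auto
      qed (use r0 \<delta> in auto)
    qed simp
  qed
qed

end

lemma hoelder_over_lists:
  fixes F :: "3 list => real^3 => real"
  assumes "!!is. length is = n ==> \<exists>C. \<forall>x\<in>U. \<forall>y\<in>U. \<bar>F is x - F is y\<bar> <= C * norm (x - y) powr \<alpha>"
  shows "\<exists>C>0. \<forall>is. length is = n --> (\<forall>x\<in>U. \<forall>y\<in>U. \<bar>F is x - F is y\<bar> <= C * norm (x - y) powr \<alpha>)"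
proof -
  define P where "P is C \<longleftrightarrow> (\<forall>x\<in>U. \<forall>y\<in>U. \<bar>F is x - F is y\<bar> <= C * norm (x - y) powr \<alpha>)" for "is" C
  have mono: "P is D" if "P is C" "C <= D" for "is" C D
    using that order_trans[OF _ mult_right_mono[OF that(2) powr_ge_zero]] unfolding P_def by blast
  have "\<exists>C>0. P is C" if l: "length is = n" for "is"
  proof -
    obtain C where "P is C" using assms[OF l] unfolding P_def by blast
    then have "P is (\<bar>C\<bar> + 1)" by (rule mono) simp
    then show ?thesis by (intro exI[of _ "\<bar>C\<bar> + 1"]) simp
  qed
  then have "\<exists>C>0. \<forall>is\<in>{is. length is = n}. P is C"
    by (intro uniform_constant[OF finite_lists(1)]) (auto intro: mono)
  then show ?thesis unfolding P_def by simp
qed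

context neumann_chart
begin

text \<open>The ball about \<open>z\<close> that touches the frontier at \<open>x0\<close> lies in
  \<open>\<Omega>\<close>, so \<open>\<rho>\<close> does not decrease from \<open>x0\<close> in any
  direction into this ball. Hence \<open>grad \<rho> x0\<close> points from \<open>x0\<close> to
  \<open>z\<close>, and the mirror image of \<open>z\<close> lies straight across the boundary. The
  linear decrease of \<open>\<rho>\<close> there outweighs its curvature because \<open>rz\<close>
  is small.\<close>

lemma nearest_point:
  assumes z: "z \<in> \<Omega>" "z \<in> ball c rz" and c: "c \<in> frontier \<Omega>" and rz: "8 * rz <= R" "2 * rz <= 1" "210 * M * rz <= m"
  obtains x0 where "x0 \<in> frontier \<Omega>" "x0 \<in> ball c (R / 2)" "dist z x0 = infdist z (frontier \<Omega>)" "infdist z (frontier \<Omega>) > 0"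
    "infdist z (frontier \<Omega>) < rz"
    "!!y. y \<in> cball (x0 + reflect (unit_grad x0) (z - x0)) (infdist z (frontier \<Omega>) / 2) ==> y \<notin> \<Omega>"
proof -
  let ?d = "infdist z (frontier \<Omega>)"
  obtain x0 where x0: "x0 \<in> frontier \<Omega>" "?d = dist z x0"
    using infdist_attains_inf[of "frontier \<Omega>" z] c by auto
  have "z \<notin> frontier \<Omega>" using z open\<Omega> by (simp add: frontier_def interior_open)
  then have d0: "?d > 0" using x0 by auto
  have dr: "?d < rz" using infdist_le[OF c, of z] z(2) by (simp add: dist_commute)
  have rz0: "rz > 0" using d0 dr by simp
  have cx: "dist c x0 < 2 * rz" using dist_triangle[of c x0 z] x0(2) dr z(2) by simp
  then have x0R: "x0 \<in> ball c (R / 2)" "x0 \<in> ball c R" using rz rz0 by auto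
  note X = x0(1) x0R(1)
  define e where "e = (1 / ?d) *\<^sub>R (z - x0)"
  have e: "norm e = 1" "z - x0 = ?d *\<^sub>R e"
    using x0(2) d0 by (auto simp: e_def dist_norm)
  let ?r = "grad \<rho> x0" and ?n = "unit_grad x0"
  have nr: "norm ?r >= m" using norm_grad_x0[OF X] by simp
  have "?r = norm ?r *\<^sub>R e"
  proof (rule minimum_direction[OF e(1)])
    fix v :: "real^3" assume v: "v \<bullet> e > 0"
    show "?r \<bullet> v >= 0"
    proof (rule ccontr)
      assume neg: "\<not> ?r \<bullet> v >= 0"
      have "((%s. \<rho> (x0 + s *\<^sub>R v)) has_real_derivative grad \<rho> (x0 + 0 *\<^sub>R v) \<bullet> v) (at 0)"
        by (rule DERIV_line) (use \<rho>_diff x0R(2) in simp)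
      then have "((%s. \<rho> (x0 + s *\<^sub>R v)) has_real_derivative grad \<rho> x0 \<bullet> v) (at 0)" by simp
      from DERIV_neg_dec_right[OF this] neg obtain \<eta> where \<eta>: "\<eta> > 0" "!!s. 0 < s ==> s < \<eta> ==> \<rho> (x0 + s *\<^sub>R v) < \<rho> x0" by auto
      have v0: "norm v > 0" using v by auto
      \<comment> \<open>The first bound keeps \<open>\<rho>\<close> decreasing, the second makes
        \<open>x0 + s *\<^sub>R v\<close> closer to \<open>z\<close> than \<open>x0\<close> is, and
        the third keeps it in the chart ball.\<close>
      define s where "s = min (\<eta> / 2) (min (?d * (v \<bullet> e) / (norm v)\<^sup>2) (R / (4 * norm v)))"
      have Rp: "R > 0" by (rule Rpos)
      have s: "0 < s" "s < \<eta>" "s * (norm v)\<^sup>2 <= ?d * (v \<bullet> e)" "s * norm v <= R / 4"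
      proof -
        show s0: "0 < s" using \<eta>(1) d0 v v0 Rp by (simp add: s_def)
        show "s < \<eta>" using \<eta>(1) by (simp add: s_def)
        have "s * (norm v)\<^sup>2 <= (?d * (v \<bullet> e) / (norm v)\<^sup>2) * (norm v)\<^sup>2" by (rule mult_right_mono) (auto simp: s_def)
        then show "s * (norm v)\<^sup>2 <= ?d * (v \<bullet> e)" using v0 by simp
        have "s * norm v <= (R / (4 * norm v)) * norm v" by (rule mult_right_mono) (auto simp: s_def)
        then show "s * norm v <= R / 4" using v0 by simp
      qed
      let ?p = "x0 + s *\<^sub>R v"
      have "?p - z = s *\<^sub>R v - (z - x0)" by simp
      then have "(norm (?p - z))\<^sup>2 = (norm (s *\<^sub>R v - ?d *\<^sub>R e))\<^sup>2" by (simp only: e(2))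
      also have "... = s\<^sup>2 * (norm v)\<^sup>2 - 2 * s * ?d * (v \<bullet> e) + ?d\<^sup>2"
        using e(1) unfolding power2_norm_eq_inner
        by (simp add: inner_diff_left inner_diff_right inner_commute power2_eq_square norm_eq_1)
      also have "s\<^sup>2 * (norm v)\<^sup>2 <= s * (?d * (v \<bullet> e))"
        using mult_left_mono[OF s(3), of s] s(1) by (simp add: power2_eq_square mult.assoc)
      finally have "(norm (?p - z))\<^sup>2 <= ?d\<^sup>2 - s * ?d * (v \<bullet> e)" by (simp add: algebra_simps)
      also have "... < ?d\<^sup>2" using s(1) d0 v by simp
      finally have "norm (?p - z) < ?d" using d0 by (simp add: power2_less_imp_less)
      then have "?p \<in> \<Omega>"
        using near_frontier_ball[OF open\<Omega> z(1)] c by (metis dist_commute dist_norm empty_iff mem_ball subsetD)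
      moreover have "?p \<in> ball c R"
      proof -
        have "dist x0 ?p <= R / 4" using s(1,4) by (simp add: dist_norm)
        then show ?thesis using x0R(1) dist_triangle[of c ?p x0] Rp by simp
      qed
      ultimately have "\<rho> ?p > 0" using in\<Omega> by blast
      then show False using \<eta>(2)[OF s(1,2)] rho_x0[OF X] by simp
    qed
  qed
  then have n: "?n = e" using nr m by (metis divide_inverse inverse_eq_divide left_inverse less_le_trans linorder_not_less norm_ge_zero order_less_irrefl scaleR_one scaleR_scaleR)
  have refl: "x0 + reflect ?n (z - x0) = x0 - ?d *\<^sub>R e"
    unfolding n e(2) reflect_def using e(1) by (simp add: norm_eq_1 scaleR_left_diff_distrib[symmetric])
  show ?thesis
  proof (rule that[OF x0(1) x0R(1) x0(2)[symmetric] d0 dr])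
    fix y assume "y \<in> cball (x0 + reflect ?n (z - x0)) (?d / 2)"
    then have y: "dist (x0 - ?d *\<^sub>R e) y <= ?d / 2" unfolding refl by simp
    define h where "h = y - x0"
    have h1: "norm (h + ?d *\<^sub>R e) <= ?d / 2" using y by (simp add: h_def dist_norm norm_minus_commute algebra_simps)
    have h2: "norm h <= 3 / 2 * ?d"
    proof -
      have "norm h <= norm (h + ?d *\<^sub>R e) + norm (?d *\<^sub>R e)" using norm_triangle_ineq4[of "h + ?d *\<^sub>R e" "?d *\<^sub>R e"] by simp
      then show ?thesis using h1 e(1) d0 by simp
    qed
    have yR: "y \<in> ball c R"
    proof -
      have "dist x0 y = norm h" by (simp add: h_def dist_norm norm_minus_commute)
      then show ?thesis using cx h2 dr rz rz0 dist_triangle[of c y x0] by simp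
    qed
    have "?r \<bullet> h = norm ?r * (e \<bullet> (h + ?d *\<^sub>R e)) - norm ?r * ?d"
      using \<open>?r = norm ?r *\<^sub>R e\<close> e(1) by (metis (no_types, lifting) add_diff_cancel_right' inner_add_right inner_scaleR_left inner_scaleR_right mult.right_neutral norm_eq_1 right_diff_distrib)
    also have "e \<bullet> (h + ?d *\<^sub>R e) <= ?d / 2" using Cauchy_Schwarz_ineq2[of e "h + ?d *\<^sub>R e"] h1 e(1) by simp
    finally have "?r \<bullet> h <= norm ?r * (?d / 2) - norm ?r * ?d" by (simp add: mult_left_mono)
    also have "... = - (norm ?r * (?d / 2))" by simp
    also have "... <= - (m * (?d / 2))" using mult_right_mono[OF nr, of "?d / 2"] d0 by simp
    finally have 1: "?r \<bullet> h <= - (m * (?d / 2))" .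
    have h3: "norm h <= 1" using h2 dr rz by simp
    have "\<bar>\<rho> y - ?r \<bullet> h - 1 / 2 * quad (Ec x0) x0 y\<bar> <= 27 * M * norm h powr (2 + 1)"
      using jet_\<rho>0[OF X yR] unfolding h_def .
    also have "norm h powr (2 + 1) = norm h ^ 3" using powr_realpow'[of "norm h" 3] by simp
    also have "27 * M * norm h ^ 3 <= 27 * M * (norm h)\<^sup>2"
      using M1 h3 by (intro mult_left_mono power_decreasing) auto
    finally have 2: "\<bar>\<rho> y - ?r \<bullet> h - 1 / 2 * quad (Ec x0) x0 y\<bar> <= 27 * M * (norm h)\<^sup>2" .
    have "\<bar>quad (Ec x0) x0 y\<bar> <= 36 * M * (norm h)\<^sup>2" unfolding h_def by (rule quad_bound[OF E_le[OF X]]) (use M1 in simp)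
    then have "\<rho> y <= - (m * (?d / 2)) + 45 * M * (norm h)\<^sup>2" using 1 2 by linarith
    also have "45 * M * (norm h)\<^sup>2 <= 45 * M * (3 / 2 * ?d)\<^sup>2" using M1 h2 by (intro mult_left_mono power_mono) auto
    also have "... = (405 / 4 * M * ?d) * ?d" by (simp add: power2_eq_square)
    \<comment> \<open>\<open>405 / 4\<close> is \<open>45 * (3 / 2)\<^sup>2\<close>; its double is
      below the 210 in the hypothesis on \<open>rz\<close>.\<close>
    also have "... <= (m / 2) * ?d"
    proof (rule mult_right_mono)
      have "M * ?d <= M * rz" using dr M1 by (intro mult_left_mono) auto
      then show "405 / 4 * M * ?d <= m / 2" using rz(3) M1 rz0 mult_pos_pos[of M rz] by linarith
    qed (use d0 in simp)
    finally have "\<rho> y <= 0" by simp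
    then show "y \<notin> \<Omega>" using in\<Omega>[OF yR] by simp
  qed
qed

text \<open>On the segment between points this close the distance to the frontier is at least seven
  times the scale \<open>norm (x - y)\<close>. So \<open>mol4_estimate\<close> applies at this
  scale, with a polynomial taken at the nearest boundary point of each point of the segment.\<close>

lemma near_hoelder:
  assumes c: "c \<in> frontier \<Omega>"
  obtains K rz where "K > 0" "rz > 0" "8 * rz <= R"
    "!!i j k x y. x \<in> \<Omega> ==> x \<in> ball c rz ==> y \<in> ball c rz ==> 8 * norm (x - y) <= infdist x (frontier \<Omega>) ==>
      \<bar>pds [i, j, k] u x - pds [i, j, k] u y\<bar> <= K * norm (x - y) powr \<alpha>"
proof (rule remainder_exists)
  fix A
  assume A: "A > 0" "!!x0 r0. x0 \<in> frontier \<Omega> ==> x0 \<in> ball c (R / 2) ==> 0 < r0 ==> r0 <= 1 / 4 ==> r0 <= r2 / 4 ==> \<exists>P. approximates A r0 x0 P"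
  define r0 where "r0 = min (1 / 4) (r2 / 4)"
  have r0: "0 < r0" "r0 <= 1 / 4" "r0 <= r2 / 4" "r0 <= 1" using r_pos by (auto simp: r0_def)
  define rz where "rz = min (min (R / 8) (1 / 2)) (min (m / (210 * M)) r0)"
  have rz: "rz > 0" "8 * rz <= R" "2 * rz <= 1" "rz <= r0" "210 * M * rz <= m"
  proof -
    show "rz > 0" using Rpos m M1 r0 by (simp add: rz_def)
    show "8 * rz <= R" "2 * rz <= 1" "rz <= r0" by (auto simp: rz_def)
    have "210 * M * rz <= 210 * M * (m / (210 * M))" using M1 by (intro mult_left_mono) (auto simp: rz_def)
    then show "210 * M * rz <= m" using M1 by simp
  qed
  define B where "B = mol4_const A \<alpha> r0"
  have B: "B >= 0" unfolding B_def by (rule mol4_const_nonneg[OF A(1) \<alpha>(2) r0(1)])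
  have est: "\<bar>mol is v s z\<bar> <= B * s powr (\<alpha> - 1)" if l: "length is = 4" and z: "z \<in> \<Omega>" "z \<in> ball c rz"
    and s: "0 < s" "s <= infdist z (frontier \<Omega>) / 2" for "is" z s
  proof (rule nearest_point[OF z c rz(2,3,5)])
    let ?d = "infdist z (frontier \<Omega>)"
    fix x0
    let ?n = "unit_grad x0"
    assume x0: "x0 \<in> frontier \<Omega>" "x0 \<in> ball c (R / 2)" "dist z x0 = ?d" "?d > 0" "?d < rz"
      and ref: "!!y. y \<in> cball (x0 + reflect ?n (z - x0)) (?d / 2) ==> y \<notin> \<Omega>"
    have bz: "ball z ?d \<subseteq> \<Omega>" by (rule near_frontier_ball[OF open\<Omega> z(1)]) (use c in auto)
    obtain P gw wb pb where P: "Pol 3 P" "Ck 2 \<Omega> gw" "\<forall>y\<in>\<Omega>. laplacian (%y. u y - P y) y = gw y"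
      "\<forall>i j. \<forall>y\<in>\<Omega>. \<bar>pd i (pd j gw) y\<bar> <= A"
      and rb: "remainder_bound A \<alpha> r0 x0 ?n (norm (grad \<rho> x0)) (%y. u y - P y) wb pb"
      using A(2)[OF x0(1,2) r0(1,2,3)] unfolding approximates_def by auto
    have sr: "s <= r0" using s x0 rz by linarith
    have "\<bar>mol is (zext \<Omega> (%y. u y - P y)) s z\<bar> <= B * s powr (\<alpha> - 1)"
      unfolding B_def by (rule mol4_estimate[OF A(1) \<alpha> r0(1,4) l rb P(2,3,4) x0(3) bz ref s sr])
    moreover have "mol is v s z = mol is (zext \<Omega> (%y. u y - P y)) s z"
    proof (rule mol_subtract_Pol[OF open\<Omega> bd\<Omega> Ck_continuous_on[OF u2] ubd P(1) l s(1)])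
      have "cball z s \<subseteq> ball z ?d" using s x0(4) by auto
      then show "cball z s \<subseteq> \<Omega>" using bz by blast
      show "\<bar>u y - P y\<bar> <= A" if "y \<in> \<Omega>" for y using rb that unfolding remainder_bound_def by blast
    qed
    ultimately show ?thesis by simp
  qed
  show ?thesis
  proof (rule that[OF _ rz(1,2)])
    show "2 * scale_const + 3 * B > 0" using B scale_const by simp
    fix i j k x y assume x: "x \<in> \<Omega>" "x \<in> ball c rz" and y: "y \<in> ball c rz"
      and d: "8 * norm (x - y) <= infdist x (frontier \<Omega>)"
    show "\<bar>pds [i, j, k] u x - pds [i, j, k] u y\<bar> <= (2 * scale_const + 3 * B) * norm (x - y) powr \<alpha>"
    proof (cases "x = y")
      case False
      let ?\<delta> = "norm (x - y)"
      have \<delta>: "0 < ?\<delta>" using False by simp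
      have "infdist x (frontier \<Omega>) < rz" using infdist_le[OF c, of x] x(2) by (simp add: dist_commute)
      then have \<delta>1: "?\<delta> <= 1" using d rz by linarith
      have bx: "ball x (infdist x (frontier \<Omega>)) \<subseteq> \<Omega>" by (rule near_frontier_ball[OF open\<Omega> x(1)]) (use c in auto)
      have sub: "cball z ?\<delta> \<subseteq> \<Omega>" if "dist x z <= ?\<delta>" for z
      proof
        fix w assume "w \<in> cball z ?\<delta>"
        then have "dist x w < infdist x (frontier \<Omega>)" using that d \<delta> dist_triangle[of x w z] unfolding mem_cball by linarith
        then show "w \<in> \<Omega>" using bx by auto
      qed
      show ?thesis
      proof (rule third_derivative_hoelder_step[OF \<alpha> order_refl \<delta> \<delta>1 sub sub B])
        fix l z assume z: "z \<in> closed_segment x y"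
        have zx: "dist x z <= ?\<delta>" using segment_bound(1)[OF z] by (simp add: dist_norm norm_minus_commute)
        have "z \<in> \<Omega>" using sub[OF zx] by auto
        moreover have "z \<in> ball c rz" using closed_segment_subset[OF x(2) y convex_ball] z by blast
        moreover have "?\<delta> <= infdist z (frontier \<Omega>) / 2"
          using infdist_triangle[of x "frontier \<Omega>" z] zx d \<delta> by linarith
        ultimately show "\<bar>mol [j, i, k, l] v ?\<delta> z\<bar> <= B * ?\<delta> powr (\<alpha> - 1)" using est[of "[j, i, k, l]" z ?\<delta>] \<delta> by simp
      qed (auto simp: dist_norm)
    qed simp
  qed
qed

end

text \<open>Telescoping along the heights \<open>T * q ^ k\<close>, with a geometric series of ratio
  \<open>q powr \<alpha>\<close>. Continuity at \<open>x\<close> closes the chain, whose bound does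
  not depend on how close \<open>x\<close> is to the boundary.\<close>

lemma geometric_chain:
  fixes F :: "real^3 => real"
  assumes q: "0 < q" "q < 1" and T: "T > 0" and \<alpha>: "\<alpha> > 0" and K: "K >= 0" and F: "isCont F x"
    and step: "!!k. \<bar>F (x + (T * q ^ k) *\<^sub>R \<nu>) - F (x + (T * q ^ Suc k) *\<^sub>R \<nu>)\<bar> <= K * (T * q ^ k) powr \<alpha>"
  shows "\<bar>F (x + T *\<^sub>R \<nu>) - F x\<bar> <= K / (1 - q powr \<alpha>) * T powr \<alpha>"
proof -
  define Q where "Q = q powr \<alpha>"
  have Q: "0 < Q" "Q < 1" using q \<alpha> powr_less_mono2[of \<alpha> q 1] by (auto simp: Q_def)
  let ?x = "%k. x + (T * q ^ k) *\<^sub>R \<nu>"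
  have s: "\<bar>F (?x 0) - F (?x n)\<bar> <= K * T powr \<alpha> * (\<Sum>k<n. Q ^ k)" for n
  proof (induction n)
    case (Suc n)
    have "(T * q ^ n) powr \<alpha> = T powr \<alpha> * Q ^ n"
      using q T by (simp add: powr_mult Q_def powr_powr powr_realpow[symmetric] mult.commute)
    then have "\<bar>F (?x n) - F (?x (Suc n))\<bar> <= K * T powr \<alpha> * Q ^ n" using step[of n] by simp
    then show ?case using Suc by (simp add: distrib_left)
  qed simp
  have "\<bar>F (?x 0) - F x\<bar> <= K * T powr \<alpha> / (1 - Q)"
  proof (rule tendsto_upperbound)
    have "(%k. T * q ^ k) \<longlonglongrightarrow> T * 0" by (rule tendsto_mult[OF tendsto_const LIMSEQ_power_zero]) (use q in auto)
    then have "?x \<longlonglongrightarrow> x + (T * 0) *\<^sub>R \<nu>" by (rule tendsto_add[OF tendsto_const tendsto_scaleR[OF _ tendsto_const]])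
    then have "?x \<longlonglongrightarrow> x" by simp
    then have "(%k. F (?x k)) \<longlonglongrightarrow> F x" using F isCont_tendsto_compose by blast
    then show "(%k. \<bar>F (?x 0) - F (?x k)\<bar>) \<longlonglongrightarrow> \<bar>F (?x 0) - F x\<bar>" by (intro tendsto_intros)
    have "(\<Sum>k<n. Q ^ k) <= 1 / (1 - Q)" for n
    proof -
      have "(\<Sum>k<n. Q ^ k) = (1 - Q ^ n) / (1 - Q)" using Q sum_gp_strict[of Q n] by simp
      also have "... <= 1 / (1 - Q)" using Q by (intro divide_right_mono) auto
      finally show ?thesis .
    qed
    then have "K * T powr \<alpha> * (\<Sum>k<n. Q ^ k) <= K * T powr \<alpha> * (1 / (1 - Q))" for n
      using K by (intro mult_left_mono) auto
    then show "\<forall>\<^sub>F n in sequentially. \<bar>F (?x 0) - F (?x n)\<bar> <= K * T powr \<alpha> / (1 - Q)"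
      using s order_trans by (intro always_eventually allI) fastforce
  qed simp
  then show ?thesis by (simp add: Q_def)
qed

context neumann_chart
begin

text \<open>\<open>\<rho>\<close> rises at least at rate \<open>m\<close> along
  \<open>\<nu>\<close>, and from there to the frontier it must fall to 0 with slope at most
  \<open>3 * M\<close>.\<close>

lemma infdist_lower:
  assumes c: "c \<in> frontier \<Omega>" and rz: "8 * rz <= R" and x: "x \<in> \<Omega>" "x \<in> ball c rz"
    and p: "x + s *\<^sub>R \<nu> \<in> ball c rz" and s: "s >= 0"
  shows "m / (3 * M) * s <= infdist (x + s *\<^sub>R \<nu>) (frontier \<Omega>)" "x + s *\<^sub>R \<nu> \<in> \<Omega>"
proof -
  let ?p = "x + s *\<^sub>R \<nu>"
  obtain x0 where x0: "x0 \<in> frontier \<Omega>" "infdist ?p (frontier \<Omega>) = dist ?p x0"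
    using infdist_attains_inf[of "frontier \<Omega>" ?p] c by auto
  have rz0: "rz > 0" using x(2) by (simp add: le_less_trans[OF zero_le_dist])
  have "dist ?p x0 < rz" using infdist_le[OF c, of ?p] p x0(2) by (simp add: dist_commute)
  then have "dist c x0 < R" using dist_triangle[of c x0 ?p] p rz rz0 unfolding mem_ball by linarith
  then have x0R: "x0 \<in> ball c R" by simp
  have pR: "?p \<in> ball c R" and xR: "x \<in> ball c R" using p x rz rz0 by auto
  have "m * s <= \<rho> x + m * s" using in\<Omega>[OF xR] x by simp
  also have "... <= \<rho> ?p" by (rule lift[OF xR pR s])
  finally have l: "m * s <= \<rho> ?p" .
  then have "\<rho> ?p > 0" using lift[OF xR pR s] in\<Omega>[OF xR] x m s mult_nonneg_nonneg[of m s] by linarith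
  then show "?p \<in> \<Omega>" using in\<Omega>[OF pR] by simp
  have "\<bar>\<rho> ?p - \<rho> x0\<bar> <= 3 * M * norm (?p - x0)"
    by (rule mvt_grad[where U="ball c R"])
      (use closed_segment_subset[OF pR x0R convex_ball] grad\<rho>_le \<rho>_diff in auto)
  moreover have "\<rho> x0 = 0" using bdry[OF x0R] x0 by simp
  ultimately have "m * s <= 3 * M * infdist ?p (frontier \<Omega>)" using l by (simp only: x0(2) dist_norm)
  then show "m / (3 * M) * s <= infdist ?p (frontier \<Omega>)" using M1 by (simp add: field_simps)
qed

theorem boundary_third_derivative_hoelder:
  assumes c: "c \<in> frontier \<Omega>"
  obtains K r where "r > 0" "!!i j k x y. x \<in> \<Omega> ==> y \<in> \<Omega> ==> x \<in> ball c r ==> y \<in> ball c r ==>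
      \<bar>pds [i, j, k] u x - pds [i, j, k] u y\<bar> <= K * norm (x - y) powr \<alpha>"
proof (rule near_hoelder[OF c])
  fix K rz
  assume K: "K > 0" and rz: "rz > 0" "8 * rz <= R" and N:
    "!!i j k x y. x \<in> \<Omega> ==> x \<in> ball c rz ==> y \<in> ball c rz ==> 8 * norm (x - y) <= infdist x (frontier \<Omega>) ==>
      \<bar>pds [i, j, k] u x - pds [i, j, k] u y\<bar> <= K * norm (x - y) powr \<alpha>"
  have C3: "Ck 3 \<Omega> u" by (rule interior_C3(1))
  define \<kappa> where "\<kappa> = m / (3 * M)"
  have \<kappa>: "0 < \<kappa>" "\<kappa> <= 1"
  proof -
    have cR: "c \<in> ball c (R / 2)" using Rpos by simp
    show "0 < \<kappa>" using m M1 by (simp add: \<kappa>_def)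
    show "\<kappa> <= 1" using norm_grad_x0[OF c cR] M1 by (simp add: \<kappa>_def)
  qed
  \<comment> \<open>At height \<open>\<Lambda> * t\<close> the distance to the frontier is at least
    \<open>\<kappa> * \<Lambda> * t = 8 * t\<close>, which is what \<open>near_hoelder\<close> asks
    for points at distance \<open>t\<close>.\<close>
  define \<Lambda> where "\<Lambda> = 8 / \<kappa>"
  \<comment> \<open>Consecutive heights differ by the fraction \<open>\<kappa> / 8\<close>, so eight
    times a step is \<open>\<kappa>\<close> times the height and thus at most the distance to the
    frontier.\<close>
  define q where "q = 1 - \<kappa> / 8"
  have q: "0 < q" "q < 1" using \<kappa> by (auto simp: q_def)
  have \<Lambda>: "\<Lambda> > 0" "\<kappa> * \<Lambda> = 8" using \<kappa> by (auto simp: \<Lambda>_def)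
  \<comment> \<open>As \<open>t < 2 * r\<close>, points raised by \<open>\<Lambda> * t\<close> stay
    in the ball of radius \<open>r + 2 * \<Lambda> * r = rz\<close>.\<close>
  define r where "r = rz / (1 + 2 * \<Lambda>)"
  have r: "r > 0" "r + 2 * \<Lambda> * r = rz"
  proof -
    have "r * (1 + 2 * \<Lambda>) = rz" using \<Lambda> by (simp add: r_def)
    then show "r + 2 * \<Lambda> * r = rz" by (simp add: algebra_simps)
    show "r > 0" using rz \<Lambda> by (simp add: r_def)
  qed
  define K' where "K' = K / (1 - q powr \<alpha>)"
  show ?thesis
  proof (rule that[of r "2 * (K' * \<Lambda> powr \<alpha>) + K"])
    show "r > 0" by (rule r(1))
    fix i j k x y assume x: "x \<in> \<Omega>" "x \<in> ball c r" and y: "y \<in> \<Omega>" "y \<in> ball c r"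
    define F where "F = pds [i, j, k] u"
    define t where "t = norm (x - y)"
    have F: "isCont F z" if "z \<in> \<Omega>" for z
    proof -
      have "Ck 0 \<Omega> F" unfolding F_def by (rule Ck_pds) (use C3 in \<open>simp add: numeral_3_eq_3\<close>)
      then show ?thesis using continuous_on_eq_continuous_at[OF open\<Omega>] that by auto
    qed
    show "\<bar>pds [i, j, k] u x - pds [i, j, k] u y\<bar> <= (2 * (K' * \<Lambda> powr \<alpha>) + K) * norm (x - y) powr \<alpha>"
    proof (cases "x = y")
      case False
      then have t: "t > 0" by (simp add: t_def)
      have "t < 2 * r"
      proof -
        have "dist x y <= dist c x + dist c y" by (rule dist_triangle3)
        then show ?thesis using x y by (simp add: t_def dist_norm)
      qed
      then have Tr: "\<Lambda> * t < 2 * \<Lambda> * r" using \<Lambda> mult_strict_left_mono[of t "2 * r" \<Lambda>] by simp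
      have up: "z + s *\<^sub>R \<nu> \<in> ball c rz" if "z \<in> ball c r" "0 <= s" "s <= \<Lambda> * t" for z s
      proof -
        have "dist z (z + s *\<^sub>R \<nu>) = s" using that unit\<nu> by (simp add: dist_norm)
        then show ?thesis using that Tr r dist_triangle[of c "z + s *\<^sub>R \<nu>" z] unfolding mem_ball by linarith
      qed
      have inz: "z \<in> ball c rz" if "z \<in> ball c r" for z using up[OF that, of 0] t \<Lambda> by simp
      have vert: "\<bar>F (z + (\<Lambda> * t) *\<^sub>R \<nu>) - F z\<bar> <= K' * (\<Lambda> * t) powr \<alpha>" if z: "z \<in> \<Omega>" "z \<in> ball c r" for z
        unfolding K'_def
      proof (rule geometric_chain[OF q _ \<alpha>(1) _ F[OF z(1)]])
        fix n
        have h: "0 <= \<Lambda> * t * q ^ n" "\<Lambda> * t * q ^ n <= \<Lambda> * t" and h': "0 <= \<Lambda> * t * q ^ Suc n" "\<Lambda> * t * q ^ Suc n <= \<Lambda> * t"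
          using \<Lambda> t q power_le_one[of q n] power_le_one[of q "Suc n"] by (auto intro!: mult_left_le simp del: power_Suc)
        note b = up[OF z(2) h] and b' = up[OF z(2) h']
        note low = infdist_lower[OF c rz(2) z(1) inz[OF z(2)] b h(1), folded \<kappa>_def]
        have eq: "z + (\<Lambda> * t * q ^ n) *\<^sub>R \<nu> - (z + (\<Lambda> * t * q ^ Suc n) *\<^sub>R \<nu>) = (\<Lambda> * t * q ^ n * (1 - q)) *\<^sub>R \<nu>"
          by (simp add: algebra_simps)
        have n: "norm (z + (\<Lambda> * t * q ^ n) *\<^sub>R \<nu> - (z + (\<Lambda> * t * q ^ Suc n) *\<^sub>R \<nu>)) = \<Lambda> * t * q ^ n * (\<kappa> / 8)"
          unfolding eq using unit\<nu> \<Lambda> t q \<kappa> by (simp add: q_def)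
        have "\<bar>F (z + (\<Lambda> * t * q ^ n) *\<^sub>R \<nu>) - F (z + (\<Lambda> * t * q ^ Suc n) *\<^sub>R \<nu>)\<bar>
          <= K * (\<Lambda> * t * q ^ n * (\<kappa> / 8)) powr \<alpha>"
          unfolding F_def n[symmetric] by (rule N[OF low(2) b b']) (use low(1) in \<open>unfold n, simp add: mult_ac\<close>)
        also have "... <= K * (\<Lambda> * t * q ^ n) powr \<alpha>"
          using h(1) \<kappa> K \<alpha> by (intro mult_left_mono powr_mono2 mult_left_le) auto
        finally show "\<bar>F (z + (\<Lambda> * t * q ^ n) *\<^sub>R \<nu>) - F (z + (\<Lambda> * t * q ^ Suc n) *\<^sub>R \<nu>)\<bar> <= K * (\<Lambda> * t * q ^ n) powr \<alpha>" .
      qed (use \<Lambda> t K in auto)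
      let ?x = "x + (\<Lambda> * t) *\<^sub>R \<nu>" and ?y = "y + (\<Lambda> * t) *\<^sub>R \<nu>"
      have T0: "0 <= \<Lambda> * t" using \<Lambda> t by simp
      note bx = up[OF x(2) T0 order_refl] and bY = up[OF y(2) T0 order_refl]
      note low = infdist_lower[OF c rz(2) x(1) inz[OF x(2)] bx T0, folded \<kappa>_def]
      have eq: "\<kappa> * (\<Lambda> * t) = 8 * t" using \<Lambda> by (simp add: mult.assoc[symmetric])
      have "norm (?x - ?y) = t" by (simp add: t_def)
      then have "8 * norm (?x - ?y) <= infdist ?x (frontier \<Omega>)" using low(1) eq by (simp only:)
      then have "\<bar>F ?x - F ?y\<bar> <= K * norm (?x - ?y) powr \<alpha>"
        unfolding F_def by (rule N[OF low(2) bx bY])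
      then have 1: "\<bar>F ?x - F ?y\<bar> <= K * t powr \<alpha>" by (simp add: t_def)
      have "(\<Lambda> * t) powr \<alpha> = \<Lambda> powr \<alpha> * t powr \<alpha>" using \<Lambda> t by (simp add: powr_mult)
      then have "\<bar>F x - F y\<bar> <= K' * (\<Lambda> powr \<alpha> * t powr \<alpha>) + K * t powr \<alpha> + K' * (\<Lambda> powr \<alpha> * t powr \<alpha>)"
        using vert[OF x] vert[OF y] 1 by simp
      also have "... = (2 * (K' * \<Lambda> powr \<alpha>) + K) * t powr \<alpha>" by (simp add: algebra_simps)
      finally show ?thesis unfolding F_def t_def .
    qed simp
  qed
qed

end

section \<open>From local to global Hoelder bounds, and functions on the closure\<close>

lemma hoelder_cont_compact_cover:
  fixes F :: "real^3 => real"
  assumes bd: "bounded U" and \<alpha>: "0 < \<alpha>"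
    and loc: "!!c. c \<in> closure U ==> \<exists>r>0. \<exists>K. \<forall>x\<in>U \<inter> ball c r. \<forall>y\<in>U \<inter> ball c r. \<bar>F x - F y\<bar> <= K * norm (x - y) powr \<alpha>"
  shows "hoelder_cont \<alpha> U F" "bounded (F ` U)"
proof -
  obtain r K where rK: "!!c. c \<in> closure U ==> r c > 0"
    "!!c x y. c \<in> closure U ==> x \<in> U \<inter> ball c (r c) ==> y \<in> U \<inter> ball c (r c) ==> \<bar>F x - F y\<bar> <= K c * norm (x - y) powr \<alpha>"
    using loc by metis
  have "compact (closure U)" using bd by (simp add: compact_closure)
  moreover have "closure U \<subseteq> (\<Union>c\<in>closure U. ball c (r c / 2))" using rK(1) by fastforce
  ultimately obtain S where S: "S \<subseteq> closure U" "finite S" "closure U \<subseteq> (\<Union>c\<in>S. ball c (r c / 2))"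
    using compactE_image[of "closure U" "closure U" "%c. ball c (r c / 2)"] by auto
  define K0 where "K0 = (\<Sum>c\<in>S. \<bar>K c\<bar>)"
  have K0: "K c <= K0" if "c \<in> S" for c
    using member_le_sum[OF that, of "%c. \<bar>K c\<bar>"] S(2) by (simp add: K0_def)
  have K0n: "K0 >= 0" by (simp add: K0_def sum_nonneg)
  \<comment> \<open>The balls of half radius cover, so two points closer than \<delta> lie together
    in one of the full balls. Pairs farther apart are handled by boundedness, at the price of a
    factor \<open>1 / \<delta> powr \<alpha>\<close>.\<close>
  have "\<exists>\<delta>>0. \<forall>c\<in>S. 2 * \<delta> <= r c"
  proof (cases "S = {}")
    case False
    let ?\<delta> = "Min (r ` S) / 2"
    have "Min (r ` S) > 0" using False S rK(1) by (subst Min_gr_iff) auto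
    moreover have "2 * ?\<delta> <= r c" if "c \<in> S" for c using that S by simp
    ultimately show ?thesis by (intro exI[of _ ?\<delta>]) auto
  qed (auto intro: exI[of _ 1])
  then obtain \<delta> where \<delta>: "\<delta> > 0" "!!c. c \<in> S ==> 2 * \<delta> <= r c" by auto
  have small: "\<bar>F x - F y\<bar> <= K0 * norm (x - y) powr \<alpha>" if xy: "x \<in> U" "y \<in> U" "norm (x - y) < \<delta>" for x y
  proof -
    have "x \<in> (\<Union>c\<in>S. ball c (r c / 2))" by (rule subsetD[OF S(3) subsetD[OF closure_subset xy(1)]])
    then obtain c where c: "c \<in> S" "dist c x < r c / 2" by auto
    have "dist c y < r c" using dist_triangle[of c y x] c \<delta>(2)[OF c(1)] xy(3) by (simp add: dist_norm)
    moreover have "dist c x < r c" using c zero_le_dist[of c x] by linarith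
    ultimately have "\<bar>F x - F y\<bar> <= K c * norm (x - y) powr \<alpha>" using c S xy by (intro rK(2)) auto
    also have "... <= K0 * norm (x - y) powr \<alpha>" by (rule mult_right_mono[OF K0[OF c(1)]]) simp
    finally show ?thesis .
  qed
  have "\<exists>B. \<forall>x\<in>U \<inter> ball c (r c). \<bar>F x\<bar> <= B" if c: "c \<in> S" for c
  proof (cases "U \<inter> ball c (r c) = {}")
    case False
    then obtain x0 where x0: "x0 \<in> U \<inter> ball c (r c)" by blast
    have "\<bar>F x\<bar> <= \<bar>F x0\<bar> + \<bar>K c\<bar> * (2 * r c) powr \<alpha>" if x: "x \<in> U \<inter> ball c (r c)" for x
    proof -
      have "\<bar>F x - F x0\<bar> <= K c * norm (x - x0) powr \<alpha>" using rK(2)[OF _ x x0] c S by auto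
      also have "... <= \<bar>K c\<bar> * (2 * r c) powr \<alpha>"
      proof (rule mult_mono)
        have "norm (x - x0) <= 2 * r c" using x x0 dist_triangle3[of x x0 c] by (simp add: dist_norm)
        then show "norm (x - x0) powr \<alpha> <= (2 * r c) powr \<alpha>" using \<alpha> by (intro powr_mono2) auto
      qed auto
      finally show ?thesis by linarith
    qed
    then show ?thesis by blast
  qed auto
  then obtain B where B: "!!c x. c \<in> S ==> x \<in> U \<inter> ball c (r c) ==> \<bar>F x\<bar> <= B c" by metis
  define B0 where "B0 = (\<Sum>c\<in>S. \<bar>B c\<bar>)"
  have FB: "\<bar>F x\<bar> <= B0" if x: "x \<in> U" for x
  proof -
    have "x \<in> (\<Union>c\<in>S. ball c (r c / 2))" by (rule subsetD[OF S(3) subsetD[OF closure_subset x]])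
    then obtain c where c: "c \<in> S" "dist c x < r c / 2" by auto
    have "dist c x < r c" using c zero_le_dist[of c x] by linarith
    then have "\<bar>F x\<bar> <= B c" using B[OF c(1)] x by auto
    also have "... <= \<bar>B c\<bar>" by simp
    also have "... <= B0" unfolding B0_def by (rule member_le_sum[OF c(1)]) (use S(2) in auto)
    finally show ?thesis .
  qed
  show "bounded (F ` U)" unfolding bounded_iff using FB by auto
  show "hoelder_cont \<alpha> U F"
    unfolding hoelder_cont_def
  proof (intro exI[of _ "K0 + 2 * \<bar>B0\<bar> / \<delta> powr \<alpha>"] ballI)
    fix x y assume xy: "x \<in> U" "y \<in> U"
    show "norm (F x - F y) <= (K0 + 2 * \<bar>B0\<bar> / \<delta> powr \<alpha>) * dist x y powr \<alpha>"
    proof (cases "norm (x - y) < \<delta>")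
      case True
      have "\<bar>F x - F y\<bar> <= K0 * norm (x - y) powr \<alpha>" by (rule small[OF xy True])
      also have "... <= (K0 + 2 * \<bar>B0\<bar> / \<delta> powr \<alpha>) * norm (x - y) powr \<alpha>" by (intro mult_right_mono) auto
      finally show ?thesis by (simp add: dist_norm)
    next
      case False
      have "\<bar>F x - F y\<bar> <= 2 * \<bar>B0\<bar>" using FB[OF xy(1)] FB[OF xy(2)] by linarith
      also have "... = 2 * \<bar>B0\<bar> / \<delta> powr \<alpha> * \<delta> powr \<alpha>" using \<delta> by simp
      also have "... <= (K0 + 2 * \<bar>B0\<bar> / \<delta> powr \<alpha>) * norm (x - y) powr \<alpha>"
        using False \<delta> \<alpha> K0n by (intro mult_mono powr_mono2) auto
      finally show ?thesis by (simp add: dist_norm)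
    qed
  qed
qed

lemma hoelder_cont_mono:
  assumes "hoelder_cont \<alpha> U v" "bounded U" "0 < \<beta>" "\<beta> <= \<alpha>" shows "hoelder_cont \<beta> U v"
proof -
  obtain C where C: "!!x y. x \<in> U ==> y \<in> U ==> norm (v x - v y) <= C * dist x y powr \<alpha>"
    using assms(1) by (auto simp: hoelder_cont_def)
  obtain B where B: "!!x. x \<in> U ==> norm x <= B" using assms(2) by (auto simp: bounded_iff)
  show ?thesis unfolding hoelder_cont_def
  proof (intro exI[of _ "\<bar>C\<bar> * (2 * \<bar>B\<bar>) powr (\<alpha> - \<beta>)"] ballI)
    fix x y assume xy: "x \<in> U" "y \<in> U"
    have d: "dist x y <= 2 * \<bar>B\<bar>" using B[OF xy(1)] B[OF xy(2)] norm_triangle_ineq4[of x y] by (simp add: dist_norm)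
    have "norm (v x - v y) <= C * dist x y powr \<alpha>" by (rule C[OF xy])
    also have "... <= \<bar>C\<bar> * dist x y powr \<alpha>" by (intro mult_right_mono) auto
    also have "dist x y powr \<alpha> = dist x y powr (\<alpha> - \<beta>) * dist x y powr \<beta>" by (simp add: powr_add[symmetric])
    also have "\<bar>C\<bar> * (dist x y powr (\<alpha> - \<beta>) * dist x y powr \<beta>) <= \<bar>C\<bar> * ((2 * \<bar>B\<bar>) powr (\<alpha> - \<beta>) * dist x y powr \<beta>)"
      using d assms by (intro mult_left_mono mult_right_mono powr_mono2) auto
    finally show "norm (v x - v y) <= \<bar>C\<bar> * (2 * \<bar>B\<bar>) powr (\<alpha> - \<beta>) * dist x y powr \<beta>" by (simp add: mult.assoc)
  qed
qed

lemma hoelder_cont_uniform: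
  assumes "hoelder_cont \<alpha> U v" "\<alpha> > 0" shows "uniformly_continuous_on U v"
proof -
  obtain C where C: "!!x y. x \<in> U ==> y \<in> U ==> norm (v x - v y) <= C * dist x y powr \<alpha>"
    using assms(1) by (auto simp: hoelder_cont_def)
  show ?thesis unfolding uniformly_continuous_on_def
  proof (intro allI impI)
    fix e :: real assume e: "e > 0"
    define d where "d = (e / (\<bar>C\<bar> + 1)) powr (1 / \<alpha>)"
    have d: "d > 0" using e by (simp add: d_def)
    have dp: "d powr \<alpha> = e / (\<bar>C\<bar> + 1)" using e assms(2) by (simp add: d_def powr_powr)
    show "\<exists>d>0. \<forall>x\<in>U. \<forall>x'\<in>U. dist x' x < d --> dist (v x') (v x) < e"
    proof (intro exI[of _ d] conjI ballI impI d)
      fix x y assume xy: "x \<in> U" "y \<in> U" "dist y x < d"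
      have "dist (v y) (v x) <= C * dist y x powr \<alpha>" using C[OF xy(2,1)] by (simp add: dist_norm)
      also have "... <= \<bar>C\<bar> * d powr \<alpha>" using xy(3) assms(2) by (intro mult_mono powr_mono2) auto
      also have "... < (\<bar>C\<bar> + 1) * d powr \<alpha>" using d by simp
      also have "... = e" unfolding dp by (simp add: field_simps)
      finally show "dist (v y) (v x) < e" .
    qed
  qed
qed

lemma Ck_closure_0:
  "Ck_closure 0 U u \<longleftrightarrow> continuous_on U u \<and> (\<exists>g. continuous_on (closure U) g \<and> (\<forall>x\<in>U. g x = u x))"
  by (auto simp: Ck_closure_def)

lemma Ck_closure_Suc:
  "Ck_closure (Suc k) U u \<longleftrightarrow> (\<forall>x\<in>U. u differentiable at x) \<and>
     (\<exists>g. continuous_on (closure U) g \<and> (\<forall>x\<in>U. g x = u x)) \<and> (\<forall>i. Ck_closure k U (pd i u))"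
proof -
  have *: "(\<forall>is::3 list. length is <= Suc k --> Q is) \<longleftrightarrow> Q [] \<and> (\<forall>i is. length is <= k --> Q (i # is))" for Q
    by (metis Suc_le_mono le0 length_Cons list.size(3) neq_Nil_conv)
  show ?thesis unfolding Ck_closure_def * by (auto simp del: Ck.simps simp: Ck.simps(2))
qed

lemma Ck_closure_Ck: "Ck_closure k U u ==> Ck k U u" by (simp add: Ck_closure_def)

lemma Ck_closure_extension:
  "Ck_closure k U u ==> \<exists>g. continuous_on (closure U) g \<and> (\<forall>x\<in>U. g x = u x)"
  unfolding Ck_closure_def by (drule conjunct2, drule spec[of _ "[]"]) simp

lemma Ck_closure_mono:
  assumes "Ck_closure k U u" "j <= k" shows "Ck_closure j U u"
  using assms Ck_mono[of k U u j] order_trans[OF _ assms(2)] by (auto simp: Ck_closure_def)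

lemma Ck_closure_cong_imp:
  assumes "open U" "!!x. x \<in> U ==> f x = g x" and f: "Ck_closure k U f"
  shows "Ck_closure k U g"
  unfolding Ck_closure_def
proof (intro conjI allI impI)
  show "Ck k U g" by (rule Ck_cong_imp[OF assms(1,2) Ck_closure_Ck[OF f]])
  fix "is" :: "3 list" assume "length is <= k"
  then obtain h where h: "continuous_on (closure U) h" "\<forall>x\<in>U. h x = pds is f x" using f by (auto simp: Ck_closure_def)
  have "pds is f x = pds is g x" if "x \<in> U" for x by (rule pds_cong[OF assms(1,2) that])
  then show "\<exists>h. continuous_on (closure U) h \<and> (\<forall>x\<in>U. h x = pds is g x)" using h by auto
qed

lemma Ck_closure_add:
  fixes f g :: "real^3 => real"
  assumes U: "open U" shows "Ck_closure k U f ==> Ck_closure k U g ==> Ck_closure k U (%x. f x + g x)"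
proof (induction k arbitrary: f g)
  case 0
  then obtain f' g' where "continuous_on (closure U) f'" "\<forall>x\<in>U. f' x = f x" "continuous_on (closure U) g'" "\<forall>x\<in>U. g' x = g x"
    by (auto simp: Ck_closure_0)
  then show ?case using 0 by (auto simp: Ck_closure_0 intro!: continuous_intros exI[of _ "%x. f' x + g' x"])
next
  case (Suc k)
  obtain f' g' where "continuous_on (closure U) f'" "\<forall>x\<in>U. f' x = f x" "continuous_on (closure U) g'" "\<forall>x\<in>U. g' x = g x"
    using Ck_closure_extension[OF Suc.prems(1)] Ck_closure_extension[OF Suc.prems(2)] by auto
  then have e: "\<exists>h. continuous_on (closure U) h \<and> (\<forall>x\<in>U. h x = f x + g x)"
    by (intro exI[of _ "%x. f' x + g' x"]) (auto intro: continuous_intros)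
  have d: "\<forall>x\<in>U. f differentiable at x" "\<forall>x\<in>U. g differentiable at x" using Suc.prems by (auto simp: Ck_closure_Suc)
  have "Ck_closure k U (pd i (%x. f x + g x))" for i
  proof (rule Ck_closure_cong_imp[OF U])
    show "Ck_closure k U (%x. pd i f x + pd i g x)" using Suc by (simp add: Ck_closure_Suc)
  qed (use d in \<open>simp add: pd_add\<close>)
  then show ?case using e d by (auto simp: Ck_closure_Suc)
qed

lemma Ck_closure_mult:
  fixes f g :: "real^3 => real"
  assumes U: "open U" shows "Ck_closure k U f ==> Ck_closure k U g ==> Ck_closure k U (%x. f x * g x)"
proof (induction k arbitrary: f g)
  case 0
  then obtain f' g' where "continuous_on (closure U) f'" "\<forall>x\<in>U. f' x = f x" "continuous_on (closure U) g'" "\<forall>x\<in>U. g' x = g x"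
    by (auto simp: Ck_closure_0)
  then show ?case using 0 by (auto simp: Ck_closure_0 intro!: continuous_intros exI[of _ "%x. f' x * g' x"])
next
  case (Suc k)
  obtain f' g' where "continuous_on (closure U) f'" "\<forall>x\<in>U. f' x = f x" "continuous_on (closure U) g'" "\<forall>x\<in>U. g' x = g x"
    using Ck_closure_extension[OF Suc.prems(1)] Ck_closure_extension[OF Suc.prems(2)] by auto
  then have e: "\<exists>h. continuous_on (closure U) h \<and> (\<forall>x\<in>U. h x = f x * g x)"
    by (intro exI[of _ "%x. f' x * g' x"]) (auto intro: continuous_intros)
  have d: "\<forall>x\<in>U. f differentiable at x" "\<forall>x\<in>U. g differentiable at x" using Suc.prems by (auto simp: Ck_closure_Suc)
  have low: "Ck_closure k U f" "Ck_closure k U g" using Suc.prems Ck_closure_mono[of "Suc k" U _ k] by auto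
  have "Ck_closure k U (pd i (%x. f x * g x))" for i
  proof (rule Ck_closure_cong_imp[OF U])
    show "Ck_closure k U (%x. f x * pd i g x + pd i f x * g x)"
      using Suc.prems by (intro Ck_closure_add[OF U] Suc.IH low) (auto simp: Ck_closure_Suc)
  qed (use d in \<open>simp add: pd_mult\<close>)
  then show ?case using e d by (auto simp: Ck_closure_Suc intro: differentiable_mult)
qed

lemma Ck_closure_const: "Ck_closure k U (%x. c)"
proof (induction k arbitrary: c)
  case 0 show ?case by (auto simp: Ck_closure_0 intro!: exI[of _ "%x. c"])
next
  case (Suc k) then show ?case by (auto simp: Ck_closure_Suc pd_const intro!: exI[of _ "%x. c"])
qed

lemma Ck_closure_nth:
  fixes A :: "real^3 => real^3"
  assumes U: "open U" and A: "Ck_closure k U A" shows "Ck_closure k U (%x. A x $ j)"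
  unfolding Ck_closure_def
proof (intro conjI allI impI)
  show "Ck k U (%x. A x $ j)" by (rule Ck_nth[OF U Ck_closure_Ck[OF A]])
  fix "is" :: "3 list" assume l: "length is <= k"
  then obtain h where h: "continuous_on (closure U) h" "\<forall>x\<in>U. h x = pds is A x" using A by (auto simp: Ck_closure_def)
  have "Ck (length is) U A" by (rule Ck_mono[OF Ck_closure_Ck[OF A] l])
  then have "pds is (%x. A x $ j) x = pds is A x $ j" if "x \<in> U" for x by (rule pds_nth[OF U that])
  then show "\<exists>h. continuous_on (closure U) h \<and> (\<forall>x\<in>U. h x = pds is (%x. A x $ j) x)"
    using h by (intro exI[of _ "%x. h x $ j"]) (auto intro: continuous_intros)
qed

lemma bounded_extension:
  fixes f h :: "real^3 => 'b::real_normed_vector"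
  assumes "bounded U" "continuous_on (closure U) h" "!!x. x \<in> U ==> h x = f x"
  shows "bounded (f ` U)"
proof -
  have "compact (h ` closure U)" by (rule compact_continuous_image[OF assms(2)]) (use assms(1) in simp)
  then have "bounded (h ` closure U)" by (rule compact_imp_bounded)
  then have "bounded (h ` U)" by (rule bounded_subset) (simp add: image_mono closure_subset)
  then show ?thesis using assms(3) by simp
qed

lemma Ck_closure_bound:
  fixes u :: "real^3 => real"
  assumes U: "bounded U" and u: "Ck_closure k U u"
  shows "\<exists>M\<ge>0. \<forall>is x. length is <= k --> x \<in> U --> \<bar>pds is u x\<bar> <= M"
proof -
  let ?S = "{is :: 3 list. length is <= k}"
  have fin: "finite ?S" by (rule finite_lists(2))
  have "\<exists>M. \<forall>x\<in>U. \<bar>pds is u x\<bar> <= M" if l: "is \<in> ?S" for "is"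
  proof -
    obtain h where h: "continuous_on (closure U) h" "\<forall>x\<in>U. h x = pds is u x" using u l by (auto simp: Ck_closure_def)
    then have "bounded (pds is u ` U)" by (intro bounded_extension[OF U h(1)]) auto
    then show ?thesis by (auto simp: bounded_iff)
  qed
  then obtain M where M: "!!is x. is \<in> ?S ==> x \<in> U ==> \<bar>pds is u x\<bar> <= M is" by metis
  show ?thesis
  proof (intro exI[of _ "\<Sum>is\<in>?S. \<bar>M is\<bar>"] conjI allI impI sum_nonneg)
    fix "is" :: "3 list" and x assume l: "length is <= k" and x: "x \<in> U"
    then have S: "is \<in> ?S" by simp
    have "\<bar>pds is u x\<bar> <= \<bar>M is\<bar>" using M[OF S x] by linarith
    also have "... <= (\<Sum>is\<in>?S. \<bar>M is\<bar>)" by (rule member_le_sum[OF S _ fin]) simp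
    finally show "\<bar>pds is u x\<bar> <= (\<Sum>is\<in>?S. \<bar>M is\<bar>)" .
  qed simp
qed

text \<open>A point of the closure outside \<open>U\<close> is an accumulation point of
  \<open>U\<close>, so the limit in \<open>ext\<close> is unique there and equals the value of any
  continuous extension.\<close>

lemma ext_eq:
  fixes h :: "real^3 => 'b::t2_space"
  assumes "continuous_on (closure U) h" "!!x. x \<in> U ==> h x = u x" "x \<in> closure U"
  shows "ext U u x = h x"
proof (cases "x \<in> U")
  case False
  then have nt: "at x within U \<noteq> bot" using assms(3) by (simp add: trivial_limit_within closure_def)
  have "(h \<longlongrightarrow> h x) (at x within closure U)" using assms(1,3) by (simp add: continuous_on_def)
  then have "(h \<longlongrightarrow> h x) (at x within U)" by (rule tendsto_within_subset[OF _ closure_subset])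
  then have "(u \<longlongrightarrow> h x) (at x within U)"
    by (rule tendsto_cong[THEN iffD1, rotated]) (use assms(2) in \<open>auto simp: eventually_at_filter\<close>)
  then show ?thesis unfolding ext_def using False tendsto_Lim[OF nt] by simp
qed (use assms(2) in \<open>simp add: ext_def\<close>)

text \<open>The extensions still missing are those of the third derivatives. A Hoelder condition
  makes them uniformly continuous, hence extendable to the closure, and boundedness follows by
  compactness.\<close>

lemma Ck_hoelder_3I:
  fixes u :: "real^3 => real"
  assumes U: "bounded U" and u3: "Ck 3 U u" and u2: "Ck_closure 2 U u"
    and \<alpha>: "0 < \<alpha>" and h: "!!i j k. hoelder_cont \<alpha> U (pds [i, j, k] u)"
  shows "Ck_hoelder 3 \<alpha> U u"
proof -
  have e: "\<exists>g. continuous_on (closure U) g \<and> (\<forall>x\<in>U. g x = pds is u x)" if l: "length is <= 3" for "is"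
  proof (cases "length is <= 2")
    case True
    then show ?thesis using u2 by (simp add: Ck_closure_def)
  next
    case False
    then have "length is = 3" using l by simp
    then obtain i j k where isl: "is = [i, j, k]" by (auto simp: numeral_3_eq_3 length_Suc_conv)
    have "uniformly_continuous_on U (pds is u)" unfolding isl by (rule hoelder_cont_uniform[OF h \<alpha>])
    then show ?thesis
    proof (rule uniformly_continuous_on_extension_on_closure)
      fix g assume g: "uniformly_continuous_on (closure U) g" "!!x. x \<in> U ==> pds is u x = g x"
      show ?thesis by (intro exI[of _ g] conjI ballI uniformly_continuous_imp_continuous[OF g(1)]) (simp add: g(2))
    qed
  qed
  show ?thesis
    unfolding Ck_hoelder_def Ck_closure_def
  proof (intro conjI allI impI u3 e)
    fix "is" :: "3 list" assume "length is <= 3"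
    from e[OF this] obtain g where g: "continuous_on (closure U) g" "\<forall>x\<in>U. g x = pds is u x" by auto
    then show "bounded (pds is u ` U)" by (intro bounded_extension[OF U g(1)]) auto
  next
    fix "is" :: "3 list" assume "length is = 3"
    then obtain i j k where "is = [i, j, k]" by (auto simp: numeral_3_eq_3 length_Suc_conv)
    then show "hoelder_cont \<alpha> U (pds is u)" using h by simp
  qed
qed

section \<open>The normal vector and charts of the boundary\<close>

context defining_function
begin

lemma rho_expansion:
  assumes x: "x \<in> frontier \<Omega>" "x \<in> ball c R" and e: "e > 0"
  shows "\<exists>d>0. ball x d \<subseteq> ball c R \<and> (\<forall>y\<in>ball x d. \<bar>\<rho> y - grad \<rho> x \<bullet> (y - x)\<bar> <= e * norm (y - x))"
proof -
  have "(\<rho> has_derivative (%h. grad \<rho> x \<bullet> h)) (at x)" by (rule has_derivative_grad[OF \<rho>_diff[OF x(2)]])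
  then obtain d1 where d1: "d1 > 0" "!!y. norm (y - x) < d1 ==> norm (\<rho> y - \<rho> x - grad \<rho> x \<bullet> (y - x)) <= e * norm (y - x)"
    using e unfolding has_derivative_at_alt by blast
  obtain d2 where d2: "d2 > 0" "ball x d2 \<subseteq> ball c R" using openE[OF open_ball x(2)] by blast
  have "\<rho> x = 0" using bdry[OF x(2)] x(1) by simp
  then show ?thesis
    using d1 d2 by (intro exI[of _ "min d1 d2"]) (auto simp: dist_norm norm_minus_commute subset_iff)
qed

lemma norm_grad_ge: "y \<in> ball c R ==> m <= norm (grad \<rho> y)"
  using transversal[of y] norm_cauchy_schwarz[of "grad \<rho> y" \<nu>] unit\<nu> by simp

text \<open>\<open>outer_normal\<close> is a definite description, so existence and uniqueness are
  both at stake. A candidate must be orthogonal to every tangent direction because the frontier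
  contains points near each of them; this leaves two unit vectors, and the expansion of
  \<open>\<rho>\<close> decides which one points out of \<open>\<Omega>\<close>.\<close>

lemma outer_normal_eq:
  assumes x: "x \<in> frontier \<Omega>" "x \<in> ball c R"
  shows "outer_normal \<Omega> x = - ((1 / norm (grad \<rho> x)) *\<^sub>R grad \<rho> x)"
proof -
  let ?g = "grad \<rho> x"
  define w where "w = (1 / norm ?g) *\<^sub>R ?g"
  have g: "norm ?g > 0" using norm_grad_ge[OF x(2)] m by linarith
  have w: "norm w = 1" "?g = norm ?g *\<^sub>R w" "?g \<bullet> w = norm ?g" "w \<bullet> w = 1"
    using g by (auto simp: w_def power2_norm_eq_inner[symmetric] power2_eq_square norm_eq_1)
  have side: "\<forall>\<^sub>F t in at_right 0. x + t *\<^sub>R w \<in> \<Omega> \<and> x + t *\<^sub>R (- w) \<in> exterior \<Omega>"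
  proof -
    have "norm ?g / 2 > 0" using g by simp
    then obtain d where d: "d > 0" "ball x d \<subseteq> ball c R"
      "!!y. y \<in> ball x d ==> \<bar>\<rho> y - ?g \<bullet> (y - x)\<bar> <= norm ?g / 2 * norm (y - x)"
      using rho_expansion[OF x] by meson
    have "x + t *\<^sub>R w \<in> \<Omega> \<and> x + t *\<^sub>R (- w) \<in> exterior \<Omega>" if t: "0 < t" "t < d" for t
    proof
      have gt: "t * norm ?g > 0" using g t by simp
      have b: "x + t *\<^sub>R w \<in> ball x d" "x + t *\<^sub>R (- w) \<in> ball x d" using t w(1) by (auto simp: dist_norm)
      have "\<bar>\<rho> (x + t *\<^sub>R w) - t * norm ?g\<bar> <= t * norm ?g / 2" using d(3)[OF b(1)] t w by (simp add: mult.commute)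
      then have "\<rho> (x + t *\<^sub>R w) > 0" using gt unfolding abs_le_iff by linarith
      then show "x + t *\<^sub>R w \<in> \<Omega>" using in\<Omega> b(1) d(2) by blast
      have "\<bar>\<rho> (x + t *\<^sub>R (- w)) + t * norm ?g\<bar> <= t * norm ?g / 2" using d(3)[OF b(2)] t w by (simp add: mult.commute)
      then have "\<rho> (x + t *\<^sub>R (- w)) < 0" using gt unfolding abs_le_iff by linarith
      then have "x + t *\<^sub>R (- w) \<notin> \<Omega>" "x + t *\<^sub>R (- w) \<notin> frontier \<Omega>"
        using in\<Omega>[OF subsetD[OF d(2) b(2)]] bdry[OF subsetD[OF d(2) b(2)]] by linarith+
      then show "x + t *\<^sub>R (- w) \<in> exterior \<Omega>" using open\<Omega> by (auto simp: frontier_def interior_open)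
    qed
    then show ?thesis unfolding eventually_at_right_field using d(1) by (intro exI[of _ d]) auto
  qed
  have small: "((%y. ((y - x) \<bullet> (- w)) / norm (y - x)) \<longlongrightarrow> 0) (at x within frontier \<Omega>)"
    unfolding Lim_within
  proof (intro allI impI)
    fix e :: real assume e: "e > 0"
    then have "e * norm ?g / 2 > 0" using g by simp
    then obtain d where d: "d > 0" "ball x d \<subseteq> ball c R"
      "!!y. y \<in> ball x d ==> \<bar>\<rho> y - ?g \<bullet> (y - x)\<bar> <= e * norm ?g / 2 * norm (y - x)"
      using rho_expansion[OF x] by meson
    show "\<exists>d>0. \<forall>y\<in>frontier \<Omega>. 0 < dist y x \<and> dist y x < d --> dist (((y - x) \<bullet> (- w)) / norm (y - x)) 0 < e"
    proof (intro exI[of _ d] conjI ballI impI d(1))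
      fix y assume y: "y \<in> frontier \<Omega>" "0 < dist y x \<and> dist y x < d"
      then have yb: "y \<in> ball x d" by (simp add: dist_commute)
      then have "\<rho> y = 0" using bdry[of y] y d(2) by blast
      then have "\<bar>?g \<bullet> (y - x)\<bar> <= e * norm ?g / 2 * norm (y - x)" using d(3)[OF yb] by simp
      moreover have "?g \<bullet> (y - x) = norm ?g * (w \<bullet> (y - x))" by (subst w(2)) simp
      ultimately have "norm ?g * \<bar>w \<bullet> (y - x)\<bar> <= norm ?g * (e / 2 * norm (y - x))" using g by (simp add: abs_mult mult_ac)
      then have "\<bar>w \<bullet> (y - x)\<bar> <= e / 2 * norm (y - x)" using g by (simp only: mult_le_cancel_left_pos)
      moreover have "norm (y - x) > 0" using y by (simp add: dist_norm)
      ultimately have "\<bar>w \<bullet> (y - x)\<bar> / norm (y - x) <= e / 2" by (simp add: divide_le_eq)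
      then have "\<bar>w \<bullet> (y - x)\<bar> / norm (y - x) < e" using e by linarith
      then show "dist (((y - x) \<bullet> (- w)) / norm (y - x)) 0 < e" by (simp add: abs_divide inner_commute)
    qed
  qed
  show ?thesis
    unfolding outer_normal_def w_def[symmetric]
  proof (rule the_equality, intro conjI)
    show "norm (- w) = 1" using w by simp
    show "((%y. ((y - x) \<bullet> (- w)) / norm (y - x)) \<longlongrightarrow> 0) (at x within frontier \<Omega>)" by (rule small)
    show "\<forall>\<^sub>F t in at_right 0. x + t *\<^sub>R (- w) \<in> exterior \<Omega>" by (rule eventually_mono[OF side]) simp
    fix n :: "real^3"
    assume n: "norm n = 1 \<and> ((%y. ((y - x) \<bullet> n) / norm (y - x)) \<longlongrightarrow> 0) (at x within frontier \<Omega>) \<and>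
      (\<forall>\<^sub>F t in at_right 0. x + t *\<^sub>R n \<in> exterior \<Omega>)"
    \<comment> \<open>Of \<open>3 * e\<close>, two parts come from the tangency condition at a
      frontier point at distance at most \<open>2 * t\<close>, and one from the shift along
      \<open>\<nu>\<close> by at most \<open>e * t\<close>.\<close>
    have tang: "\<bar>n \<bullet> \<tau>\<bar> <= 3 * e" if \<tau>: "\<tau> \<bullet> ?g = 0" "norm \<tau> = 1" and e: "0 < e" "e <= 1 / 2" for \<tau> e
    proof -
      obtain d1 where d1: "d1 > 0" "!!y. y \<in> frontier \<Omega> ==> 0 < dist y x ==> dist y x < d1 ==> dist (((y - x) \<bullet> n) / norm (y - x)) 0 < e"
        using n e(1) unfolding Lim_within by meson
      have "e * m > 0" using e m by simp
      then obtain d2 where d2: "d2 > 0" "ball x d2 \<subseteq> ball c R"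
        "!!y. y \<in> ball x d2 ==> \<bar>\<rho> y - ?g \<bullet> (y - x)\<bar> <= e * m * norm (y - x)"
      using rho_expansion[OF x] by meson
      define t where "t = min d1 d2 / 4"
      have t: "t > 0" "4 * t <= d1" "4 * t <= d2" using d1 d2 by (auto simp: t_def)
      let ?p = "x + t *\<^sub>R \<tau>"
      have "?p \<in> ball x d2" using t \<tau>(2) by (simp add: dist_norm)
      from d2(3)[OF this] have "\<bar>\<rho> ?p\<bar> <= e * m * t" using t \<tau> by (simp add: inner_commute)
      then have \<rho>p: "\<bar>\<rho> ?p\<bar> / m <= e * t" using m by (simp add: field_simps)
      have et: "e * t <= t / 2" "0 < e * t" using e t by (auto simp: mult_right_mono[of e "1/2" t, simplified])
      have "cball ?p (\<bar>\<rho> ?p\<bar> / m) \<subseteq> ball c R"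
      proof
        fix z assume "z \<in> cball ?p (\<bar>\<rho> ?p\<bar> / m)"
        then have "dist ?p z <= t / 2" using \<rho>p et by simp
        moreover have "dist x ?p = t" using t \<tau>(2) by (simp add: dist_norm)
        ultimately have "dist x z < d2" using dist_triangle[of x z ?p] t by linarith
        then show "z \<in> ball c R" using d2(2) by auto
      qed
      from frontier_near[OF this] obtain s where s: "\<bar>s\<bar> <= \<bar>\<rho> ?p\<bar> / m" "?p + s *\<^sub>R \<nu> \<in> frontier \<Omega>" .
      let ?y = "?p + s *\<^sub>R \<nu>"
      have s': "\<bar>s\<bar> <= e * t" using s(1) \<rho>p by simp
      have y: "?y - x = t *\<^sub>R \<tau> + s *\<^sub>R \<nu>" by simp
      have n1: "norm (t *\<^sub>R \<tau>) = t" "norm (s *\<^sub>R \<nu>) = \<bar>s\<bar>" using t \<tau>(2) unit\<nu> by auto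
      have up: "norm (?y - x) <= 2 * t" using norm_triangle_ineq[of "t *\<^sub>R \<tau>" "s *\<^sub>R \<nu>"] n1 s' et t unfolding y by linarith
      have lo: "norm (?y - x) > 0" using norm_diff_ineq[of "t *\<^sub>R \<tau>" "s *\<^sub>R \<nu>"] n1 s' et t unfolding y by linarith
      have "dist (((?y - x) \<bullet> n) / norm (?y - x)) 0 < e" by (rule d1(2)[OF s(2)]) (use lo up t in \<open>auto simp: dist_norm\<close>)
      then have "\<bar>(?y - x) \<bullet> n\<bar> <= e * norm (?y - x)" using lo by (simp add: abs_divide divide_less_eq)
      also have "... <= e * (2 * t)" using up e by (intro mult_left_mono) auto
      finally have 1: "\<bar>(?y - x) \<bullet> n\<bar> <= e * (2 * t)" .
      have "\<bar>\<nu> \<bullet> n\<bar> <= 1" using Cauchy_Schwarz_ineq2[of \<nu> n] n unit\<nu> by simp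
      from abs_mult_le[OF s' this] have 2: "\<bar>s * (\<nu> \<bullet> n)\<bar> <= e * t" by simp
      have "(?y - x) \<bullet> n = t * (n \<bullet> \<tau>) + s * (\<nu> \<bullet> n)"
        unfolding y inner_commute[of n \<tau>] by (simp only: inner_add_left inner_scaleR_left)
      then have "\<bar>t * (n \<bullet> \<tau>)\<bar> <= e * (2 * t) + e * t" using 1 2 by linarith
      also have "... = t * (3 * e)" by (simp add: algebra_simps)
      finally have "\<bar>t * (n \<bullet> \<tau>)\<bar> <= t * (3 * e)" .
      then show ?thesis using t by (simp add: abs_mult)
    qed
    define v where "v = n - (n \<bullet> w) *\<^sub>R w"
    have vw: "v \<bullet> w = 0" using w by (simp add: v_def inner_diff_left)
    have "v = 0"
    proof (rule ccontr)
      assume v: "v \<noteq> 0"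
      have vg: "((1 / norm v) *\<^sub>R v) \<bullet> ?g = 0" by (subst w(2)) (simp add: vw)
      have nv: "n \<bullet> v = v \<bullet> v" using vw by (simp add: v_def inner_diff_left inner_diff_right inner_commute)
      have nn: "n \<bullet> ((1 / norm v) *\<^sub>R v) = norm v" using nv v by (simp add: power2_norm_eq_inner[symmetric] power2_eq_square)
      define e where "e = min (1 / 2) (norm v / 6)"
      have e: "0 < e" "e <= 1 / 2" "6 * e <= norm v" using v by (auto simp: e_def)
      have "\<bar>n \<bullet> ((1 / norm v) *\<^sub>R v)\<bar> <= 3 * e" by (rule tang[OF vg _ e(1,2)]) (use v in simp)
      then show False using e v unfolding nn by simp
    qed
    then have nw: "n = (n \<bullet> w) *\<^sub>R w" by (simp add: v_def)
    then have "norm n = \<bar>n \<bullet> w\<bar>" using w(1) by (metis mult.right_neutral norm_scaleR)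
    then have "n \<bullet> w = 1 \<or> n \<bullet> w = - 1" using n by linarith
    moreover have "n \<bullet> w \<noteq> 1"
    proof
      assume "n \<bullet> w = 1"
      then have "n = w" using nw by simp
      then have "\<forall>\<^sub>F t in at_right 0. x + t *\<^sub>R w \<in> exterior \<Omega> \<and> x + t *\<^sub>R w \<in> \<Omega>"
        using n side by (auto elim: eventually_elim2)
      then have "\<forall>\<^sub>F t in at_right (0::real). False" by (rule eventually_mono) (use closure_subset in auto)
      then show False by simp
    qed
    ultimately show "n = - w" using nw by auto
  qed
qed

end

text \<open>\<open>\<rho>\<close> is the third component of the straightening map. The definition of
  the boundary only puts points of \<open>\<Omega>\<close> on the positive side; the converse is
  topological: the preimage of a half ball is connected, meets \<open>\<Omega>\<close> and misses
  the frontier, so it lies in \<open>\<Omega>\<close>.\<close>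

lemma boundary_chart:
  assumes \<Omega>: "open \<Omega>" "bounded \<Omega>" and hb: "hoelder_boundary r \<alpha> \<Omega>" "3 <= r" and \<alpha>: "0 < \<alpha>" "\<alpha> < 1"
    and c: "c \<in> frontier \<Omega>"
  obtains \<rho> R m \<nu> M where "defining_function \<Omega> \<rho> c R m \<nu>" "R > 0" "Ck 3 (ball c R) \<rho>"
    "!!is y. y \<in> ball c R ==> length is <= 3 ==> \<bar>pds is \<rho> y\<bar> <= M"
    "!!i j k x y. x \<in> ball c R ==> y \<in> ball c R ==> \<bar>pds [i, j, k] \<rho> x - pds [i, j, k] \<rho> y\<bar> <= M * norm (x - y) powr \<alpha>"
proof -
  obtain e \<psi> where e: "e > 0" and inj: "inj_on \<psi> (ball c e)" and op: "open (\<psi> ` ball c e)"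
    and pos: "\<psi> ` (ball c e \<inter> \<Omega>) \<subseteq> {y. y $ 3 > 0}" and zero: "\<psi> ` (ball c e \<inter> frontier \<Omega>) \<subseteq> {y. y $ 3 = 0}"
    and \<psi>: "Ck_hoelder r \<alpha> (ball c e) \<psi>" and \<phi>: "Ck_hoelder r \<alpha> (\<psi> ` ball c e) (inv_into (ball c e) \<psi>)"
    using hb(1) c unfolding hoelder_boundary_def Let_def by blast
  define B where "B = ball c e"
  define \<phi> where "\<phi> = inv_into B \<psi>"
  define \<rho> where "\<rho> = (%x. \<psi> x $ 3)"
  note inj = inj[folded B_def] and op = op[folded B_def] and \<psi> = \<psi>[folded B_def] and \<phi> = \<phi>[folded B_def, folded \<phi>_def]
  have B: "open B" "bounded B" "convex B" "c \<in> B" using e by (auto simp: B_def)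
  have pos: "\<rho> y > 0" if "y \<in> B" "y \<in> \<Omega>" for y using subsetD[OF pos, of "\<psi> y"] that by (simp add: B_def \<rho>_def)
  have zero: "\<rho> y = 0" if "y \<in> B" "y \<in> frontier \<Omega>" for y using subsetD[OF zero, of "\<psi> y"] that by (simp add: B_def \<rho>_def)
  have \<psi>C: "Ck_closure r B \<psi>" using \<psi> by (simp add: Ck_hoelder_def)
  have \<rho>C: "Ck_closure r B \<rho>" unfolding \<rho>_def by (rule Ck_closure_nth[OF B(1) \<psi>C])
  have \<rho>3: "Ck 3 B \<rho>" using Ck_mono[OF Ck_closure_Ck[OF \<rho>C] hb(2)] .
  have \<rho>1: "Ck 1 B \<rho>" by (rule Ck_mono[OF \<rho>3]) simp
  obtain M1 where M1: "M1 >= 0" "!!is x. length is <= r ==> x \<in> B ==> \<bar>pds is \<rho> x\<bar> <= M1"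
    using Ck_closure_bound[OF B(2) \<rho>C] by auto
  have "\<exists>C>0. \<forall>is. length is = 3 --> (\<forall>x\<in>B. \<forall>y\<in>B. \<bar>pds is \<rho> x - pds is \<rho> y\<bar> <= C * norm (x - y) powr \<alpha>)"
  proof (rule hoelder_over_lists)
    fix "is" :: "3 list" assume l: "length is = 3"
    show "\<exists>C. \<forall>x\<in>B. \<forall>y\<in>B. \<bar>pds is \<rho> x - pds is \<rho> y\<bar> <= C * norm (x - y) powr \<alpha>"
    \<comment> \<open>For \<open>r = 3\<close> the Hoelder bound is part of the assumption; for
      larger \<open>r\<close> bounded fourth derivatives give a Lipschitz bound, which implies it on
      a ball.\<close>
    proof (cases "r = 3")
      case True
      then have "hoelder_cont \<alpha> B (pds is \<psi>)" using \<psi> l by (simp add: Ck_hoelder_def)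
      then obtain C where C: "!!x y. x \<in> B ==> y \<in> B ==> norm (pds is \<psi> x - pds is \<psi> y) <= C * dist x y powr \<alpha>"
        by (auto simp: hoelder_cont_def)
      have "Ck (length is) B \<psi>" using Ck_closure_Ck[OF \<psi>C] True l by simp
      then have eq: "pds is \<rho> x = pds is \<psi> x $ 3" if "x \<in> B" for x unfolding \<rho>_def by (rule pds_nth[OF B(1) that])
      show ?thesis
      proof (intro exI[of _ C] ballI)
        fix x y assume xy: "x \<in> B" "y \<in> B"
        have "\<bar>pds is \<rho> x - pds is \<rho> y\<bar> <= norm (pds is \<psi> x - pds is \<psi> y)"
          using component_le_norm_cart[of "pds is \<psi> x - pds is \<psi> y" 3] by (simp add: eq xy)
        also have "... <= C * norm (x - y) powr \<alpha>" using C[OF xy] by (simp add: dist_norm)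
        finally show "\<bar>pds is \<rho> x - pds is \<rho> y\<bar> <= C * norm (x - y) powr \<alpha>" .
      qed
    next
      case False
      then have r4: "4 <= r" using hb(2) by simp
      show ?thesis
      proof (intro exI[of _ "3 * M1 * (2 * e) powr (1 - \<alpha>)"] ballI)
        fix x y assume xy: "x \<in> B" "y \<in> B"
        have seg: "closed_segment x y \<subseteq> B" by (rule closed_segment_subset[OF xy B(3)])
        have "Ck 1 B (pds is \<rho>)" by (rule Ck_pds) (use Ck_mono[OF Ck_closure_Ck[OF \<rho>C] r4] l in simp)
        then have "\<bar>pds is \<rho> x - pds is \<rho> y\<bar> <= (3 * M1) * norm (x - y)"
        proof (intro mvt_grad[OF seg] norm_grad_le)
          fix i z assume "z \<in> closed_segment x y"
          then show "\<bar>pd i (pds is \<rho>) z\<bar> <= M1" using M1(2)[of "is @ [i]" z] l r4 seg by (auto simp: pds_snoc)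
        qed auto
        also have "norm (x - y) = norm (x - y) powr (1 - \<alpha>) * norm (x - y) powr \<alpha>" by (simp add: powr_add[symmetric])
        also have "3 * M1 * (norm (x - y) powr (1 - \<alpha>) * norm (x - y) powr \<alpha>) <= 3 * M1 * ((2 * e) powr (1 - \<alpha>) * norm (x - y) powr \<alpha>)"
        proof (intro mult_left_mono mult_right_mono powr_mono2)
          have "dist x y <= dist c x + dist c y" by (rule dist_triangle3)
          then show "norm (x - y) <= 2 * e" using xy by (simp add: B_def dist_norm)
        qed (use M1 \<alpha> in auto)
        finally show "\<bar>pds is \<rho> x - pds is \<rho> y\<bar> <= 3 * M1 * (2 * e) powr (1 - \<alpha>) * norm (x - y) powr \<alpha>" by (simp add: mult.assoc)
      qed
    qed
  qed
  then obtain C where C: "C > 0" "!!is x y. length is = 3 ==> x \<in> B ==> y \<in> B ==> \<bar>pds is \<rho> x - pds is \<rho> y\<bar> <= C * norm (x - y) powr \<alpha>"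
    by auto
  have \<psi>\<phi>: "\<psi> (\<phi> y) = y" "\<phi> y \<in> B" if "y \<in> \<psi> ` B" for y
    using that by (auto simp: \<phi>_def f_inv_into_f inv_into_into)
  have \<phi>\<psi>: "\<phi> (\<psi> y) = y" if "y \<in> B" for y using inv_into_f_f[OF inj that] by (simp add: \<phi>_def)
  have \<phi>1: "Ck 1 (\<psi> ` B) \<phi>" using \<phi> Ck_mono[of r _ \<phi> 1] hb(2) by (auto simp: Ck_hoelder_def Ck_closure_def)
  have \<psi>c: "continuous_on B \<psi>" by (rule Ck_continuous_on[OF Ck_closure_Ck[OF \<psi>C]])
  \<comment> \<open>Otherwise the third coordinate, which is \<open>\<rho>\<close> composed with the
    inverse chart, would have derivative zero.\<close>
  have g0: "grad \<rho> c \<noteq> 0"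
  proof
    assume g: "grad \<rho> c = 0"
    have cB: "\<psi> c \<in> \<psi> ` B" using B(4) by simp
    obtain D where D: "(\<phi> has_derivative D) (at (\<psi> c))" using \<phi>1 cB by (auto simp: differentiable_def)
    have "(\<rho> has_derivative (%h. grad \<rho> c \<bullet> h)) (at (\<phi> (\<psi> c)))"
      unfolding \<phi>\<psi>[OF B(4)] by (rule has_derivative_grad) (use \<rho>1 B(4) in simp)
    from has_derivative_compose[OF D this] have "((%y. \<rho> (\<phi> y)) has_derivative (%h. 0)) (at (\<psi> c))" by (simp add: g)
    then have "((%y. y $ 3) has_derivative (%h. 0)) (at (\<psi> c))"
      by (rule has_derivative_transform_within_open[OF _ op cB]) (simp add: \<rho>_def \<psi>\<phi>)
    moreover have "((%y. y $ 3) has_derivative (%h :: real^3. h $ 3)) (at (\<psi> c))"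
      by (rule bounded_linear.has_derivative[OF bounded_linear_vec_nth has_derivative_ident])
    ultimately have "(%h :: real^3. 0) = (%h. h $ 3)" by (rule has_derivative_unique)
    from fun_cong[OF this, of "axis 3 1"] show False by simp
  qed
  define \<nu> where "\<nu> = (1 / norm (grad \<rho> c)) *\<^sub>R grad \<rho> c"
  \<comment> \<open>Half of the slope of \<open>\<rho>\<close> at \<open>c\<close>, which continuity
    preserves in a smaller ball.\<close>
  define m where "m = norm (grad \<rho> c) / 2"
  have m: "m > 0" and \<nu>: "norm \<nu> = 1" and gc: "grad \<rho> c \<bullet> \<nu> = 2 * m"
    using g0 by (auto simp: m_def \<nu>_def power2_norm_eq_inner[symmetric] power2_eq_square)
  have "continuous_on B (%y. grad \<rho> y \<bullet> \<nu>)" unfolding grad_def by (intro continuous_intros) (use \<rho>1 in simp)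
  then have "isCont (%y. grad \<rho> y \<bullet> \<nu>) c" using B by (simp add: continuous_on_eq_continuous_at)
  then have "\<forall>\<^sub>F y in at c. grad \<rho> y \<bullet> \<nu> > m" unfolding isCont_def by (rule order_tendstoD) (use gc m in simp)
  then obtain R1 where R1: "R1 > 0" "!!y. y \<in> ball c R1 ==> grad \<rho> y \<bullet> \<nu> >= m"
    using gc m unfolding eventually_at by (metis dist_commute less_eq_real_def mem_ball mult_2 less_add_same_cancel1 zero_less_dist_iff UNIV_I)
  obtain \<epsilon> where \<epsilon>: "\<epsilon> > 0" "ball (\<psi> c) \<epsilon> \<subseteq> \<psi> ` B" using op B(4) open_contains_ball by blast
  define N where "N = B \<inter> \<psi> -` ball (\<psi> c) \<epsilon>"
  have N: "open N" "c \<in> N" using continuous_open_preimage[OF \<psi>c B(1) open_ball] B(4) \<epsilon> by (auto simp: N_def)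
  define H where "H = ball (\<psi> c) \<epsilon> \<inter> {y. axis 3 1 \<bullet> y > 0}"
  have Hpos: "y $ 3 > 0" if "y \<in> H" for y using that by (simp add: H_def inner_axis')
  have "connected (\<phi> ` H)"
  proof (rule connected_continuous_image)
    show "continuous_on H \<phi>" by (rule continuous_on_subset[OF Ck_continuous_on[OF \<phi>1]]) (use \<epsilon> in \<open>auto simp: H_def\<close>)
    show "connected H" unfolding H_def by (intro convex_connected convex_Int convex_ball convex_halfspace_gt)
  qed
  moreover have "\<phi> ` H \<inter> frontier \<Omega> = {}"
  proof -
    have "\<phi> y \<notin> frontier \<Omega>" if y: "y \<in> H" for y
    proof
      have yB: "y \<in> \<psi> ` B" using y \<epsilon> by (auto simp: H_def)
      assume "\<phi> y \<in> frontier \<Omega>"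
      then have "\<rho> (\<phi> y) = 0" by (rule zero[OF \<psi>\<phi>(2)[OF yB]])
      then show False using Hpos[OF y] by (simp add: \<rho>_def \<psi>\<phi>(1)[OF yB])
    qed
    then show ?thesis by auto
  qed
  moreover have inH: "\<psi> y \<in> H" if "y \<in> N" "\<rho> y > 0" for y
    using that by (simp add: H_def N_def \<rho>_def inner_axis')
  moreover have "\<phi> ` H \<inter> \<Omega> \<noteq> {}"
  proof -
    have "c \<in> closure \<Omega>" using c by (simp add: frontier_def)
    then obtain z where z: "z \<in> N" "z \<in> \<Omega>" using N by (auto simp: closure_iff_nhds_not_empty)
    then have zB: "z \<in> B" by (simp add: N_def)
    have "\<psi> z \<in> H" by (rule inH[OF z(1) pos[OF zB z(2)]])
    then show ?thesis using \<phi>\<psi>[OF zB] z(2) by (metis IntI emptyE imageI)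
  qed
  ultimately have sub: "\<phi> ` H \<subseteq> \<Omega>" using connected_Int_frontier[of "\<phi> ` H" \<Omega>] by blast
  obtain R where R: "R > 0" "ball c R \<subseteq> N \<inter> ball c R1"
    using openE[OF open_Int[OF N(1) open_ball], of c c R1] N(2) R1(1) by auto
  then have RB: "ball c R \<subseteq> B" by (auto simp: N_def)
  have iff: "y \<in> \<Omega> \<longleftrightarrow> \<rho> y > 0" if y: "y \<in> ball c R" for y
  proof
    assume "\<rho> y > 0"
    then have "\<psi> y \<in> H" using inH R(2) y by blast
    then have "\<phi> (\<psi> y) \<in> \<Omega>" using sub by blast
    then show "y \<in> \<Omega>" using \<phi>\<psi> y RB by auto
  qed (use pos y RB in blast)
  have D: "defining_function \<Omega> \<rho> c R m \<nu>"
  proof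
    show "Ck 1 (ball c R) \<rho>" by (rule Ck_subset[OF \<rho>1 RB])
    show tr: "m <= grad \<rho> y \<bullet> \<nu>" if "y \<in> ball c R" for y using R1(2) R(2) that by blast
    show "y \<in> \<Omega> \<longleftrightarrow> \<rho> y > 0" if "y \<in> ball c R" for y by (rule iff[OF that])
    show "y \<in> frontier \<Omega> \<longleftrightarrow> \<rho> y = 0" if y: "y \<in> ball c R" for y
    proof
      assume \<rho>0: "\<rho> y = 0"
      have "((%s. \<rho> (y + s *\<^sub>R \<nu>)) has_real_derivative grad \<rho> (y + 0 *\<^sub>R \<nu>) \<bullet> \<nu>) (at 0)"
        by (rule DERIV_line) (use \<rho>1 RB y in auto)
      then have "((%s. \<rho> (y + s *\<^sub>R \<nu>)) has_real_derivative grad \<rho> y \<bullet> \<nu>) (at 0)" by simp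
      \<comment> \<open>Along \<open>\<nu>\<close> the function \<open>\<rho>\<close> becomes
        positive at once, so a zero of \<open>\<rho>\<close> is a limit of points of
        \<open>\<Omega>\<close>.\<close>
      from DERIV_pos_inc_right[OF this] obtain d where d: "d > 0" "!!s. 0 < s ==> s < d ==> \<rho> y < \<rho> (y + s *\<^sub>R \<nu>)"
        using tr[OF y] m by auto
      obtain d' where d': "d' > 0" "ball y d' \<subseteq> ball c R" using openE[OF open_ball y] by blast
      have "y \<in> closure \<Omega>"
        unfolding closure_approachable
      proof (intro allI impI)
        fix \<eta> :: real assume \<eta>: "\<eta> > 0"
        define s where "s = min (\<eta> / 2) (min (d / 2) (d' / 2))"
        have s: "0 < s" "s < \<eta>" "s < d" "s < d'" using \<eta> d d' by (auto simp: s_def)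
        have "dist y (y + s *\<^sub>R \<nu>) = s" using s \<nu> by (simp add: dist_norm)
        then have "y + s *\<^sub>R \<nu> \<in> ball c R" using s d' by (auto simp: subset_iff)
        then have "y + s *\<^sub>R \<nu> \<in> \<Omega>" using iff d(2)[OF s(1,3)] \<rho>0 by simp
        then show "\<exists>z\<in>\<Omega>. dist z y < \<eta>" using \<open>dist y (y + s *\<^sub>R \<nu>) = s\<close> s by (metis dist_commute)
      qed
      moreover have "y \<notin> \<Omega>" using iff[OF y] \<rho>0 by simp
      ultimately show "y \<in> frontier \<Omega>" using \<Omega>(1) by (simp add: frontier_def interior_open)
    qed (use zero y RB in blast)
  qed (use \<Omega> m \<nu> in auto)
  show ?thesis
  proof (rule that[OF D R(1) Ck_subset[OF \<rho>3 RB], of "M1 + C"])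
    show "\<bar>pds is \<rho> y\<bar> <= M1 + C" if "y \<in> ball c R" "length is <= 3" for "is" y
    proof -
      have "\<bar>pds is \<rho> y\<bar> <= M1" by (rule M1(2)) (use that hb(2) RB in auto)
      then show ?thesis using C by linarith
    qed
    show "\<bar>pds [i, j, k] \<rho> x - pds [i, j, k] \<rho> y\<bar> <= (M1 + C) * norm (x - y) powr \<alpha>" if "x \<in> ball c R" "y \<in> ball c R" for i j k x y
    proof -
      have "\<bar>pds [i, j, k] \<rho> x - pds [i, j, k] \<rho> y\<bar> <= C * norm (x - y) powr \<alpha>" by (rule C(2)) (use that RB in auto)
      also have "... <= (M1 + C) * norm (x - y) powr \<alpha>" using M1(1) by (intro mult_right_mono) auto
      finally show ?thesis .
    qed
  qed
qed

text \<open>Every point of the closure has a neighbourhood with a Hoelder bound for the third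
  derivatives, from the interior estimate or from a chart, and compactness makes it global.
  Exponents below \<alpha> follow because \<open>\<Omega>\<close> is bounded.\<close>

theorem neumann_regularity:
  assumes \<Omega>: "open \<Omega>" "bounded \<Omega>" and hb: "hoelder_boundary r \<alpha> \<Omega>" "3 <= r" and \<alpha>: "0 < \<alpha>" "\<alpha> < 1"
    and u: "Ck_hoelder 2 \<alpha> \<Omega> u" and g: "Ck_closure 2 \<Omega> g"
    and lap: "!!x. x \<in> \<Omega> ==> laplacian u x = g x"
    and neumann: "!!x. x \<in> frontier \<Omega> ==> outer_normal \<Omega> x \<bullet> ext \<Omega> (grad u) x = 0"
    and \<beta>: "0 < \<beta>" "\<beta> <= \<alpha>"
  shows "Ck_hoelder 3 \<beta> \<Omega> u"
proof -
  have uC: "Ck_closure 2 \<Omega> u" using u by (simp add: Ck_hoelder_def)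
  obtain Mu where Mu: "Mu >= 0" "!!is x. length is <= 2 ==> x \<in> \<Omega> ==> \<bar>pds is u x\<bar> <= Mu"
    using Ck_closure_bound[OF \<Omega>(2) uC] by auto
  obtain Mg where Mg: "Mg >= 0" "!!is x. length is <= 2 ==> x \<in> \<Omega> ==> \<bar>pds is g x\<bar> <= Mg"
    using Ck_closure_bound[OF \<Omega>(2) g] by auto
  have "\<exists>C>0. \<forall>is. length is = 2 --> (\<forall>x\<in>\<Omega>. \<forall>y\<in>\<Omega>. \<bar>pds is u x - pds is u y\<bar> <= C * norm (x - y) powr \<alpha>)"
  proof (rule hoelder_over_lists)
    fix "is" :: "3 list" assume "length is = 2"
    then have "hoelder_cont \<alpha> \<Omega> (pds is u)" using u by (simp add: Ck_hoelder_def)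
    then show "\<exists>C. \<forall>x\<in>\<Omega>. \<forall>y\<in>\<Omega>. \<bar>pds is u x - pds is u y\<bar> <= C * norm (x - y) powr \<alpha>"
      by (auto simp: hoelder_cont_def dist_norm)
  qed
  then obtain Cu where Cu: "Cu > 0" "!!is x y. length is = 2 ==> x \<in> \<Omega> ==> y \<in> \<Omega> ==> \<bar>pds is u x - pds is u y\<bar> <= Cu * norm (x - y) powr \<alpha>"
    by auto
  define M where "M = 1 + Mu + Mg + Cu"
  have M: "Mu <= M" "Mg <= M" "Cu <= M" "1 <= M" using Mu(1) Mg(1) Cu(1) by (auto simp: M_def)
  \<comment> \<open>Stated for every larger constant, because in a chart the constant
    \<open>M'\<close> must bound \<open>\<rho>\<close> as well.\<close>
  have I: "interior \<Omega> u g M'" if "M <= M'" for M'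
  proof
    show "Ck 2 \<Omega> u" "Ck 2 \<Omega> g" using uC g by (auto simp: Ck_closure_def)
    show "laplacian u x = g x" if "x \<in> \<Omega>" for x by (rule lap[OF that])
    show "\<bar>u x\<bar> <= M'" if "x \<in> \<Omega>" for x using Mu(2)[of "[]" x] that M \<open>M <= M'\<close> by simp
    show "\<bar>pd i (pd j g) x\<bar> <= M'" if "x \<in> \<Omega>" for i j x using Mg(2)[of "[j, i]" x] that M \<open>M <= M'\<close> by simp
  qed (use \<Omega> in auto)
  have "\<forall>is::3 list. length is <= 2 --> (\<exists>h. continuous_on (closure \<Omega>) h \<and> (\<forall>x\<in>\<Omega>. h x = pds is u x))"
    using uC by (simp add: Ck_closure_def)
  then obtain ub where ub: "!!is. length is <= 2 ==> continuous_on (closure \<Omega>) (ub is)"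
    "!!is y. length is <= 2 ==> y \<in> \<Omega> ==> ub is y = pds is u y" by metis
  have "\<forall>is::3 list. length is <= 2 --> (\<exists>h. continuous_on (closure \<Omega>) h \<and> (\<forall>x\<in>\<Omega>. h x = pds is g x))"
    using g by (simp add: Ck_closure_def)
  then obtain gb where gb: "!!is. length is <= 2 ==> continuous_on (closure \<Omega>) (gb is)"
    "!!is y. length is <= 2 ==> y \<in> \<Omega> ==> gb is y = pds is g y" by metis
  have loc: "\<exists>r>0. \<exists>K. \<forall>x\<in>\<Omega> \<inter> ball c r. \<forall>y\<in>\<Omega> \<inter> ball c r. \<bar>pds [i, j, k] u x - pds [i, j, k] u y\<bar> <= K * norm (x - y) powr \<alpha>"
    if c: "c \<in> closure \<Omega>" for c i j k
  proof (cases "c \<in> \<Omega>")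
    case True
    have M0: "M > 0" using M(4) by simp
    show ?thesis
    proof (rule interior.interior_third_derivative_hoelder[OF I[OF order_refl] M0 \<alpha> True])
      fix r K assume r: "r > 0" and h: "!!i j k x y. x \<in> ball c r ==> y \<in> ball c r ==>
        \<bar>pds [i, j, k] u x - pds [i, j, k] u y\<bar> <= K * norm (x - y) powr \<alpha>"
      show ?thesis by (intro exI[of _ r] conjI exI[of _ K] ballI r h) auto
    qed
  next
    case False
    then have fr: "c \<in> frontier \<Omega>" using c \<Omega>(1) by (simp add: frontier_def interior_open)
    show ?thesis
    proof (rule boundary_chart[OF \<Omega> hb \<alpha> fr])
      fix \<rho> R m \<nu> Mc
      assume D: "defining_function \<Omega> \<rho> c R m \<nu>" and R: "R > 0" and \<rho>3: "Ck 3 (ball c R) \<rho>"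
        and \<rho>b: "!!is y. y \<in> ball c R ==> length is <= 3 ==> \<bar>pds is \<rho> y\<bar> <= Mc"
        and \<rho>h: "!!i j k x y. x \<in> ball c R ==> y \<in> ball c R ==> \<bar>pds [i, j, k] \<rho> x - pds [i, j, k] \<rho> y\<bar> <= Mc * norm (x - y) powr \<alpha>"
      define M' where "M' = M + \<bar>Mc\<bar>"
      have M': "M <= M'" "Mc <= M'" using M(4) unfolding M'_def by linarith+
      have pw: "X <= A * t powr \<alpha> ==> A <= M' ==> X <= M' * t powr \<alpha>" for X A t
        by (rule order_trans[OF _ mult_right_mono]) auto
      have "neumann_chart \<Omega> u g M' \<rho> c R m \<nu> \<alpha> ub gb"
      proof (intro neumann_chart.intro I[OF M'(1)] D neumann_chart_axioms.intro \<alpha> R \<rho>3)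
        show "1 <= M'" using M M' by simp
        show "\<bar>pds is \<rho> y\<bar> <= M'" if "y \<in> ball c R" "length is <= 3" for "is" y
          by (rule order_trans[OF \<rho>b[OF that] M'(2)])
        show "\<bar>pds [i, j, k] \<rho> x - pds [i, j, k] \<rho> y\<bar> <= M' * norm (x - y) powr \<alpha>"
          if "x \<in> ball c R" "y \<in> ball c R" for i j k x y by (rule pw[OF \<rho>h[OF that] M'(2)])
        show "\<bar>pds [i, j] u x - pds [i, j] u y\<bar> <= M' * norm (x - y) powr \<alpha>" if "x \<in> \<Omega>" "y \<in> \<Omega>" for i j x y
          by (rule pw[OF Cu(2)[OF _ that]]) (use M M' in auto)
        show "\<bar>pds is u y\<bar> <= M'" if "length is <= 2" "y \<in> \<Omega>" for "is" y using Mu(2)[OF that] M M' by simp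
        show "\<bar>pds is g y\<bar> <= M'" if "length is <= 1" "y \<in> \<Omega>" for "is" y using Mg(2)[of "is" y] that M M' by simp
        show "(\<Sum>i\<in>UNIV. ub [i] y * pd i \<rho> y) = 0" if y: "y \<in> frontier \<Omega>" "y \<in> ball c R" for y
        proof -
          have cb: "continuous_on (closure \<Omega>) (%x. \<chi> i. ub [i] x)" by (intro continuous_intros ub(1)) simp
          have "ext \<Omega> (grad u) y = (\<chi> i. ub [i] y)"
            by (rule ext_eq[OF cb]) (use y ub(2)[of "[i]" for i] in \<open>auto simp: grad_def frontier_def\<close>)
          then have "grad \<rho> y \<bullet> (\<chi> i. ub [i] y) / norm (grad \<rho> y) = 0"
            using neumann[OF y(1)] defining_function.outer_normal_eq[OF D y] by simp
          moreover have "norm (grad \<rho> y) > 0"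
            using defining_function.norm_grad_ge[OF D y(2)] defining_function.m[OF D] by linarith
          ultimately have "grad \<rho> y \<bullet> (\<chi> i. ub [i] y) = 0" by simp
          then show ?thesis by (simp add: grad_def inner_vec_def mult.commute)
        qed
      qed (use ub gb in auto)
      then show ?thesis
      proof (rule neumann_chart.boundary_third_derivative_hoelder[OF _ fr])
        fix K r assume r: "r > 0" and h: "!!i j k x y. x \<in> \<Omega> ==> y \<in> \<Omega> ==> x \<in> ball c r ==> y \<in> ball c r ==>
          \<bar>pds [i, j, k] u x - pds [i, j, k] u y\<bar> <= K * norm (x - y) powr \<alpha>"
        show ?thesis by (intro exI[of _ r] conjI exI[of _ K] ballI r h) auto
      qed
    qed
  qed
  have h: "hoelder_cont \<beta> \<Omega> (pds [i, j, k] u)" for i j k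
    by (rule hoelder_cont_mono[OF hoelder_cont_compact_cover(1)[OF \<Omega>(2) \<alpha>(1) loc] \<Omega>(2) \<beta>])
  have "Ck 3 \<Omega> u" by (rule interior.interior_C3(1)[OF I[OF order_refl]])
  then show ?thesis by (rule Ck_hoelder_3I[OF \<Omega>(2) _ uC \<beta>(1) h])
qed

section \<open>Assembling the solution of problem (N)\<close>

lemma ext_cong: "(!!x. x \<in> U ==> f x = g x) ==> ext U f x = ext U g x"
proof -
  assume h: "!!x. x \<in> U ==> f x = g x"
  have "(f \<longlongrightarrow> l) (at x within U) = (g \<longlongrightarrow> l) (at x within U)" for l
    by (rule tendsto_cong) (use h in \<open>auto simp: eventually_at_filter\<close>)
  then show ?thesis using h by (simp add: ext_def Topological_Spaces.Lim_def)
qed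

lemma Ck_hoelder_cong:
  assumes U: "open U" and eq: "!!x. x \<in> U ==> f x = g x" and f: "Ck_hoelder k \<alpha> U f"
  shows "Ck_hoelder k \<alpha> U g"
proof -
  have p: "pds is f x = pds is g x" if "x \<in> U" for "is" x by (rule pds_cong[OF U eq that])
  then have "pds is f ` U = pds is g ` U" for "is" by (rule image_cong[OF HOL.refl])
  moreover have "hoelder_cont \<alpha> U (pds is f) = hoelder_cont \<alpha> U (pds is g)" for "is"
    unfolding hoelder_cont_def using p by (simp cong: ball_cong_simp)
  moreover have "Ck_closure k U g" by (rule Ck_closure_cong_imp[OF U eq]) (use f in \<open>simp_all add: Ck_hoelder_def\<close>)
  ultimately show ?thesis using f by (simp add: Ck_hoelder_def)
qed

lemma curl_cong:
  assumes "open U" "x \<in> U" "!!y. y \<in> U ==> u y = v y" shows "curl u x = curl v x"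
  unfolding curl_def using pd_cong[OF assms] by simp

lemma divergence_cong:
  assumes "open U" "x \<in> U" "!!y. y \<in> U ==> u y = v y" shows "divergence u x = divergence v x"
  unfolding divergence_def using pd_cong[OF assms] by simp

lemma curl_scaleR: "u differentiable at x ==> curl (%y. c *\<^sub>R u y) x = c *\<^sub>R curl u x"
  unfolding curl_def by (simp add: pd_scaleR vec_eq_iff forall_3 right_diff_distrib)

lemma curl_extension:
  assumes "Ck_closure 1 U A"
  obtains h where "continuous_on (closure U) h" "!!x. x \<in> U ==> h x = curl A x"
proof -
  have "\<forall>i. \<exists>h. continuous_on (closure U) h \<and> (\<forall>x\<in>U. h x = pd i A x)"
    using assms by (simp add: Ck_closure_Suc Ck_closure_0)
  then obtain h where h: "!!i. continuous_on (closure U) (h i)" "!!i x. x \<in> U ==> h i x = pd i A x" by metis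
  have v: "(vector [a, b, c] :: real^3) = a *\<^sub>R axis 1 1 + b *\<^sub>R axis 2 1 + c *\<^sub>R axis 3 1" for a b c
    by (simp add: vec_eq_iff forall_3 axis_def)
  show ?thesis
  proof (rule that)
    show "continuous_on (closure U) (%x. vector [h 2 x $ 3 - h 3 x $ 2, h 3 x $ 1 - h 1 x $ 3, h 1 x $ 2 - h 2 x $ 1] :: real^3)"
      unfolding v by (intro continuous_intros h)
  qed (simp add: curl_def h)
qed

lemma KK_cong:
  assumes U: "open \<Omega>" and eq: "!!x. x \<in> \<Omega> ==> A x = B x" and A: "(f, A) \<in> KK \<alpha> \<Omega>"
  shows "(f, B) \<in> KK \<alpha> \<Omega>"
proof -
  have "ext \<Omega> A x = ext \<Omega> B x" for x by (rule ext_cong[OF eq])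
  then show ?thesis using A Ck_hoelder_cong[OF U eq] by (simp add: KK_def)
qed

lemma UU_cong:
  assumes U: "open \<Omega>" and eq: "!!x. x \<in> \<Omega> ==> G x = H x" and G: "(f, G) \<in> UU lam \<alpha> \<Omega>"
  shows "(f, H) \<in> UU lam \<alpha> \<Omega>"
proof -
  have c: "(- lam / (f x)\<^sup>2) *\<^sub>R curl G x = (- lam / (f x)\<^sup>2) *\<^sub>R curl H x" if "x \<in> \<Omega>" for x
    by (simp add: curl_cong[OF U that eq])
  show ?thesis using G KK_cong[OF U c] Ck_hoelder_cong[OF U eq] by (simp add: UU_def)
qed

lemma threshold_solution:
  assumes T: "threshold_numbers \<alpha> \<Omega> BT L K" and lam: "0 < lam" "lam < L" and \<kappa>: "K lam < \<kappa>"
  obtains f A where "solves_fA lam \<kappa> \<Omega> BT f A" "(f, A) \<in> KK \<alpha> \<Omega>"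
    "(f, %x. lam *\<^sub>R curl A x) \<in> UU lam \<alpha> \<Omega>" "\<kappa> > 0"
  using mp[OF spec[OF conjunct2[OF T[unfolded threshold_numbers_def]]] conjI[OF lam]]
proof (elim conjE exE, goal_cases)
  case (1 F AA Alim)
  note h = mp[OF spec[OF 1(3)] \<kappa>]
  show ?case
    by (rule 1(1)[OF h[THEN conjunct1] h[THEN conjunct2, THEN conjunct2, THEN conjunct2, THEN conjunct1]
          h[THEN conjunct2, THEN conjunct2, THEN conjunct2, THEN conjunct2, THEN conjunct2]]) (use 1(2) \<kappa> in simp)
qed

theorem lemma7p2:
  fixes \<alpha> :: real and r :: nat and \<Omega> :: "(real^3) set"
    and He \<H> :: "real^3 \<Rightarrow> real^3"
    and lambda_fA :: "(real^3) set \<Rightarrow> (real^3 \<Rightarrow> real^3) \<Rightarrow> real"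
    and kappa_fA :: "(real^3) set \<Rightarrow> (real^3 \<Rightarrow> real^3) \<Rightarrow> real \<Rightarrow> real"
  assumes "0 < \<alpha>" "\<alpha> < 1"
    and "open \<Omega>" "connected \<Omega>" "\<Omega> \<noteq> {}" "bounded \<Omega>" "simply_connected \<Omega>"
    and "connected (exterior \<Omega>)"
    and "3 \<le> r" "hoelder_boundary r \<alpha> \<Omega>"
    and "Ck_hoelder_loc 2 \<alpha> (exterior \<Omega>) He" "Ck_hoelder_loc_closure 1 \<alpha> (exterior \<Omega>) He"
    and "\<forall>x\<in>exterior \<Omega>. curl He x = 0 \<and> divergence He x = 0"
    and "surface_integral \<Omega> (\<lambda>x. outer_normal \<Omega> x \<bullet> ext (exterior \<Omega>) He x) = 0"
    and "Ck_hoelder_loc_closure 2 \<alpha> (exterior \<Omega>) \<H>"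
    and "\<forall>x\<in>exterior \<Omega>. curl \<H> x = 0 \<and> divergence \<H> x = 0"
    and "(SUP x\<in>frontier \<Omega>. norm (outer_tangential_trace \<Omega> \<H> x)) < sqrt (5 / 18)"
    and "Ck_hoelder 0 \<alpha> (exterior \<Omega>) (\<lambda>x. \<H> x - He x)"
    and "((\<lambda>x. \<H> x - He x) \<longlongrightarrow> 0) at_infinity"
    and "threshold_numbers \<alpha> \<Omega> (outer_tangential_trace \<Omega> \<H>)
           (lambda_fA \<Omega> (outer_tangential_trace \<Omega> \<H>))
           (kappa_fA \<Omega> (outer_tangential_trace \<Omega> \<H>))"
  shows "\<forall>lam \<kappa>. 0 < lam \<and> lam < lambda_fA \<Omega> (outer_tangential_trace \<Omega> \<H>) \<and>
             kappa_fA \<Omega> (outer_tangential_trace \<Omega> \<H>) lam < \<kappa> \<longrightarrow>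
           (\<exists>f H. solves_N lam \<kappa> \<Omega> He f H \<and> (f, H) \<in> UU lam \<alpha> \<Omega> \<and>
                  (\<forall>x\<in>exterior \<Omega>. H x = \<H> x) \<and>
                  (\<forall>\<beta>. 0 < \<beta> \<and> \<beta> < min (1/2) \<alpha> \<longrightarrow> Ck_hoelder 3 \<beta> \<Omega> f) \<and>
                  H \<in> Ct_hoelder \<alpha> \<Omega>)"
proof (intro allI impI, elim conjE)
  fix lam \<kappa>
  let ?BT = "outer_tangential_trace \<Omega> \<H>"
  assume lam: "0 < lam" "lam < lambda_fA \<Omega> ?BT" and \<kappa>: "kappa_fA \<Omega> ?BT lam < \<kappa>"
  note \<Omega> = \<open>open \<Omega>\<close> \<open>bounded \<Omega>\<close>
  obtain f A where sol: "solves_fA lam \<kappa> \<Omega> ?BT f A" and KK: "(f, A) \<in> KK \<alpha> \<Omega>"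
    and UU0: "(f, %x. lam *\<^sub>R curl A x) \<in> UU lam \<alpha> \<Omega>" and \<kappa>0: "\<kappa> > 0"
    by (rule threshold_solution[OF assms(20) lam \<kappa>])
  define H0 where "H0 = (%x. lam *\<^sub>R curl A x)"
  \<comment> \<open>On the frontier this takes the values of \<open>\<H>\<close>, but traces are
    limits from either side, taken by \<open>ext\<close>, so one function represents both
    fields.\<close>
  define H where "H = (%x. if x \<in> \<Omega> then H0 x else \<H> x)"
  have UU: "(f, H0) \<in> UU lam \<alpha> \<Omega>" using UU0 by (simp add: H0_def)
  have HH0: "H0 x = H x" if "x \<in> \<Omega>" for x using that by (simp add: H_def)
  have Hext: "H x = \<H> x" if "x \<in> exterior \<Omega>" for x using that closure_subset by (auto simp: H_def)
  have oe: "open (exterior \<Omega>)" by (rule open_Compl[OF closed_closure])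
  have fpos: "f x > 0" if "x \<in> \<Omega>" for x
  proof -
    have "ext \<Omega> f x > 0" using KK subsetD[OF closure_subset that] by (simp add: KK_def)
    then show ?thesis using that by (simp add: ext_def)
  qed
  have A1: "A differentiable at x" if "x \<in> \<Omega>" for x using sol that by (auto simp: solves_fA_def numeral_2_eq_2)
  have H01: "H0 differentiable at x" if "x \<in> \<Omega>" for x
    using UU that by (auto simp: UU_def Ck_hoelder_def Ck_closure_def numeral_2_eq_2)
  \<comment> \<open>The second equation of the interior problem, with \<open>curl (curl A)\<close>
    replaced by \<open>curl H0\<close> divided by \<open>lam\<close>. It expresses \<open>A\<close>
    through \<open>f\<close> and \<open>curl H\<close>, which is how the first equation takes the
    form it has in (N).\<close>
  have curlH: "curl H x = - ((f x)\<^sup>2 / lam) *\<^sub>R A x" if x: "x \<in> \<Omega>" for x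
  proof -
    have "(%y. (1 / lam) *\<^sub>R H0 y) = curl A" using lam by (simp add: H0_def)
    then have "curl (curl A) x = (1 / lam) *\<^sub>R curl H0 x" using curl_scaleR[OF H01[OF x], of "1 / lam"] by simp
    then have 1: "curl H0 x = lam *\<^sub>R curl (curl A) x" using lam by simp
    have "lam\<^sup>2 *\<^sub>R curl (curl A) x + (f x)\<^sup>2 *\<^sub>R A x = 0" using sol x by (simp add: solves_fA_def)
    then have "lam *\<^sub>R curl H0 x = - ((f x)\<^sup>2 *\<^sub>R A x)" by (simp add: 1 power2_eq_square eq_neg_iff_add_eq_0)
    then have "(1 / lam) *\<^sub>R (lam *\<^sub>R curl H0 x) = (1 / lam) *\<^sub>R (- ((f x)\<^sup>2 *\<^sub>R A x))" by simp
    then have "curl H0 x = - ((f x)\<^sup>2 / lam) *\<^sub>R A x" using lam by simp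
    then show ?thesis using curl_cong[OF \<Omega>(1) x HH0] by simp
  qed
  have trace: "inner_tangential_trace \<Omega> H x = outer_tangential_trace \<Omega> H x" if x: "x \<in> frontier \<Omega>" for x
  proof -
    have "Ck_closure 1 \<Omega> A" using sol by (simp add: solves_fA_def)
    then show ?thesis
    proof (rule curl_extension)
      fix h assume h: "continuous_on (closure \<Omega>) h" "!!x. x \<in> \<Omega> ==> h x = curl A x"
      have xc: "x \<in> closure \<Omega>" using x by (simp add: frontier_def)
      have "ext \<Omega> H x = lam *\<^sub>R h x"
        by (rule ext_eq[OF _ _ xc]) (use h in \<open>auto intro: continuous_intros simp: H_def H0_def\<close>)
      moreover have "ext \<Omega> (curl A) x = h x" by (rule ext_eq[OF h xc])
      ultimately have "inner_tangential_trace \<Omega> H x = lam *\<^sub>R inner_tangential_trace \<Omega> (curl A) x"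
        by (simp add: tangential_def algebra_simps)
      also have "... = ?BT x" using sol x by (simp add: solves_fA_def)
      also have "... = outer_tangential_trace \<Omega> H x"
      proof -
        have "ext (exterior \<Omega>) H x = ext (exterior \<Omega>) \<H> x" by (rule ext_cong[OF Hext])
        then show ?thesis by (simp add: tangential_def)
      qed
      finally show ?thesis .
    qed
  qed
  have N: "solves_N lam \<kappa> \<Omega> He f H"
    unfolding solves_N_def
  proof (intro conjI ballI)
    fix x assume x: "x \<in> \<Omega>"
    have "lam\<^sup>2 / (f x) ^ 4 * (norm (curl H x))\<^sup>2 = (norm (A x))\<^sup>2"
      unfolding curlH[OF x] using lam fpos[OF x] by (simp add: power_mult_distrib power_divide eval_nat_numeral)
    then show "- (lam\<^sup>2 / \<kappa>\<^sup>2) * laplacian f x = (1 - (f x)\<^sup>2 - lam\<^sup>2 / (f x) ^ 4 * (norm (curl H x))\<^sup>2) * f x"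
      using sol x by (simp add: solves_fA_def)
    \<comment> \<open>The field under the outer curl is a constant multiple of \<open>A\<close>, so
      its curl is a multiple of \<open>curl A\<close>, that is, of \<open>H\<close>.\<close>
    have "(1 / (f y)\<^sup>2) *\<^sub>R curl H y = (- (1 / lam)) *\<^sub>R A y" if "y \<in> \<Omega>" for y
      unfolding curlH[OF that] using fpos[OF that] by simp
    from curl_cong[OF \<Omega>(1) x this] have "curl (%y. (1 / (f y)\<^sup>2) *\<^sub>R curl H y) x = (- (1 / lam)) *\<^sub>R curl A x"
      by (simp only: curl_scaleR[OF A1[OF x]])
    then show "lam\<^sup>2 *\<^sub>R curl (%y. (1 / (f y)\<^sup>2) *\<^sub>R curl H y) x + H x = 0"
      using x lam by (simp add: H_def H0_def power2_eq_square)
  next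
    fix x assume x: "x \<in> exterior \<Omega>"
    show "curl H x = 0" "divergence H x = 0"
      using curl_cong[OF oe x Hext] divergence_cong[OF oe x Hext] assms(16) x by auto
  next
    fix x assume x: "x \<in> frontier \<Omega>"
    show "outer_normal \<Omega> x \<bullet> ext \<Omega> (grad f) x = 0" using sol x by (simp add: solves_fA_def)
    show "inner_tangential_trace \<Omega> H x = outer_tangential_trace \<Omega> H x" by (rule trace[OF x])
  next
    obtain B where B: "!!x. x \<in> \<Omega> ==> norm x <= B" using \<Omega>(2) by (auto simp: bounded_iff)
    have "\<forall>\<^sub>F x in at_infinity. \<H> x - He x = H x - He x"
      unfolding eventually_at_infinity using B by (intro exI[of _ "B + 1"]) (force simp: H_def)
    from tendsto_cong[THEN iffD1, OF this assms(19)] show "((%x. H x - He x) \<longlongrightarrow> 0) at_infinity" .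
  qed
  \<comment> \<open>The regularity reaches the exponent \<alpha> itself; the range of \<beta> in the
    theorem lies below it.\<close>
  have reg: "Ck_hoelder 3 \<beta> \<Omega> f" if \<beta>: "0 < \<beta>" "\<beta> <= \<alpha>" for \<beta>
  proof (rule neumann_regularity[OF \<Omega> assms(10,9,1,2)])
    \<comment> \<open>The right side of the equation for \<open>f\<close>, written as a polynomial
      in \<open>f\<close> and the components of \<open>A\<close>: it is of class C^2 up to the
      boundary because \<open>f\<close> and \<open>A\<close> are.\<close>
    let ?g = "%x. (- (\<kappa>\<^sup>2 / lam\<^sup>2)) * ((1 + (- 1) * (f x * f x + (A x $ 1 * A x $ 1 + (A x $ 2 * A x $ 2 + A x $ 3 * A x $ 3)))) * f x)"
    show "Ck_hoelder 2 \<alpha> \<Omega> f" using KK by (simp add: KK_def)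
    then have fC: "Ck_closure 2 \<Omega> f" by (simp add: Ck_hoelder_def)
    have "Ck_closure 2 \<Omega> A" using KK by (simp add: KK_def Ck_hoelder_def)
    note AC = Ck_closure_nth[OF \<Omega>(1) this]
    show "Ck_closure 2 \<Omega> ?g"
      by (intro Ck_closure_mult[OF \<Omega>(1)] Ck_closure_add[OF \<Omega>(1)] Ck_closure_const fC AC)
    fix x assume x: "x \<in> \<Omega>"
    have "- (lam\<^sup>2 / \<kappa>\<^sup>2) * laplacian f x = (1 - (f x)\<^sup>2 - (norm (A x))\<^sup>2) * f x" using sol x by (simp add: solves_fA_def)
    moreover have "(norm (A x))\<^sup>2 = A x $ 1 * A x $ 1 + (A x $ 2 * A x $ 2 + A x $ 3 * A x $ 3)"
      by (simp add: power2_norm_eq_inner inner_vec_def sum_3)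
    ultimately have "?g x = (- (\<kappa>\<^sup>2 / lam\<^sup>2)) * (- (lam\<^sup>2 / \<kappa>\<^sup>2) * laplacian f x)" by (simp add: power2_eq_square algebra_simps)
    also have "... = laplacian f x" using lam \<kappa>0 by simp
    finally show "laplacian f x = ?g x" by simp
  next
    show "outer_normal \<Omega> x \<bullet> ext \<Omega> (grad f) x = 0" if "x \<in> frontier \<Omega>" for x using sol that by (simp add: solves_fA_def)
  qed (use \<beta> in auto)
  have UH: "(f, H) \<in> UU lam \<alpha> \<Omega>" by (rule UU_cong[OF \<Omega>(1) HH0 UU])
  have "H \<in> Ct_hoelder \<alpha> \<Omega>"
  proof -
    have "Ck_hoelder 2 \<alpha> (ball c \<rho> \<inter> exterior \<Omega>) H" for c \<rho>
      by (rule Ck_hoelder_cong[of _ \<H>]) (use assms(15) Hext oe in \<open>auto simp: Ck_hoelder_loc_closure_def\<close>)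
    then show ?thesis using UH trace by (simp add: Ct_hoelder_def UU_def Ck_hoelder_loc_closure_def)
  qed
  then show "\<exists>f H. solves_N lam \<kappa> \<Omega> He f H \<and> (f, H) \<in> UU lam \<alpha> \<Omega> \<and> (\<forall>x\<in>exterior \<Omega>. H x = \<H> x) \<and>
      (\<forall>\<beta>. 0 < \<beta> \<and> \<beta> < min (1/2) \<alpha> --> Ck_hoelder 3 \<beta> \<Omega> f) \<and> H \<in> Ct_hoelder \<alpha> \<Omega>"
    using N UH Hext reg by (intro exI[of _ f] exI[of _ H]) auto
qed

end
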